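(* Suppose Assumptions 1 and 2 hold, $\alpha\ge1$, $B_\beta\ge2(B_r+\gamma(1-\gamma)^{-1}B_rM_{1,\varphi})$, and let $\{\rho_\pi\}$ be a family of measures with properties (i)–(iv) of Lemma 1 with constants $\bar D,\mathcal B$. Let $\eta>0$, and for each policy $\pi$ let $\tilde\phi^\pi$ be a probability measure on $\mathcal S\times\mathcal A$. Let $(\rho_t,\pi_t)_{t\ge0}$ solve the coupled system $$\partial_t\rho_t=-\eta\,\mathrm{div}\bigl(\rho_t\,g(\cdot;\rho_t,\pi_t)\bigr),\qquad \partial_t\pi_t=\pi_t A_t,\quad A_t(s,a)=Q_t(s,a)-\int Q_t(s,a')\pi_t(a'\mid s)\mathrm da',$$ with $Q_t=Q(\cdot;\rho_t)$, $\rho_0=\mathcal N(0,I_D)$, and weighting distribution $\tilde\Phi^{\pi_t}=\tilde{\mathcal E}^{\pi_t}_{\tilde\phi^{\pi_t}}$ in $g$, and assume $t\mapsto\rho_t$ and $t\mapsto\rho_{\pi_t}$ are absolutely continuous curves in $(\mathscr P_2(\mathbb R^D),W_2)$. Then for almost every $t$, $$(1-\sqrt\gamma)\,\|Q_t-Q^{\pi_t}\|^2_{2,\tilde\phi^{\pi_t}}\le-\frac{\mathrm d}{\mathrm dt}\frac{\tilde W_2^2(\rho_t,\rho_{\pi_t})}{2\eta}+\Delta_t,$$ where $$\Delta_t=2\alpha^{1/2}\eta^{-1}\mathcal B B_1\,\tilde W_2(\rho_t,\rho_0)\tilde W_2(\rho_t,\rho_{\pi_t})+\alpha^{-1}B_2\Bigl(4B_1\max\{\tilde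 W_2(\rho_{\pi_t},\rho_0),\tilde W_2(\rho_t,\rho_0)\}+B_r\Bigr)\tilde W_2(\rho_t,\rho_{\pi_t})^2.$$
   Context: Same MDP, network, $g$, Assumptions 1 and 2, and Lemma 1 as follows. MDP $(\mathcal S,\mathcal A,\gamma,P,r,\mathcal D_0)$, $\|(s,a)\|_2\le1$, $\gamma\in(0,1)$; $Q^\pi$ the action-value function; $\tilde P^\pi(s',a'\mid s,a)=\pi(a'\mid s')P(s'\mid s,a)$; for a probability measure $\tilde{\mathcal D}$ on $\mathcal S\times\mathcal A$, $\tilde{\mathcal E}^\pi_{\tilde{\mathcal D}}(\mathrm d(s,a))=(1-\gamma)\sum_{m\ge0}\gamma^m\mathbb P((s_m,a_m)\in\mathrm d(s,a))$ for the Markov chain with $(s_0,a_0)\sim\tilde{\mathcal D}$ and transitions $\tilde P^\pi$. Network: $\theta=(b,w)\in\mathbb R\times\mathbb R^{d+1}$, $D=d+2$, $\sigma(s,a;\theta)=B_\beta\beta(b)\tilde\sigma(w^\top(s,a,1))$, $Q(s,a;\rho)=\alpha\int\sigma(s,a;\theta)\rho(\mathrm d\theta)$, $\tilde W_2=\alpha W_2$, $g(\theta;\rho,\pi)=-\mathbb E\{[Q(s,a;\rho)-r(s,a)-\gamma Q(s',a';\rho)]\alpha^{-1}\nabla_\theta\sigma(s,a;\theta)\}$ with $(s,a)\sim\tilde\Phi^\pi$, $(s',a')\sim\tilde P^\pi(\cdot\mid s,a)$. $B_1=\sup\|\nabla_\theta\sigma(s,a;\theta)\|$ and $B_2=\sup\|\nabla^2_{\theta\theta}\sigma(s,a;\theta)\|_F$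 over $(s,a)\in\mathcal S\times\mathcal A$, $\theta\in\mathbb R^D$ (finite under Assumption 1). Assumption 1: $\beta:\mathbb R\to(-1,1)$ odd, invertible, $L_{0,\beta}$-Lipschitz, $L_{1,\beta}$-smooth, $\beta^{-1}$ $\ell_\beta$-Lipschitz on $[-2/3,2/3]$; $\tilde\sigma$ odd, bounded, Lipschitz and smooth. Assumption 2: $r(s,a)=B_r\int\tilde\sigma((s,a,1)^\top w)\mu(\mathrm dw)$, $P(s'\mid s,a)=\int\tilde\sigma((s,a,1)^\top w)\varphi(s')\psi(s';\mathrm dw)$ with probability measures $\mu,\psi(s';\cdot)\in\mathscr P_2(\mathbb R^{d+1})$, $\varphi\ge0$; $0\le r\le B_r$; $\chi^2(\mu\|\mathcal N(0,I_{d+1}))<M_\mu$, $\chi^2(\psi(s;\cdot)\|\mathcal N(0,I_{d+1}))<M_\psi$, $\int\varphi\le M_{1,\varphi}$, $\int\varphi^2\le M_{2,\varphi}$; weighted homogeneous Sobolev distances $\|\cdot\|_{\dot H^{-1}(m)}$ between $\psi(s;\cdot)$, $\psi(s';\cdot)$, $\mu$ (with $m\in\{\mu,\psi(s'';\cdot)\}$) bounded by $\mathcal G$, where $\|\nu_1-\nu_2\|_{\dot H^{-1}(m)}=\sup\{|\int f\mathrm d(\nu_1-\nu_2)|:\int\|\nabla f\|^2\mathrm dm\le1\}$. Lemma 1 properties of $\rho_\pi$: (i) $Q(\cdot;\rho_\pi)=Q^\pi$; (ii) $g(\cdot;\rho_\pi,\pi)=0$; (iii) $\tilde W_2(\rho_\pi,\rho_0)\le\bar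 D$; (iv) $W_2(\rho_{\pi_1},\rho_{\pi_2})\le\alpha^{-1/2}\mathcal B\sup_s\mathbb E_{s'\sim\mathcal E^{\pi_1}_s}\|\pi_1(\cdot\mid s')-\pi_2(\cdot\mid s')\|_1$, with $\mathcal E^{\pi}_s$ the state visitation measure started at $s$. *)

theory Defs
  imports "HOL-Probability.Probability"
begin

definition P2 :: "'x::euclidean_space measure \<Rightarrow> bool" where
  "P2 \<mu> \<longleftrightarrow> prob_space \<mu> \<and> sets \<mu> = sets borel \<and>
     (\<integral>\<^sup>+ x. ennreal ((norm x)\<^sup>2) \<partial>\<mu>) < \<infinity>"

definition couplings :: "'x::euclidean_space measure \<Rightarrow> 'x measure \<Rightarrow> ('x \<times> 'x) measure set" where
  "couplings \<mu> \<nu> = {p. prob_space p \<and> sets p = sets borel \<and>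
      distr p borel fst = \<mu> \<and> distr p borel snd = \<nu>}"

text \<open>2-Wasserstein distance (real-valued; finite on P_2).\<close>
definition W2 :: "'x::euclidean_space measure \<Rightarrow> 'x measure \<Rightarrow> real" where
  "W2 \<mu> \<nu> = sqrt (enn2real (INF p\<in>couplings \<mu> \<nu>.
      \<integral>\<^sup>+ z. ennreal ((norm (fst z - snd z))\<^sup>2) \<partial>p))"

definition std_normal :: "'x::euclidean_space measure" where
  "std_normal = density lborel
     (\<lambda>x. ennreal ((2 * pi) powr (- real DIM('x) / 2) * exp (- (norm x)\<^sup>2 / 2)))"

definition chi_sq :: "'x measure \<Rightarrow> 'x measure \<Rightarrow> ereal" where
  "chi_sq \<mu> \<nu> = (if absolutely_continuous \<nu> \<mu>
      then enn2ereal (\<integral>\<^sup>+ x. (RN_deriv \<nu> \<mu> x)\<^sup>2 \<partial>\<nu>) - 1 else \<infinity>)"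

definition Hneg :: "'x::euclidean_space measure \<Rightarrow> 'x measure \<Rightarrow> 'x measure \<Rightarrow> ereal" where
  "Hneg \<nu>1 \<nu>2 m = (SUP fG \<in> {(f, G). (\<forall>x. (f has_derivative (\<lambda>h. G x \<bullet> h)) (at x)) \<and>
        G \<in> borel_measurable borel \<and> integrable \<nu>1 f \<and> integrable \<nu>2 f \<and>
        (\<integral>\<^sup>+ x. ennreal ((norm (G x))\<^sup>2) \<partial>m) \<le> 1}.
      ereal \<bar>(\<integral>x. fst fG x \<partial>\<nu>1) - (\<integral>x. fst fG x \<partial>\<nu>2)\<bar>)"

definition W2_abs_cont :: "(real \<Rightarrow> 'x::euclidean_space measure) \<Rightarrow> bool" where
  "W2_abs_cont c \<longleftrightarrow> (\<forall>t\<ge>0. P2 (c t)) \<and>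
     (\<exists>m. (\<forall>T. m absolutely_integrable_on {0..T}) \<and>
          (\<forall>s t. 0 \<le> s \<longrightarrow> s \<le> t \<longrightarrow> W2 (c s) (c t) \<le> integral {s..t} m))"

definition odd_fun :: "(real \<Rightarrow> real) \<Rightarrow> bool" where
  "odd_fun f \<longleftrightarrow> (\<forall>x. f (- x) = - f x)"

definition smooth_with :: "real \<Rightarrow> (real \<Rightarrow> real) \<Rightarrow> bool" where
  "smooth_with L f \<longleftrightarrow> (\<forall>x. f differentiable at x) \<and> lipschitz_on L UNIV (deriv f)"

definition Assumption1 ::
  "(real \<Rightarrow> real) \<Rightarrow> (real \<Rightarrow> real) \<Rightarrow> real \<Rightarrow> real \<Rightarrow> real \<Rightarrow> bool" where
  "Assumption1 \<beta> \<sigma>t L0 L1 l \<longleftrightarrow>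
     bij_betw \<beta> UNIV {-1<..<1} \<and> odd_fun \<beta> \<and> lipschitz_on L0 UNIV \<beta> \<and>
     smooth_with L1 \<beta> \<and> (\<forall>x. deriv \<beta> differentiable at x) \<and>
     lipschitz_on l {-2/3..2/3} (inv_into UNIV \<beta>) \<and>
     odd_fun \<sigma>t \<and> bounded (range \<sigma>t) \<and> (\<exists>L. lipschitz_on L UNIV \<sigma>t) \<and>
     (\<exists>L. smooth_with L \<sigma>t) \<and> (\<forall>x. deriv \<sigma>t differentiable at x)"

definition policy :: "'s::euclidean_space set \<Rightarrow> 'a::euclidean_space set \<Rightarrow> ('s \<Rightarrow> 'a \<Rightarrow> real) \<Rightarrow> bool" where
  "policy S Act \<pi> \<longleftrightarrow> (\<lambda>(s, a). \<pi> s a) \<in> borel_measurable borel \<and>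
     (\<forall>s\<in>S. (\<forall>a\<in>Act. 0 \<le> \<pi> s a) \<and> integrable lborel (\<lambda>a. indicator Act a * \<pi> s a) \<and>
        (\<integral>a. indicator Act a * \<pi> s a \<partial>lborel) = 1)"

text \<open>Transition operator of the state-action chain: (Pt f)(s,a) = E_{(s',a') ~ P~^pi(.|s,a)} f(s',a').
  P s' s a is the transition density P(s'|s,a).\<close>
definition Pt :: "'s::euclidean_space set \<Rightarrow> 'a::euclidean_space set \<Rightarrow> ('s \<Rightarrow> 's \<Rightarrow> 'a \<Rightarrow> real) \<Rightarrow>
    ('s \<Rightarrow> 'a \<Rightarrow> real) \<Rightarrow> ('s \<times> 'a \<Rightarrow> real) \<Rightarrow> 's \<times> 'a \<Rightarrow> real" where
  "Pt S Act P \<pi> f = (\<lambda>(s, a). \<integral>s'. indicator S s' * P s' s a *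
      (\<integral>a'. indicator Act a' * \<pi> s' a' * f (s', a') \<partial>lborel) \<partial>lborel)"

text \<open>Action-value function Q^pi(s,a) = E[sum_m gamma^m r(s_m,a_m) | s_0 = s, a_0 = a].\<close>
definition Qpi :: "'s::euclidean_space set \<Rightarrow> 'a::euclidean_space set \<Rightarrow> ('s \<Rightarrow> 's \<Rightarrow> 'a \<Rightarrow> real) \<Rightarrow>
    ('s \<Rightarrow> 'a \<Rightarrow> real) \<Rightarrow> real \<Rightarrow> ('s \<Rightarrow> 'a \<Rightarrow> real) \<Rightarrow> 's \<times> 'a \<Rightarrow> real" where
  "Qpi S Act P r \<gamma> \<pi> = (\<lambda>x. \<Sum>m. \<gamma> ^ m * ((Pt S Act P \<pi> ^^ m) (\<lambda>(s, a). r s a)) x)"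

definition chain_step :: "'s::euclidean_space set \<Rightarrow> 'a::euclidean_space set \<Rightarrow> ('s \<Rightarrow> 's \<Rightarrow> 'a \<Rightarrow> real) \<Rightarrow>
    ('s \<Rightarrow> 'a \<Rightarrow> real) \<Rightarrow> ('s \<times> 'a) measure \<Rightarrow> ('s \<times> 'a) measure" where
  "chain_step S Act P \<pi> M = measure_of UNIV (sets borel)
     (\<lambda>X. \<integral>\<^sup>+ x. (\<integral>\<^sup>+ s'. indicator S s' * ennreal (P s' (fst x) (snd x)) *
          (\<integral>\<^sup>+ a'. indicator Act a' * ennreal (\<pi> s' a') * indicator X (s', a') \<partial>lborel) \<partial>lborel) \<partial>M)"

definition visit :: "'s::euclidean_space set \<Rightarrow> 'a::euclidean_space set \<Rightarrow> ('s \<Rightarrow> 's \<Rightarrow> 'a \<Rightarrow> real) \<Rightarrow>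
    real \<Rightarrow> ('s \<Rightarrow> 'a \<Rightarrow> real) \<Rightarrow> ('s \<times> 'a) measure \<Rightarrow> ('s \<times> 'a) measure" where
  "visit S Act P \<gamma> \<pi> D = measure_of UNIV (sets borel)
     (\<lambda>X. ennreal (1 - \<gamma>) * (\<Sum>m. ennreal (\<gamma> ^ m) * emeasure ((chain_step S Act P \<pi> ^^ m) D) X))"

definition init_at :: "'a::euclidean_space set \<Rightarrow> ('s::euclidean_space \<Rightarrow> 'a \<Rightarrow> real) \<Rightarrow> 's \<Rightarrow> ('s \<times> 'a) measure" where
  "init_at Act \<pi> s = measure_of UNIV (sets borel)
     (\<lambda>X. \<integral>\<^sup>+ a. indicator Act a * ennreal (\<pi> s a) * indicator X (s, a) \<partial>lborel)"

definition state_visit :: "'s::euclidean_space set \<Rightarrow> 'a::euclidean_space set \<Rightarrow> ('s \<Rightarrow> 's \<Rightarrow> 'a \<Rightarrow> real) \<Rightarrow>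
    real \<Rightarrow> ('s \<Rightarrow> 'a \<Rightarrow> real) \<Rightarrow> 's \<Rightarrow> 's measure" where
  "state_visit S Act P \<gamma> \<pi> s = distr (visit S Act P \<gamma> \<pi> (init_at Act \<pi> s)) borel fst"

definition pol_l1 :: "'a::euclidean_space set \<Rightarrow> ('s \<Rightarrow> 'a \<Rightarrow> real) \<Rightarrow> ('s \<Rightarrow> 'a \<Rightarrow> real) \<Rightarrow> 's \<Rightarrow> real" where
  "pol_l1 Act \<pi>1 \<pi>2 s = (\<integral>a. indicator Act a * \<bar>\<pi>1 s a - \<pi>2 s a\<bar> \<partial>lborel)"

section \<open>Two-layer network, theta = (b, w)\<close>

definition sig :: "real \<Rightarrow> (real \<Rightarrow> real) \<Rightarrow> (real \<Rightarrow> real) \<Rightarrow> 's::euclidean_space \<times> 'a::euclidean_space \<Rightarrow>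
    real \<times> ('s \<times> 'a \<times> real) \<Rightarrow> real" where
  "sig B\<beta> \<beta> \<sigma>t x \<theta> = B\<beta> * \<beta> (fst \<theta>) * \<sigma>t (snd \<theta> \<bullet> (fst x, snd x, 1))"

definition grad_sig :: "real \<Rightarrow> (real \<Rightarrow> real) \<Rightarrow> (real \<Rightarrow> real) \<Rightarrow> 's::euclidean_space \<times> 'a::euclidean_space \<Rightarrow>
    real \<times> ('s \<times> 'a \<times> real) \<Rightarrow> real \<times> ('s \<times> 'a \<times> real)" where
  "grad_sig B\<beta> \<beta> \<sigma>t x \<theta> = (let z = (fst x, snd x, 1::real); u = snd \<theta> \<bullet> z in
     (B\<beta> * deriv \<beta> (fst \<theta>) * \<sigma>t u, (B\<beta> * \<beta> (fst \<theta>) * deriv \<sigma>t u) *\<^sub>R z))"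

text \<open>Frobenius norm of the Hessian of sig in theta (explicit; blocks bb, bw, wb, ww).\<close>
definition hess_sig_F :: "real \<Rightarrow> (real \<Rightarrow> real) \<Rightarrow> (real \<Rightarrow> real) \<Rightarrow> 's::euclidean_space \<times> 'a::euclidean_space \<Rightarrow>
    real \<times> ('s \<times> 'a \<times> real) \<Rightarrow> real" where
  "hess_sig_F B\<beta> \<beta> \<sigma>t x \<theta> = (let z = (fst x, snd x, 1::real); u = snd \<theta> \<bullet> z; b = fst \<theta> in
     \<bar>B\<beta>\<bar> * sqrt ((deriv (deriv \<beta>) b * \<sigma>t u)\<^sup>2 + 2 * (deriv \<beta> b * deriv \<sigma>t u)\<^sup>2 * (norm z)\<^sup>2
        + (\<beta> b * deriv (deriv \<sigma>t) u)\<^sup>2 * (norm z) ^ 4))"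

definition B1c :: "'s::euclidean_space set \<Rightarrow> 'a::euclidean_space set \<Rightarrow> real \<Rightarrow> (real \<Rightarrow> real) \<Rightarrow> (real \<Rightarrow> real) \<Rightarrow> real" where
  "B1c S Act B\<beta> \<beta> \<sigma>t = (SUP p \<in> (S \<times> Act) \<times> (UNIV :: (real \<times> ('s \<times> 'a \<times> real)) set).
      norm (grad_sig B\<beta> \<beta> \<sigma>t (fst p) (snd p)))"

definition B2c :: "'s::euclidean_space set \<Rightarrow> 'a::euclidean_space set \<Rightarrow> real \<Rightarrow> (real \<Rightarrow> real) \<Rightarrow> (real \<Rightarrow> real) \<Rightarrow> real" where
  "B2c S Act B\<beta> \<beta> \<sigma>t = (SUP p \<in> (S \<times> Act) \<times> (UNIV :: (real \<times> ('s \<times> 'a \<times> real)) set).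
      hess_sig_F B\<beta> \<beta> \<sigma>t (fst p) (snd p))"

definition Qnet :: "real \<Rightarrow> real \<Rightarrow> (real \<Rightarrow> real) \<Rightarrow> (real \<Rightarrow> real) \<Rightarrow> (real \<times> ('s::euclidean_space \<times> 'a::euclidean_space \<times> real)) measure \<Rightarrow>
    's \<times> 'a \<Rightarrow> real" where
  "Qnet \<alpha> B\<beta> \<beta> \<sigma>t \<rho> x = \<alpha> * (\<integral>\<theta>. sig B\<beta> \<beta> \<sigma>t x \<theta> \<partial>\<rho>)"

definition gfield :: "'s::euclidean_space set \<Rightarrow> 'a::euclidean_space set \<Rightarrow> ('s \<Rightarrow> 's \<Rightarrow> 'a \<Rightarrow> real) \<Rightarrow>
    ('s \<Rightarrow> 'a \<Rightarrow> real) \<Rightarrow> real \<Rightarrow> real \<Rightarrow> real \<Rightarrow> (real \<Rightarrow> real) \<Rightarrow> (real \<Rightarrow> real) \<Rightarrow>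
    ('s \<times> 'a) measure \<Rightarrow> (real \<times> ('s \<times> 'a \<times> real)) measure \<Rightarrow> ('s \<Rightarrow> 'a \<Rightarrow> real) \<Rightarrow>
    real \<times> ('s \<times> 'a \<times> real) \<Rightarrow> real \<times> ('s \<times> 'a \<times> real)" where
  "gfield S Act P r \<gamma> \<alpha> B\<beta> \<beta> \<sigma>t \<Phi> \<rho> \<pi> \<theta> =
     - (\<integral>x. (Qnet \<alpha> B\<beta> \<beta> \<sigma>t \<rho> x - r (fst x) (snd x)
              - \<gamma> * Pt S Act P \<pi> (Qnet \<alpha> B\<beta> \<beta> \<sigma>t \<rho>) x)
            *\<^sub>R ((1 / \<alpha>) *\<^sub>R grad_sig B\<beta> \<beta> \<sigma>t x \<theta>) \<partial>\<Phi>)"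

definition Assumption2 :: "'s::euclidean_space set \<Rightarrow> 'a::euclidean_space set \<Rightarrow> ('s \<Rightarrow> 's \<Rightarrow> 'a \<Rightarrow> real) \<Rightarrow>
    ('s \<Rightarrow> 'a \<Rightarrow> real) \<Rightarrow> (real \<Rightarrow> real) \<Rightarrow> real \<Rightarrow> ('s \<times> 'a \<times> real) measure \<Rightarrow> ('s \<Rightarrow> real) \<Rightarrow>
    ('s \<Rightarrow> ('s \<times> 'a \<times> real) measure) \<Rightarrow> real \<Rightarrow> real \<Rightarrow> real \<Rightarrow> real \<Rightarrow> real \<Rightarrow> bool" where
  "Assumption2 S Act P r \<sigma>t Br \<mu> \<phi> \<psi> M\<mu> M\<psi> M1 M2 G \<longleftrightarrow>
     (\<forall>s\<in>S. \<forall>a\<in>Act. r s a = Br * (\<integral>w. \<sigma>t ((s, a, 1) \<bullet> w) \<partial>\<mu>)) \<and>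
     (\<forall>s'\<in>S. \<forall>s\<in>S. \<forall>a\<in>Act. P s' s a = (\<integral>w. \<sigma>t ((s, a, 1) \<bullet> w) * \<phi> s' \<partial>\<psi> s')) \<and>
     P2 \<mu> \<and> (\<forall>s\<in>S. P2 (\<psi> s)) \<and>
     \<phi> \<in> borel_measurable borel \<and> (\<forall>s. 0 \<le> \<phi> s) \<and>
     (\<forall>s\<in>S. \<forall>a\<in>Act. 0 \<le> r s a \<and> r s a \<le> Br) \<and>
     chi_sq \<mu> std_normal < ereal M\<mu> \<and> (\<forall>s\<in>S. chi_sq (\<psi> s) std_normal < ereal M\<psi>) \<and>
     (\<integral>\<^sup>+ s. indicator S s * ennreal (\<phi> s) \<partial>lborel) \<le> ennreal M1 \<and>
     (\<integral>\<^sup>+ s. indicator S s * ennreal ((\<phi> s)\<^sup>2) \<partial>lborel) \<le> ennreal M2 \<and>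
     (\<forall>s\<in>S. \<forall>s'\<in>S. \<forall>s''\<in>S. \<forall>\<nu>1\<in>{\<psi> s, \<psi> s', \<mu>}. \<forall>\<nu>2\<in>{\<psi> s, \<psi> s', \<mu>}. \<forall>m\<in>{\<mu>, \<psi> s''}.
        Hneg \<nu>1 \<nu>2 m \<le> ereal G)"

definition MDP :: "'s::euclidean_space set \<Rightarrow> 'a::euclidean_space set \<Rightarrow> ('s \<Rightarrow> 's \<Rightarrow> 'a \<Rightarrow> real) \<Rightarrow>
    ('s \<Rightarrow> 'a \<Rightarrow> real) \<Rightarrow> real \<Rightarrow> bool" where
  "MDP S Act P r \<gamma> \<longleftrightarrow> 0 < \<gamma> \<and> \<gamma> < 1 \<and> S \<in> sets lborel \<and> Act \<in> sets lborel \<and>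
     S \<noteq> {} \<and> Act \<noteq> {} \<and> (\<forall>s\<in>S. \<forall>a\<in>Act. norm (s, a) \<le> 1) \<and>
     (\<lambda>(s', s, a). P s' s a) \<in> borel_measurable borel \<and> (\<lambda>(s, a). r s a) \<in> borel_measurable borel \<and>
     (\<forall>s\<in>S. \<forall>a\<in>Act. (\<forall>s'. 0 \<le> P s' s a) \<and> integrable lborel (\<lambda>s'. indicator S s' * P s' s a) \<and>
        (\<integral>s'. indicator S s' * P s' s a \<partial>lborel) = 1)"

definition Lemma1_family where
  "Lemma1_family S Act P r \<gamma> \<alpha> B\<beta> \<beta> \<sigma>t \<phi>t \<rho>P Dbar Bcal \<longleftrightarrow>
     (\<forall>\<pi>. policy S Act \<pi> \<longrightarrow>
        P2 (\<rho>P \<pi>) \<and>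
        (\<forall>s\<in>S. \<forall>a\<in>Act. Qnet \<alpha> B\<beta> \<beta> \<sigma>t (\<rho>P \<pi>) (s, a) = Qpi S Act P r \<gamma> \<pi> (s, a)) \<and>
        (\<forall>\<theta>. gfield S Act P r \<gamma> \<alpha> B\<beta> \<beta> \<sigma>t (visit S Act P \<gamma> \<pi> (\<phi>t \<pi>)) (\<rho>P \<pi>) \<pi> \<theta> = 0) \<and>
        \<alpha> * W2 (\<rho>P \<pi>) std_normal \<le> Dbar) \<and>
     (\<forall>\<pi>1 \<pi>2. policy S Act \<pi>1 \<longrightarrow> policy S Act \<pi>2 \<longrightarrow>
        ereal (W2 (\<rho>P \<pi>1) (\<rho>P \<pi>2)) \<le> ereal (\<alpha> powr (-1/2) * Bcal) *
          (SUP s\<in>S. enn2ereal (\<integral>\<^sup>+ s'. ennreal (pol_l1 Act \<pi>1 \<pi>2 s') \<partial>state_visit S Act P \<gamma> \<pi>1 s)))"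

section \<open>Weak solution of the continuity equation d/dt rho_t = - eta div(rho_t v_t)\<close>

definition weak_continuity_eq :: "real \<Rightarrow> (real \<Rightarrow> 'x::euclidean_space measure) \<Rightarrow> (real \<Rightarrow> 'x \<Rightarrow> 'x) \<Rightarrow> bool" where
  "weak_continuity_eq \<eta> \<rho> v \<longleftrightarrow>
     (\<forall>f G. (\<forall>x. (f has_derivative (\<lambda>h. G x \<bullet> h)) (at x)) \<and> continuous_on UNIV G \<and>
        bounded {x. f x \<noteq> 0} \<longrightarrow>
        (\<forall>t1 t2. 0 \<le> t1 \<longrightarrow> t1 \<le> t2 \<longrightarrow>
           (\<lambda>t. \<eta> * (\<integral>\<theta>. G \<theta> \<bullet> v t \<theta> \<partial>\<rho> t)) integrable_on {t1..t2} \<and>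
           (\<integral>\<theta>. f \<theta> \<partial>\<rho> t2) - (\<integral>\<theta>. f \<theta> \<partial>\<rho> t1) =
             integral {t1..t2} (\<lambda>t. \<eta> * (\<integral>\<theta>. G \<theta> \<bullet> v t \<theta> \<partial>\<rho> t))))"

end

theory Submission
  imports Defs
begin

text \<open>
  At almost every \<open>t\<close> the squared distance has a derivative, so it suffices to bound its right
  difference quotient. Moving \<open>\<rho>\<^sub>t\<close> first and the target \<open>\<rho>\<^sub>\<pi>\<close> afterwards splits the increment in two.
  The target moves at most at the rate given by property (iv), because the replicator equation
  changes \<open>\<pi>\<^sub>t\<close> at relative speed at most \<open>2 sup |Q\<^sub>t|\<close>. The motion of \<open>\<rho>\<^sub>t\<close> contributes
  \<open>2 \<integral> \<langle>x - y, \<eta> g(x)\<rangle> d\<gamma>\<close> for nearly optimal couplings \<open>\<gamma>\<close> of \<open>\<rho>\<^sub>t\<close> and \<open>\<rho>\<^sub>\<pi>\<close>, and a first order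
  Taylor expansion of the network turns this integral into the inner product of the temporal
  difference error with \<open>Q\<^sub>t - Q\<^sup>\<pi>\<close>. Since the visitation measure satisfies
  \<open>\<Phi> = (1 - \<gamma>) \<phi> + \<gamma> \<Phi> P\<close>, that inner product dominates \<open>(1 - sqrt \<gamma>)\<close> times the squared error.

  Neither optimal plans nor disintegrations are needed. Entropic regularisation yields couplings with
  a density with respect to the product measure that are optimal up to any prescribed error. Their
  conditional means are gradients of log-sum-exp functions, so the limit of the difference quotients
  can be read off from the weak continuity equation for a countable family of test functions, and
  Lebesgue differentiation applies to all of them at almost every time.
\<close>

section \<open>Differentiation almost everywhere\<close>

text \<open>When \<open>\<rho>\<close> moves along a field, the displacement x - y of a plan is
  paired with a function of x alone, so only the mean of y given x matters. The continuity equation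
  speaks only of gradients of \<open>C^1\<close> functions of compact support, at times that depend
  on the function, whereas the mean of an optimal plan is a priori just an \<open>L^2\<close> field.
  Hence the detour through kernels whose mean is explicit and has finitely many parameters: these
  can be approximated from a countable set. The price is that the kernels are only nearly optimal. A
  deficit in the cost is divided by the time step h, so it must be \<open>o(h)\<close> and the
  kernel must change with h, while the limit of the pairing is known for one kernel at a time.
  Selecting barycentres of nearly minimal norm resolves this conflict. The bound on
  \<open>|Q_t|\<close> that enters both the policy speed and the Taylor error comes from the start:
  the network average over the Gaussian vanishes because \<beta> is odd, so \<open>|Q_t|\<close> is
  at most \<open>B1\<close> times the scaled distance from \<open>\<rho> 0\<close>.\<close>

lemma negligible_henstock_bad_set:
  fixes f :: "real \<Rightarrow> real"
  assumes f: "f integrable_on {a..b}" and k: "k > 0"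
  shows "negligible {x. \<forall>d>0. \<exists>c e. c < e \<and> e - c < d \<and> x \<in> {c..e} \<and> {c..e} \<subseteq> {a..b} \<and>
            k * (e - c) < \<bar>(e - c) * f x - integral {c..e} f\<bar>}" (is "negligible ?E")
proof (subst negligible_outer_le, intro allI impI)
  fix eps :: real assume eps: "eps > 0"
  \<comment> \<open>The 5 is the enlargement factor of the Vitali covering used below, and
    \<open>k\<close> converts an error of Riemann sums into a total length.\<close>
  define e' where "e' = eps * k / 5"
  have e': "e' > 0" using eps k by (simp add: e'_def)
  obtain \<gamma> where gau: "gauge \<gamma>"
    and hen: "\<And>p. \<lbrakk>p tagged_partial_division_of (cbox a b); \<gamma> fine p\<rbrakk> \<Longrightarrow>
             sum (\<lambda>(x,k). norm(measure lborel k *\<^sub>R f x - integral k f)) p < e'"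
    using Henstock_lemma[OF _ e', of f a b] f by auto
  have ex: "\<exists>c e. c < e \<and> e - c < 1 \<and> x \<in> {c..e} \<and> {c..e} \<subseteq> {a..b} \<and> {c..e} \<subseteq> \<gamma> x \<and>
            k * (e - c) < \<bar>(e - c) * f x - integral {c..e} f\<bar>" if x: "x \<in> ?E" for x
  proof -
    obtain d where d: "d > 0" "ball x d \<subseteq> \<gamma> x"
      using gau unfolding gauge_def by (meson open_contains_ball)
    have "min d 1 > 0" using d by auto
    then obtain c e where ce: "c < e" "e - c < min d 1" "x \<in> {c..e}" "{c..e} \<subseteq> {a..b}"
      "k * (e - c) < \<bar>(e - c) * f x - integral {c..e} f\<bar>"
      using x by blast
    have "{c..e} \<subseteq> ball x d" using ce by (auto simp: dist_real_def)
    then show ?thesis using ce d by (intro exI[of _ c] exI[of _ e]) auto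
  qed
  define Q where "Q x c e \<longleftrightarrow> c < e \<and> e - c < 1 \<and> x \<in> {c..e} \<and> {c..e} \<subseteq> {a..b} \<and> {c..e} \<subseteq> \<gamma> x \<and>
            k * (e - c) < \<bar>(e - c) * f x - integral {c..e} f\<bar>" for x c e
  have "\<forall>x\<in>?E. \<exists>q. Q x (fst q) (snd q)"
  proof
    fix x assume "x \<in> ?E"
    from ex[OF this] obtain c e where "Q x c e" unfolding Q_def by blast
    then show "\<exists>q. Q x (fst q) (snd q)" by (intro exI[of _ "(c, e)"]) simp
  qed
  from bchoice[OF this] obtain q where q: "\<forall>x\<in>?E. Q x (fst (q x)) (snd (q x))" ..
  define c e where "c x = fst (q x)" and "e x = snd (q x)" for x
  have ce: "c x < e x \<and> e x - c x < 1 \<and> x \<in> {c x..e x} \<and>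
        {c x..e x} \<subseteq> {a..b} \<and> {c x..e x} \<subseteq> \<gamma> x \<and>
            k * (e x - c x) < \<bar>(e x - c x) * f x - integral {c x..e x} f\<bar>" if "x \<in> ?E" for x
    using bspec[OF q that] unfolding Q_def c_def e_def .
  define m r where "m x = (c x + e x) / 2" and "r x = (e x - c x) / 2" for x
  have r2: "2 * r x = e x - c x" for x by (simp add: r_def)
  have cb: "cball (m x) (r x) = {c x..e x}" for x
    unfolding cball_eq_atLeastAtMost m_def r_def by (simp add: field_simps)
  have cov: "?E \<subseteq> (\<Union>i\<in>?E. cball (m i) (r i))" unfolding cb using ce by blast
  have rb: "0 < r i \<and> r i \<le> 1" if "i \<in> ?E" for i using ce[OF that] by (auto simp: r_def)
  obtain C where C: "countable C" "C \<subseteq> ?E"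
     "pairwise (\<lambda>i j. disjnt (cball (m i) (r i)) (cball (m j) (r j))) C"
     "?E \<subseteq> (\<Union>i\<in>C. cball (m i) (5 * r i))"
    using Vitali_covering_lemma_cballs[OF cov rb] by blast
  \<comment> \<open>Disjoint intervals of the family form a partial tagged division fine for the
    gauge, so by Henstock's lemma their summed errors stay below \<open>e'\<close>, although each
    error exceeds \<open>k\<close> times the length. Hence the total length is at most
    \<open>e' / k\<close>.\<close>
  have sumr: "(\<Sum>i\<in>C'. 2 * r i) \<le> e' / k" if C': "finite C'" "C' \<subseteq> C" for C'
  proof -
    let ?p = "(\<lambda>i. (i, {c i..e i})) ` C'"
    have inj: "inj_on (\<lambda>i. (i, {c i..e i})) C'" by (auto simp: inj_on_def)
    have p: "?p tagged_partial_division_of (cbox a b)"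
      unfolding tagged_partial_division_of_def
    proof (intro conjI allI impI)
      show "finite ?p" using C' by simp
    next
      fix x K assume "(x, K) \<in> ?p"
      then have x: "x \<in> C'" "K = {c x..e x}" by auto
      then have "x \<in> ?E" using C' C by blast
      from ce[OF this] show "x \<in> K" "K \<subseteq> cbox a b" "\<exists>a b. K = cbox a b" using x by auto
    next
      fix x1 K1 x2 K2 assume "(x1, K1) \<in> ?p \<and> (x2, K2) \<in> ?p \<and> (x1, K1) \<noteq> (x2, K2)"
      then have x: "x1 \<in> C" "x2 \<in> C" "x1 \<noteq> x2" "K1 = {c x1..e x1}" "K2 = {c x2..e x2}"
        using C' by auto
      then have "disjnt K1 K2" using C(3) unfolding pairwise_def cb by auto
      then show "interior K1 \<inter> interior K2 = {}"
        by (metis disjnt_def interior_Int interior_empty)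
    qed
    have fin: "\<gamma> fine ?p"
    proof (rule fineI)
      fix x K assume "(x, K) \<in> ?p"
      then have x: "x \<in> C'" "K = {c x..e x}" by auto
      then have "x \<in> ?E" using C' C by blast
      from ce[OF this] show "K \<subseteq> \<gamma> x" using x by auto
    qed
    have "(\<Sum>i\<in>C'. k * (2 * r i)) \<le> (\<Sum>i\<in>C'. norm (measure lborel {c i..e i} *\<^sub>R f i - integral {c i..e i} f))"
    proof (rule sum_mono)
      fix i assume "i \<in> C'"
      then have "i \<in> ?E" using C' C by blast
      from ce[OF this] have "k * (e i - c i) \<le> \<bar>(e i - c i) * f i - integral {c i..e i} f\<bar>" "c i < e i" by auto
      then show "k * (2 * r i) \<le> norm (measure lborel {c i..e i} *\<^sub>R f i - integral {c i..e i} f)"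
        using r2[of i] by simp
    qed
    also have "\<dots> = sum (\<lambda>(x,k). norm(measure lborel k *\<^sub>R f x - integral k f)) ?p"
      by (subst sum.reindex[OF inj]) simp
    also have "\<dots> < e'" by (rule hen[OF p fin])
    finally show ?thesis using k by (simp add: sum_distrib_left[symmetric] field_simps)
  qed
  let ?T = "\<Union>i\<in>C. cball (m i) (5 * r i)"
  have bd: "measure lebesgue (\<Union>i\<in>I'. cball (m i) (5 * r i)) \<le> eps" if I': "I' \<subseteq> C" "finite I'" for I'
  proof -
    have "measure lebesgue (\<Union>i\<in>I'. cball (m i) (5 * r i)) \<le> (\<Sum>i\<in>I'. measure lebesgue (cball (m i) (5 * r i)))"
      using I' by (intro measure_UNION_le) auto
    also have "\<dots> = (\<Sum>i\<in>I'. 5 * (2 * r i))"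
    proof (rule sum.cong[OF refl])
      fix i assume "i \<in> I'"
      then have "r i > 0" using rb I' C by blast
      then show "measure lebesgue (cball (m i) (5 * r i)) = 5 * (2 * r i)"
        unfolding cball_eq_atLeastAtMost by simp
    qed
    also have "\<dots> = 5 * (\<Sum>i\<in>I'. 2 * r i)" by (simp add: sum_distrib_left)
    also have "\<dots> \<le> 5 * (e' / k)" using sumr[OF I'(2,1)] by simp
    also have "\<dots> = eps" using k by (simp add: e'_def)
    finally show ?thesis .
  qed
  have "?T \<in> lmeasurable"
    by (rule fmeasurable_UN_bound[OF C(1) _ bd]) auto
  moreover have "measure lebesgue ?T \<le> eps"
    by (rule measure_UN_bound[OF C(1) _ bd]) auto
  ultimately show "\<exists>T. ?E \<subseteq> T \<and> T \<in> lmeasurable \<and> measure lebesgue T \<le> eps"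
    using C(4) by blast
qed

text \<open>Off the countable union of the bad sets with thresholds 1/(n+1), every short interval
  containing the point has an average close to the value there. Absolute integrability is not
  assumed: the weak continuity equation supplies only gauge integrability of its right-hand
  side.\<close>

theorem indefinite_integral_has_derivative_ae:
  fixes f :: "real \<Rightarrow> real"
  assumes f: "f integrable_on {a..b}"
  obtains N where "negligible N"
    "\<And>x. x \<in> {a<..<b} - N \<Longrightarrow> ((\<lambda>u. integral {a..u} f) has_real_derivative f x) (at x)"
proof -
  let ?E = "\<lambda>k. {x. \<forall>d>0. \<exists>c e. c < e \<and> e - c < d \<and> x \<in> {c..e} \<and> {c..e} \<subseteq> {a..b} \<and>
            k * (e - c) < \<bar>(e - c) * f x - integral {c..e} f\<bar>}"
  let ?N = "\<Union>n. ?E (inverse (real (Suc n)))"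
  have "negligible ?N"
  proof (rule negligible_countable_Union)
    show "countable (range (\<lambda>n. ?E (inverse (real (Suc n)))))" by blast
    fix A assume "A \<in> range (\<lambda>n. ?E (inverse (real (Suc n))))"
    then obtain n where "A = ?E (inverse (real (Suc n)))" by blast
    then show "negligible A" using negligible_henstock_bad_set[OF f, of "inverse (real (Suc n))"] by simp
  qed
  moreover have "((\<lambda>u. integral {a..u} f) has_real_derivative f x) (at x)" if x: "x \<in> {a<..<b} - ?N" for x
    unfolding has_field_derivative_def has_derivative_within_alt
  proof (intro conjI allI impI)
    show "bounded_linear ((*) (f x))" by (rule bounded_linear_mult_right)
    fix eps :: real assume "eps > 0"
    then obtain n where n: "inverse (real (Suc n)) < eps" using reals_Archimedean by blast
    have "x \<notin> ?E (inverse (real (Suc n)))" using x by blast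
    then obtain d where d: "d > 0"
      and d1: "\<not> (\<exists>c e. c < e \<and> e - c < d \<and> x \<in> {c..e} \<and> {c..e} \<subseteq> {a..b} \<and>
            inverse (real (Suc n)) * (e - c) < \<bar>(e - c) * f x - integral {c..e} f\<bar>)"
      by blast
    have dd: "\<bar>(e - c) * f x - integral {c..e} f\<bar> \<le> inverse (real (Suc n)) * (e - c)"
      if "c < e" "e - c < d" "x \<in> {c..e}" "{c..e} \<subseteq> {a..b}" for c e
      using d1 that not_le by blast
    define d' where "d' = min d (min (x - a) (b - x))"
    have d': "d' > 0" using d x by (auto simp: d'_def)
    have "norm (integral {a..y} f - integral {a..x} f - f x * (y - x)) \<le> eps * norm (y - x)"
      if y: "norm (y - x) < d'" for y
    proof (cases "y = x")
      case True then show ?thesis by simp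
    next
      case False
      define c e where "c = min x y" and "e = max x y"
      have ce: "c < e" "e - c < d" "x \<in> {c..e}" "{c..e} \<subseteq> {a..b}" "a \<le> c"
        using y False x by (auto simp: c_def e_def d'_def)
      have ig: "f integrable_on {a..e}" by (rule integrable_on_subinterval[OF f]) (use ce in auto)
      have "integral {a..c} f + integral {c..e} f = integral {a..e} f"
        by (rule Henstock_Kurzweil_Integration.integral_combine[OF _ _ ig]) (use ce in auto)
      then have "\<bar>integral {a..y} f - integral {a..x} f - f x * (y - x)\<bar> = \<bar>(e - c) * f x - integral {c..e} f\<bar>"
        by (cases "x < y") (auto simp: c_def e_def algebra_simps abs_minus_commute min_def max_def split: if_splits)
      also have "\<dots> \<le> inverse (real (Suc n)) * (e - c)" by (rule dd[OF ce(1-4)])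
      also have "\<dots> \<le> eps * (e - c)" using n ce by (intro mult_right_mono) auto
      also have "e - c = \<bar>y - x\<bar>" by (auto simp: c_def e_def)
      finally show ?thesis by simp
    qed
    then show "\<exists>d>0. \<forall>y\<in>UNIV. norm (y - x) < d \<longrightarrow>
        norm (integral {a..y} f - integral {a..x} f - f x * (y - x)) \<le> eps * norm (y - x)"
      using d' by blast
  qed
  ultimately show ?thesis by (rule that)
qed

lemma lebesgue_negligible_AE_lborel:
  assumes "negligible N" shows "AE x in lborel. x \<notin> N"
proof -
  have "N \<in> null_sets lebesgue" using assms by (simp add: negligible_iff_null_sets)
  then obtain N' where "N' \<in> null_sets lborel" "N \<subseteq> N'"
    by (auto simp: null_sets_completion_iff2)
  then show ?thesis by (intro AE_I'[of N']) auto
qed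

lemma ennreal_add_eqD:
  assumes "ennreal a + ennreal b = ennreal c" "0 \<le> a" "0 \<le> b" "0 \<le> c"
  shows "a + b = c"
  using assms by (metis add_nonneg_nonneg ennreal_inj ennreal_plus)

lemma UN_Ioc_symmetric: "(\<Union>i::nat. {- real i<..real i}) = UNIV"
proof -
  have "x \<in> (\<Union>i::nat. {- real i<..real i})" for x :: real
  proof -
    obtain i where "\<bar>x\<bar> < real i" using reals_Archimedean2 by blast
    then show ?thesis by (intro UN_I[of i]) auto
  qed
  then show ?thesis by blast
qed

text \<open>The Stieltjes measures of \<open>G\<close> and \<open>H\<close> add up to the measure
  with density \<open>m\<close> on half-open intervals, hence on all Borel sets by a Dynkin
  argument; a Lebesgue null set therefore has mass zero under each summand. Finiteness is what
  permits complements in that argument.\<close>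

lemma absolutely_continuous_finite_measure_dominated:
  fixes G H :: "real \<Rightarrow> real" and m :: "real \<Rightarrow> real"
  assumes G: "mono G" "continuous_on UNIV G" and H: "mono H" "continuous_on UNIV H"
    and fin: "finite_measure (interval_measure G)" "finite_measure (interval_measure H)"
    and m: "integrable lborel m" "\<And>x. 0 \<le> m x"
    and eq: "\<And>s t. s \<le> t \<Longrightarrow> G t - G s + (H t - H s) = (LINT x:{s<..t}|lborel. m x)"
  shows "absolutely_continuous lborel (interval_measure G)"
proof -
  let ?\<nu> = "density lborel (\<lambda>x. ennreal (m x))"
  have [measurable]: "m \<in> borel_measurable borel" using m(1) by auto
  have rc: "continuous (at_right a) G" "continuous (at_right a) H" for a
    using G H by (auto simp: continuous_on_eq_continuous_at continuous_at_imp_continuous_at_within)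
  interpret g: finite_measure "interval_measure G" by fact
  interpret h: finite_measure "interval_measure H" by fact
  have nufin: "emeasure ?\<nu> UNIV < \<infinity>"
    using m by (auto simp: emeasure_density integrable_iff_bounded)
  interpret n: finite_measure ?\<nu> by standard (use nufin in auto)
  have bas: "emeasure (interval_measure G) {s<..t} + emeasure (interval_measure H) {s<..t} = emeasure ?\<nu> {s<..t}"
    if st: "s \<le> t" for s t
  proof -
    have "emeasure ?\<nu> {s<..t} = (\<integral>\<^sup>+x. ennreal (indicator {s<..t} x * m x) \<partial>lborel)"
      by (subst emeasure_density) (auto intro!: nn_integral_cong simp: indicator_def)
    also have "\<dots> = ennreal (LINT x:{s<..t}|lborel. m x)"
      unfolding set_lebesgue_integral_def
      by (subst nn_integral_eq_integral) (use m in \<open>auto intro: integrable_mult_indicator[of _ lborel m, simplified]\<close>)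
    also have "\<dots> = ennreal (G t - G s) + ennreal (H t - H s)"
      using eq[OF st] G H st by (subst ennreal_plus[symmetric]) (auto simp: mono_def)
    also have "ennreal (G t - G s) = emeasure (interval_measure G) {s<..t}"
      by (subst emeasure_interval_measure_Ioc[OF st]) (use G rc in \<open>auto simp: mono_def\<close>)
    also have "ennreal (H t - H s) = emeasure (interval_measure H) {s<..t}"
      by (subst emeasure_interval_measure_Ioc[OF st]) (use H rc in \<open>auto simp: mono_def\<close>)
    finally show ?thesis by simp
  qed
  have univ: "emeasure (interval_measure G) UNIV + emeasure (interval_measure H) UNIV = emeasure ?\<nu> UNIV"
  proof -
    have inc: "incseq (\<lambda>i::nat. {- real i<..real i})" by (auto simp: incseq_def)
    have lim: "(\<lambda>i::nat. emeasure M {- real i<..real i}) \<longlonglongrightarrow> emeasure M UNIV" if "sets M = sets borel" for M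
    proof -
      have "range (\<lambda>i::nat. {- real i<..real i}) \<subseteq> sets M"
        unfolding that by (rule image_subsetI) simp
      from Lim_emeasure_incseq[OF this inc] show ?thesis unfolding UN_Ioc_symmetric .
    qed
    have "(\<lambda>i::nat. emeasure (interval_measure G) {- real i<..real i} + emeasure (interval_measure H) {- real i<..real i})
        \<longlonglongrightarrow> emeasure (interval_measure G) UNIV + emeasure (interval_measure H) UNIV"
      by (intro tendsto_add lim) auto
    moreover have "(\<lambda>i::nat. emeasure ?\<nu> {- real i<..real i}) \<longlonglongrightarrow> emeasure ?\<nu> UNIV"
      by (rule lim) auto
    moreover have "(\<lambda>i::nat. emeasure ?\<nu> {- real i<..real i}) =
        (\<lambda>i::nat. emeasure (interval_measure G) {- real i<..real i} + emeasure (interval_measure H) {- real i<..real i})"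
      by (rule ext, rule bas[symmetric]) auto
    ultimately show ?thesis using LIMSEQ_unique by metis
  qed
  have all: "emeasure (interval_measure G) A + emeasure (interval_measure H) A = emeasure ?\<nu> A"
    if A: "A \<in> sets borel" for A
  proof -
    have sb: "sets borel = sigma_sets UNIV (range (\<lambda>(a::real, b). {a<..b}))"
      by (subst borel_sigma_sets_Ioc) auto
    have int: "Int_stable (range (\<lambda>(a::real, b). {a<..b}))"
    proof (rule Int_stableI)
      fix A B assume "A \<in> range (\<lambda>(a::real, b). {a<..b})" "B \<in> range (\<lambda>(a::real, b). {a<..b})"
      then obtain a b c d where "A = {a<..b}" "B = {c<..d}" by auto
      then have "A \<inter> B = {max a c<..min b d}" by auto
      then show "A \<inter> B \<in> range (\<lambda>(a::real, b). {a<..b})" by auto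
    qed
    note int
    moreover have "range (\<lambda>(a::real, b). {a<..b}) \<subseteq> Pow UNIV" by simp
    moreover have "A \<in> sigma_sets UNIV (range (\<lambda>(a::real, b). {a<..b}))" using A sb by simp
    ultimately show ?thesis
    proof (induction rule: sigma_sets_induct_disjoint)
      case (basic A)
      then obtain a b where "A = {a<..b}" by auto
      then show ?case using bas[of a b] by (cases "a \<le> b") auto
    next
      case empty then show ?case by simp
    next
      case (compl A)
      then have A: "A \<in> sets borel" using sb by simp
      have gg: "measure (interval_measure G) UNIV + measure (interval_measure H) UNIV = measure ?\<nu> UNIV"
        using univ unfolding g.emeasure_eq_measure h.emeasure_eq_measure n.emeasure_eq_measure
        by (auto intro: ennreal_add_eqD)
      have "measure (interval_measure G) A + measure (interval_measure H) A = measure ?\<nu> A"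
        using compl unfolding g.emeasure_eq_measure h.emeasure_eq_measure n.emeasure_eq_measure
        by (auto intro: ennreal_add_eqD)
      then have "measure (interval_measure G) (UNIV - A) + measure (interval_measure H) (UNIV - A) = measure ?\<nu> (UNIV - A)"
        using gg n.finite_measure_compl[of A] g.finite_measure_compl[of A] h.finite_measure_compl[of A] A by simp
      then show ?case unfolding g.emeasure_eq_measure h.emeasure_eq_measure n.emeasure_eq_measure
        by (subst ennreal_plus[symmetric]) auto
    next
      case (union A)
      then have A: "range A \<subseteq> sets borel" using sb by auto
      have s: "emeasure M (\<Union>i. A i) = (\<Sum>i. emeasure M (A i))" if "sets M = sets borel" for M
        using suminf_emeasure[of A M] A union that by auto
      have "(\<Sum>i. emeasure (interval_measure G) (A i)) + (\<Sum>i. emeasure (interval_measure H) (A i)) =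
          (\<Sum>i. emeasure (interval_measure G) (A i) + emeasure (interval_measure H) (A i))"
        by (rule suminf_add) auto
      then show ?case using union by (simp add: s)
    qed
  qed
  show ?thesis
    unfolding absolutely_continuous_def
  proof
    fix A assume "A \<in> null_sets (lborel::real measure)"
    then have A: "A \<in> sets borel" "emeasure lborel A = 0" by auto
    then have "A \<in> null_sets ?\<nu>"
      by (subst null_sets_density_iff) (auto intro!: AE_I[of _ _ A])
    then have "emeasure (interval_measure G) A = 0" using all[OF A(1)] by auto
    then show "A \<in> null_sets (interval_measure G)" using A by auto
  qed
qed


lemma finite_interval_measure_bounded:
  fixes G :: "real \<Rightarrow> real"
  assumes G: "mono G" "continuous_on UNIV G" and b: "\<And>x. \<bar>G x\<bar> \<le> B"
  shows "finite_measure (interval_measure G)"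
proof
  have inc: "incseq (\<lambda>i::nat. {- real i<..real i})" by (auto simp: incseq_def)
  have rc: "continuous (at_right a) G" for a
    using G by (auto simp: continuous_on_eq_continuous_at continuous_at_imp_continuous_at_within)
  have "emeasure (interval_measure G) {- real i<..real i} \<le> ennreal (2 * B)" for i
    by (subst emeasure_interval_measure_Ioc) (use G rc b[of "real i"] b[of "- real i"] in \<open>auto simp: mono_def intro!: ennreal_leI\<close>)
  then have "emeasure (interval_measure G) (\<Union>i::nat. {- real i<..real i}) \<le> ennreal (2 * B)"
    by (subst SUP_emeasure_incseq[symmetric, OF _ inc]) (auto intro: SUP_least)
  then show "emeasure (interval_measure G) (space (interval_measure G)) \<noteq> \<infinity>"
    by (auto simp: UN_Ioc_symmetric top_unique)
qed

text \<open>With \<open>A\<close> the primitive of the dominating function, \<open>A + F\<close> and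
  \<open>A - F\<close> are increasing and the sum of their measures has a density, so the measure of
  \<open>A + F\<close> has one as well. By Radon-Nikodym, \<open>A + F\<close> is an indefinite
  integral; Lebesgue differentiation of it and of \<open>A\<close> yields the derivative of
  \<open>F\<close>.\<close>

theorem integral_dominated_increments_differentiable_ae:
  fixes F m :: "real \<Rightarrow> real"
  assumes m: "m absolutely_integrable_on {0..T}"
    and F: "\<And>s t. 0 \<le> s \<Longrightarrow> s \<le> t \<Longrightarrow> t \<le> T \<Longrightarrow> \<bar>F t - F s\<bar> \<le> integral {s..t} m"
  shows "AE t in lborel. 0 < t \<and> t < T \<longrightarrow> F differentiable (at t)"
proof (cases "0 < T")
  case False then show ?thesis by auto
next
  case T: True
  \<comment> \<open>The bound is only Lebesgue measurable, while densities with respect to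
    \<open>lborel\<close> must be Borel; a Borel version of its absolute value is used from here
    on.\<close>
  obtain m1 where m1[measurable]: "m1 \<in> borel_measurable borel"
    and m1eq: "AE x in lebesgue. indicator {0..T} x * \<bar>m x\<bar> = m1 x"
  proof -
    have "(\<lambda>x. indicator {0..T} x * \<bar>m x\<bar>) \<in> borel_measurable lebesgue"
      using absolutely_integrable_norm[OF m] unfolding set_integrable_def by (auto dest: borel_measurable_integrable)
    then obtain g where "g \<in> borel_measurable lborel" "AE x in lborel. indicator {0..T} x * \<bar>m x\<bar> = g x"
      using completion_ex_borel_measurable_real[of "\<lambda>x. indicator {0..T} x * \<bar>m x\<bar>" lborel] by auto
    then show ?thesis by (intro that[of g]) (auto intro: AE_completion)
  qed
  define M1 where "M1 x = indicator {0..T} x * \<bar>m1 x\<bar>" for x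
  have M1m[measurable]: "M1 \<in> borel_measurable borel" unfolding M1_def by measurable
  have M1nn: "0 \<le> M1 x" for x by (simp add: M1_def)
  have M1ae: "AE x in lebesgue. indicator {0..T} x * \<bar>m x\<bar> = M1 x"
    using m1eq by eventually_elim (auto simp: M1_def indicator_def split: if_splits)
  have M1L: "integrable lebesgue M1"
    using absolutely_integrable_norm[OF m] unfolding set_integrable_def
    by (rule integrable_cong_AE_imp) (use M1ae in \<open>auto intro: measurable_completion elim!: AE_mp\<close>)
  have M1i: "integrable lborel M1"
    using M1L by (subst (asm) integrable_completion) auto
  have M1set: "set_integrable lborel S M1" if "S \<in> sets borel" for S
    unfolding set_integrable_def using integrable_mult_indicator[OF _ M1i, of S] that by simp
  define A where "A t = integral {0..t} M1" for t
  have M1on: "M1 integrable_on {s..t}" for s t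
    by (rule set_borel_integral_eq_integral(1)[OF M1set]) simp
  have Adiff: "A t - A s = integral {s..t} M1" if "0 \<le> s" "s \<le> t" for s t
    using Henstock_Kurzweil_Integration.integral_combine[OF that M1on] by (simp add: A_def)
  have Amono: "A s \<le> A t" if "0 \<le> s" "s \<le> t" for s t
    using Adiff[OF that] Henstock_Kurzweil_Integration.integral_nonneg[OF M1on, of s t] M1nn by auto
  have FA: "\<bar>F t - F s\<bar> \<le> A t - A s" if st: "0 \<le> s" "s \<le> t" "t \<le> T" for s t
  proof -
    have mi: "(\<lambda>x. \<bar>m x\<bar>) integrable_on {s..t}" "m integrable_on {s..t}"
    proof -
      have "m absolutely_integrable_on {s..t}"
        by (rule set_integrable_subset[OF m]) (use st in auto)
      then show "(\<lambda>x. \<bar>m x\<bar>) integrable_on {s..t}" "m integrable_on {s..t}"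
        by (auto simp: absolutely_integrable_on_def)
    qed
    have "\<bar>F t - F s\<bar> \<le> integral {s..t} m" by (rule F[OF st])
    also have "\<dots> \<le> integral {s..t} (\<lambda>x. \<bar>m x\<bar>)"
      by (rule integral_le[OF mi(2,1)]) auto
    also have "\<dots> = integral {s..t} M1"
    proof -
      obtain N where N: "N \<in> null_sets lebesgue" "{x. indicator {0..T} x * \<bar>m x\<bar> \<noteq> M1 x} \<subseteq> N"
        using M1ae by (auto simp: eventually_ae_filter)
      show ?thesis
      proof (rule integral_spike[of N])
        show "negligible N" using N by (simp add: negligible_iff_null_sets)
        fix x assume x: "x \<in> {s..t} - N"
        then have "indicator {0..T} x * \<bar>m x\<bar> = M1 x" using N by blast
        then show "M1 x = \<bar>m x\<bar>" using x st by (auto simp: indicator_def)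
      qed
    qed
    also have "\<dots> = A t - A s" using Adiff[of s t] st by simp
    finally show ?thesis .
  qed
  \<comment> \<open>Clamping the time to \<open>[0, T]\<close> extends \<open>F\<close> and
    \<open>A\<close> to the whole line as constants outside the interval, which keeps both Stieltjes
    measures finite.\<close>
  define cl where "cl t = max 0 (min T t)" for t
  have cl: "0 \<le> cl t" "cl t \<le> T" "s \<le> t \<Longrightarrow> cl s \<le> cl t" for s t using T by (auto simp: cl_def)
  have clc: "continuous_on UNIV cl" unfolding cl_def by (intro continuous_intros)
  have Ac: "continuous_on {0..T} A" unfolding A_def by (rule indefinite_integral_continuous_1[OF M1on])
  have Acl: "continuous_on UNIV (\<lambda>t. A (cl t))"
    by (rule continuous_on_compose2[OF Ac clc]) (use cl in auto)
  have Fc: "continuous_on {0..T} F"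
  proof (rule continuous_on_iff[THEN iffD2], intro ballI allI impI)
    fix x e assume x: "x \<in> {0..T}" and e: "(0::real) < e"
    from Ac x e obtain d where d: "d > 0" "\<And>y. y \<in> {0..T} \<Longrightarrow> dist y x < d \<Longrightarrow> dist (A y) (A x) < e"
      unfolding continuous_on_iff by blast
    have "dist (F y) (F x) < e" if y: "y \<in> {0..T}" "dist y x < d" for y
    proof -
      have "\<bar>F y - F x\<bar> \<le> \<bar>A y - A x\<bar>"
        using FA[of x y] FA[of y x] x y(1) by (cases "x \<le> y") auto
      then show ?thesis using d(2)[OF y] by (simp add: dist_real_def)
    qed
    then show "\<exists>d>0. \<forall>x'\<in>{0..T}. dist x' x < d \<longrightarrow> dist (F x') (F x) < e" using d(1) by blast
  qed
  have Fcl: "continuous_on UNIV (\<lambda>t. F (cl t))"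
    by (rule continuous_on_compose2[OF Fc clc]) (use cl in auto)
  define G H where "G t = F (cl t) + A (cl t)" and "H t = A (cl t) - F (cl t)" for t
  have Gm: "mono G" "mono H"
  proof -
    have "\<bar>F (cl t) - F (cl s)\<bar> \<le> A (cl t) - A (cl s)" if "s \<le> t" for s t
      using FA[of "cl s" "cl t"] cl that by auto
    then have "F (cl s) + A (cl s) \<le> F (cl t) + A (cl t) \<and> A (cl s) - F (cl s) \<le> A (cl t) - F (cl t)"
      if "s \<le> t" for s t using that by (smt (verit))
    then show "mono G" "mono H" unfolding mono_def G_def H_def by auto
  qed
  have Gc: "continuous_on UNIV G" "continuous_on UNIV H"
    unfolding G_def H_def by (intro continuous_intros Acl Fcl)+
  have Gb: "\<bar>G x\<bar> \<le> \<bar>G 0\<bar> + \<bar>G T\<bar>" "\<bar>H x\<bar> \<le> \<bar>H 0\<bar> + \<bar>H T\<bar>" for x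
  proof -
    have "G x = G (cl x)" "H x = H (cl x)" using cl T by (auto simp: G_def H_def cl_def)
    moreover have "G 0 \<le> G (cl x)" "G (cl x) \<le> G T" "H 0 \<le> H (cl x)" "H (cl x) \<le> H T"
      using Gm cl by (auto simp: mono_def)
    ultimately show "\<bar>G x\<bar> \<le> \<bar>G 0\<bar> + \<bar>G T\<bar>" "\<bar>H x\<bar> \<le> \<bar>H 0\<bar> + \<bar>H T\<bar>" by linarith+
  qed
  note fin = finite_interval_measure_bounded[OF Gm(1) Gc(1) Gb(1)] finite_interval_measure_bounded[OF Gm(2) Gc(2) Gb(2)]
  have eq: "G t - G s + (H t - H s) = (LINT x:{s<..t}|lborel. 2 * M1 x)" if st: "s \<le> t" for s t
  proof -
    have "AE x in lborel. x \<noteq> 0 \<and> x \<noteq> T \<and> x \<noteq> s \<and> x \<noteq> t"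
      by (intro AE_conjI AE_lborel_singleton)
    then have "AE x in lborel. indicator {s<..t} x *\<^sub>R (2 * M1 x) = indicator {cl s..cl t} x *\<^sub>R (2 * M1 x)"
      by eventually_elim (auto simp: M1_def indicator_def cl_def)
    then have "(LINT x:{s<..t}|lborel. 2 * M1 x) = (LINT x:{cl s..cl t}|lborel. 2 * M1 x)"
      unfolding set_lebesgue_integral_def by (intro integral_cong_AE) auto
    also have "\<dots> = 2 * (LINT x:{cl s..cl t}|lborel. M1 x)" by simp
    also have "\<dots> = 2 * integral {cl s..cl t} M1"
      by (subst set_borel_integral_eq_integral(2)[OF M1set]) auto
    also have "\<dots> = 2 * (A (cl t) - A (cl s))" using Adiff[of "cl s" "cl t"] cl st by simp
    finally show ?thesis by (simp add: G_def H_def)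
  qed
  have ac: "absolutely_continuous lborel (interval_measure G)"
    by (rule absolutely_continuous_finite_measure_dominated[OF Gm(1) Gc(1) Gm(2) Gc(2) fin _ _ eq])
       (use M1i M1nn in auto)
  interpret g: finite_measure "interval_measure G" by (rule fin)
  define f where "f = RN_deriv lborel (interval_measure G)"
  have fm[measurable]: "f \<in> borel_measurable borel" unfolding f_def by measurable
  have dens: "density lborel f = interval_measure G"
    unfolding f_def by (rule sigma_finite_measure.density_RN_deriv[OF sigma_finite_lborel ac]) simp
  have ffin: "(\<integral>\<^sup>+x. f x \<partial>lborel) < \<infinity>"
  proof -
    have "(\<integral>\<^sup>+x. f x \<partial>lborel) = emeasure (density lborel f) UNIV" by (subst emeasure_density) auto
    also have "\<dots> < \<infinity>" unfolding dens using g.emeasure_finite[of UNIV] unfolding infinity_ennreal_def less_top .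
    finally show ?thesis .
  qed
  have fae: "AE x in lborel. f x = ennreal (enn2real (f x))"
    using nn_integral_PInf_AE[of f lborel] ffin by (auto simp: less_top elim!: AE_mp)
  have fi: "integrable lborel (\<lambda>x. enn2real (f x))"
    by (rule integrableI_nonneg) (use ffin fae in \<open>auto simp: nn_integral_cong_AE[OF fae, symmetric]\<close>)
  have fset: "set_integrable lborel S (\<lambda>x. enn2real (f x))" if "S \<in> sets borel" for S
    unfolding set_integrable_def using integrable_mult_indicator[OF _ fi, of S] that by simp
  have Gf: "G t - G 0 = integral {0..t} (\<lambda>x. enn2real (f x))" if t: "0 \<le> t" for t
  proof -
    have "ennreal (G t - G 0) = emeasure (interval_measure G) {0<..t}"
      by (rule emeasure_interval_measure_Ioc[symmetric])
        (use Gm Gc t in \<open>auto simp: mono_def continuous_on_eq_continuous_at continuous_at_imp_continuous_at_within\<close>)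
    also have "\<dots> = (\<integral>\<^sup>+x. f x * indicator {0<..t} x \<partial>lborel)"
      unfolding dens[symmetric] by (subst emeasure_density) auto
    also have "\<dots> = (\<integral>\<^sup>+x. ennreal (indicator {0..t} x *\<^sub>R enn2real (f x)) \<partial>lborel)"
    proof (rule nn_integral_cong_AE)
      show "AE x in lborel. f x * indicator {0<..t} x = ennreal (indicator {0..t} x *\<^sub>R enn2real (f x))"
        using fae AE_lborel_singleton[of 0] by eventually_elim (auto simp: indicator_def)
    qed
    also have "\<dots> = ennreal (LINT x:{0..t}|lborel. enn2real (f x))"
      unfolding set_lebesgue_integral_def
      by (rule nn_integral_eq_integral) (use fset[of "{0..t}"] in \<open>auto simp: set_integrable_def\<close>)
    also have "(LINT x:{0..t}|lborel. enn2real (f x)) = integral {0..t} (\<lambda>x. enn2real (f x))"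
      by (rule set_borel_integral_eq_integral(2)[OF fset]) simp
    finally show ?thesis
      using Gm t Henstock_Kurzweil_Integration.integral_nonneg[OF set_borel_integral_eq_integral(1)[OF fset], of "{0..t}"]
      by (subst (asm) ennreal_inj) (auto simp: mono_def)
  qed
  obtain N1 where N1: "negligible N1" "\<And>x. x \<in> {0<..<T} - N1 \<Longrightarrow> (A has_real_derivative M1 x) (at x)"
    using indefinite_integral_has_derivative_ae[OF M1on, of 0 T] unfolding A_def by blast
  obtain N2 where N2: "negligible N2" "\<And>x. x \<in> {0<..<T} - N2 \<Longrightarrow>
      ((\<lambda>t. integral {0..t} (\<lambda>x. enn2real (f x))) has_real_derivative enn2real (f x)) (at x)"
    using indefinite_integral_has_derivative_ae[OF set_borel_integral_eq_integral(1)[OF fset[of "{0..T}"]]] by auto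
  have "AE x in lborel. x \<notin> N1 \<union> N2"
    by (rule lebesgue_negligible_AE_lborel) (use N1 N2 in auto)
  then show ?thesis
  proof eventually_elim
    fix t assume t: "t \<notin> N1 \<union> N2"
    show "0 < t \<and> t < T \<longrightarrow> F differentiable (at t)"
    proof
      assume tT: "0 < t \<and> t < T"
      have "((\<lambda>u. G 0 + integral {0..u} (\<lambda>x. enn2real (f x)) - A u) has_real_derivative 0 + enn2real (f t) - M1 t) (at t)"
        by (intro derivative_intros N1 N2) (use t tT in auto)
      then have "(F has_real_derivative 0 + enn2real (f t) - M1 t) (at t)"
      proof (rule has_field_derivative_transform_within_open[of _ _ _ "{0<..<T}"])
        fix u assume u: "u \<in> {0<..<T}"
        then have "G u = F u + A u" by (simp add: G_def cl_def)
        then show "G 0 + integral {0..u} (\<lambda>x. enn2real (f x)) - A u = F u" using Gf[of u] u by simp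
      qed (use tT in auto)
      then show "F differentiable (at t)" using real_differentiable_def by blast
    qed
  qed
qed

section \<open>Couplings and the Wasserstein distance\<close>

lemma borel_measurable_fst_snd_prod [measurable (raw)]:
  fixes f :: "'c \<Rightarrow> 'a::second_countable_topology \<times> 'b::second_countable_topology"
  assumes "f \<in> borel_measurable M"
  shows "(\<lambda>x. fst (f x)) \<in> borel_measurable M" "(\<lambda>x. snd (f x)) \<in> borel_measurable M"
proof -
  have "fst \<in> borel_measurable (borel :: ('a \<times> 'b) measure)" "snd \<in> borel_measurable (borel :: ('a \<times> 'b) measure)"
    by (intro borel_measurable_continuous_onI continuous_intros)+
  from measurable_compose[OF assms this(1)] measurable_compose[OF assms this(2)]
  show "(\<lambda>x. fst (f x)) \<in> borel_measurable M" "(\<lambda>x. snd (f x)) \<in> borel_measurable M" .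
qed

lemma P2_integrable:
  fixes f :: "'x::euclidean_space \<Rightarrow> 'b::{banach, second_countable_topology}"
  assumes P: "P2 \<mu>" and f: "f \<in> borel_measurable borel"
    and b: "\<And>x. norm (f x) \<le> a + b * (norm x)\<^sup>2"
  shows "integrable \<mu> f"
proof -
  interpret prob_space \<mu> using P by (simp add: P2_def)
  have s[measurable_cong]: "sets \<mu> = sets borel" using P by (simp add: P2_def)
  have "integrable \<mu> (\<lambda>x. (norm x)\<^sup>2)"
    by (rule integrableI_nonneg) (use P in \<open>auto simp: P2_def\<close>)
  then have "integrable \<mu> (\<lambda>x. a + b * (norm x)\<^sup>2)" by auto
  then show ?thesis
  proof (rule Bochner_Integration.integrable_bound)
    show "f \<in> borel_measurable \<mu>" using f by measurable
    show "AE x in \<mu>. norm (f x) \<le> norm (a + b * (norm x)\<^sup>2)"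
      by (intro AE_I2 order_trans[OF b]) (metis abs_ge_self real_norm_def)
  qed
qed

lemma norm_le_one_plus_sq: "norm x \<le> 1 + (norm x)\<^sup>2"
proof -
  have "0 \<le> (norm x - 1/2)\<^sup>2" by simp
  then show ?thesis by (simp add: power2_eq_square algebra_simps)
qed

lemma P2_integrable_linear:
  fixes f :: "'x::euclidean_space \<Rightarrow> 'b::{banach, second_countable_topology}"
  assumes P: "P2 \<mu>" and f: "f \<in> borel_measurable borel"
    and b: "\<And>x. norm (f x) \<le> a + b * norm x"
  shows "integrable \<mu> f"
proof (rule P2_integrable[OF P f, of "a + \<bar>b\<bar>" "\<bar>b\<bar>"])
  fix x :: 'x
  have "b * norm x \<le> \<bar>b\<bar> * (1 + (norm x)\<^sup>2)"
    using norm_le_one_plus_sq[of x] by (intro mult_mono) auto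
  then show "norm (f x) \<le> a + \<bar>b\<bar> + \<bar>b\<bar> * (norm x)\<^sup>2"
    using b[of x] by (simp add: algebra_simps)
qed

lemma couplings_sets: "p \<in> couplings \<mu> \<nu> \<Longrightarrow> sets p = sets borel"
  by (simp add: couplings_def)

lemma nn_integral_coupling_fst:
  assumes p: "p \<in> couplings \<mu> \<nu>" and f: "f \<in> borel_measurable borel"
  shows "(\<integral>\<^sup>+ z. f (fst z) \<partial>p) = (\<integral>\<^sup>+ x. f x \<partial>\<mu>)" "(\<integral>\<^sup>+ z. f (snd z) \<partial>p) = (\<integral>\<^sup>+ x. f x \<partial>\<nu>)"
proof -
  have [measurable_cong]: "sets p = sets borel" by (rule couplings_sets[OF p])
  have "\<mu> = distr p borel fst" "\<nu> = distr p borel snd" using p by (auto simp: couplings_def)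
  then show "(\<integral>\<^sup>+ z. f (fst z) \<partial>p) = (\<integral>\<^sup>+ x. f x \<partial>\<mu>)" "(\<integral>\<^sup>+ z. f (snd z) \<partial>p) = (\<integral>\<^sup>+ x. f x \<partial>\<nu>)"
    using f by (auto simp: nn_integral_distr)
qed

lemma integral_coupling:
  fixes f :: "'x::euclidean_space \<Rightarrow> 'b::{banach, second_countable_topology}"
  assumes p: "p \<in> couplings \<mu> \<nu>" and f: "f \<in> borel_measurable borel"
  shows "(\<integral> z. f (fst z) \<partial>p) = (\<integral> x. f x \<partial>\<mu>)" "(\<integral> z. f (snd z) \<partial>p) = (\<integral> x. f x \<partial>\<nu>)"
proof -
  have [measurable_cong]: "sets p = sets borel" by (rule couplings_sets[OF p])
  have "\<mu> = distr p borel fst" "\<nu> = distr p borel snd" using p by (auto simp: couplings_def)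
  then show "(\<integral> z. f (fst z) \<partial>p) = (\<integral> x. f x \<partial>\<mu>)" "(\<integral> z. f (snd z) \<partial>p) = (\<integral> x. f x \<partial>\<nu>)"
    using f by (auto simp: integral_distr)
qed

lemma norm_pair_sq: "(norm z)\<^sup>2 = (norm (fst z))\<^sup>2 + (norm (snd z))\<^sup>2"
  by (simp add: norm_prod_def)

lemma couplings_P2:
  assumes p: "p \<in> couplings \<mu> \<nu>" and "P2 \<mu>" "P2 \<nu>"
  shows "P2 p"
proof -
  have [measurable_cong]: "sets p = sets borel" by (rule couplings_sets[OF p])
  have "(\<integral>\<^sup>+ z. ennreal ((norm z)\<^sup>2) \<partial>p) = (\<integral>\<^sup>+ z. ennreal ((norm (fst z))\<^sup>2) + ennreal ((norm (snd z))\<^sup>2) \<partial>p)"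
    by (intro nn_integral_cong) (simp add: norm_pair_sq)
  also have "\<dots> = (\<integral>\<^sup>+ z. ennreal ((norm (fst z))\<^sup>2) \<partial>p) + (\<integral>\<^sup>+ z. ennreal ((norm (snd z))\<^sup>2) \<partial>p)"
    by (rule nn_integral_add) auto
  also have "\<dots> = (\<integral>\<^sup>+ x. ennreal ((norm x)\<^sup>2) \<partial>\<mu>) + (\<integral>\<^sup>+ x. ennreal ((norm x)\<^sup>2) \<partial>\<nu>)"
    using nn_integral_coupling_fst[OF p, of "\<lambda>x. ennreal ((norm x)\<^sup>2)"] by simp
  also have "\<dots> < \<infinity>" using assms(2,3) by (simp add: P2_def)
  finally show ?thesis using p by (simp add: P2_def couplings_def)
qed

text \<open>Real-valued form of the transport cost whose infimum defines \<open>W2\<close>; on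
  couplings of measures with finite second moment nothing is lost by it.\<close>

definition cost :: "('x::euclidean_space \<times> 'x) measure \<Rightarrow> real" where
  "cost p = (\<integral> z. (norm (fst z - snd z))\<^sup>2 \<partial>p)"

lemma norm_diff_sq_le:
  fixes x y :: "'x::real_inner"
  shows "(norm (x - y))\<^sup>2 \<le> 2 * ((norm x)\<^sup>2 + (norm y)\<^sup>2)"
proof -
  have "0 \<le> (norm (x + y))\<^sup>2" by simp
  then show ?thesis unfolding power2_norm_eq_inner by (simp add: inner_add inner_diff inner_commute algebra_simps)
qed

lemma integrable_cost:
  assumes "P2 p" shows "integrable p (\<lambda>z. (norm (fst z - snd z))\<^sup>2)"
proof (rule P2_integrable[OF assms, of _ 0 2])
  show "(\<lambda>z::'a \<times> 'a. (norm (fst z - snd z))\<^sup>2) \<in> borel_measurable borel" by measurable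
  fix z :: "'a \<times> 'a" show "norm ((norm (fst z - snd z))\<^sup>2) \<le> 0 + 2 * (norm z)\<^sup>2"
    using norm_diff_sq_le[of "fst z" "snd z"] by (simp add: norm_pair_sq)
qed

lemma nn_integral_cost:
  assumes "P2 p" shows "(\<integral>\<^sup>+ z. ennreal ((norm (fst z - snd z))\<^sup>2) \<partial>p) = ennreal (cost p)"
  unfolding cost_def by (rule nn_integral_eq_integral[OF integrable_cost[OF assms]]) auto

lemma cost_nonneg: "0 \<le> cost p"
  by (simp add: cost_def)

lemma W2_nonneg: "0 \<le> W2 \<mu> \<nu>"
  by (simp add: W2_def)

lemma pair_measure_coupling:
  assumes "P2 \<mu>" "P2 \<nu>"
  shows "\<mu> \<Otimes>\<^sub>M \<nu> \<in> couplings \<mu> \<nu>"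
proof -
  interpret m: prob_space \<mu> using assms by (simp add: P2_def)
  interpret n: prob_space \<nu> using assms by (simp add: P2_def)
  interpret pair_prob_space \<mu> \<nu> ..
  have s: "sets \<mu> = sets borel" "sets \<nu> = sets borel" using assms by (auto simp: P2_def)
  have "distr (\<mu> \<Otimes>\<^sub>M \<nu>) borel fst = distr (\<mu> \<Otimes>\<^sub>M \<nu>) \<mu> fst" by (rule distr_cong) (auto simp: s)
  also have "\<dots> = \<mu>" by (rule n.distr_pair_fst)
  finally have f: "distr (\<mu> \<Otimes>\<^sub>M \<nu>) borel fst = \<mu>" .
  have "distr (\<mu> \<Otimes>\<^sub>M \<nu>) borel snd = distr (distr (\<nu> \<Otimes>\<^sub>M \<mu>) (\<mu> \<Otimes>\<^sub>M \<nu>) (\<lambda>(x, y). (y, x))) borel snd"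
    by (subst distr_pair_swap) simp
  also have "\<dots> = distr (\<nu> \<Otimes>\<^sub>M \<mu>) borel (snd \<circ> (\<lambda>(x, y). (y, x)))"
    by (rule distr_distr) (use s in measurable)
  also have "\<dots> = distr (\<nu> \<Otimes>\<^sub>M \<mu>) \<nu> fst" by (rule distr_cong) (auto simp: s)
  also have "\<dots> = \<nu>" by (rule m.distr_pair_fst)
  finally have sn: "distr (\<mu> \<Otimes>\<^sub>M \<nu>) borel snd = \<nu>" .
  have "sets (\<mu> \<Otimes>\<^sub>M \<nu>) = sets (borel \<Otimes>\<^sub>M borel)" by (rule sets_pair_measure_cong[OF s])
  then show ?thesis using f sn prob_space_axioms unfolding borel_prod by (simp add: couplings_def)
qed

lemma W2_le_cost:
  assumes p: "p \<in> couplings \<mu> \<nu>" and P: "P2 \<mu>" "P2 \<nu>"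
  shows "(W2 \<mu> \<nu>)\<^sup>2 \<le> cost p"
proof -
  have "(INF p\<in>couplings \<mu> \<nu>. \<integral>\<^sup>+ z. ennreal ((norm (fst z - snd z))\<^sup>2) \<partial>p) \<le> ennreal (cost p)"
    unfolding nn_integral_cost[OF couplings_P2[OF p P], symmetric] by (rule INF_lower[OF p])
  then have "enn2real (INF p\<in>couplings \<mu> \<nu>. \<integral>\<^sup>+ z. ennreal ((norm (fst z - snd z))\<^sup>2) \<partial>p) \<le> cost p"
    using cost_nonneg by (intro enn2real_leI) auto
  then show ?thesis by (simp add: W2_def)
qed

text \<open>The product coupling has finite cost, so the infimum inside \<open>W2\<close> is finite
  and its conversion to a real number is faithful; couplings close to the infimum then
  exist.\<close>

lemma ex_near_optimal_coupling:
  assumes P: "P2 \<mu>" "P2 \<nu>" and e: "e > 0"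
  obtains p where "p \<in> couplings \<mu> \<nu>" "cost p \<le> (W2 \<mu> \<nu>)\<^sup>2 + e"
proof -
  let ?I = "INF p\<in>couplings \<mu> \<nu>. \<integral>\<^sup>+ z. ennreal ((norm (fst z - snd z))\<^sup>2) \<partial>p"
  have c: "\<mu> \<Otimes>\<^sub>M \<nu> \<in> couplings \<mu> \<nu>" by (rule pair_measure_coupling[OF P])
  have "?I \<le> ennreal (cost (\<mu> \<Otimes>\<^sub>M \<nu>))"
    unfolding nn_integral_cost[OF couplings_P2[OF c P], symmetric] by (rule INF_lower[OF c])
  then have fin: "?I < top" by (simp add: order_le_less_trans)
  then have I: "?I = ennreal ((W2 \<mu> \<nu>)\<^sup>2)" by (simp add: W2_def)
  have "?I < ennreal ((W2 \<mu> \<nu>)\<^sup>2 + e)" unfolding I using e by (intro ennreal_lessI) (auto intro: add_nonneg_pos)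
  then obtain p where p: "p \<in> couplings \<mu> \<nu>" "(\<integral>\<^sup>+ z. ennreal ((norm (fst z - snd z))\<^sup>2) \<partial>p) < ennreal ((W2 \<mu> \<nu>)\<^sup>2 + e)"
    unfolding INF_less_iff by blast
  then have "cost p < (W2 \<mu> \<nu>)\<^sup>2 + e"
    unfolding nn_integral_cost[OF couplings_P2[OF p(1) P]] using cost_nonneg by (subst (asm) ennreal_less_iff) auto
  then show ?thesis using p by (intro that[of p]) auto
qed

lemma couplings_swap:
  assumes p: "p \<in> couplings \<mu> \<nu>"
  shows "distr p borel prod.swap \<in> couplings \<nu> \<mu>"
proof -
  interpret prob_space p using p by (simp add: couplings_def)
  have [measurable_cong]: "sets p = sets borel" by (rule couplings_sets[OF p])
  have sw[measurable]: "prod.swap \<in> p \<rightarrow>\<^sub>M borel" unfolding prod.swap_def by measurable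
  have "prob_space (distr p borel prod.swap)"
    by (rule prob_space_distr[OF sw])
  moreover have "distr (distr p borel prod.swap) borel fst = distr p borel (fst \<circ> prod.swap)"
    "distr (distr p borel prod.swap) borel snd = distr p borel (snd \<circ> prod.swap)"
    by (rule distr_distr; measurable)+
  moreover have "(fst \<circ> prod.swap :: 'a \<times> 'a \<Rightarrow> 'a) = snd" "(snd \<circ> prod.swap :: 'a \<times> 'a \<Rightarrow> 'a) = fst" by auto
  ultimately show ?thesis using p by (simp add: couplings_def)
qed

lemma W2_commute:
  assumes P: "P2 \<mu>" "P2 \<nu>"
  shows "W2 \<mu> \<nu> = W2 \<nu> \<mu>"
proof -
  have *: "(W2 \<nu> \<mu>)\<^sup>2 \<le> (W2 \<mu> \<nu>)\<^sup>2" if P: "P2 \<mu>" "P2 \<nu>" for \<mu> \<nu> :: "'a measure"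
  proof (rule field_le_epsilon)
    fix e :: real assume "e > 0"
    then obtain p where p: "p \<in> couplings \<mu> \<nu>" "cost p \<le> (W2 \<mu> \<nu>)\<^sup>2 + e"
      using ex_near_optimal_coupling[OF P] by blast
    have [measurable_cong]: "sets p = sets borel" by (rule couplings_sets[OF p(1)])
    have sw[measurable]: "prod.swap \<in> p \<rightarrow>\<^sub>M borel" unfolding prod.swap_def by measurable
    have "(W2 \<nu> \<mu>)\<^sup>2 \<le> cost (distr p borel prod.swap)" by (rule W2_le_cost[OF couplings_swap[OF p(1)] P(2,1)])
    also have "\<dots> = cost p" unfolding cost_def
      by (subst integral_distr) (auto simp: norm_minus_commute)
    finally show "(W2 \<nu> \<mu>)\<^sup>2 \<le> (W2 \<mu> \<nu>)\<^sup>2 + e" using p by simp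
  qed
  from *[OF P] *[OF P(2,1)] have "(W2 \<nu> \<mu>)\<^sup>2 = (W2 \<mu> \<nu>)\<^sup>2" by simp
  then show ?thesis using W2_nonneg by (metis power2_eq_imp_eq)
qed

section \<open>Gibbs kernels and the entropic dual problem\<close>

definition gibbs_Z :: "real \<Rightarrow> nat \<Rightarrow> (nat \<Rightarrow> 'x::euclidean_space) \<Rightarrow> (nat \<Rightarrow> real) \<Rightarrow> 'x \<Rightarrow> real" where
  "gibbs_Z \<kappa> N y w x = (\<Sum>i<N. exp (\<kappa> * (x \<bullet> y i - w i)))"

text \<open>Soft maximum at inverse temperature \<kappa> of the affine functions
  \<open>x \<bullet> y i - w i\<close>: a smoothed Legendre transform, and thus a smoothed
  Kantorovich potential for a target with atoms \<open>y i\<close>, the \<open>w i\<close> being the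
  dual variables.\<close>

definition lse :: "real \<Rightarrow> nat \<Rightarrow> (nat \<Rightarrow> 'x::euclidean_space) \<Rightarrow> (nat \<Rightarrow> real) \<Rightarrow> 'x \<Rightarrow> real" where
  "lse \<kappa> N y w x = ln (gibbs_Z \<kappa> N y w x) / \<kappa>"

text \<open>Probability of choosing the atom \<open>y i\<close> when standing at \<open>x\<close>;
  as \<kappa> grows it concentrates on the maximisers of
  \<open>x \<bullet> y i - w i\<close>.\<close>

definition gibbs :: "real \<Rightarrow> nat \<Rightarrow> (nat \<Rightarrow> 'x::euclidean_space) \<Rightarrow> (nat \<Rightarrow> real) \<Rightarrow> nat \<Rightarrow> 'x \<Rightarrow> real" where
  "gibbs \<kappa> N y w i x = exp (\<kappa> * (x \<bullet> y i - w i)) / gibbs_Z \<kappa> N y w x"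

definition gibbs_mean :: "real \<Rightarrow> nat \<Rightarrow> (nat \<Rightarrow> 'x::euclidean_space) \<Rightarrow> (nat \<Rightarrow> real) \<Rightarrow> 'x \<Rightarrow> 'x" where
  "gibbs_mean \<kappa> N y w x = (\<Sum>i<N. gibbs \<kappa> N y w i x *\<^sub>R y i)"

lemma gibbs_Z_pos: "0 < N \<Longrightarrow> 0 < gibbs_Z \<kappa> N y w x"
  unfolding gibbs_Z_def by (intro sum_pos) auto

lemma gibbs_nonneg: "0 \<le> gibbs \<kappa> N y w i x"
  unfolding gibbs_def gibbs_Z_def by (intro divide_nonneg_nonneg sum_nonneg) auto

lemma gibbs_sum: "0 < N \<Longrightarrow> (\<Sum>i<N. gibbs \<kappa> N y w i x) = 1"
  using gibbs_Z_pos[of N \<kappa> y w x]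
  by (simp add: gibbs_def sum_divide_distrib[symmetric]) (simp add: gibbs_Z_def)

lemma gibbs_le_1: "i < N \<Longrightarrow> gibbs \<kappa> N y w i x \<le> 1"
  using member_le_sum[of i "{..<N}" "\<lambda>i. gibbs \<kappa> N y w i x"] gibbs_sum[of N \<kappa> y w x] gibbs_nonneg
  by fastforce

lemma gibbs_Z_continuous: "continuous_on UNIV (gibbs_Z \<kappa> N y w)"
  unfolding gibbs_Z_def by (intro continuous_intros)

lemma gibbs_continuous: "0 < N \<Longrightarrow> continuous_on UNIV (gibbs \<kappa> N y w i)"
  unfolding gibbs_def using gibbs_Z_pos[of N \<kappa> y w]
  by (intro continuous_intros gibbs_Z_continuous) (auto simp: less_imp_neq[symmetric])

lemma gibbs_mean_continuous: "0 < N \<Longrightarrow> continuous_on UNIV (gibbs_mean \<kappa> N y w)"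
  unfolding gibbs_mean_def by (intro continuous_intros gibbs_continuous)

lemma lse_continuous: "0 < N \<Longrightarrow> continuous_on UNIV (lse \<kappa> N y w)"
  unfolding lse_def divide_inverse using gibbs_Z_pos[of N \<kappa> y w]
  by (intro continuous_intros gibbs_Z_continuous) (auto simp: less_imp_neq[symmetric])

lemma gibbs_mean_bound: "0 < N \<Longrightarrow> norm (gibbs_mean \<kappa> N y w x) \<le> (\<Sum>i<N. norm (y i))"
  unfolding gibbs_mean_def
proof (rule order_trans[OF norm_sum], rule sum_mono)
  fix i assume "0 < N" "i \<in> {..<N}"
  then show "norm (gibbs \<kappa> N y w i x *\<^sub>R y i) \<le> norm (y i)"
    using gibbs_le_1[of i N \<kappa> y w x] gibbs_nonneg[of \<kappa> N y w i x] by (simp add: mult_left_le_one_le)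
qed

lemma lse_has_derivative:
  assumes N: "0 < N" and k: "0 < \<kappa>"
  shows "(lse \<kappa> N y w has_derivative (\<lambda>h. gibbs_mean \<kappa> N y w x \<bullet> h)) (at x)"
proof -
  have Z: "gibbs_Z \<kappa> N y w x > 0" by (rule gibbs_Z_pos[OF N])
  have "(gibbs_Z \<kappa> N y w has_derivative (\<lambda>h. \<Sum>i<N. exp (\<kappa> * (x \<bullet> y i - w i)) * (\<kappa> * (h \<bullet> y i)))) (at x)"
    unfolding gibbs_Z_def
    by (auto intro!: derivative_eq_intros sum.cong simp: algebra_simps)
  from has_derivative_ln[OF Z this]
  have "((\<lambda>x. ln (gibbs_Z \<kappa> N y w x) * inverse \<kappa>) has_derivative
      (\<lambda>h. ((\<Sum>i<N. exp (\<kappa> * (x \<bullet> y i - w i)) * (\<kappa> * (h \<bullet> y i))) * inverse (gibbs_Z \<kappa> N y w x)) * inverse \<kappa>)) (at x)"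
    by (rule has_derivative_mult_left)
  moreover have "((\<Sum>i<N. exp (\<kappa> * (x \<bullet> y i - w i)) * (\<kappa> * (h \<bullet> y i))) * inverse (gibbs_Z \<kappa> N y w x)) * inverse \<kappa>
      = gibbs_mean \<kappa> N y w x \<bullet> h" for h
    unfolding gibbs_mean_def gibbs_def inner_sum_left sum_distrib_right
    using k by (intro sum.cong) (auto simp: inner_commute divide_inverse)
  ultimately show ?thesis by (simp add: lse_def[abs_def] divide_inverse)
qed

lemma lse_lower:
  assumes "i < N" "0 < \<kappa>"
  shows "x \<bullet> y i - w i \<le> lse \<kappa> N y w x"
proof -
  have "exp (\<kappa> * (x \<bullet> y i - w i)) \<le> gibbs_Z \<kappa> N y w x"
    unfolding gibbs_Z_def using assms by (intro member_le_sum) auto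
  then have "\<kappa> * (x \<bullet> y i - w i) \<le> ln (gibbs_Z \<kappa> N y w x)"
    using gibbs_Z_pos[of N \<kappa> y w x] assms by (subst ln_ge_iff) auto
  then show ?thesis using assms by (simp add: lse_def field_simps)
qed

lemma lse_upper:
  assumes N: "0 < N" and k: "0 < \<kappa>" and b: "\<And>i. i < N \<Longrightarrow> x \<bullet> y i - w i \<le> c"
  shows "lse \<kappa> N y w x \<le> c + ln (real N) / \<kappa>"
proof -
  have "gibbs_Z \<kappa> N y w x \<le> (\<Sum>i<N. exp (\<kappa> * c))"
    unfolding gibbs_Z_def using b k by (intro sum_mono) auto
  also have "\<dots> = real N * exp (\<kappa> * c)" by simp
  finally have "ln (gibbs_Z \<kappa> N y w x) \<le> ln (real N * exp (\<kappa> * c))"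
    using gibbs_Z_pos[OF N] N by (subst ln_le_cancel_iff) auto
  also have "\<dots> = ln (real N) + \<kappa> * c" using N by (subst ln_mult) auto
  finally show ?thesis using k by (simp add: lse_def field_simps)
qed

lemma lse_bound:
  assumes N: "0 < N" and k: "0 < \<kappa>"
  shows "\<bar>lse \<kappa> N y w x\<bar> \<le> (ln (real N) / \<kappa> + (\<Sum>i<N. \<bar>w i\<bar>)) + (\<Sum>i<N. norm (y i)) * norm x"
proof -
  have *: "\<bar>x \<bullet> y i - w i\<bar> \<le> (\<Sum>i<N. \<bar>w i\<bar>) + (\<Sum>i<N. norm (y i)) * norm x" if "i < N" for i
  proof -
    have "\<bar>w i\<bar> \<le> (\<Sum>i<N. \<bar>w i\<bar>)" "norm (y i) \<le> (\<Sum>i<N. norm (y i))"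
      using that by (auto intro!: member_le_sum)
    moreover have "\<bar>x \<bullet> y i\<bar> \<le> norm (y i) * norm x" using Cauchy_Schwarz_ineq2[of x "y i"] by (simp add: mult.commute)
    moreover have "norm (y i) * norm x \<le> (\<Sum>i<N. norm (y i)) * norm x" using calculation by (intro mult_right_mono) auto
    ultimately show ?thesis by linarith
  qed
  have "lse \<kappa> N y w x \<le> (\<Sum>i<N. \<bar>w i\<bar>) + (\<Sum>i<N. norm (y i)) * norm x + ln (real N) / \<kappa>"
    by (rule lse_upper[OF N k]) (use * in \<open>fastforce simp: abs_le_iff\<close>)
  moreover have "- ((\<Sum>i<N. \<bar>w i\<bar>) + (\<Sum>i<N. norm (y i)) * norm x) \<le> lse \<kappa> N y w x"
    using lse_lower[of 0 N \<kappa> x y w] *[of 0] N k by linarith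
  moreover have "0 \<le> ln (real N) / \<kappa>" using N k by simp
  ultimately show ?thesis by linarith
qed

text \<open>The log-sum-exp value is the Gibbs average of the exponents plus the entropy divided by
  \<kappa>, and the entropy of a law on \<open>N\<close> points is at most
  \<open>ln N\<close>.\<close>

lemma gibbs_entropy:
  assumes N: "0 < N" and k: "0 < \<kappa>"
  shows "lse \<kappa> N y w x - ln (real N) / \<kappa> \<le> (\<Sum>i<N. gibbs \<kappa> N y w i x * (x \<bullet> y i - w i))"
proof -
  let ?P = "\<lambda>i. gibbs \<kappa> N y w i x" and ?Z = "gibbs_Z \<kappa> N y w x"
  have Z: "?Z > 0" by (rule gibbs_Z_pos[OF N])
  have Ppos: "?P i > 0" for i using Z by (simp add: gibbs_def)
  have lnP: "ln (?P i) = \<kappa> * (x \<bullet> y i - w i) - ln ?Z" for i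
    using Z by (simp add: gibbs_def ln_div)
  \<comment> \<open>\<open>ln z \<le> z - 1\<close> at \<open>z = 1 / (N P)\<close>: after
    multiplication by \<open>P\<close> and summation this is nonnegativity of the relative entropy
    with respect to the uniform law.\<close>
  have "- ln (real N) - ln (?P i) \<le> 1 / (real N * ?P i) - 1" for i
  proof -
    have "ln (1 / (real N * ?P i)) \<le> 1 / (real N * ?P i) - 1"
      using N Ppos[of i] by (intro ln_le_minus_one) auto
    then show ?thesis using N Ppos[of i] by (simp add: ln_div ln_mult)
  qed
  then have "?P i * (- ln (real N) - ln (?P i)) \<le> ?P i * (1 / (real N * ?P i) - 1)" for i
    using Ppos[of i] by (intro mult_left_mono) auto
  then have "(\<Sum>i<N. ?P i * (- ln (real N) - ln (?P i))) \<le> (\<Sum>i<N. ?P i * (1 / (real N * ?P i) - 1))"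
    by (intro sum_mono)
  also have "\<dots> = (\<Sum>i<N. 1 / real N - ?P i)"
    using Ppos by (intro sum.cong) (auto simp: field_simps less_imp_neq[symmetric])
  also have "\<dots> = 0" using N gibbs_sum[OF N, of \<kappa> y w x] by (simp add: sum_subtractf)
  finally have "(\<Sum>i<N. ?P i * (- ln (real N) - ln (?P i))) \<le> 0" .
  moreover have "(\<Sum>i<N. ?P i * (- ln (real N) - ln (?P i))) = - (\<Sum>i<N. ?P i * (ln (real N) + ln (?P i)))"
    unfolding sum_negf[symmetric] by (intro sum.cong) (auto simp: algebra_simps)
  ultimately have "0 \<le> (\<Sum>i<N. ?P i * (ln (real N) + ln (?P i)))" by simp
  also have "\<dots> = (\<Sum>i<N. ?P i) * (ln (real N) - ln ?Z) + \<kappa> * (\<Sum>i<N. ?P i * (x \<bullet> y i - w i))"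
    by (simp add: lnP sum_distrib_left sum_distrib_right sum.distrib[symmetric] algebra_simps)
  finally show ?thesis using k gibbs_sum[OF N, of \<kappa> y w x] by (simp add: lse_def field_simps)
qed

text \<open>The shift multiplies the partition function by
  \<open>1 + P (exp (-\<kappa> s) - 1)\<close>, and \<open>ln (1 + u) \<le> u\<close>. The bound is
  an equality at \<open>s = 0\<close>, so a minimiser of the dual functional also minimises an
  explicit function of \<open>s\<close>; no differentiation under the integral is involved.\<close>

lemma lse_shift_one:
  assumes N: "0 < N" and k: "0 < \<kappa>" and i: "i < N"
  shows "lse \<kappa> N y (w(i := w i + s)) x \<le> lse \<kappa> N y w x + gibbs \<kappa> N y w i x * ((exp (- \<kappa> * s) - 1) / \<kappa>)"
proof -
  let ?Z = "gibbs_Z \<kappa> N y w x" and ?P = "gibbs \<kappa> N y w i x" and ?w = "w(i := w i + s)"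
  have Z: "?Z > 0" by (rule gibbs_Z_pos[OF N])
  have Z': "gibbs_Z \<kappa> N y ?w x > 0" by (rule gibbs_Z_pos[OF N])
  have "gibbs_Z \<kappa> N y ?w x = exp (\<kappa> * (x \<bullet> y i - (w i + s))) + (\<Sum>j\<in>{..<N}-{i}. exp (\<kappa> * (x \<bullet> y j - w j)))"
    unfolding gibbs_Z_def using i by (subst sum.remove[of _ i]) auto
  moreover have "?Z = exp (\<kappa> * (x \<bullet> y i - w i)) + (\<Sum>j\<in>{..<N}-{i}. exp (\<kappa> * (x \<bullet> y j - w j)))"
    unfolding gibbs_Z_def using i by (subst sum.remove[of _ i]) auto
  moreover have "exp (\<kappa> * (x \<bullet> y i - (w i + s))) = exp (\<kappa> * (x \<bullet> y i - w i)) * exp (- \<kappa> * s)"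
    unfolding exp_add[symmetric] by (simp add: algebra_simps)
  ultimately have eq: "gibbs_Z \<kappa> N y ?w x = ?Z + exp (\<kappa> * (x \<bullet> y i - w i)) * (exp (- \<kappa> * s) - 1)"
    by (simp add: algebra_simps)
  then have eq2: "gibbs_Z \<kappa> N y ?w x = ?Z * (1 + ?P * (exp (- \<kappa> * s) - 1))"
    using Z by (simp add: gibbs_def distrib_left)
  have pos: "1 + ?P * (exp (- \<kappa> * s) - 1) > 0" using Z Z' eq2 by (simp add: zero_less_mult_iff)
  have "ln (gibbs_Z \<kappa> N y ?w x) = ln ?Z + ln (1 + ?P * (exp (- \<kappa> * s) - 1))"
    unfolding eq2 using Z pos by (subst ln_mult) auto
  also have "\<dots> \<le> ln ?Z + ?P * (exp (- \<kappa> * s) - 1)"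
    using ln_le_minus_one[OF pos] by simp
  finally have "ln (gibbs_Z \<kappa> N y ?w x) / \<kappa> \<le> (ln ?Z + ?P * (exp (- \<kappa> * s) - 1)) / \<kappa>"
    using k by (simp add: divide_right_mono)
  then show ?thesis by (simp add: lse_def add_divide_distrib)
qed

text \<open>Changing the weights alters each exponent by at most \<kappa> times their
  \<open>l1\<close> distance. This makes the dual functional continuous in the product
  topology.\<close>

lemma lse_lipschitz_w:
  assumes N: "0 < N" and k: "0 < \<kappa>"
  shows "\<bar>lse \<kappa> N y w x - lse \<kappa> N y w' x\<bar> \<le> (\<Sum>i<N. \<bar>w i - w' i\<bar>)"
proof -
  have *: "lse \<kappa> N y w x \<le> lse \<kappa> N y w' x + (\<Sum>i<N. \<bar>w i - w' i\<bar>)" for w w'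
  proof -
    let ?D = "\<Sum>i<N. \<bar>w i - w' i\<bar>"
    have "gibbs_Z \<kappa> N y w x \<le> (\<Sum>i<N. exp (\<kappa> * (x \<bullet> y i - w' i)) * exp (\<kappa> * ?D))"
      unfolding gibbs_Z_def
    proof (rule sum_mono)
      fix i assume "i \<in> {..<N}"
      then have "\<bar>w i - w' i\<bar> \<le> ?D" by (intro member_le_sum) auto
      then have "\<kappa> * (x \<bullet> y i - w i) \<le> \<kappa> * (x \<bullet> y i - w' i + ?D)" using k by (intro mult_left_mono) auto
      then show "exp (\<kappa> * (x \<bullet> y i - w i)) \<le> exp (\<kappa> * (x \<bullet> y i - w' i)) * exp (\<kappa> * ?D)"
        unfolding exp_add[symmetric] by (simp add: algebra_simps)
    qed
    also have "\<dots> = gibbs_Z \<kappa> N y w' x * exp (\<kappa> * ?D)" by (simp add: gibbs_Z_def sum_distrib_right)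
    finally have "ln (gibbs_Z \<kappa> N y w x) \<le> ln (gibbs_Z \<kappa> N y w' x * exp (\<kappa> * ?D))"
      using gibbs_Z_pos[OF N] by (subst ln_le_cancel_iff) auto
    also have "\<dots> = ln (gibbs_Z \<kappa> N y w' x) + \<kappa> * ?D" using gibbs_Z_pos[OF N, of \<kappa> y w' x] by (simp add: ln_mult)
    finally show ?thesis using k by (simp add: lse_def field_simps)
  qed
  from *[of w w'] *[of w' w] show ?thesis by (simp add: abs_minus_commute abs_le_iff)
qed

text \<open>A constant added to all weights is compensated by the linear term of the dual
  functional, because the \<open>q i\<close> sum to one; weights may therefore be normalised before
  a minimiser is sought.\<close>

lemma lse_translate:
  assumes N: "0 < N" and k: "0 < \<kappa>" and ww: "\<And>i. i < N \<Longrightarrow> w' i = w i - c"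
  shows "lse \<kappa> N y w' x = lse \<kappa> N y w x + c"
proof -
  have "gibbs_Z \<kappa> N y w' x = gibbs_Z \<kappa> N y w x * exp (\<kappa> * c)"
    unfolding gibbs_Z_def sum_distrib_right exp_add[symmetric]
    by (intro sum.cong) (auto simp: ww algebra_simps)
  then have "ln (gibbs_Z \<kappa> N y w' x) = ln (gibbs_Z \<kappa> N y w x) + \<kappa> * c"
    using gibbs_Z_pos[OF N, of \<kappa> y w x] by (simp add: ln_mult)
  then show ?thesis using k by (simp add: lse_def field_simps)
qed

lemma lse_integrable:
  assumes "0 < N" "0 < \<kappa>" "P2 \<rho>"
  shows "integrable \<rho> (lse \<kappa> N y w)"
  by (rule P2_integrable_linear[OF assms(3) borel_measurable_continuous_onI[OF lse_continuous[OF assms(1)]]])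
     (use lse_bound[OF assms(1,2), of y w] in auto)

lemma gibbs_integrable:
  assumes "i < N" "P2 \<rho>"
  shows "integrable \<rho> (gibbs \<kappa> N y w i)"
proof (rule P2_integrable_linear[OF assms(2), of _ 1 0])
  show "gibbs \<kappa> N y w i \<in> borel_measurable borel"
    by (rule borel_measurable_continuous_onI[OF gibbs_continuous]) (use assms in auto)
  show "norm (gibbs \<kappa> N y w i x) \<le> 1 + 0 * norm x" for x
    using gibbs_le_1[OF assms(1), of \<kappa> y w x] gibbs_nonneg[of \<kappa> N y w i x] by simp
qed

text \<open>Weights are functions on all naturals; pinning the coordinates from \<open>N\<close> on
  to 0 makes the box a product of compact sets, hence compact by Tychonoff.\<close>

lemma compact_box_functions:
  fixes M :: real
  shows "compact {w :: nat \<Rightarrow> real. \<forall>i. if i < N then \<bar>w i\<bar> \<le> M else w i = 0}"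
proof -
  have "{w :: nat \<Rightarrow> real. \<forall>i. if i < N then \<bar>w i\<bar> \<le> M else w i = 0} =
     (PiE UNIV (\<lambda>i. if i < N then {-M..M} else {0}))"
    by (force simp: PiE_def Pi_def abs_le_iff split: if_splits)
  moreover have "compactin (product_topology (\<lambda>i. euclidean) UNIV) (PiE UNIV (\<lambda>i::nat. if i < N then {-M..M} else {0}))"
    by (auto simp: compactin_PiE)
  ultimately show ?thesis by (simp add: euclidean_product_topology)
qed

text \<open>The weights minimise the convex dual functional; its stationarity is the marginal condition.\<close>

lemma ex_gibbs_weights:
  fixes y :: "nat \<Rightarrow> 'x::euclidean_space"
  assumes N: "0 < N" and k: "0 < \<kappa>" and P: "P2 \<rho>"
    and q: "\<And>i. i < N \<Longrightarrow> 0 < q i" "(\<Sum>i<N. q i) = 1"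
  obtains w where "\<And>i. i < N \<Longrightarrow> (\<integral>x. gibbs \<kappa> N y w i x \<partial>\<rho>) = q i"
proof -
  interpret prob_space \<rho> using P by (simp add: P2_def)
  define J where "J w = (\<integral>x. lse \<kappa> N y w x \<partial>\<rho>) + (\<Sum>i<N. q i * w i)" for w
  note li = lse_integrable[OF N k P]
  have q1: "q i \<le> 1" if "i < N" for i
    using member_le_sum[of i "{..<N}" q] q that by (auto intro: less_imp_le)
  have Jlip: "\<bar>J w - J w'\<bar> \<le> 2 * (\<Sum>i<N. \<bar>w i - w' i\<bar>)" for w w'
  proof -
    have "\<bar>(\<integral>x. lse \<kappa> N y w x \<partial>\<rho>) - (\<integral>x. lse \<kappa> N y w' x \<partial>\<rho>)\<bar> = \<bar>\<integral>x. lse \<kappa> N y w x - lse \<kappa> N y w' x \<partial>\<rho>\<bar>"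
      by (subst Bochner_Integration.integral_diff[OF li li]) simp
    also have "\<dots> \<le> (\<integral>x. \<bar>lse \<kappa> N y w x - lse \<kappa> N y w' x\<bar> \<partial>\<rho>)" by (rule integral_abs_bound)
    also have "\<dots> \<le> (\<integral>x. (\<Sum>i<N. \<bar>w i - w' i\<bar>) \<partial>\<rho>)"
      by (rule integral_mono) (use li lse_lipschitz_w[OF N k] in auto)
    also have "\<dots> = (\<Sum>i<N. \<bar>w i - w' i\<bar>)" by (simp add: prob_space)
    finally have 1: "\<bar>(\<integral>x. lse \<kappa> N y w x \<partial>\<rho>) - (\<integral>x. lse \<kappa> N y w' x \<partial>\<rho>)\<bar> \<le> (\<Sum>i<N. \<bar>w i - w' i\<bar>)" .
    have "\<bar>(\<Sum>i<N. q i * w i) - (\<Sum>i<N. q i * w' i)\<bar> = \<bar>\<Sum>i<N. q i * (w i - w' i)\<bar>"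
      by (simp add: sum_subtractf algebra_simps)
    also have "\<dots> \<le> (\<Sum>i<N. \<bar>q i * (w i - w' i)\<bar>)" by (rule sum_abs)
    also have "\<dots> \<le> (\<Sum>i<N. \<bar>w i - w' i\<bar>)"
    proof (rule sum_mono)
      fix i assume "i \<in> {..<N}"
      then have "0 \<le> q i" "q i \<le> 1" using q q1 by (auto intro: less_imp_le)
      then show "\<bar>q i * (w i - w' i)\<bar> \<le> \<bar>w i - w' i\<bar>" by (simp add: abs_mult mult_left_le_one_le)
    qed
    finally show ?thesis using 1 unfolding J_def by linarith
  qed
  define qm where "qm = Min (q ` {..<N})"
  have qm: "0 < qm" "\<And>i. i < N \<Longrightarrow> qm \<le> q i"
    unfolding qm_def using N q by (subst Min_gr_iff; auto) (auto intro: Min_le)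
  define Y where "Y = (\<Sum>i<N. norm (y i)) * (\<integral>x. norm x \<partial>\<rho>)"
  \<comment> \<open>For weights of \<open>q\<close>-average 0 that are not worse than the zero
    weights, \<open>lse_lower\<close> gives \<open>- A\<close> as a lower bound of every weight, and
    the zero average then gives \<open>A / q i\<close> as an upper bound. This fixes the box in
    which a minimiser is sought.\<close>
  define A where "A = \<bar>J (\<lambda>i. 0)\<bar> + Y"
  have ni: "integrable \<rho> (\<lambda>x. norm x)" by (rule P2_integrable_linear[OF P, of _ 0 1]) auto
  have Y0: "0 \<le> Y" unfolding Y_def by (intro mult_nonneg_nonneg sum_nonneg) auto
  define M where "M = A / qm"
  have A0: "0 \<le> A" using Y0 by (simp add: A_def)
  have AM: "A \<le> M" using A0 qm q1[OF N] qm(2)[OF N] by (simp add: M_def field_simps mult_right_le_one_le)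
  define K where "K = {w :: nat \<Rightarrow> real. \<forall>i. if i < N then \<bar>w i\<bar> \<le> M else w i = 0}"
  have "compact K" unfolding K_def by (rule compact_box_functions)
  moreover have "(\<lambda>i. 0) \<in> K" using A0 AM by (simp add: K_def)
  moreover have "continuous_on K J"
  proof (rule continuous_on_subset[of UNIV], rule continuous_at_imp_continuous_on, rule ballI)
    fix w :: "nat \<Rightarrow> real"
    have c: "((\<lambda>w'. w' i) \<longlongrightarrow> w i) (at w)" for i
      using continuous_on_product_coordinates[of i] unfolding continuous_on_def by auto
    have "((\<lambda>w'. 2 * (\<Sum>i<N. \<bar>w' i - w i\<bar>)) \<longlongrightarrow> 2 * (\<Sum>i<N. \<bar>w i - w i\<bar>)) (at w)"
      by (intro tendsto_intros c)
    then have "((\<lambda>w'. 2 * (\<Sum>i<N. \<bar>w' i - w i\<bar>)) \<longlongrightarrow> 0) (at w)" by simp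
    then have "((\<lambda>w'. J w' - J w) \<longlongrightarrow> 0) (at w)"
      by (rule Lim_null_comparison[rotated]) (use Jlip in auto)
    then show "isCont J w" by (simp add: isCont_def LIM_zero_iff)
  qed simp
  ultimately obtain w where w: "w \<in> K" "\<And>u. u \<in> K \<Longrightarrow> J w \<le> J u"
    using continuous_attains_inf[of K J] by blast
  \<comment> \<open>Minimality in the box extends to all weights: a competitor is either worse than
    the zero weights or can be translated to average 0, which puts it into the box.\<close>
  have min: "J w \<le> J u" for u
  proof (cases "J u \<le> J (\<lambda>i. 0)")
    case False then show ?thesis using w(2)[of "\<lambda>i. 0"] \<open>(\<lambda>i. 0) \<in> K\<close> by simp
  next
    case True
    define c where "c = (\<Sum>i<N. q i * u i)"
    define v where "v i = (if i < N then u i - c else 0)" for i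
    have sv: "(\<Sum>i<N. q i * v i) = 0"
      using q(2) by (simp add: v_def right_diff_distrib sum_subtractf sum_distrib_right[symmetric] c_def)
    have "lse \<kappa> N y v = (\<lambda>x. lse \<kappa> N y u x + c)"
      by (rule ext, rule lse_translate[OF N k]) (simp add: v_def)
    then have "J v = (\<integral>x. lse \<kappa> N y u x + c \<partial>\<rho>)" unfolding J_def sv by simp
    then have Jv: "J v = J u" using li by (simp add: J_def prob_space c_def)
    have lower: "- A \<le> v i" if i: "i < N" for i
    proof -
      have xi: "integrable \<rho> (\<lambda>x. x \<bullet> y i)"
        by (rule P2_integrable_linear[OF P, of _ 0 "norm (y i)"]) (auto simp: Cauchy_Schwarz_ineq2 mult.commute)
      have "\<bar>\<integral>x. x \<bullet> y i \<partial>\<rho>\<bar> \<le> (\<integral>x. norm (y i) * norm x \<partial>\<rho>)"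
        using xi ni by (intro order_trans[OF integral_abs_bound] integral_mono) (auto simp: Cauchy_Schwarz_ineq2 mult.commute)
      also have "\<dots> \<le> Y"
        unfolding Y_def using i by (simp, intro mult_right_mono member_le_sum) auto
      finally have b: "\<bar>\<integral>x. x \<bullet> y i \<partial>\<rho>\<bar> \<le> Y" .
      have "(\<integral>x. x \<bullet> y i - v i \<partial>\<rho>) \<le> (\<integral>x. lse \<kappa> N y v x \<partial>\<rho>)"
        using xi li by (intro integral_mono lse_lower[OF i k]) auto
      also have "\<dots> = J v" by (simp add: J_def sv)
      finally have "(\<integral>x. x \<bullet> y i \<partial>\<rho>) - v i \<le> J v" using xi by (simp add: prob_space)
      then show ?thesis using b Jv True unfolding A_def by linarith
    qed
    have upper: "v i \<le> M" if i: "i < N" for i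
    proof -
      have "q i * v i = - (\<Sum>j\<in>{..<N}-{i}. q j * v j)"
        using sv i by (subst (asm) sum.remove[of _ i]) auto
      also have "\<dots> = (\<Sum>j\<in>{..<N}-{i}. q j * (- v j))" by (simp add: sum_negf)
      also have "\<dots> \<le> (\<Sum>j\<in>{..<N}-{i}. q j * A)"
        using q lower by (intro sum_mono mult_left_mono) (auto intro: less_imp_le simp: minus_le_iff)
      also have "\<dots> \<le> (\<Sum>j<N. q j * A)"
        using q A0 by (intro sum_mono2) (auto intro!: mult_nonneg_nonneg less_imp_le[OF q(1)])
      also have "\<dots> = A" using q by (simp add: sum_distrib_right[symmetric])
      finally have "q i * v i \<le> A" .
      then have "v i \<le> A / q i" using q(1)[OF i] by (simp add: field_simps)
      also have "\<dots> \<le> M" unfolding M_def using qm i A0 by (intro divide_left_mono) (auto intro: mult_pos_pos q)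
      finally show ?thesis .
    qed
    have "v \<in> K" using lower upper AM unfolding K_def by (fastforce simp: v_def)
    then show ?thesis using w(2) Jv by metis
  qed
  have "(\<integral>x. gibbs \<kappa> N y w i x \<partial>\<rho>) = q i" if i: "i < N" for i
  proof -
    let ?a = "\<integral>x. gibbs \<kappa> N y w i x \<partial>\<rho>"
    note gi = gibbs_integrable[OF i P, of \<kappa> y w]
    \<comment> \<open>Explicit upper bound for the change of \<open>J\<close> when the weight
      \<open>i\<close> is moved by \<open>s\<close>. It vanishes at 0 and is nowhere negative, and
      its derivative at 0 is the prescribed mass minus the actual mass.\<close>
    define f where "f s = ?a * ((exp (- \<kappa> * s) - 1) / \<kappa>) + q i * s" for s
    have ge: "f 0 \<le> f s" for s
    proof -
      let ?w = "w(i := w i + s)"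
      have "(\<integral>x. lse \<kappa> N y ?w x \<partial>\<rho>) \<le> (\<integral>x. lse \<kappa> N y w x + gibbs \<kappa> N y w i x * ((exp (- \<kappa> * s) - 1) / \<kappa>) \<partial>\<rho>)"
        using li gi by (intro integral_mono lse_shift_one[OF N k i]) auto
      also have "\<dots> = (\<integral>x. lse \<kappa> N y w x \<partial>\<rho>) + ?a * ((exp (- \<kappa> * s) - 1) / \<kappa>)"
        using li gi by simp
      finally have 1: "(\<integral>x. lse \<kappa> N y ?w x \<partial>\<rho>) \<le> (\<integral>x. lse \<kappa> N y w x \<partial>\<rho>) + ?a * ((exp (- \<kappa> * s) - 1) / \<kappa>)" .
      have "(\<Sum>j<N. q j * ?w j) = (\<Sum>j<N. q j * w j + (if j = i then q i * s else 0))"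
        by (intro sum.cong) (auto simp: algebra_simps)
      also have "\<dots> = (\<Sum>j<N. q j * w j) + q i * s" using i by (simp add: sum.distrib sum.delta)
      finally have "J ?w \<le> J w + f s" using 1 by (simp add: J_def f_def)
      then show ?thesis using min[of ?w] by (simp add: f_def)
    qed
    have "DERIV f 0 :> - ?a + q i"
      unfolding f_def using k by (auto intro!: derivative_eq_intros)
    from DERIV_local_min[OF this, of 1] ge have "- ?a + q i = 0" by auto
    then show ?thesis by simp
  qed
  then show ?thesis by (rule that)
qed

section \<open>Entropic couplings\<close>

lemma P2_sets: "P2 \<mu> \<Longrightarrow> sets \<mu> = sets borel"
  by (simp add: P2_def)

lemma P2_prob: "P2 \<mu> \<Longrightarrow> prob_space \<mu>"
  by (simp add: P2_def)

lemma P2_space: "P2 \<mu> \<Longrightarrow> space \<mu> = UNIV"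
  using sets_eq_imp_space_eq[OF P2_sets] by simp

lemma P2_integrable_norm_sq: "P2 \<mu> \<Longrightarrow> integrable \<mu> (\<lambda>x. (norm x)\<^sup>2)"
  by (rule P2_integrable[of _ _ 0 1]) auto

text \<open>Simple functions converge to the identity in \<open>L^2(\<nu>)\<close>, and their level
  sets of positive mass serve as cells. Replacing the value on a cell by its centroid does not
  increase the quadratic error and makes the cell average exact, which later identifies the
  barycentric projection with \<open>gibbs_mean\<close> without any error.\<close>

lemma P2_quantize:
  fixes \<nu> :: "'x::euclidean_space measure"
  assumes P: "P2 \<nu>" and d: "0 < \<delta>"
  obtains N :: nat and C :: "nat \<Rightarrow> 'x set" and c :: "nat \<Rightarrow> 'x" where
    "0 < N" "\<And>i. i < N \<Longrightarrow> C i \<in> sets borel" "\<And>i. i < N \<Longrightarrow> 0 < measure \<nu> (C i)"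
    "\<And>i j. i < N \<Longrightarrow> j < N \<Longrightarrow> i \<noteq> j \<Longrightarrow> C i \<inter> C j = {}"
    "AE y in \<nu>. \<exists>i<N. y \<in> C i"
    "\<And>i. i < N \<Longrightarrow> (\<integral>y. indicator (C i) y *\<^sub>R y \<partial>\<nu>) = measure \<nu> (C i) *\<^sub>R c i"
    "(\<integral>y. (\<Sum>i<N. indicator (C i) y * (norm (y - c i))\<^sup>2) \<partial>\<nu>) \<le> \<delta>"
proof -
  interpret prob_space \<nu> by (rule P2_prob[OF P])
  have s[measurable_cong]: "sets \<nu> = sets borel" by (rule P2_sets[OF P])
  have sp: "space \<nu> = UNIV" by (rule P2_space[OF P])
  have "(\<lambda>x::'x. x) \<in> borel_measurable \<nu>" by measurable
  from borel_measurable_implies_sequence_metric[OF this, of 0]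
  obtain F where F: "\<And>i. simple_function \<nu> (F i)" "\<And>x. (\<lambda>i. F i x) \<longlonglongrightarrow> x" "\<And>i x. norm (F i x) \<le> 2 * norm x"
    unfolding sp by auto
  have Fm[measurable]: "F n \<in> borel_measurable \<nu>" for n using F(1) by (rule borel_measurable_simple_function)
  \<comment> \<open>\<open>10 = 2 (1 + 2^2)\<close>, from the bound
    \<open>norm (F n x) \<le> 2 * norm x\<close>.\<close>
  have b: "(norm (x - F n x))\<^sup>2 \<le> 10 * (norm x)\<^sup>2" for n x
  proof -
    have "(norm (F n x))\<^sup>2 \<le> (2 * norm x)\<^sup>2" using F(3) by (intro power_mono) auto
    then show ?thesis using norm_diff_sq_le[of x "F n x"] by (simp add: power_mult_distrib)
  qed
  have "(\<lambda>n. \<integral>x. (norm (x - F n x))\<^sup>2 \<partial>\<nu>) \<longlonglongrightarrow> (\<integral>x. 0 \<partial>\<nu>)"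
  proof (rule integral_dominated_convergence[where w="\<lambda>x. 10 * (norm x)\<^sup>2"])
    show "AE x in \<nu>. (\<lambda>n. (norm (x - F n x))\<^sup>2) \<longlonglongrightarrow> 0"
    proof (rule AE_I2)
      fix x
      have "(\<lambda>n. (norm (x - F n x))\<^sup>2) \<longlonglongrightarrow> (norm (x - x))\<^sup>2" by (intro tendsto_intros F)
      then show "(\<lambda>n. (norm (x - F n x))\<^sup>2) \<longlonglongrightarrow> 0" by simp
    qed
  qed (use b P2_integrable_norm_sq[OF P] in auto)
  then have "eventually (\<lambda>n. (\<integral>x. (norm (x - F n x))\<^sup>2 \<partial>\<nu>) < \<delta>) sequentially"
    using d by (intro order_tendstoD) auto
  then obtain n where n: "(\<integral>x. (norm (x - F n x))\<^sup>2 \<partial>\<nu>) < \<delta>" by (auto simp: eventually_sequentially)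
  define A where "A v = F n -` {v}" for v
  have Am[measurable]: "A v \<in> sets borel" for v
    using measurable_sets[OF Fm[of n], of "{v}"] by (simp add: A_def sp s)
  \<comment> \<open>Null cells are discarded: the cell masses become divisors, and the box for the
    dual weights is bounded only when they are positive.\<close>
  define V where "V = {v \<in> range (F n). 0 < measure \<nu> (A v)}"
  have Rf: "finite (range (F n))" using F(1)[of n] by (simp add: simple_function_def sp)
  then have Vf: "finite V" by (simp add: V_def)
  have nul: "(\<Union>v\<in>range (F n) - V. A v) \<in> null_sets \<nu>"
  proof (rule null_sets_UN')
    show "countable (range (F n) - V)" using Rf by (simp add: countable_finite)
    fix v assume "v \<in> range (F n) - V"
    then have "measure \<nu> (A v) = 0" using measure_nonneg[of \<nu> "A v"] by (auto simp: V_def)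
    then show "A v \<in> null_sets \<nu>" by (auto simp: emeasure_eq_measure s)
  qed
  have cov: "AE y in \<nu>. F n y \<in> V"
    by (rule AE_I'[OF nul]) (auto simp: A_def)
  obtain h where h: "bij_betw h {0..<card V} V" using ex_bij_betw_nat_finite[OF Vf] by blast
  define N where "N = card V"
  have hV: "h i \<in> V" if "i < N" for i using h that by (auto simp: bij_betw_def N_def)
  have hinj: "h i \<noteq> h j" if "i < N" "j < N" "i \<noteq> j" for i j
    using h that by (auto simp: bij_betw_def N_def inj_on_def)
  have hsur: "\<exists>i<N. h i = v" if "v \<in> V" for v
  proof -
    have "v \<in> h ` {0..<N}" using h that by (simp add: bij_betw_def N_def)
    then show ?thesis by auto
  qed
  have N0: "0 < N"
  proof (rule ccontr)
    assume "\<not> 0 < N"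
    then have "V = {}" using Vf by (simp add: N_def)
    with cov have "AE y in \<nu>. False" by simp
    then show False by (simp add: AE_False)
  qed
  define C where "C i = A (h i)" for i
  have Cm[measurable]: "C i \<in> sets borel" for i by (simp add: C_def)
  define c where "c i = (1 / measure \<nu> (C i)) *\<^sub>R (\<integral>y. indicator (C i) y *\<^sub>R y \<partial>\<nu>)" for i
  have Cpos: "0 < measure \<nu> (C i)" if "i < N" for i using hV[OF that] by (simp add: V_def C_def)
  have cen: "(\<integral>y. indicator (C i) y *\<^sub>R y \<partial>\<nu>) = measure \<nu> (C i) *\<^sub>R c i" if "i < N" for i
    using Cpos[OF that] by (simp add: c_def)
  have disj: "C i \<inter> C j = {}" if "i < N" "j < N" "i \<noteq> j" for i j
    using hinj[OF that] by (auto simp: C_def A_def)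
  have ac: "AE y in \<nu>. \<exists>i<N. y \<in> C i"
    using cov by eventually_elim (use hsur in \<open>fastforce simp: C_def A_def\<close>)
  have int2: "integrable \<nu> (\<lambda>y. indicator (C i) y * (norm (y - a))\<^sup>2)" for i a
  proof (rule P2_integrable[OF P, of _ "2 * (norm a)\<^sup>2" 2])
    fix x show "norm (indicator (C i) x * (norm (x - a))\<^sup>2) \<le> 2 * (norm a)\<^sup>2 + 2 * (norm x)\<^sup>2"
      using norm_diff_sq_le[of x a] by (auto simp: indicator_def)
  qed simp
  \<comment> \<open>The centroid minimises the quadratic error on its cell; \<open>D\<close> is the
    cross term, of integral zero by the centroid equation.\<close>
  have cell: "(\<integral>y. indicator (C i) y * (norm (y - c i))\<^sup>2 \<partial>\<nu>) \<le> (\<integral>y. indicator (C i) y * (norm (y - h i))\<^sup>2 \<partial>\<nu>)"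
    if i: "i < N" for i
  proof -
    have i1: "integrable \<nu> (\<lambda>y. indicator (C i) y *\<^sub>R y)"
      by (rule P2_integrable_linear[OF P, of _ 0 1]) (auto simp: indicator_def)
    define u where "u = c i - h i"
    define D where "D y = (indicator (C i) y *\<^sub>R y) \<bullet> u - indicator (C i) y * (c i \<bullet> u)" for y
    have i2: "integrable \<nu> (\<lambda>y. (indicator (C i) y *\<^sub>R y) \<bullet> u)" by (rule integrable_inner_left) (rule i1)
    have i3: "integrable \<nu> (\<lambda>y. indicator (C i) y * (c i \<bullet> u))"
      by (intro integrable_mult_left integrable_real_indicator) (auto simp: s emeasure_eq_measure)
    have i4: "integrable \<nu> D" unfolding D_def by (rule Bochner_Integration.integrable_diff[OF i2 i3])
    have "(\<integral>y. D y \<partial>\<nu>) = (\<integral>y. (indicator (C i) y *\<^sub>R y) \<bullet> u \<partial>\<nu>) - (\<integral>y. indicator (C i) y * (c i \<bullet> u) \<partial>\<nu>)"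
      unfolding D_def by (rule Bochner_Integration.integral_diff[OF i2 i3])
    also have "(\<integral>y. (indicator (C i) y *\<^sub>R y) \<bullet> u \<partial>\<nu>) = (measure \<nu> (C i) *\<^sub>R c i) \<bullet> u"
      unfolding cen[OF i, symmetric] by (rule integral_inner_left) (rule i1)
    also have "(\<integral>y. indicator (C i) y * (c i \<bullet> u) \<partial>\<nu>) = measure \<nu> (C i) * (c i \<bullet> u)" by (simp add: s)
    finally have D0: "(\<integral>y. D y \<partial>\<nu>) = 0" by simp
    have "(\<integral>y. indicator (C i) y * (norm (y - c i))\<^sup>2 \<partial>\<nu>) =
      (\<integral>y. indicator (C i) y * (norm (y - c i))\<^sup>2 + 2 * D y \<partial>\<nu>)"
      using int2 i4 D0 by simp
    also have "\<dots> \<le> (\<integral>y. indicator (C i) y * (norm (y - h i))\<^sup>2 \<partial>\<nu>)"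
    proof (rule integral_mono)
      fix y
      have "0 \<le> (norm u)\<^sup>2" by simp
      moreover have "(norm (y - h i))\<^sup>2 = (norm (y - c i))\<^sup>2 + 2 * (y \<bullet> u - c i \<bullet> u) + (norm u)\<^sup>2"
        unfolding power2_norm_eq_inner u_def by (simp add: inner_diff inner_commute algebra_simps)
      ultimately show "indicator (C i) y * (norm (y - c i))\<^sup>2 + 2 * D y \<le> indicator (C i) y * (norm (y - h i))\<^sup>2"
        by (simp add: D_def indicator_def)
    qed (use int2 i4 in auto)
    finally show ?thesis .
  qed
  have "(\<integral>y. (\<Sum>i<N. indicator (C i) y * (norm (y - c i))\<^sup>2) \<partial>\<nu>) = (\<Sum>i<N. \<integral>y. indicator (C i) y * (norm (y - c i))\<^sup>2 \<partial>\<nu>)"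
    using int2 by (intro Bochner_Integration.integral_sum) auto
  also have "\<dots> \<le> (\<Sum>i<N. \<integral>y. indicator (C i) y * (norm (y - h i))\<^sup>2 \<partial>\<nu>)"
    using cell by (intro sum_mono) auto
  also have "\<dots> = (\<integral>y. (\<Sum>i<N. indicator (C i) y * (norm (y - h i))\<^sup>2) \<partial>\<nu>)"
    using int2 by (intro Bochner_Integration.integral_sum[symmetric]) auto
  also have "\<dots> \<le> (\<integral>y. (norm (y - F n y))\<^sup>2 \<partial>\<nu>)"
  proof (rule integral_mono_AE)
    show "integrable \<nu> (\<lambda>y. \<Sum>i<N. indicator (C i) y * (norm (y - h i))\<^sup>2)"
      by (intro Bochner_Integration.integrable_sum int2)
    show "integrable \<nu> (\<lambda>y. (norm (y - F n y))\<^sup>2)"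
      by (rule Bochner_Integration.integrable_bound[of _ "\<lambda>x. 10 * (norm x)\<^sup>2"])
         (use b P2_integrable_norm_sq[OF P] in auto)
    show "AE y in \<nu>. (\<Sum>i<N. indicator (C i) y * (norm (y - h i))\<^sup>2) \<le> (norm (y - F n y))\<^sup>2"
      using ac
    proof eventually_elim
      fix y assume "\<exists>i<N. y \<in> C i"
      then obtain j where j: "j < N" "y \<in> C j" by blast
      have "(\<Sum>i<N. indicator (C i) y * (norm (y - h i))\<^sup>2) = (\<Sum>i<N. if i = j then (norm (y - h j))\<^sup>2 else 0)"
        using j disj by (intro sum.cong) (auto simp: indicator_def)
      also have "\<dots> = (norm (y - F n y))\<^sup>2" using j by (simp add: C_def A_def)
      finally show "(\<Sum>i<N. indicator (C i) y * (norm (y - h i))\<^sup>2) \<le> (norm (y - F n y))\<^sup>2" by simp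
    qed
  qed
  finally have "(\<integral>y. (\<Sum>i<N. indicator (C i) y * (norm (y - c i))\<^sup>2) \<partial>\<nu>) \<le> \<delta>" using n by simp
  with N0 Cm Cpos disj ac cen show ?thesis by (intro that[of N C c]) auto
qed

text \<open>Bounded density of a coupling with respect to the product measure. The first
  normalisation holds for every \<open>x\<close>, so that \<open>k x\<close> is a probability
  density at each point; the second holds only almost everywhere, since the cells cover the target
  only up to a null set.\<close>

definition kcoup :: "'x::euclidean_space measure \<Rightarrow> 'x measure \<Rightarrow> ('x \<Rightarrow> 'x \<Rightarrow> real) \<Rightarrow> bool" where
  "kcoup \<rho> \<nu> k \<longleftrightarrow> (\<lambda>z. k (fst z) (snd z)) \<in> borel_measurable borel \<and>
     (\<exists>M. \<forall>x y. 0 \<le> k x y \<and> k x y \<le> M) \<and>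
     (\<forall>x. (\<integral>y. k x y \<partial>\<nu>) = 1) \<and> (AE y in \<nu>. (\<integral>x. k x y \<partial>\<rho>) = 1)"

definition bary :: "'x::euclidean_space measure \<Rightarrow> ('x \<Rightarrow> 'x \<Rightarrow> real) \<Rightarrow> 'x \<Rightarrow> 'x" where
  "bary \<nu> k x = (\<integral>y. k x y *\<^sub>R y \<partial>\<nu>)"

text \<open>Entropic regularisation: the Gibbs kernel couples the two measures exactly, loses only
  \<open>ln N / \<kappa>\<close> in the transport cost, and its barycentric projection is the gradient of a smooth
  function.\<close>

lemma ex_gibbs_coupling:
  fixes \<rho> \<nu> :: "'x::euclidean_space measure"
  assumes Pr: "P2 \<rho>" and Pn: "P2 \<nu>" and e: "0 < e"
  obtains \<kappa> N :: nat and y w k where "0 < \<kappa>" "0 < N" "kcoup \<rho> \<nu> k" "bary \<nu> k = gibbs_mean (real \<kappa>) N y w"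
    "\<And>p. p \<in> couplings \<rho> \<nu> \<Longrightarrow> (\<integral>z. fst z \<bullet> snd z \<partial>p) \<le> (\<integral>x. x \<bullet> bary \<nu> k x \<partial>\<rho>) + e"
proof -
  interpret r: prob_space \<rho> by (rule P2_prob[OF Pr])
  interpret n: prob_space \<nu> by (rule P2_prob[OF Pn])
  have sn: "sets \<nu> = sets borel" by (rule P2_sets[OF Pn])
  define m2 where "m2 = (\<integral>x. (norm x)\<^sup>2 \<partial>\<rho>)"
  have m2: "0 \<le> m2" by (simp add: m2_def)
  \<comment> \<open>Young parameter for \<open>x \<bullet> (y - c i)\<close>: \<open>s\<close> keeps
    the part in \<open>x\<close> below \<open>e / 2\<close>, and the quantisation error
    \<open>s * e / 2\<close> does the same for the part in \<open>y\<close>, which is divided by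
    \<open>s\<close>. Halved together they cost \<open>e / 2\<close>.\<close>
  define s where "s = e / (2 * (m2 + 1))"
  have s: "0 < s" "s * m2 \<le> e / 2" using e m2 by (auto simp: s_def field_simps)
  have sd: "0 < s * e / 2" using s e by simp
  obtain N :: nat and C :: "nat \<Rightarrow> 'x set" and c where N: "0 < N" and C: "\<And>i. i < N \<Longrightarrow> C i \<in> sets borel"
    and Cpos: "\<And>i. i < N \<Longrightarrow> 0 < measure \<nu> (C i)"
    and disj: "\<And>i j. i < N \<Longrightarrow> j < N \<Longrightarrow> i \<noteq> j \<Longrightarrow> C i \<inter> C j = {}"
    and cov: "AE y in \<nu>. \<exists>i<N. y \<in> C i"
    and cen: "\<And>i. i < N \<Longrightarrow> (\<integral>y. indicator (C i) y *\<^sub>R y \<partial>\<nu>) = measure \<nu> (C i) *\<^sub>R c i"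
    and err: "(\<integral>y. (\<Sum>i<N. indicator (C i) y * (norm (y - c i))\<^sup>2) \<partial>\<nu>) \<le> s * e / 2"
    by (rule P2_quantize[OF Pn sd]) (rule that)
  define q where "q i = measure \<nu> (C i)" for i
  have qpos: "0 < q i" if "i < N" for i using Cpos[OF that] by (simp add: q_def)
  have cov1: "AE y in \<nu>. (\<Sum>i<N. indicator (C i) y) = (1::real)"
    using cov
  proof eventually_elim
    fix y assume "\<exists>i<N. y \<in> C i"
    then obtain j where j: "j < N" "y \<in> C j" by blast
    have "(\<Sum>i<N. indicator (C i) y) = (\<Sum>i<N. if i = j then 1 else (0::real))"
      using j disj by (intro sum.cong) (auto simp: indicator_def)
    then show "(\<Sum>i<N. indicator (C i) y) = (1::real)" using j by simp
  qed
  have indi: "integrable \<nu> (indicator (C i) :: _ \<Rightarrow> real)" if "i < N" for i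
    using C[OF that] by (intro integrable_real_indicator) (auto simp: sn n.emeasure_eq_measure)
  have indq: "(\<integral>y. indicator (C i) y \<partial>\<nu>) = q i" if "i < N" for i
    using C[OF that] by (simp add: q_def sn)
  have qsum: "(\<Sum>i<N. q i) = 1"
  proof -
    have "(\<Sum>i<N. q i) = (\<Sum>i<N. \<integral>y. indicator (C i) y \<partial>\<nu>)" using indq by simp
    also have "\<dots> = (\<integral>y. (\<Sum>i<N. indicator (C i) y) \<partial>\<nu>)" using indi by (intro Bochner_Integration.integral_sum[symmetric]) auto
    also have "\<dots> = (\<integral>y. 1 \<partial>\<nu>)" using cov1 C sn
      by (intro integral_cong_AE borel_measurable_sum borel_measurable_indicator) auto
    also have "\<dots> = 1" by (simp add: n.prob_space)
    finally show ?thesis .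
  qed
  obtain \<kappa> :: nat where kap: "0 < \<kappa>" "ln (real N) / real \<kappa> \<le> e / 2"
  proof -
    obtain K :: nat where "2 * ln (real N) / e < real K" using reals_Archimedean2 by blast
    then have "ln (real N) / real (Suc K) \<le> e / 2" using e by (simp add: field_simps)
    then show ?thesis by (intro that[of "Suc K"]) auto
  qed
  obtain w where w: "\<And>i. i < N \<Longrightarrow> (\<integral>x. gibbs (real \<kappa>) N c w i x \<partial>\<rho>) = q i"
    using ex_gibbs_weights[OF N _ Pr qpos qsum, of "real \<kappa>" c] kap by auto
  let ?g = "gibbs (real \<kappa>) N c w" and ?L = "lse (real \<kappa>) N c w"
  have gm[measurable]: "?g i \<in> borel_measurable borel" for i
    by (rule borel_measurable_continuous_onI[OF gibbs_continuous[OF N]])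
  \<comment> \<open>From \<open>x\<close>, a cell is chosen with its Gibbs probability, and then
    \<open>y\<close> is drawn from \<nu> conditioned on that cell.\<close>
  define k where "k x y = (\<Sum>i<N. ?g i x * (indicator (C i) y / q i))" for x y
  have kb: "0 \<le> k x y \<and> k x y \<le> (\<Sum>i<N. 1 / q i)" for x y
  proof
    show "0 \<le> k x y" unfolding k_def using qpos
      by (intro sum_nonneg mult_nonneg_nonneg gibbs_nonneg divide_nonneg_nonneg) (auto intro: less_imp_le)
    show "k x y \<le> (\<Sum>i<N. 1 / q i)" unfolding k_def
    proof (rule sum_mono)
      fix i assume "i \<in> {..<N}"
      then have i: "i < N" by simp
      have "?g i x * (indicator (C i) y / q i) \<le> 1 * (1 / q i)"
        using gibbs_le_1[OF i] gibbs_nonneg qpos[OF i] by (intro mult_mono divide_right_mono) (auto simp: indicator_def)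
      then show "?g i x * (indicator (C i) y / q i) \<le> 1 / q i" by simp
    qed
  qed
  have km: "(\<lambda>z. k (fst z) (snd z)) \<in> borel_measurable borel"
    unfolding k_def
  proof (rule borel_measurable_sum)
    fix i assume "i \<in> {..<N}"
    then have [measurable]: "C i \<in> sets borel" using C by simp
    show "(\<lambda>z::'x \<times> 'x. ?g i (fst z) * (indicator (C i) (snd z) / q i)) \<in> borel_measurable borel" by measurable
  qed
  have k1: "(\<integral>y. k x y \<partial>\<nu>) = 1" for x
  proof -
    have "(\<integral>y. k x y \<partial>\<nu>) = (\<Sum>i<N. \<integral>y. ?g i x * (indicator (C i) y / q i) \<partial>\<nu>)"
      unfolding k_def using indi by (intro Bochner_Integration.integral_sum integrable_mult_right integrable_divide) auto
    also have "\<dots> = (\<Sum>i<N. ?g i x)"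
    proof (rule sum.cong[OF refl])
      fix i assume "i \<in> {..<N}"
      then have i: "i < N" by simp
      show "(\<integral>y. ?g i x * (indicator (C i) y / q i) \<partial>\<nu>) = ?g i x" using indq[OF i] qpos[OF i] by simp
    qed
    also have "\<dots> = 1" by (rule gibbs_sum[OF N])
    finally show ?thesis .
  qed
  have k2: "AE y in \<nu>. (\<integral>x. k x y \<partial>\<rho>) = 1"
    using cov1
  proof eventually_elim
    fix y assume y: "(\<Sum>i<N. indicator (C i) y) = (1::real)"
    have "(\<integral>x. k x y \<partial>\<rho>) = (\<Sum>i<N. \<integral>x. ?g i x * (indicator (C i) y / q i) \<partial>\<rho>)"
      unfolding k_def using gibbs_integrable[OF _ Pr] by (intro Bochner_Integration.integral_sum integrable_mult_left) auto
    also have "\<dots> = (\<Sum>i<N. indicator (C i) y)"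
    proof (rule sum.cong[OF refl])
      fix i assume "i \<in> {..<N}"
      then have i: "i < N" by simp
      show "(\<integral>x. ?g i x * (indicator (C i) y / q i) \<partial>\<rho>) = indicator (C i) y" using w[OF i] qpos[OF i] by simp
    qed
    finally show "(\<integral>x. k x y \<partial>\<rho>) = 1" using y by simp
  qed
  have kc: "kcoup \<rho> \<nu> k" unfolding kcoup_def using kb km k1 k2 by blast
  have indy: "integrable \<nu> (\<lambda>y. indicator (C i) y *\<^sub>R y)" if i: "i < N" for i
    by (rule P2_integrable_linear[OF Pn, of _ 0 1]) (use C[OF i] in \<open>auto simp: indicator_def\<close>)
  have bk: "bary \<nu> k x = gibbs_mean (real \<kappa>) N c w x" for x
  proof -
    have "bary \<nu> k x = (\<integral>y. (\<Sum>i<N. (?g i x / q i) *\<^sub>R (indicator (C i) y *\<^sub>R y)) \<partial>\<nu>)"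
      unfolding bary_def k_def scaleR_sum_left by (simp add: mult.commute)
    also have "\<dots> = (\<Sum>i<N. \<integral>y. (?g i x / q i) *\<^sub>R (indicator (C i) y *\<^sub>R y) \<partial>\<nu>)"
      using indy by (intro Bochner_Integration.integral_sum integrable_scaleR_right) auto
    also have "\<dots> = (\<Sum>i<N. ?g i x *\<^sub>R c i)"
    proof (rule sum.cong[OF refl])
      fix i assume "i \<in> {..<N}"
      then have i: "i < N" by simp
      show "(\<integral>y. (?g i x / q i) *\<^sub>R (indicator (C i) y *\<^sub>R y) \<partial>\<nu>) = ?g i x *\<^sub>R c i"
        unfolding integral_scaleR_right cen[OF i] using qpos[OF i] by (simp add: q_def)
    qed
    finally show ?thesis by (simp add: gibbs_mean_def)
  qed
  have Li: "integrable \<rho> ?L" using lse_integrable[OF N _ Pr] kap by simp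
  \<comment> \<open>Value of the dual functional at the chosen weights. The Gibbs kernel falls short
    of it by at most the entropy term \<open>e / 2\<close>, and no coupling exceeds it by more than
    the quantisation cost \<open>e / 2\<close>.\<close>
  define B where "B = (\<integral>x. ?L x \<partial>\<rho>) + (\<Sum>i<N. q i * w i)"
  have low: "B - e / 2 \<le> (\<integral>x. x \<bullet> bary \<nu> k x \<partial>\<rho>)"
  proof -
    have gi: "integrable \<rho> (\<lambda>x. ?g i x * w i)" if "i < N" for i
      using gibbs_integrable[OF that Pr] by auto
    have gx: "integrable \<rho> (\<lambda>x. ?g i x * (x \<bullet> c i))" if i: "i < N" for i
    proof (rule P2_integrable_linear[OF Pr, of _ 0 "norm (c i)"])
      fix x
      have "\<bar>?g i x\<bar> * \<bar>x \<bullet> c i\<bar> \<le> 1 * (norm x * norm (c i))"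
        using gibbs_le_1[OF i, of "real \<kappa>" c w x] gibbs_nonneg[of "real \<kappa>" N c w i x]
        by (intro mult_mono Cauchy_Schwarz_ineq2) auto
      then show "norm (?g i x * (x \<bullet> c i)) \<le> 0 + norm (c i) * norm x" by (simp add: abs_mult mult.commute)
    qed measurable
    have "B - e / 2 \<le> (\<integral>x. ?L x - ln (real N) / real \<kappa> \<partial>\<rho>) + (\<Sum>i<N. q i * w i)"
      using Li kap by (simp add: B_def r.prob_space)
    also have "(\<integral>x. ?L x - ln (real N) / real \<kappa> \<partial>\<rho>) \<le> (\<integral>x. (\<Sum>i<N. ?g i x * (x \<bullet> c i) - ?g i x * w i) \<partial>\<rho>)"
    proof (rule integral_mono)
      show "integrable \<rho> (\<lambda>x. ?L x - ln (real N) / real \<kappa>)" using Li by auto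
      show "integrable \<rho> (\<lambda>x. \<Sum>i<N. ?g i x * (x \<bullet> c i) - ?g i x * w i)" using gi gx by auto
      fix x show "?L x - ln (real N) / real \<kappa> \<le> (\<Sum>i<N. ?g i x * (x \<bullet> c i) - ?g i x * w i)"
        using gibbs_entropy[OF N, of "real \<kappa>" c w x] kap by (simp add: right_diff_distrib)
    qed
    also have "\<dots> = (\<Sum>i<N. (\<integral>x. ?g i x * (x \<bullet> c i) \<partial>\<rho>) - q i * w i)"
    proof -
      have "\<dots> = (\<Sum>i<N. (\<integral>x. ?g i x * (x \<bullet> c i) - ?g i x * w i \<partial>\<rho>))"
        using gi gx by (intro Bochner_Integration.integral_sum) auto
      also have "\<dots> = (\<Sum>i<N. (\<integral>x. ?g i x * (x \<bullet> c i) \<partial>\<rho>) - q i * w i)"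
        using gi gx w by (intro sum.cong) auto
      finally show ?thesis .
    qed
    also have "\<dots> + (\<Sum>i<N. q i * w i) = (\<Sum>i<N. (\<integral>x. ?g i x * (x \<bullet> c i) \<partial>\<rho>))"
      by (simp add: sum_subtractf)
    also have "\<dots> = (\<integral>x. (\<Sum>i<N. ?g i x * (x \<bullet> c i)) \<partial>\<rho>)"
      using gx by (intro Bochner_Integration.integral_sum[symmetric]) auto
    also have "\<dots> = (\<integral>x. x \<bullet> bary \<nu> k x \<partial>\<rho>)"
      by (simp add: bk gibbs_mean_def inner_sum_right)
    finally show ?thesis by simp
  qed
  \<comment> \<open>Weak duality: on cell \<open>j\<close>, \<open>x \<bullet> y\<close> splits into
    \<open>x \<bullet> (y - c j)\<close>, absorbed by Young's inequality in \<open>f1\<close>, and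
    \<open>x \<bullet> c j\<close>, bounded by the dual potentials in \<open>f2\<close>.\<close>
  have up: "(\<integral>z. fst z \<bullet> snd z \<partial>p) \<le> B + e / 2" if p: "p \<in> couplings \<rho> \<nu>" for p
  proof -
    have Pp: "P2 p" by (rule couplings_P2[OF p Pr Pn])
    interpret p: prob_space p by (rule P2_prob[OF Pp])
    have sp[measurable_cong]: "sets p = sets borel" by (rule P2_sets[OF Pp])
    define f1 where "f1 z = (s * (norm (fst z))\<^sup>2 + (1 / s) * (\<Sum>i<N. indicator (C i) (snd z) * (norm (snd z - c i))\<^sup>2)) / 2" for z :: "'x \<times> 'x"
    define f2 where "f2 z = ?L (fst z) + (\<Sum>i<N. indicator (C i) (snd z) * w i)" for z :: "'x \<times> 'x"
    have Lm: "?L \<in> borel_measurable borel" by (rule borel_measurable_continuous_onI[OF lse_continuous[OF N]])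
    have hm: "(\<lambda>y. \<Sum>i<N. indicator (C i) y * (norm (y - c i))\<^sup>2) \<in> borel_measurable borel"
    proof (rule borel_measurable_sum)
      fix i assume "i \<in> {..<N}"
      then have [measurable]: "C i \<in> sets borel" using C by simp
      show "(\<lambda>y. indicator (C i) y * (norm (y - c i))\<^sup>2) \<in> borel_measurable borel" by measurable
    qed
    have hw: "(\<lambda>y. \<Sum>i<N. indicator (C i) y * w i) \<in> borel_measurable borel"
    proof (rule borel_measurable_sum)
      fix i assume "i \<in> {..<N}"
      then have [measurable]: "C i \<in> sets borel" using C by simp
      show "(\<lambda>y. indicator (C i) y * w i) \<in> borel_measurable borel" by measurable
    qed
    have tr: "integrable p (\<lambda>z. f (fst z))" if "integrable \<rho> f" "f \<in> borel_measurable borel" for f :: "'x \<Rightarrow> real"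
    proof -
      have "distr p borel fst = \<rho>" using p by (simp add: couplings_def)
      moreover have "fst \<in> measurable p borel" by measurable
      ultimately show ?thesis using that integrable_distr_eq[of fst p borel f] by simp
    qed
    have tr2: "integrable p (\<lambda>z. f (snd z))" if "integrable \<nu> f" "f \<in> borel_measurable borel" for f :: "'x \<Rightarrow> real"
    proof -
      have "distr p borel snd = \<nu>" using p by (simp add: couplings_def)
      moreover have "snd \<in> measurable p borel" by measurable
      ultimately show ?thesis using that integrable_distr_eq[of snd p borel f] by simp
    qed
    have hI: "integrable \<nu> (\<lambda>y. \<Sum>i<N. indicator (C i) y * (norm (y - c i))\<^sup>2)"
    proof (rule Bochner_Integration.integrable_sum)
      fix i assume "i \<in> {..<N}"
      then have [measurable]: "C i \<in> sets borel" using C by simp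
      show "integrable \<nu> (\<lambda>y. indicator (C i) y * (norm (y - c i))\<^sup>2)"
      proof (rule P2_integrable[OF Pn, of _ "2 * (norm (c i))\<^sup>2" 2])
        fix x show "norm (indicator (C i) x * (norm (x - c i))\<^sup>2) \<le> 2 * (norm (c i))\<^sup>2 + 2 * (norm x)\<^sup>2"
          using norm_diff_sq_le[of x "c i"] by (auto simp: indicator_def)
      qed measurable
    qed
    have hwI: "integrable \<nu> (\<lambda>y. \<Sum>i<N. indicator (C i) y * w i)"
      using indi by (intro Bochner_Integration.integrable_sum integrable_mult_left) auto
    have i1: "integrable p f1" unfolding f1_def
      by (intro integrable_divide Bochner_Integration.integrable_add integrable_mult_right tr[OF P2_integrable_norm_sq[OF Pr]] tr2[OF hI hm]) simp
    have i2: "integrable p f2" unfolding f2_def by (rule Bochner_Integration.integrable_add[OF tr[OF Li Lm] tr2[OF hwI hw]])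
    have "AE z in p. \<exists>i<N. snd z \<in> C i"
    proof -
      have d: "distr p borel snd = \<nu>" using p by (simp add: couplings_def)
      have "AE y in distr p borel snd. \<exists>i<N. y \<in> C i" unfolding d by (rule cov)
      then show ?thesis by (rule AE_distrD[rotated]) measurable
    qed
    then have "AE z in p. fst z \<bullet> snd z \<le> f1 z + f2 z"
    proof eventually_elim
      fix z :: "'x \<times> 'x" assume "\<exists>i<N. snd z \<in> C i"
      then obtain j where j: "j < N" "snd z \<in> C j" by blast
      let ?x = "fst z" and ?y = "snd z"
      have sumj: "(\<Sum>i<N. indicator (C i) ?y * f i) = f j" for f :: "nat \<Rightarrow> real"
      proof -
        have "(\<Sum>i<N. indicator (C i) ?y * f i) = (\<Sum>i<N. if i = j then f j else 0)"
          using j disj by (intro sum.cong) (auto simp: indicator_def)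
        then show ?thesis using j by simp
      qed
      let ?u = "?y - c j"
      have "0 \<le> (norm (s *\<^sub>R ?x - ?u))\<^sup>2" by simp
      also have "\<dots> = s * (s * (norm ?x)\<^sup>2 + (1 / s) * (norm ?u)\<^sup>2 - 2 * (?x \<bullet> ?u))"
        unfolding power2_norm_eq_inner using s by (simp add: inner_diff inner_commute algebra_simps)
      finally have "2 * (?x \<bullet> ?u) \<le> s * (norm ?x)\<^sup>2 + (1 / s) * (norm ?u)\<^sup>2"
        using s by (simp add: zero_le_mult_iff)
      then have "?x \<bullet> ?u \<le> f1 z" by (simp add: f1_def sumj)
      moreover have "?x \<bullet> c j \<le> f2 z"
        using lse_lower[OF j(1), of "real \<kappa>" ?x c w] kap by (simp add: f2_def sumj)
      ultimately show "?x \<bullet> ?y \<le> f1 z + f2 z" by (simp add: inner_diff_right)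
    qed
    then have "(\<integral>z. fst z \<bullet> snd z \<partial>p) \<le> (\<integral>z. f1 z + f2 z \<partial>p)"
    proof (rule integral_mono_AE[rotated 2])
      show "integrable p (\<lambda>z. fst z \<bullet> snd z)"
      proof (rule P2_integrable[OF Pp, of _ 0 1])
        fix z :: "'x \<times> 'x"
        have "\<bar>fst z \<bullet> snd z\<bar> \<le> norm (fst z) * norm (snd z)" by (rule Cauchy_Schwarz_ineq2)
        also have "\<dots> \<le> (norm (fst z))\<^sup>2 + (norm (snd z))\<^sup>2"
        proof -
          have "2 * (norm (fst z) * norm (snd z)) \<le> (norm (fst z))\<^sup>2 + (norm (snd z))\<^sup>2"
            using sum_squares_bound[of "norm (fst z)" "norm (snd z)"] by (simp add: mult.assoc)
          moreover have "0 \<le> norm (fst z) * norm (snd z)" by simp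
          ultimately show ?thesis by linarith
        qed
        finally show "norm (fst z \<bullet> snd z) \<le> 0 + 1 * (norm z)\<^sup>2" by (simp add: norm_pair_sq)
      qed measurable
      show "integrable p (\<lambda>z. f1 z + f2 z)" using i1 i2 by auto
    qed
    also have "\<dots> = (\<integral>z. f1 z \<partial>p) + (\<integral>z. f2 z \<partial>p)" using i1 i2 by simp
    also have "(\<integral>z. f1 z \<partial>p) = (s * m2 + (1 / s) * (\<integral>y. (\<Sum>i<N. indicator (C i) y * (norm (y - c i))\<^sup>2) \<partial>\<nu>)) / 2"
    proof -
      define hh where "hh y = (\<Sum>i<N. indicator (C i) y * (norm (y - c i))\<^sup>2)" for y
      have a1: "(\<integral>z. (norm (fst z))\<^sup>2 \<partial>p) = m2" unfolding m2_def by (rule integral_coupling(1)[OF p]) simp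
      have a2: "(\<integral>z. hh (snd z) \<partial>p) = (\<integral>y. hh y \<partial>\<nu>)" unfolding hh_def by (rule integral_coupling(2)[OF p hm])
      have j1: "integrable p (\<lambda>z. (norm (fst z))\<^sup>2)" by (rule tr[OF P2_integrable_norm_sq[OF Pr]]) simp
      have j2: "integrable p (\<lambda>z. hh (snd z))" unfolding hh_def by (rule tr2[OF hI hm])
      show ?thesis unfolding f1_def hh_def[symmetric] using j1 j2 a1 a2 by simp
    qed
    also have "\<dots> \<le> (e / 2 + (1 / s) * (s * e / 2)) / 2"
      using s err by (intro divide_right_mono add_mono mult_left_mono) auto
    also have "\<dots> = e / 2" using s by simp
    also have "(\<integral>z. f2 z \<partial>p) = B"
    proof -
      have "(\<integral>z. f2 z \<partial>p) = (\<integral>z. ?L (fst z) \<partial>p) + (\<integral>z. (\<Sum>i<N. indicator (C i) (snd z) * w i) \<partial>p)"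
        unfolding f2_def by (rule Bochner_Integration.integral_add[OF tr[OF Li Lm] tr2[OF hwI hw]])
      also have "(\<integral>z. ?L (fst z) \<partial>p) = (\<integral>x. ?L x \<partial>\<rho>)" by (rule integral_coupling(1)[OF p Lm])
      also have "(\<integral>z. (\<Sum>i<N. indicator (C i) (snd z) * w i) \<partial>p) = (\<integral>y. (\<Sum>i<N. indicator (C i) y * w i) \<partial>\<nu>)"
        by (rule integral_coupling(2)[OF p hw])
      also have "(\<integral>y. (\<Sum>i<N. indicator (C i) y * w i) \<partial>\<nu>) = (\<Sum>i<N. \<integral>y. indicator (C i) y * w i \<partial>\<nu>)"
        using indi by (intro Bochner_Integration.integral_sum) auto
      also have "\<dots> = (\<Sum>i<N. q i * w i)" using indq by (intro sum.cong) auto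
      finally show ?thesis by (simp add: B_def)
    qed
    finally show ?thesis by simp
  qed
  show ?thesis
  proof (rule that[of \<kappa> N k c w])
    fix p assume "p \<in> couplings \<rho> \<nu>"
    from up[OF this] low show "(\<integral>z. fst z \<bullet> snd z \<partial>p) \<le> (\<integral>x. x \<bullet> bary \<nu> k x \<partial>\<rho>) + e" by linarith
  qed (use kap N kc bk in auto)
qed

section \<open>Gluing\<close>

lemma norm_fst_snd_le: "norm (fst z) \<le> norm z" "norm (snd z) \<le> norm z"
  by (rule power2_le_imp_le; simp add: norm_pair_sq)+

lemma kcoup_measurable:
  assumes "kcoup \<rho> \<nu> k" and f: "f \<in> borel_measurable M" and g: "g \<in> borel_measurable M"
  shows "(\<lambda>w. k (f w) (g w)) \<in> borel_measurable M"
proof -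
  have "(\<lambda>z. k (fst z) (snd z)) \<in> borel_measurable borel" using assms by (simp add: kcoup_def)
  from measurable_compose[OF borel_measurable_Pair[OF f g] this] show ?thesis by simp
qed

lemma kcoup_nn:
  assumes k: "kcoup \<rho> \<nu> k" and P: "P2 \<rho>" "P2 \<nu>"
  shows "(\<integral>\<^sup>+y. ennreal (k x y) \<partial>\<nu>) = 1" "AE y in \<nu>. (\<integral>\<^sup>+x. ennreal (k x y) \<partial>\<rho>) = 1"
    "integrable \<nu> (\<lambda>y. k x y)" "integrable \<nu> (\<lambda>y. k x y *\<^sub>R y)" "integrable \<nu> (\<lambda>y. k x y * (norm y)\<^sup>2)" "0 \<le> k x y'"
proof -
  obtain M where M: "\<And>x y. 0 \<le> k x y" "\<And>x y. k x y \<le> M" using k by (auto simp: kcoup_def)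
  have m1: "(\<lambda>y. k x y) \<in> borel_measurable borel" "(\<lambda>x. k x y) \<in> borel_measurable borel" for x y
    by (rule kcoup_measurable[OF k]; simp)+
  have i1: "integrable \<nu> (\<lambda>y. k x y)" for x
    by (rule P2_integrable_linear[OF P(2) m1(1), of _ M 0]) (use M in auto)
  have i2: "integrable \<rho> (\<lambda>x. k x y)" for y
    by (rule P2_integrable_linear[OF P(1) m1(2), of _ M 0]) (use M in auto)
  show "integrable \<nu> (\<lambda>y. k x y)" by (rule i1)
  show "integrable \<nu> (\<lambda>y. k x y *\<^sub>R y)"
    by (rule P2_integrable_linear[OF P(2), of _ 0 M]) (use M m1 in \<open>auto intro!: mult_right_mono\<close>)
  show "integrable \<nu> (\<lambda>y. k x y * (norm y)\<^sup>2)"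
    by (rule P2_integrable[OF P(2), of _ 0 M]) (use M m1 in \<open>auto intro!: mult_right_mono simp: abs_mult\<close>)
  show "0 \<le> k x y'" by (rule M)
  show "(\<integral>\<^sup>+y. ennreal (k x y) \<partial>\<nu>) = 1"
    using k by (subst nn_integral_eq_integral[OF i1]) (auto simp: M kcoup_def)
  have "AE y in \<nu>. (\<integral>x. k x y \<partial>\<rho>) = 1" using k by (simp add: kcoup_def)
  then show "AE y in \<nu>. (\<integral>\<^sup>+x. ennreal (k x y) \<partial>\<rho>) = 1"
    by eventually_elim (subst nn_integral_eq_integral[OF i2], auto simp: M)
qed

text \<open>Law of a triple \<open>((x, x'), y)\<close> in which the pair has law \<open>p\<close>
  and \<open>y\<close>, given the pair, depends on \<open>x\<close> alone.\<close>

definition glue :: "('x::euclidean_space \<times> 'x) measure \<Rightarrow> 'x measure \<Rightarrow> ('x \<Rightarrow> 'x \<Rightarrow> real) \<Rightarrow> (('x \<times> 'x) \<times> 'x) measure" where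
  "glue p \<nu> k = density (p \<Otimes>\<^sub>M \<nu>) (\<lambda>w. ennreal (k (fst (fst w)) (snd w)))"

context
  fixes \<rho> \<tau> \<nu> :: "'x::euclidean_space measure" and p :: "('x \<times> 'x) measure" and k
  assumes Pr: "P2 \<rho>" and Pt: "P2 \<tau>" and Pn: "P2 \<nu>" and p: "p \<in> couplings \<rho> \<tau>" and k: "kcoup \<rho> \<nu> k"
begin

lemma P2p: "P2 p"
  by (rule couplings_P2[OF p Pr Pt])

lemma sets_glue: "sets (glue p \<nu> k) = sets borel"
proof -
  have "sets (p \<Otimes>\<^sub>M \<nu>) = sets (borel \<Otimes>\<^sub>M borel)"
    by (rule sets_pair_measure_cong[OF P2_sets[OF P2p] P2_sets[OF Pn]])
  then show ?thesis unfolding borel_prod by (simp add: glue_def)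
qed

lemma glue_kernel_measurable: "(\<lambda>w. k (fst (fst w)) (snd w)) \<in> borel_measurable (p \<Otimes>\<^sub>M \<nu>)"
proof -
  have [measurable_cong]: "sets p = sets borel" "sets \<nu> = sets borel" using P2_sets[OF P2p] P2_sets[OF Pn] by auto
  show ?thesis by (rule kcoup_measurable[OF k]) measurable
qed

lemma glue_nn_fst:
  assumes f[measurable]: "f \<in> borel_measurable borel"
  shows "(\<integral>\<^sup>+w. f (fst w) \<partial>glue p \<nu> k) = (\<integral>\<^sup>+z. f z \<partial>p)"
proof -
  interpret n: prob_space \<nu> by (rule P2_prob[OF Pn])
  have [measurable_cong]: "sets p = sets borel" "sets \<nu> = sets borel" using P2_sets[OF P2p] P2_sets[OF Pn] by auto
  note [measurable] = glue_kernel_measurable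
  have km: "(\<lambda>y. k x y) \<in> borel_measurable \<nu>" for x by (rule kcoup_measurable[OF k]) measurable
  have "(\<integral>\<^sup>+w. f (fst w) \<partial>glue p \<nu> k) = (\<integral>\<^sup>+w. ennreal (k (fst (fst w)) (snd w)) * f (fst w) \<partial>(p \<Otimes>\<^sub>M \<nu>))"
    unfolding glue_def by (rule nn_integral_density) measurable
  also have "\<dots> = (\<integral>\<^sup>+z. \<integral>\<^sup>+y. ennreal (k (fst z) y) * f z \<partial>\<nu> \<partial>p)"
    by (subst n.nn_integral_fst[symmetric]) auto
  also have "\<dots> = (\<integral>\<^sup>+z. f z \<partial>p)"
    by (intro nn_integral_cong) (use km in \<open>simp add: nn_integral_multc kcoup_nn(1)[OF k Pr Pn]\<close>)
  finally show ?thesis .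
qed

text \<open>The pair enters the density only through its first component, whose law is
  \<open>\<rho>\<close>, so the second normalisation of the kernel applies. That it holds only
  almost everywhere is harmless under the integral.\<close>

lemma glue_nn_snd:
  assumes f[measurable]: "f \<in> borel_measurable borel"
  shows "(\<integral>\<^sup>+w. f (snd w) \<partial>glue p \<nu> k) = (\<integral>\<^sup>+y. f y \<partial>\<nu>)"
proof -
  interpret n: prob_space \<nu> by (rule P2_prob[OF Pn])
  interpret p: prob_space p by (rule P2_prob[OF P2p])
  interpret pn: pair_sigma_finite p \<nu> ..
  have [measurable_cong]: "sets p = sets borel" "sets \<nu> = sets borel" using P2_sets[OF P2p] P2_sets[OF Pn] by auto
  note [measurable] = glue_kernel_measurable
  have km[measurable]: "(\<lambda>x. k x y) \<in> borel_measurable borel" for y by (rule kcoup_measurable[OF k]) measurable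
  have "(\<integral>\<^sup>+w. f (snd w) \<partial>glue p \<nu> k) = (\<integral>\<^sup>+w. ennreal (k (fst (fst w)) (snd w)) * f (snd w) \<partial>(p \<Otimes>\<^sub>M \<nu>))"
    unfolding glue_def by (rule nn_integral_density) measurable
  also have "\<dots> = (\<integral>\<^sup>+y. \<integral>\<^sup>+z. ennreal (k (fst z) y) * f y \<partial>p \<partial>\<nu>)"
    by (subst pn.nn_integral_snd[symmetric]) auto
  also have "\<dots> = (\<integral>\<^sup>+y. (\<integral>\<^sup>+z. ennreal (k (fst z) y) \<partial>p) * f y \<partial>\<nu>)"
    by (intro nn_integral_cong nn_integral_multc) measurable
  also have "\<dots> = (\<integral>\<^sup>+y. (\<integral>\<^sup>+x. ennreal (k x y) \<partial>\<rho>) * f y \<partial>\<nu>)"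
    by (intro nn_integral_cong arg_cong2[where f="(*)"] refl nn_integral_coupling_fst(1)[OF p]) measurable
  also have "\<dots> = (\<integral>\<^sup>+y. f y \<partial>\<nu>)"
  proof (rule nn_integral_cong_AE)
    show "AE y in \<nu>. (\<integral>\<^sup>+x. ennreal (k x y) \<partial>\<rho>) * f y = f y"
      using kcoup_nn(2)[OF k Pr Pn] by eventually_elim simp
  qed
  finally show ?thesis .
qed

lemma distr_glue: "distr (glue p \<nu> k) borel fst = p" "distr (glue p \<nu> k) borel snd = \<nu>"
proof -
  have [measurable_cong]: "sets (glue p \<nu> k) = sets borel" by (rule sets_glue)
  show "distr (glue p \<nu> k) borel fst = p"
  proof (rule measure_eqI)
    show "sets (distr (glue p \<nu> k) borel fst) = sets p" using P2_sets[OF P2p] by simp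
    fix A assume "A \<in> sets (distr (glue p \<nu> k) borel fst)"
    then have A[measurable]: "A \<in> sets borel" by simp
    have "emeasure (distr (glue p \<nu> k) borel fst) A = (\<integral>\<^sup>+z. indicator A z \<partial>distr (glue p \<nu> k) borel fst)"
      by simp
    also have "\<dots> = (\<integral>\<^sup>+w. indicator A (fst w) \<partial>glue p \<nu> k)" by (rule nn_integral_distr) measurable
    also have "\<dots> = (\<integral>\<^sup>+z. indicator A z \<partial>p)" by (rule glue_nn_fst) measurable
    also have "\<dots> = emeasure p A" using P2_sets[OF P2p] by simp
    finally show "emeasure (distr (glue p \<nu> k) borel fst) A = emeasure p A" .
  qed
  show "distr (glue p \<nu> k) borel snd = \<nu>"
  proof (rule measure_eqI)
    show "sets (distr (glue p \<nu> k) borel snd) = sets \<nu>" using P2_sets[OF Pn] by simp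
    fix A assume "A \<in> sets (distr (glue p \<nu> k) borel snd)"
    then have A[measurable]: "A \<in> sets borel" by simp
    have "emeasure (distr (glue p \<nu> k) borel snd) A = (\<integral>\<^sup>+z. indicator A z \<partial>distr (glue p \<nu> k) borel snd)"
      by simp
    also have "\<dots> = (\<integral>\<^sup>+w. indicator A (snd w) \<partial>glue p \<nu> k)" by (rule nn_integral_distr) measurable
    also have "\<dots> = (\<integral>\<^sup>+z. indicator A z \<partial>\<nu>)" by (rule glue_nn_snd) measurable
    also have "\<dots> = emeasure \<nu> A" using P2_sets[OF Pn] by simp
    finally show "emeasure (distr (glue p \<nu> k) borel snd) A = emeasure \<nu> A" .
  qed
qed

lemma glue_P2: "P2 (glue p \<nu> k)"
proof -
  have [measurable_cong]: "sets (glue p \<nu> k) = sets borel" by (rule sets_glue)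
  have "prob_space (glue p \<nu> k)"
  proof
    have "emeasure (glue p \<nu> k) (space (glue p \<nu> k)) = (\<integral>\<^sup>+w. 1 \<partial>glue p \<nu> k)" by simp
    also have "\<dots> = (\<integral>\<^sup>+z. 1 \<partial>p)" by (rule glue_nn_fst) simp
    also have "\<dots> = 1" using prob_space.emeasure_space_1[OF P2_prob[OF P2p]] by simp
    finally show "emeasure (glue p \<nu> k) (space (glue p \<nu> k)) = 1" .
  qed
  moreover have "(\<integral>\<^sup>+ w. ennreal ((norm w)\<^sup>2) \<partial>glue p \<nu> k) < \<infinity>"
  proof -
    have "(\<integral>\<^sup>+ w. ennreal ((norm w)\<^sup>2) \<partial>glue p \<nu> k) = (\<integral>\<^sup>+ w. ennreal ((norm (fst w))\<^sup>2) + ennreal ((norm (snd w))\<^sup>2) \<partial>glue p \<nu> k)"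
      by (intro nn_integral_cong) (simp add: norm_pair_sq[where z="_ :: ('x \<times> 'x) \<times> 'x"])
    also have "\<dots> = (\<integral>\<^sup>+ w. ennreal ((norm (fst w))\<^sup>2) \<partial>glue p \<nu> k) + (\<integral>\<^sup>+ w. ennreal ((norm (snd w))\<^sup>2) \<partial>glue p \<nu> k)"
      by (rule nn_integral_add) measurable
    also have "\<dots> = (\<integral>\<^sup>+ w. ennreal ((norm w)\<^sup>2) \<partial>p) + (\<integral>\<^sup>+ w. ennreal ((norm w)\<^sup>2) \<partial>\<nu>)"
      using glue_nn_fst[of "\<lambda>w. ennreal ((norm w)\<^sup>2)"] glue_nn_snd[of "\<lambda>w. ennreal ((norm w)\<^sup>2)"] by simp
    also have "\<dots> < \<infinity>" using P2p Pn by (simp add: P2_def)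
    finally show ?thesis .
  qed
  ultimately show ?thesis using sets_glue by (simp add: P2_def)
qed

lemma glue_integral_fst:
  fixes f :: "'x \<times> 'x \<Rightarrow> real"
  assumes f: "f \<in> borel_measurable borel"
  shows "(\<integral>w. f (fst w) \<partial>glue p \<nu> k) = (\<integral>z. f z \<partial>p)"
proof -
  have [measurable_cong]: "sets (glue p \<nu> k) = sets borel" by (rule sets_glue)
  have "(\<integral>z. f z \<partial>distr (glue p \<nu> k) borel fst) = (\<integral>w. f (fst w) \<partial>glue p \<nu> k)"
    by (rule integral_distr) (use f in auto)
  then show ?thesis by (simp add: distr_glue)
qed

lemma glue_integral_snd:
  fixes f :: "'x \<Rightarrow> real"
  assumes f: "f \<in> borel_measurable borel"
  shows "(\<integral>w. f (snd w) \<partial>glue p \<nu> k) = (\<integral>z. f z \<partial>\<nu>)"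
proof -
  have [measurable_cong]: "sets (glue p \<nu> k) = sets borel" by (rule sets_glue)
  have "(\<integral>z. f z \<partial>distr (glue p \<nu> k) borel snd) = (\<integral>w. f (snd w) \<partial>glue p \<nu> k)"
    by (rule integral_distr) (use f in auto)
  then show ?thesis by (simp add: distr_glue)
qed

text \<open>Given the pair \<open>(x, x')\<close>, the variable \<open>y\<close> has mean
  \<open>bary \<nu> k x\<close>, so integrating it out replaces it by the barycentre. Linear growth
  of \<open>h\<close> keeps the product integrable against second moments.\<close>

lemma glue_integral_bary:
  assumes h[measurable]: "h \<in> borel_measurable borel" and hb: "\<And>z. norm (h z) \<le> a + b * norm z"
  shows "(\<integral>w. h (fst w) \<bullet> snd w \<partial>glue p \<nu> k) = (\<integral>z. h z \<bullet> bary \<nu> k (fst z) \<partial>p)"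
    "integrable (glue p \<nu> k) (\<lambda>w. h (fst w) \<bullet> snd w)"
proof -
  interpret n: prob_space \<nu> by (rule P2_prob[OF Pn])
  interpret p: prob_space p by (rule P2_prob[OF P2p])
  interpret pn: pair_sigma_finite p \<nu> ..
  have [measurable_cong]: "sets p = sets borel" "sets \<nu> = sets borel" using P2_sets[OF P2p] P2_sets[OF Pn] by auto
  have sg[measurable_cong]: "sets (glue p \<nu> k) = sets borel" by (rule sets_glue)
  note [measurable] = glue_kernel_measurable
  have a0: "0 \<le> a" using order_trans[OF norm_ge_zero[of "h 0"] hb[of 0]] by simp
  show i: "integrable (glue p \<nu> k) (\<lambda>w. h (fst w) \<bullet> snd w)"
  proof (rule P2_integrable[OF glue_P2, of _ a "a + 2 * \<bar>b\<bar>"])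
    fix w :: "('x \<times> 'x) \<times> 'x"
    have fw: "norm (fst w) \<le> norm w" "norm (snd w) \<le> norm w" by (rule norm_fst_snd_le)+
    have "\<bar>h (fst w) \<bullet> snd w\<bar> \<le> norm (h (fst w)) * norm (snd w)" by (rule Cauchy_Schwarz_ineq2)
    also have "\<dots> \<le> (a + \<bar>b\<bar> * norm w) * norm w"
    proof (rule mult_mono)
      have "b * norm (fst w) \<le> \<bar>b\<bar> * norm w" using fw by (intro mult_mono) auto
      then show "norm (h (fst w)) \<le> a + \<bar>b\<bar> * norm w" using hb[of "fst w"] by linarith
    qed (use fw a0 in auto)
    also have "\<dots> = a * norm w + \<bar>b\<bar> * (norm w)\<^sup>2" by (simp add: algebra_simps power2_eq_square)
    also have "\<dots> \<le> a * (1 + (norm w)\<^sup>2) + \<bar>b\<bar> * (norm w)\<^sup>2"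
      using norm_le_one_plus_sq[of w] a0 by (intro add_right_mono mult_left_mono) auto
    also have "\<dots> \<le> a + (a + 2 * \<bar>b\<bar>) * (norm w)\<^sup>2" by (simp add: algebra_simps)
    finally show "norm (h (fst w) \<bullet> snd w) \<le> a + (a + 2 * \<bar>b\<bar>) * (norm w)\<^sup>2" by simp
  qed measurable
  have k0: "0 \<le> k x y" for x y by (rule kcoup_nn(6)[OF k Pr Pn])
  have fm: "(\<lambda>w. h (fst w) \<bullet> snd w) \<in> borel_measurable (p \<Otimes>\<^sub>M \<nu>)" by measurable
  have i2: "integrable (p \<Otimes>\<^sub>M \<nu>) (\<lambda>w. k (fst (fst w)) (snd w) *\<^sub>R (h (fst w) \<bullet> snd w))"
    using i unfolding glue_def by (subst (asm) integrable_density) (use k0 fm in auto)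
  have "(\<integral>w. h (fst w) \<bullet> snd w \<partial>glue p \<nu> k) = (\<integral>w. k (fst (fst w)) (snd w) *\<^sub>R (h (fst w) \<bullet> snd w) \<partial>(p \<Otimes>\<^sub>M \<nu>))"
    unfolding glue_def by (rule integral_density) (use k0 fm in auto)
  also have "\<dots> = (\<integral>z. \<integral>y. k (fst z) y *\<^sub>R (h z \<bullet> y) \<partial>\<nu> \<partial>p)"
    using pn.integral_fst'[OF i2] by simp
  also have "\<dots> = (\<integral>z. h z \<bullet> bary \<nu> k (fst z) \<partial>p)"
  proof (rule Bochner_Integration.integral_cong[OF refl])
    fix z
    have "(\<integral>y. k (fst z) y *\<^sub>R (h z \<bullet> y) \<partial>\<nu>) = (\<integral>y. h z \<bullet> (k (fst z) y *\<^sub>R y) \<partial>\<nu>)" by simp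
    also have "\<dots> = h z \<bullet> bary \<nu> k (fst z)"
      unfolding bary_def using kcoup_nn(4)[OF k Pr Pn, of "fst z"] by (intro integral_inner_right) auto
    finally show "(\<integral>y. k (fst z) y *\<^sub>R (h z \<bullet> y) \<partial>\<nu>) = h z \<bullet> bary \<nu> k (fst z)" .
  qed
  finally show "(\<integral>w. h (fst w) \<bullet> snd w \<partial>glue p \<nu> k) = (\<integral>z. h z \<bullet> bary \<nu> k (fst z) \<partial>p)" .
qed

text \<open>Forgetting the common variable \<open>x\<close> leaves a competitor for the distance
  between \<tau> and \<nu>.\<close>

lemma glue_coupling: "distr (glue p \<nu> k) borel (\<lambda>w. (snd (fst w), snd w)) \<in> couplings \<tau> \<nu>"
proof -
  interpret g: prob_space "glue p \<nu> k" by (rule P2_prob[OF glue_P2])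
  have [measurable_cong]: "sets (glue p \<nu> k) = sets borel" by (rule sets_glue)
  have [measurable_cong]: "sets p = sets borel" by (rule P2_sets[OF P2p])
  have m[measurable]: "(\<lambda>w. (snd (fst w), snd w)) \<in> borel_measurable (glue p \<nu> k)" by measurable
  let ?q = "distr (glue p \<nu> k) borel (\<lambda>w. (snd (fst w), snd w))"
  have "distr ?q borel fst = distr (glue p \<nu> k) borel (snd \<circ> fst)"
    by (subst distr_distr) (auto simp: comp_def)
  also have "\<dots> = distr (distr (glue p \<nu> k) borel fst) borel snd"
    by (subst distr_distr) (auto simp: comp_def)
  also have "\<dots> = \<tau>" unfolding distr_glue using p by (simp add: couplings_def)
  finally have 1: "distr ?q borel fst = \<tau>" .
  have "distr ?q borel snd = distr (glue p \<nu> k) borel snd"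
    by (subst distr_distr) (auto simp: comp_def)
  also have "\<dots> = \<nu>" by (rule distr_glue)
  finally show ?thesis using 1 g.prob_space_distr[OF m] by (simp add: couplings_def)
qed

lemma bary_measurable: "bary \<nu> k \<in> borel_measurable borel"
proof -
  interpret n: prob_space \<nu> by (rule P2_prob[OF Pn])
  have [measurable_cong]: "sets \<nu> = sets borel" by (rule P2_sets[OF Pn])
  have [measurable]: "(\<lambda>z. k (fst z) (snd z)) \<in> borel_measurable (borel \<Otimes>\<^sub>M \<nu>)" by (rule kcoup_measurable[OF k]) measurable
  have "(\<lambda>x. \<integral>y. (\<lambda>(x, y). k x y *\<^sub>R y) (x, y) \<partial>\<nu>) \<in> borel_measurable borel"
    by (rule n.borel_measurable_lebesgue_integral) (simp add: split_beta')
  then show ?thesis by (simp add: bary_def[abs_def])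
qed

lemma bary_bound: "\<exists>M. \<forall>x. norm (bary \<nu> k x) \<le> M"
proof -
  interpret n: prob_space \<nu> by (rule P2_prob[OF Pn])
  obtain M where M: "\<And>x y. 0 \<le> k x y" "\<And>x y. k x y \<le> M" using k by (auto simp: kcoup_def)
  have ni: "integrable \<nu> (\<lambda>y. norm y)" by (rule P2_integrable_linear[OF Pn, of _ 0 1]) auto
  have "norm (bary \<nu> k x) \<le> (\<integral>y. M * norm y \<partial>\<nu>)" for x
    unfolding bary_def
  proof (rule order_trans[OF integral_norm_bound], rule integral_mono)
    show "integrable \<nu> (\<lambda>y. norm (k x y *\<^sub>R y))" by (rule integrable_norm[OF kcoup_nn(4)[OF k Pr Pn]])
    show "integrable \<nu> (\<lambda>y. M * norm y)" using ni by simp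
    fix y show "norm (k x y *\<^sub>R y) \<le> M * norm y" using M[of x y] by (simp add: mult_right_mono)
  qed
  then show ?thesis by blast
qed

end

text \<open>Transport cost of the coupling with density \<open>k\<close>, with the square expanded:
  the second moments are fixed and the cross term sees the kernel only through its barycentre. In
  this form the cost is visibly affine in \<open>k\<close>.\<close>

definition kcost :: "'x::euclidean_space measure \<Rightarrow> 'x measure \<Rightarrow> ('x \<Rightarrow> 'x \<Rightarrow> real) \<Rightarrow> real" where
  "kcost \<rho> \<nu> k = (\<integral>x. (norm x)\<^sup>2 \<partial>\<rho>) + (\<integral>y. (norm y)\<^sup>2 \<partial>\<nu>) - 2 * (\<integral>x. x \<bullet> bary \<nu> k x \<partial>\<rho>)"

lemma bounded_linear_growth_inner:
  fixes x :: "'x::euclidean_space"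
  assumes "norm u \<le> a" shows "\<bar>x \<bullet> u\<bar> \<le> a + a * (norm x)\<^sup>2"
proof -
  have "\<bar>x \<bullet> u\<bar> \<le> norm x * norm u" by (rule Cauchy_Schwarz_ineq2)
  also have "\<dots> \<le> (1 + (norm x)\<^sup>2) * a" using assms norm_le_one_plus_sq[of x] by (intro mult_mono) auto
  finally show ?thesis by (simp add: algebra_simps)
qed

lemma cost_glue_coupling:
  fixes \<rho> \<tau> \<nu> :: "'x::euclidean_space measure"
  assumes Pr: "P2 \<rho>" and Pt: "P2 \<tau>" and Pn: "P2 \<nu>" and p: "p \<in> couplings \<rho> \<tau>" and k: "kcoup \<rho> \<nu> k"
  shows "cost (distr (glue p \<nu> k) borel (\<lambda>w. (snd (fst w), snd w))) =
     (\<integral>z. (norm z)\<^sup>2 \<partial>\<tau>) + (\<integral>y. (norm y)\<^sup>2 \<partial>\<nu>) - 2 * (\<integral>z. snd z \<bullet> bary \<nu> k (fst z) \<partial>p)"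
proof -
  note ctx = Pr Pt Pn p k
  note G = glue_P2[OF ctx]
  have [measurable_cong]: "sets (glue p \<nu> k) = sets borel" by (rule P2_sets[OF G])
  have Pp: "P2 p" by (rule couplings_P2[OF p Pr Pt])
  have "cost (distr (glue p \<nu> k) borel (\<lambda>w. (snd (fst w), snd w))) = (\<integral>w. (norm (snd (fst w) - snd w))\<^sup>2 \<partial>glue p \<nu> k)"
    unfolding cost_def by (subst integral_distr) auto
  also have "\<dots> = (\<integral>w. (norm (snd (fst w)))\<^sup>2 + (norm (snd w))\<^sup>2 - 2 * (snd (fst w) \<bullet> snd w) \<partial>glue p \<nu> k)"
    unfolding power2_norm_eq_inner by (simp add: inner_diff inner_commute algebra_simps)
  also have "\<dots> = (\<integral>w. (norm (snd (fst w)))\<^sup>2 \<partial>glue p \<nu> k) + (\<integral>w. (norm (snd w))\<^sup>2 \<partial>glue p \<nu> k) - 2 * (\<integral>w. snd (fst w) \<bullet> snd w \<partial>glue p \<nu> k)"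
  proof -
    have i1: "integrable (glue p \<nu> k) (\<lambda>w. (norm (snd (fst w)))\<^sup>2)"
      by (rule P2_integrable[OF G, of _ 0 1]) (auto simp: norm_pair_sq[where z="_ :: ('x \<times> 'x) \<times> 'x"] norm_pair_sq[where z="_ :: 'x \<times> 'x"])
    have i2: "integrable (glue p \<nu> k) (\<lambda>w. (norm (snd w))\<^sup>2)"
      by (rule P2_integrable[OF G, of _ 0 1]) (auto simp: norm_pair_sq[where z="_ :: ('x \<times> 'x) \<times> 'x"])
    have i3: "integrable (glue p \<nu> k) (\<lambda>w. snd (fst w) \<bullet> snd w)"
      by (rule glue_integral_bary(2)[OF ctx, of snd 0 1]) (auto simp: norm_fst_snd_le)
    show ?thesis using i1 i2 i3 by simp
  qed
  also have "(\<integral>w. (norm (snd (fst w)))\<^sup>2 \<partial>glue p \<nu> k) = (\<integral>z. (norm z)\<^sup>2 \<partial>\<tau>)"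
    using glue_integral_fst[OF ctx, of "\<lambda>z. (norm (snd z))\<^sup>2"] integral_coupling(2)[OF p, of "\<lambda>z. (norm z)\<^sup>2"] by simp
  also have "(\<integral>w. (norm (snd w))\<^sup>2 \<partial>glue p \<nu> k) = (\<integral>y. (norm y)\<^sup>2 \<partial>\<nu>)"
    using glue_integral_snd[OF ctx, of "\<lambda>z. (norm z)\<^sup>2"] by simp
  also have "(\<integral>w. snd (fst w) \<bullet> snd w \<partial>glue p \<nu> k) = (\<integral>z. snd z \<bullet> bary \<nu> k (fst z) \<partial>p)"
    by (rule glue_integral_bary(1)[OF ctx, of snd 0 1]) (auto simp: norm_fst_snd_le)
  finally show ?thesis .
qed

lemma diagonal_coupling:
  assumes "P2 \<rho>" shows "distr \<rho> borel (\<lambda>x. (x, x)) \<in> couplings \<rho> \<rho>"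
proof -
  interpret prob_space \<rho> by (rule P2_prob[OF assms])
  have [measurable_cong]: "sets \<rho> = sets borel" by (rule P2_sets[OF assms])
  have m[measurable]: "(\<lambda>x. (x, x)) \<in> borel_measurable \<rho>" by measurable
  have id: "distr \<rho> borel (\<lambda>x. x) = \<rho>" by (rule distr_id2) (rule P2_sets[OF assms, symmetric])
  have "distr (distr \<rho> borel (\<lambda>x. (x, x))) borel fst = \<rho>" "distr (distr \<rho> borel (\<lambda>x. (x, x))) borel snd = \<rho>"
    by (subst distr_distr; simp add: comp_def id)+
  then show ?thesis using prob_space_distr[OF m] by (simp add: couplings_def)
qed

text \<open>The gluing of a plan with a kernel coupling needs no disintegration, because the kernel has a
  density with respect to the product measure.\<close>

lemma W2_glue_bound:
  fixes \<rho> \<tau> \<nu> :: "'x::euclidean_space measure"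
  assumes Pr: "P2 \<rho>" and Pt: "P2 \<tau>" and Pn: "P2 \<nu>" and p: "p \<in> couplings \<rho> \<tau>" and k: "kcoup \<rho> \<nu> k"
  shows "(W2 \<tau> \<nu>)\<^sup>2 \<le> kcost \<rho> \<nu> k + cost p + 2 * (\<integral>z. (fst z - bary \<nu> k (fst z)) \<bullet> (snd z - fst z) \<partial>p)"
proof -
  note ctx = Pr Pt Pn p k
  have Pp: "P2 p" by (rule couplings_P2[OF p Pr Pt])
  obtain M where M: "\<And>x. norm (bary \<nu> k x) \<le> M" using bary_bound[OF ctx] by blast
  note [measurable] = bary_measurable[OF ctx]
  have "(W2 \<tau> \<nu>)\<^sup>2 \<le> (\<integral>z. (norm z)\<^sup>2 \<partial>\<tau>) + (\<integral>y. (norm y)\<^sup>2 \<partial>\<nu>) - 2 * (\<integral>z. snd z \<bullet> bary \<nu> k (fst z) \<partial>p)"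
    using W2_le_cost[OF glue_coupling[OF ctx] Pt Pn] unfolding cost_glue_coupling[OF ctx] .
  also have "(\<integral>z. (norm z)\<^sup>2 \<partial>\<tau>) = (\<integral>z. (norm (snd z))\<^sup>2 \<partial>p)"
    using integral_coupling(2)[OF p, of "\<lambda>z. (norm z)\<^sup>2"] by simp
  finally have 1: "(W2 \<tau> \<nu>)\<^sup>2 \<le> (\<integral>z. (norm (snd z))\<^sup>2 \<partial>p) + (\<integral>y. (norm y)\<^sup>2 \<partial>\<nu>) - 2 * (\<integral>z. snd z \<bullet> bary \<nu> k (fst z) \<partial>p)" .
  have i1: "integrable p (\<lambda>z. (norm (snd z))\<^sup>2)" "integrable p (\<lambda>z. (norm (fst z))\<^sup>2)"
    by (rule P2_integrable[OF Pp, of _ 0 1]; simp add: norm_pair_sq)+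
  have i2: "integrable p (\<lambda>z. snd z \<bullet> bary \<nu> k (fst z))" "integrable p (\<lambda>z. fst z \<bullet> bary \<nu> k (fst z))"
  proof -
    have "0 \<le> M" using norm_ge_zero[of "bary \<nu> k 0"] M[of 0] by linarith
    then have *: "M + M * (norm (snd z))\<^sup>2 \<le> M + M * (norm z)\<^sup>2" "M + M * (norm (fst z))\<^sup>2 \<le> M + M * (norm z)\<^sup>2" for z :: "'x \<times> 'x"
      by (auto simp: norm_pair_sq intro!: mult_left_mono)
    show "integrable p (\<lambda>z. snd z \<bullet> bary \<nu> k (fst z))"
    proof (rule P2_integrable[OF Pp, of _ M M])
      fix z :: "'x \<times> 'x" show "norm (snd z \<bullet> bary \<nu> k (fst z)) \<le> M + M * (norm z)\<^sup>2"
        using order_trans[OF bounded_linear_growth_inner[OF M, of "snd z" "fst z"] *(1)] by simp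
    qed measurable
    show "integrable p (\<lambda>z. fst z \<bullet> bary \<nu> k (fst z))"
    proof (rule P2_integrable[OF Pp, of _ M M])
      fix z :: "'x \<times> 'x" show "norm (fst z \<bullet> bary \<nu> k (fst z)) \<le> M + M * (norm z)\<^sup>2"
        using order_trans[OF bounded_linear_growth_inner[OF M, of "fst z" "fst z"] *(2)] by simp
    qed measurable
  qed
  have i3: "integrable p (\<lambda>z. (norm (fst z - snd z))\<^sup>2)" by (rule integrable_cost[OF Pp])
  have "kcost \<rho> \<nu> k = (\<integral>z. (norm (fst z))\<^sup>2 \<partial>p) + (\<integral>y. (norm y)\<^sup>2 \<partial>\<nu>) - 2 * (\<integral>z. fst z \<bullet> bary \<nu> k (fst z) \<partial>p)"
    unfolding kcost_def using integral_coupling(1)[OF p, of "\<lambda>z. (norm z)\<^sup>2"] integral_coupling(1)[OF p, of "\<lambda>x. x \<bullet> bary \<nu> k x"] by simp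
  \<comment> \<open>Polarisation rewrites the inner product of \<open>fst z\<close> with the
    displacement as a combination of squared norms, so that the two expanded costs can be
    compared.\<close>
  moreover have "(\<integral>z. (fst z - bary \<nu> k (fst z)) \<bullet> (snd z - fst z) \<partial>p) =
     (\<integral>z. (norm (snd z))\<^sup>2 / 2 - (norm (fst z))\<^sup>2 / 2 - (norm (fst z - snd z))\<^sup>2 / 2 - snd z \<bullet> bary \<nu> k (fst z) + fst z \<bullet> bary \<nu> k (fst z) \<partial>p)"
    unfolding power2_norm_eq_inner
    by (intro Bochner_Integration.integral_cong refl) (simp add: inner_diff inner_commute field_simps)
  moreover have "\<dots> = (\<integral>z. (norm (snd z))\<^sup>2 \<partial>p) / 2 - (\<integral>z. (norm (fst z))\<^sup>2 \<partial>p) / 2 - cost p / 2 - (\<integral>z. snd z \<bullet> bary \<nu> k (fst z) \<partial>p) + (\<integral>z. fst z \<bullet> bary \<nu> k (fst z) \<partial>p)"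
    unfolding cost_def using i1 i2 i3 by simp
  ultimately show ?thesis using 1 by argo
qed

text \<open>Gluing with the diagonal coupling of \<open>\<rho>\<close> realises the kernel as an
  actual plan. Against a bounded field of the first variable, the second variable of this plan may
  be replaced by the barycentre; this links the pairing in the difference quotient to the network
  estimate, which is carried out on plans.\<close>

lemma kcost_coupling:
  fixes \<rho> \<nu> :: "'x::euclidean_space measure"
  assumes Pr: "P2 \<rho>" and Pn: "P2 \<nu>" and k: "kcoup \<rho> \<nu> k"
  obtains \<gamma> where "\<gamma> \<in> couplings \<rho> \<nu>" "cost \<gamma> = kcost \<rho> \<nu> k"
    "\<forall>v C. v \<in> borel_measurable borel \<longrightarrow> (\<forall>x. norm (v x) \<le> C) \<longrightarrow>
       (\<integral>z. (fst z - snd z) \<bullet> v (fst z) \<partial>\<gamma>) = (\<integral>x. (x - bary \<nu> k x) \<bullet> v x \<partial>\<rho>)"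
proof -
  define p where "p = distr \<rho> borel (\<lambda>x. (x, x))"
  have [measurable_cong]: "sets \<rho> = sets borel" by (rule P2_sets[OF Pr])
  have p: "p \<in> couplings \<rho> \<rho>" unfolding p_def by (rule diagonal_coupling[OF Pr])
  note ctx = Pr Pr Pn p k
  note G = glue_P2[OF ctx]
  have [measurable_cong]: "sets (glue p \<nu> k) = sets borel" by (rule P2_sets[OF G])
  note [measurable] = bary_measurable[OF ctx]
  let ?q = "distr (glue p \<nu> k) borel (\<lambda>w. (snd (fst w), snd w))"
  have ip: "(\<integral>z. f z \<partial>p) = (\<integral>x. f (x, x) \<partial>\<rho>)" if "f \<in> borel_measurable borel" for f :: "'x \<times> 'x \<Rightarrow> real"
    unfolding p_def using that by (subst integral_distr) auto
  have "cost ?q = kcost \<rho> \<nu> k"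
    unfolding cost_glue_coupling[OF ctx] kcost_def by (subst ip) auto
  moreover have "(\<integral>z. (fst z - snd z) \<bullet> v (fst z) \<partial>?q) = (\<integral>x. (x - bary \<nu> k x) \<bullet> v x \<partial>\<rho>)"
    if v[measurable]: "v \<in> borel_measurable borel" and C: "\<And>x. norm (v x) \<le> C" for v C
  proof -
    have C0: "0 \<le> C" using norm_ge_zero[of "v 0"] C[of 0] by linarith
    have "(\<integral>z. (fst z - snd z) \<bullet> v (fst z) \<partial>?q) = (\<integral>w. (snd (fst w) - snd w) \<bullet> v (snd (fst w)) \<partial>glue p \<nu> k)"
      by (subst integral_distr) auto
    also have "\<dots> = (\<integral>w. snd (fst w) \<bullet> v (snd (fst w)) - v (snd (fst w)) \<bullet> snd w \<partial>glue p \<nu> k)"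
      by (simp add: inner_diff_left inner_diff_right inner_commute)
    also have "\<dots> = (\<integral>w. snd (fst w) \<bullet> v (snd (fst w)) \<partial>glue p \<nu> k) - (\<integral>w. v (snd (fst w)) \<bullet> snd w \<partial>glue p \<nu> k)"
    proof (rule Bochner_Integration.integral_diff)
      show "integrable (glue p \<nu> k) (\<lambda>w. snd (fst w) \<bullet> v (snd (fst w)))"
      proof (rule P2_integrable[OF G, of _ C C])
        fix w :: "('x \<times> 'x) \<times> 'x"
        have "(norm (snd (fst w)))\<^sup>2 \<le> (norm w)\<^sup>2" by (simp add: norm_pair_sq[where z=w] norm_pair_sq[where z="fst w"])
        then have "C + C * (norm (snd (fst w)))\<^sup>2 \<le> C + C * (norm w)\<^sup>2" using C0 by (intro add_left_mono mult_left_mono)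
        then show "norm (snd (fst w) \<bullet> v (snd (fst w))) \<le> C + C * (norm w)\<^sup>2"
          using bounded_linear_growth_inner[OF C[of "snd (fst w)"], of "snd (fst w)"] by simp
      qed measurable
      show "integrable (glue p \<nu> k) (\<lambda>w. v (snd (fst w)) \<bullet> snd w)"
        by (rule glue_integral_bary(2)[OF ctx, of "\<lambda>z. v (snd z)" C 0]) (use C in auto)
    qed
    also have "(\<integral>w. snd (fst w) \<bullet> v (snd (fst w)) \<partial>glue p \<nu> k) = (\<integral>z. snd z \<bullet> v (snd z) \<partial>p)"
      by (rule glue_integral_fst[OF ctx, of "\<lambda>z. snd z \<bullet> v (snd z)"]) measurable
    also have "(\<integral>w. v (snd (fst w)) \<bullet> snd w \<partial>glue p \<nu> k) = (\<integral>z. v (snd z) \<bullet> bary \<nu> k (fst z) \<partial>p)"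
      by (rule glue_integral_bary(1)[OF ctx, of "\<lambda>z. v (snd z)" C 0]) (use C in auto)
    also have "(\<integral>z. snd z \<bullet> v (snd z) \<partial>p) = (\<integral>x. x \<bullet> v x \<partial>\<rho>)" by (subst ip) auto
    also have "(\<integral>z. v (snd z) \<bullet> bary \<nu> k (fst z) \<partial>p) = (\<integral>x. bary \<nu> k x \<bullet> v x \<partial>\<rho>)"
      by (subst ip) (auto simp: inner_commute)
    also have "(\<integral>x. x \<bullet> v x \<partial>\<rho>) - (\<integral>x. bary \<nu> k x \<bullet> v x \<partial>\<rho>) = (\<integral>x. (x - bary \<nu> k x) \<bullet> v x \<partial>\<rho>)"
    proof -
      obtain M where M: "\<And>x. norm (bary \<nu> k x) \<le> M" using bary_bound[OF ctx] by blast
      have "integrable \<rho> (\<lambda>x. x \<bullet> v x)"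
        by (rule P2_integrable[OF Pr, of _ C C]) (use bounded_linear_growth_inner[OF C] in auto)
      moreover have "integrable \<rho> (\<lambda>x. bary \<nu> k x \<bullet> v x)"
      proof (rule P2_integrable[OF Pr, of _ "M * C" 0])
        fix x
        have "0 \<le> M" using norm_ge_zero[of "bary \<nu> k 0"] M[of 0] by linarith
        then have "\<bar>bary \<nu> k x \<bullet> v x\<bar> \<le> M * C"
          by (intro order_trans[OF Cauchy_Schwarz_ineq2] mult_mono M C) auto
        then show "norm (bary \<nu> k x \<bullet> v x) \<le> M * C + 0 * (norm x)\<^sup>2" by simp
      qed measurable
      ultimately show ?thesis by (simp add: inner_diff_left)
    qed
    finally show ?thesis .
  qed
  ultimately show ?thesis using glue_coupling[OF ctx] by (intro that[of ?q]) auto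
qed

section \<open>Square-integrable pairings, barycentric estimates and the triangle inequality\<close>

lemma le_sqrt_mult_of_young:
  fixes X A B :: real
  assumes A: "0 \<le> A" and B: "0 \<le> B" and y: "\<And>s. 0 < s \<Longrightarrow> 2 * X \<le> s * A + B / s"
  shows "X \<le> sqrt A * sqrt B"
proof (cases "A = 0 \<or> B = 0")
  case True
  have "X \<le> 0"
  proof (rule ccontr)
    assume "\<not> X \<le> 0"
    then have X: "0 < X" by simp
    show False
    proof (cases "A = 0")
      case True
      \<comment> \<open>There is no optimal parameter when \<open>A\<close> vanishes; this value of
        \<open>s\<close> makes the remaining term smaller than \<open>X\<close>.\<close>
      have "2 * X \<le> B / ((B + 1) / X)" using y[of "(B + 1) / X"] X B True by simp
      also have "\<dots> = X * (B / (B + 1))" using X B by (simp add: field_simps)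
      also have "\<dots> \<le> X * 1" using X B by (intro mult_left_mono) auto
      finally show False using X by simp
    next
      case False
      then have "B = 0" using \<open>A = 0 \<or> B = 0\<close> by simp
      then have "2 * X \<le> (X / A) * A" using y[of "X / A"] X A False by simp
      then show False using X False by simp
    qed
  qed
  then show ?thesis using True by auto
next
  case False
  then have pos: "0 < A" "0 < B" using A B by auto
  define a b where "a = sqrt A" and "b = sqrt B"
  have ab: "0 < a" "0 < b" "A = a * a" "B = b * b" using pos by (auto simp: a_def b_def)
  have "2 * X \<le> (b / a) * A + B / (b / a)" using y[of "b / a"] ab by simp
  also have "\<dots> = 2 * (a * b)" using ab by (simp add: field_simps)
  finally show ?thesis by (simp add: a_def b_def)
qed

lemma L2_Cauchy_Schwarz:
  fixes u v :: "'c \<Rightarrow> 'x::euclidean_space"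
  assumes u: "u \<in> borel_measurable M" "integrable M (\<lambda>x. (norm (u x))\<^sup>2)"
    and v: "v \<in> borel_measurable M" "integrable M (\<lambda>x. (norm (v x))\<^sup>2)"
  shows "integrable M (\<lambda>x. u x \<bullet> v x)"
    "\<bar>\<integral>x. u x \<bullet> v x \<partial>M\<bar> \<le> sqrt (\<integral>x. (norm (u x))\<^sup>2 \<partial>M) * sqrt (\<integral>x. (norm (v x))\<^sup>2 \<partial>M)"
proof -
  have pt: "2 * \<bar>u x \<bullet> v x\<bar> \<le> s * (norm (u x))\<^sup>2 + (norm (v x))\<^sup>2 / s" if s: "0 < s" for s x
  proof -
    have "0 \<le> (s * norm (u x) - norm (v x))\<^sup>2" by simp
    then have "s * (2 * (norm (u x) * norm (v x))) \<le> s * (s * (norm (u x))\<^sup>2 + (norm (v x))\<^sup>2 / s)"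
      using s by (simp add: power2_eq_square algebra_simps)
    then have "2 * (norm (u x) * norm (v x)) \<le> s * (norm (u x))\<^sup>2 + (norm (v x))\<^sup>2 / s"
      using s by (simp only: mult_le_cancel_left_pos)
    then show ?thesis using Cauchy_Schwarz_ineq2[of "u x" "v x"] by linarith
  qed
  show i: "integrable M (\<lambda>x. u x \<bullet> v x)"
  proof (rule Bochner_Integration.integrable_bound)
    show "integrable M (\<lambda>x. (norm (u x))\<^sup>2 + (norm (v x))\<^sup>2)" using u v by auto
    show "(\<lambda>x. u x \<bullet> v x) \<in> borel_measurable M" using u v by auto
    show "AE x in M. norm (u x \<bullet> v x) \<le> norm ((norm (u x))\<^sup>2 + (norm (v x))\<^sup>2)"
    proof (rule AE_I2)
      fix x show "norm (u x \<bullet> v x) \<le> norm ((norm (u x))\<^sup>2 + (norm (v x))\<^sup>2)"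
        using pt[of 1 x] by simp
    qed
  qed
  show "\<bar>\<integral>x. u x \<bullet> v x \<partial>M\<bar> \<le> sqrt (\<integral>x. (norm (u x))\<^sup>2 \<partial>M) * sqrt (\<integral>x. (norm (v x))\<^sup>2 \<partial>M)"
  proof (rule le_sqrt_mult_of_young)
    fix s :: real assume s: "0 < s"
    have "2 * \<bar>\<integral>x. u x \<bullet> v x \<partial>M\<bar> \<le> 2 * (\<integral>x. \<bar>u x \<bullet> v x\<bar> \<partial>M)" by (intro mult_left_mono integral_abs_bound) auto
    also have "\<dots> = (\<integral>x. 2 * \<bar>u x \<bullet> v x\<bar> \<partial>M)" by simp
    also have "\<dots> \<le> (\<integral>x. s * (norm (u x))\<^sup>2 + (norm (v x))\<^sup>2 / s \<partial>M)"
      using i u v by (intro integral_mono pt[OF s]) auto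
    also have "\<dots> = s * (\<integral>x. (norm (u x))\<^sup>2 \<partial>M) + (\<integral>x. (norm (v x))\<^sup>2 \<partial>M) / s" using u v by simp
    finally show "2 * \<bar>\<integral>x. u x \<bullet> v x \<partial>M\<bar> \<le> s * (\<integral>x. (norm (u x))\<^sup>2 \<partial>M) + (\<integral>x. (norm (v x))\<^sup>2 \<partial>M) / s" .
  qed auto
qed

lemma P2_integrable_sq_linear:
  fixes u :: "'x::euclidean_space \<Rightarrow> 'x"
  assumes P: "P2 \<rho>" and u: "u \<in> borel_measurable borel" and b: "\<And>x. norm (u x) \<le> a + c * norm x"
  shows "integrable \<rho> (\<lambda>x. (norm (u x))\<^sup>2)"
proof (rule P2_integrable[OF P, of _ "2 * a\<^sup>2" "2 * c\<^sup>2"])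
  fix x
  have "(norm (u x))\<^sup>2 \<le> (a + c * norm x)\<^sup>2" using b[of x] by (intro power_mono) auto
  also have "\<dots> \<le> 2 * a\<^sup>2 + 2 * (c * norm x)\<^sup>2"
    using sum_squares_bound[of a "c * norm x"] by (simp add: power2_sum)
  finally show "norm ((norm (u x))\<^sup>2) \<le> 2 * a\<^sup>2 + 2 * c\<^sup>2 * (norm x)\<^sup>2" by (simp add: power_mult_distrib)
qed (use u in measurable)

text \<open>The two inequalities are conditional Jensen estimates, obtained from the plan that
  realises the kernel. Testing it with the barycentre itself, which is bounded, shows that
  \<open>y - bary x\<close> is orthogonal to the barycentre; nonnegativity of the integral of
  \<open>|y - bary x|^2\<close> does the rest.\<close>

lemma bary_facts:
  fixes \<rho> \<nu> :: "'x::euclidean_space measure"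
  assumes Pr: "P2 \<rho>" and Pn: "P2 \<nu>" and k: "kcoup \<rho> \<nu> k"
  shows "bary \<nu> k \<in> borel_measurable borel" "\<exists>M. \<forall>x. norm (bary \<nu> k x) \<le> M"
    "(\<integral>x. (norm (bary \<nu> k x))\<^sup>2 \<partial>\<rho>) \<le> (\<integral>y. (norm y)\<^sup>2 \<partial>\<nu>)"
    "(\<integral>x. (norm (x - bary \<nu> k x))\<^sup>2 \<partial>\<rho>) \<le> kcost \<rho> \<nu> k"
proof -
  note ctx = Pr Pr Pn diagonal_coupling[OF Pr] k
  show bm[measurable]: "bary \<nu> k \<in> borel_measurable borel" by (rule bary_measurable[OF ctx])
  show "\<exists>M. \<forall>x. norm (bary \<nu> k x) \<le> M" by (rule bary_bound[OF ctx])
  then obtain M where M: "\<And>x. norm (bary \<nu> k x) \<le> M" by blast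
  obtain \<gamma> where g: "\<gamma> \<in> couplings \<rho> \<nu>" "cost \<gamma> = kcost \<rho> \<nu> k"
    and gv: "\<forall>v C. v \<in> borel_measurable borel \<longrightarrow> (\<forall>x. norm (v x) \<le> C) \<longrightarrow>
       (\<integral>z. (fst z - snd z) \<bullet> v (fst z) \<partial>\<gamma>) = (\<integral>x. (x - bary \<nu> k x) \<bullet> v x \<partial>\<rho>)"
    by (rule kcost_coupling[OF Pr Pn k]) (rule that)
  have Pg: "P2 \<gamma>" by (rule couplings_P2[OF g(1) Pr Pn])
  let ?b = "bary \<nu> k"
  have i1: "integrable \<gamma> (\<lambda>z. (norm (snd z))\<^sup>2)" "integrable \<gamma> (\<lambda>z. (norm (fst z))\<^sup>2)"
    by (rule P2_integrable[OF Pg, of _ 0 1]; simp add: norm_pair_sq)+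
  have M0: "0 \<le> M" using norm_ge_zero[of "?b 0"] M[of 0] by linarith
  have i2: "integrable \<gamma> (\<lambda>z. fst z \<bullet> ?b (fst z))" "integrable \<gamma> (\<lambda>z. snd z \<bullet> ?b (fst z))"
  proof -
    have *: "M + M * (norm (snd z))\<^sup>2 \<le> M + M * (norm z)\<^sup>2" "M + M * (norm (fst z))\<^sup>2 \<le> M + M * (norm z)\<^sup>2" for z :: "'x \<times> 'x"
      using M0 by (auto simp: norm_pair_sq intro!: mult_left_mono)
    show "integrable \<gamma> (\<lambda>z. snd z \<bullet> ?b (fst z))"
    proof (rule P2_integrable[OF Pg, of _ M M])
      fix z :: "'x \<times> 'x" show "norm (snd z \<bullet> ?b (fst z)) \<le> M + M * (norm z)\<^sup>2"
        using order_trans[OF bounded_linear_growth_inner[OF M, of "snd z" "fst z"] *(1)] by simp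
    qed measurable
    show "integrable \<gamma> (\<lambda>z. fst z \<bullet> ?b (fst z))"
    proof (rule P2_integrable[OF Pg, of _ M M])
      fix z :: "'x \<times> 'x" show "norm (fst z \<bullet> ?b (fst z)) \<le> M + M * (norm z)\<^sup>2"
        using order_trans[OF bounded_linear_growth_inner[OF M, of "fst z" "fst z"] *(2)] by simp
    qed measurable
  qed
  have bb: "(norm (?b x))\<^sup>2 \<le> M\<^sup>2" for x using M[of x] by (intro power_mono) auto
  have i3: "integrable \<gamma> (\<lambda>z. (norm (?b (fst z)))\<^sup>2)"
    by (rule P2_integrable[OF Pg, of _ "M\<^sup>2" 0]) (use bb in auto)
  have ib: "integrable \<rho> (\<lambda>x. (norm (?b x))\<^sup>2)" by (rule P2_integrable[OF Pr, of _ "M\<^sup>2" 0]) (use bb in auto)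
  have ixb: "integrable \<rho> (\<lambda>x. x \<bullet> ?b x)" by (rule P2_integrable[OF Pr, of _ M M]) (use bounded_linear_growth_inner[OF M] in auto)
  have t1: "(\<integral>z. fst z \<bullet> ?b (fst z) \<partial>\<gamma>) = (\<integral>x. x \<bullet> ?b x \<partial>\<rho>)" by (rule integral_coupling(1)[OF g(1)]) simp
  have t2: "(\<integral>z. (norm (?b (fst z)))\<^sup>2 \<partial>\<gamma>) = (\<integral>x. (norm (?b x))\<^sup>2 \<partial>\<rho>)"
    by (rule integral_coupling(1)[OF g(1), of "\<lambda>x. (norm (?b x))\<^sup>2"]) simp
  have t3: "(\<integral>z. (norm (snd z))\<^sup>2 \<partial>\<gamma>) = (\<integral>y. (norm y)\<^sup>2 \<partial>\<nu>)" by (rule integral_coupling(2)[OF g(1)]) simp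
  have "(\<integral>z. (fst z - snd z) \<bullet> ?b (fst z) \<partial>\<gamma>) = (\<integral>x. (x - ?b x) \<bullet> ?b x \<partial>\<rho>)" using gv bm M by blast
  moreover have "(\<integral>z. (fst z - snd z) \<bullet> ?b (fst z) \<partial>\<gamma>) = (\<integral>x. x \<bullet> ?b x \<partial>\<rho>) - (\<integral>z. snd z \<bullet> ?b (fst z) \<partial>\<gamma>)"
    using i2 by (simp add: inner_diff_left t1)
  moreover have "(\<integral>x. (x - ?b x) \<bullet> ?b x \<partial>\<rho>) = (\<integral>x. x \<bullet> ?b x \<partial>\<rho>) - (\<integral>x. (norm (?b x))\<^sup>2 \<partial>\<rho>)"
    using ixb ib by (simp add: inner_diff_left power2_norm_eq_inner)
  ultimately have t4: "(\<integral>z. snd z \<bullet> ?b (fst z) \<partial>\<gamma>) = (\<integral>x. (norm (?b x))\<^sup>2 \<partial>\<rho>)" by simp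
  have "0 \<le> (\<integral>z. (norm (snd z - ?b (fst z)))\<^sup>2 \<partial>\<gamma>)" by simp
  also have "\<dots> = (\<integral>z. (norm (snd z))\<^sup>2 - 2 * (snd z \<bullet> ?b (fst z)) + (norm (?b (fst z)))\<^sup>2 \<partial>\<gamma>)"
    unfolding power2_norm_eq_inner by (simp add: inner_diff inner_commute algebra_simps)
  also have "\<dots> = (\<integral>y. (norm y)\<^sup>2 \<partial>\<nu>) - (\<integral>x. (norm (?b x))\<^sup>2 \<partial>\<rho>)"
    using i1 i2 i3 by (simp add: t2 t3 t4)
  finally show le: "(\<integral>x. (norm (?b x))\<^sup>2 \<partial>\<rho>) \<le> (\<integral>y. (norm y)\<^sup>2 \<partial>\<nu>)" by simp
  have "(\<integral>x. (norm (x - ?b x))\<^sup>2 \<partial>\<rho>) = (\<integral>x. (norm x)\<^sup>2 - 2 * (x \<bullet> ?b x) + (norm (?b x))\<^sup>2 \<partial>\<rho>)"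
    unfolding power2_norm_eq_inner by (simp add: inner_diff inner_commute algebra_simps)
  also have "\<dots> = (\<integral>x. (norm x)\<^sup>2 \<partial>\<rho>) - 2 * (\<integral>x. x \<bullet> ?b x \<partial>\<rho>) + (\<integral>x. (norm (?b x))\<^sup>2 \<partial>\<rho>)"
    using P2_integrable_norm_sq[OF Pr] ixb ib by simp
  finally show "(\<integral>x. (norm (x - ?b x))\<^sup>2 \<partial>\<rho>) \<le> kcost \<rho> \<nu> k" using le by (simp add: kcost_def)
qed

text \<open>With the marginals fixed, a small cost is the same as a large correlation. The error is
  \<open>e / 3\<close> for a near-optimal plan plus twice \<open>e / 3\<close> for the correlation
  gap, which the cost counts with factor two.\<close>

lemma ex_gibbs_near_optimal:
  fixes \<rho> \<nu> :: "'x::euclidean_space measure"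
  assumes Pr: "P2 \<rho>" and Pn: "P2 \<nu>" and e: "0 < e"
  obtains \<kappa> N :: nat and y w k where "0 < \<kappa>" "0 < N" "kcoup \<rho> \<nu> k" "bary \<nu> k = gibbs_mean (real \<kappa>) N y w"
    "kcost \<rho> \<nu> k \<le> (W2 \<rho> \<nu>)\<^sup>2 + e"
proof -
  have e3: "0 < e / 3" using e by simp
  obtain \<kappa> N :: nat and y w k where k: "0 < \<kappa>" "0 < N" "kcoup \<rho> \<nu> k" "bary \<nu> k = gibbs_mean (real \<kappa>) N y w"
    and opt: "\<And>p. p \<in> couplings \<rho> \<nu> \<Longrightarrow> (\<integral>z. fst z \<bullet> snd z \<partial>p) \<le> (\<integral>x. x \<bullet> bary \<nu> k x \<partial>\<rho>) + e / 3"
    by (rule ex_gibbs_coupling[OF Pr Pn e3]) (rule that)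
  obtain p where p: "p \<in> couplings \<rho> \<nu>" "cost p \<le> (W2 \<rho> \<nu>)\<^sup>2 + e / 3"
    by (rule ex_near_optimal_coupling[OF Pr Pn e3])
  have Pp: "P2 p" by (rule couplings_P2[OF p(1) Pr Pn])
  have i1: "integrable p (\<lambda>z. (norm (snd z))\<^sup>2)" "integrable p (\<lambda>z. (norm (fst z))\<^sup>2)"
    by (rule P2_integrable[OF Pp, of _ 0 1]; simp add: norm_pair_sq)+
  have sp[measurable_cong]: "sets p = sets borel" by (rule P2_sets[OF Pp])
  have i2: "integrable p (\<lambda>z. fst z \<bullet> snd z)" by (rule L2_Cauchy_Schwarz(1)) (use i1 in measurable)
  have "cost p = (\<integral>z. (norm (fst z))\<^sup>2 + (norm (snd z))\<^sup>2 - 2 * (fst z \<bullet> snd z) \<partial>p)"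
    unfolding cost_def power2_norm_eq_inner by (simp add: inner_diff inner_commute algebra_simps)
  also have "\<dots> = (\<integral>z. (norm (fst z))\<^sup>2 \<partial>p) + (\<integral>z. (norm (snd z))\<^sup>2 \<partial>p) - 2 * (\<integral>z. fst z \<bullet> snd z \<partial>p)"
    using i1 i2 by simp
  also have "(\<integral>z. (norm (fst z))\<^sup>2 \<partial>p) = (\<integral>x. (norm x)\<^sup>2 \<partial>\<rho>)" by (rule integral_coupling(1)[OF p(1)]) simp
  also have "(\<integral>z. (norm (snd z))\<^sup>2 \<partial>p) = (\<integral>x. (norm x)\<^sup>2 \<partial>\<nu>)" by (rule integral_coupling(2)[OF p(1)]) simp
  finally have "kcost \<rho> \<nu> k \<le> cost p + 2 * (e / 3)" using opt[OF p(1)] by (simp add: kcost_def)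
  then have "kcost \<rho> \<nu> k \<le> (W2 \<rho> \<nu>)\<^sup>2 + e" using p(2) by linarith
  with k show ?thesis by (intro that[of \<kappa> N k y w]) auto
qed

text \<open>The pairing of a field with the displacement of a plan is controlled by the
  \<open>L^2(\<rho>)\<close> norm of the field. This is what makes kernels with close barycentres,
  or a displacement field and its approximation by test gradients, interchangeable in the difference
  quotient.\<close>

lemma coupling_pairing_bound:
  fixes \<zeta> :: "'x::euclidean_space \<Rightarrow> 'x"
  assumes Pr: "P2 \<rho>" and Pt: "P2 \<tau>" and p: "p \<in> couplings \<rho> \<tau>"
    and z: "\<zeta> \<in> borel_measurable borel" "\<And>x. norm (\<zeta> x) \<le> a + c * norm x"
  shows "integrable p (\<lambda>z. \<zeta> (fst z) \<bullet> (snd z - fst z))"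
    "\<bar>\<integral>z. \<zeta> (fst z) \<bullet> (snd z - fst z) \<partial>p\<bar> \<le> sqrt (\<integral>x. (norm (\<zeta> x))\<^sup>2 \<partial>\<rho>) * sqrt (cost p)"
proof -
  note [measurable] = z(1)
  have Pp: "P2 p" by (rule couplings_P2[OF p Pr Pt])
  have sp[measurable_cong]: "sets p = sets borel" by (rule P2_sets[OF Pp])
  have d: "distr p borel fst = \<rho>" using p by (simp add: couplings_def)
  have i1: "integrable p (\<lambda>z. (norm (\<zeta> (fst z)))\<^sup>2)"
    using P2_integrable_sq_linear[OF Pr z] integrable_distr_eq[of fst p borel "\<lambda>x. (norm (\<zeta> x))\<^sup>2"] d by simp
  have i2: "integrable p (\<lambda>z. (norm (snd z - fst z))\<^sup>2)" using integrable_cost[OF Pp] by (simp add: norm_minus_commute)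
  have m: "(\<lambda>z. \<zeta> (fst z)) \<in> borel_measurable p" "(\<lambda>z. snd z - fst z) \<in> borel_measurable p" by measurable
  show "integrable p (\<lambda>z. \<zeta> (fst z) \<bullet> (snd z - fst z))" by (rule L2_Cauchy_Schwarz(1)[OF m(1) i1 m(2) i2])
  have "(\<integral>z. (norm (\<zeta> (fst z)))\<^sup>2 \<partial>p) = (\<integral>x. (norm (\<zeta> x))\<^sup>2 \<partial>\<rho>)"
    by (rule integral_coupling(1)[OF p, of "\<lambda>x. (norm (\<zeta> x))\<^sup>2"]) simp
  moreover have "(\<integral>z. (norm (snd z - fst z))\<^sup>2 \<partial>p) = cost p" by (simp add: cost_def norm_minus_commute)
  ultimately show "\<bar>\<integral>z. \<zeta> (fst z) \<bullet> (snd z - fst z) \<partial>p\<bar> \<le> sqrt (\<integral>x. (norm (\<zeta> x))\<^sup>2 \<partial>\<rho>) * sqrt (cost p)"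
    using L2_Cauchy_Schwarz(2)[OF m(1) i1 m(2) i2] by simp
qed

text \<open>A near-optimal kernel from \<open>\<rho>\<close> to \<nu> is glued to a plan from
  \<open>\<rho>\<close> to \<tau>. By Cauchy-Schwarz, and since the barycentric displacement is
  bounded by the cost of the kernel, the resulting bound is the square of a sum of two square
  roots.\<close>

theorem W2_triangle:
  fixes \<rho> \<tau> \<nu> :: "'x::euclidean_space measure"
  assumes Pr: "P2 \<rho>" and Pt: "P2 \<tau>" and Pn: "P2 \<nu>"
  shows "W2 \<tau> \<nu> \<le> W2 \<tau> \<rho> + W2 \<rho> \<nu>"
proof (rule field_le_epsilon)
  fix \<epsilon> :: real assume "0 < \<epsilon>"
  \<comment> \<open>Each of the two square roots picks up at most \<open>sqrt e\<close>, which is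
    half of the tolerance.\<close>
  define e where "e = (\<epsilon> / 2)\<^sup>2"
  have e: "0 < e" "sqrt e = \<epsilon> / 2" using \<open>0 < \<epsilon>\<close> by (auto simp: e_def)
  obtain \<kappa> N :: nat and y w k where k: "kcoup \<rho> \<nu> k" "kcost \<rho> \<nu> k \<le> (W2 \<rho> \<nu>)\<^sup>2 + e"
    by (rule ex_gibbs_near_optimal[OF Pr Pn e(1)]) blast
  obtain p where p: "p \<in> couplings \<rho> \<tau>" "cost p \<le> (W2 \<rho> \<tau>)\<^sup>2 + e"
    by (rule ex_near_optimal_coupling[OF Pr Pt e(1)])
  obtain M where M: "\<And>x. norm (bary \<nu> k x) \<le> M" using bary_facts(2)[OF Pr Pn k(1)] by blast
  note [measurable] = bary_facts(1)[OF Pr Pn k(1)]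
  let ?\<zeta> = "\<lambda>x. x - bary \<nu> k x"
  have zb: "norm (?\<zeta> x) \<le> M + 1 * norm x" for x using norm_triangle_ineq4[of x "bary \<nu> k x"] M[of x] by linarith
  have kc0: "0 \<le> kcost \<rho> \<nu> k" by (rule order_trans[OF _ bary_facts(4)[OF Pr Pn k(1)]]) simp
  have "(\<integral>z. ?\<zeta> (fst z) \<bullet> (snd z - fst z) \<partial>p) \<le> sqrt (\<integral>x. (norm (?\<zeta> x))\<^sup>2 \<partial>\<rho>) * sqrt (cost p)"
    using coupling_pairing_bound(2)[OF Pr Pt p(1) _ zb] by simp
  also have "\<dots> \<le> sqrt (kcost \<rho> \<nu> k) * sqrt (cost p)"
    using bary_facts(4)[OF Pr Pn k(1)] by (intro mult_right_mono) (auto simp: cost_nonneg)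
  finally have "(W2 \<tau> \<nu>)\<^sup>2 \<le> kcost \<rho> \<nu> k + cost p + 2 * (sqrt (kcost \<rho> \<nu> k) * sqrt (cost p))"
    using W2_glue_bound[OF Pr Pt Pn p(1) k(1)] by simp
  also have "\<dots> = (sqrt (kcost \<rho> \<nu> k) + sqrt (cost p))\<^sup>2"
    using kc0 cost_nonneg[of p] by (simp add: power2_sum)
  finally have sq: "(W2 \<tau> \<nu>)\<^sup>2 \<le> (sqrt (kcost \<rho> \<nu> k) + sqrt (cost p))\<^sup>2" .
  have "W2 \<tau> \<nu> \<le> sqrt (kcost \<rho> \<nu> k) + sqrt (cost p)"
    by (rule power2_le_imp_le[OF sq]) (use kc0 cost_nonneg[of p] in auto)
  also have "sqrt (kcost \<rho> \<nu> k) \<le> sqrt ((W2 \<rho> \<nu>)\<^sup>2 + e)" using k(2) by simp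
  also have "\<dots> \<le> W2 \<rho> \<nu> + \<epsilon> / 2" using sqrt_add_le_add_sqrt[of "(W2 \<rho> \<nu>)\<^sup>2" e] e W2_nonneg[of \<rho> \<nu>] by simp
  also have "sqrt (cost p) \<le> sqrt ((W2 \<rho> \<tau>)\<^sup>2 + e)" using p(2) by simp
  also have "\<dots> \<le> W2 \<rho> \<tau> + \<epsilon> / 2" using sqrt_add_le_add_sqrt[of "(W2 \<rho> \<tau>)\<^sup>2" e] e W2_nonneg[of \<rho> \<tau>] by simp
  finally show "W2 \<tau> \<nu> \<le> W2 \<tau> \<rho> + W2 \<rho> \<nu> + \<epsilon>" using W2_commute[OF Pr Pt] by simp
qed

text \<open>All constraints on the density are linear or order bounds, and barycentre and cost are
  affine in it. The parallelogram argument for barycentres of minimal norm rests on this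
  convexity.\<close>

lemma kcoup_midpoint:
  fixes \<rho> \<nu> :: "'x::euclidean_space measure"
  assumes Pr: "P2 \<rho>" and Pn: "P2 \<nu>" and k1: "kcoup \<rho> \<nu> k1" and k2: "kcoup \<rho> \<nu> k2"
  defines "k \<equiv> \<lambda>x y. (k1 x y + k2 x y) / 2"
  shows "kcoup \<rho> \<nu> k" "bary \<nu> k = (\<lambda>x. (bary \<nu> k1 x + bary \<nu> k2 x) /\<^sub>R 2)" "kcost \<rho> \<nu> k = (kcost \<rho> \<nu> k1 + kcost \<rho> \<nu> k2) / 2"
proof -
  obtain M1 where M1: "\<And>x y. 0 \<le> k1 x y" "\<And>x y. k1 x y \<le> M1" using k1 by (auto simp: kcoup_def)
  obtain M2 where M2: "\<And>x y. 0 \<le> k2 x y" "\<And>x y. k2 x y \<le> M2" using k2 by (auto simp: kcoup_def)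
  have i: "integrable \<rho> (\<lambda>x. kk x y)" if kk: "kcoup \<rho> \<nu> kk" for kk y
  proof -
    obtain M where M: "\<And>x y. 0 \<le> kk x y" "\<And>x y. kk x y \<le> M" using kk by (auto simp: kcoup_def)
    have "(\<lambda>x. kk x y) \<in> borel_measurable borel" by (rule kcoup_measurable[OF kk]) auto
    then show ?thesis by (rule P2_integrable_linear[OF Pr, of _ M 0]) (use M in auto)
  qed
  have n1: "integrable \<nu> (\<lambda>y. k1 x y)" "integrable \<nu> (\<lambda>y. k2 x y)" for x
    using kcoup_nn(3)[OF k1 Pr Pn] kcoup_nn(3)[OF k2 Pr Pn] by auto
  have n2: "integrable \<nu> (\<lambda>y. k1 x y *\<^sub>R y)" "integrable \<nu> (\<lambda>y. k2 x y *\<^sub>R y)" for x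
    using kcoup_nn(4)[OF k1 Pr Pn] kcoup_nn(4)[OF k2 Pr Pn] by auto
  show "kcoup \<rho> \<nu> k"
    unfolding kcoup_def
  proof (intro conjI allI exI)
    have [measurable]: "(\<lambda>z. k1 (fst z) (snd z)) \<in> borel_measurable borel" "(\<lambda>z. k2 (fst z) (snd z)) \<in> borel_measurable borel"
      using k1 k2 by (auto simp: kcoup_def)
    show "(\<lambda>z. k (fst z) (snd z)) \<in> borel_measurable borel" unfolding k_def by measurable
    fix x y
    show "0 \<le> k x y" using M1(1)[of x y] M2(1)[of x y] by (simp add: k_def)
    show "k x y \<le> (M1 + M2) / 2" using M1(2)[of x y] M2(2)[of x y] by (simp add: k_def)
    show "(\<integral>y. k x y \<partial>\<nu>) = 1" using n1 k1 k2 by (simp add: k_def kcoup_def)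
  next
    have "AE y in \<nu>. (\<integral>x. k1 x y \<partial>\<rho>) = 1" "AE y in \<nu>. (\<integral>x. k2 x y \<partial>\<rho>) = 1" using k1 k2 by (auto simp: kcoup_def)
    then show "AE y in \<nu>. (\<integral>x. k x y \<partial>\<rho>) = 1"
      by eventually_elim (simp add: k_def i[OF k1] i[OF k2])
  qed
  show b: "bary \<nu> k = (\<lambda>x. (bary \<nu> k1 x + bary \<nu> k2 x) /\<^sub>R 2)"
  proof
    fix x
    have "bary \<nu> k x = (\<integral>y. (1/2) *\<^sub>R (k1 x y *\<^sub>R y + k2 x y *\<^sub>R y) \<partial>\<nu>)"
      unfolding bary_def k_def by (simp add: scaleR_add_left[symmetric] add_divide_distrib)
    also have "\<dots> = (1/2) *\<^sub>R (\<integral>y. k1 x y *\<^sub>R y + k2 x y *\<^sub>R y \<partial>\<nu>)" by (rule integral_scaleR_right)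
    also have "\<dots> = (1/2) *\<^sub>R (bary \<nu> k1 x + bary \<nu> k2 x)"
      unfolding bary_def by (subst Bochner_Integration.integral_add[OF n2]) simp
    finally show "bary \<nu> k x = (bary \<nu> k1 x + bary \<nu> k2 x) /\<^sub>R 2" by simp
  qed
  have ix: "integrable \<rho> (\<lambda>x. x \<bullet> bary \<nu> kk x)" if kk: "kcoup \<rho> \<nu> kk" for kk
  proof -
    obtain M where M: "\<And>x. norm (bary \<nu> kk x) \<le> M" using bary_facts(2)[OF Pr Pn kk] by blast
    note [measurable] = bary_facts(1)[OF Pr Pn kk]
    show ?thesis by (rule P2_integrable[OF Pr, of _ M M]) (use bounded_linear_growth_inner[OF M] in auto)
  qed
  have "(\<integral>x. x \<bullet> bary \<nu> k x \<partial>\<rho>) = (\<integral>x. (x \<bullet> bary \<nu> k1 x + x \<bullet> bary \<nu> k2 x) / 2 \<partial>\<rho>)"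
    unfolding b by (simp add: inner_add_right field_simps)
  also have "\<dots> = ((\<integral>x. x \<bullet> bary \<nu> k1 x \<partial>\<rho>) + (\<integral>x. x \<bullet> bary \<nu> k2 x \<partial>\<rho>)) / 2"
    using ix[OF k1] ix[OF k2] by simp
  finally show "kcost \<rho> \<nu> k = (kcost \<rho> \<nu> k1 + kcost \<rho> \<nu> k2) / 2" by (simp add: kcost_def field_simps)
qed

section \<open>First variation of the squared distance\<close>

text \<open>Near-optimal kernel couplings whose barycentres have almost minimal \<open>L\<^sup>2\<close> norm have
  barycentres close to one another (parallelogram law). This replaces the existence of an optimal
  plan: the pairing with the displacement of the curve may be evaluated at a fixed barycentre.\<close>

theorem W2_sq_right_increment:
  fixes \<rho> \<nu> :: "'x::euclidean_space measure" and \<rho>h :: "real \<Rightarrow> 'x measure"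
  assumes Pr: "P2 \<rho>" and Pn: "P2 \<nu>" and Ph: "\<And>h. 0 < h \<Longrightarrow> P2 (\<rho>h h)"
    and speed: "\<forall>\<^sub>F h in at_right 0. W2 \<rho> (\<rho>h h) \<le> C * h"
    and v: "v \<in> borel_measurable borel" "\<And>x. norm (v x) \<le> V"
    and good: "\<And>(\<kappa>::nat) N y w p K. 0 < \<kappa> \<Longrightarrow> 0 < N \<Longrightarrow> (\<And>h. 0 < h \<Longrightarrow> p h \<in> couplings \<rho> (\<rho>h h)) \<Longrightarrow>
        \<forall>\<^sub>F h in at_right 0. cost (p h) \<le> (K * h)\<^sup>2 \<Longrightarrow>
        ((\<lambda>h. (\<integral>z. (fst z - gibbs_mean (real \<kappa>) N y w (fst z)) \<bullet> (snd z - fst z) \<partial>p h) / h)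
           \<longlongrightarrow> (\<integral>x. (x - gibbs_mean (real \<kappa>) N y w x) \<bullet> v x \<partial>\<rho>)) (at_right 0)"
    and e: "0 < e"
  obtains \<gamma> where "\<gamma> \<in> couplings \<rho> \<nu>" "cost \<gamma> \<le> (W2 \<rho> \<nu>)\<^sup>2 + e"
    "\<forall>\<^sub>F h in at_right 0. (W2 (\<rho>h h) \<nu>)\<^sup>2 \<le> (W2 \<rho> \<nu>)\<^sup>2 + 2 * h * ((\<integral>z. (fst z - snd z) \<bullet> v (fst z) \<partial>\<gamma>) + e)"
proof -
  have "\<exists>p. p \<in> couplings \<rho> (\<rho>h h) \<and> cost p \<le> (W2 \<rho> (\<rho>h h))\<^sup>2 + h\<^sup>2" if "0 < h" for h
    using ex_near_optimal_coupling[OF Pr Ph[OF that], of "h\<^sup>2"] that by (metis zero_less_power)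
  then obtain p where p: "\<And>h. 0 < h \<Longrightarrow> p h \<in> couplings \<rho> (\<rho>h h)"
    and pc: "\<And>h. 0 < h \<Longrightarrow> cost (p h) \<le> (W2 \<rho> (\<rho>h h))\<^sup>2 + h\<^sup>2"
    by metis
  \<comment> \<open>The plans \<open>p h\<close> are optimal up to \<open>h^2\<close>, so for small
    \<open>h\<close> their cost is at most \<open>(C^2 + 1) h^2\<close>.\<close>
  define K where "K = sqrt (C\<^sup>2 + 1)"
  have K: "0 < K" "K\<^sup>2 = C\<^sup>2 + 1" by (auto simp: K_def intro!: add_nonneg_pos)
  have hpos: "\<forall>\<^sub>F h in at_right (0::real). 0 < h" by (simp add: eventually_at_right_less)
  have pK: "\<forall>\<^sub>F h in at_right 0. cost (p h) \<le> (K * h)\<^sup>2"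
    using speed hpos
  proof eventually_elim
    fix h :: real assume h: "W2 \<rho> (\<rho>h h) \<le> C * h" "0 < h"
    have "(W2 \<rho> (\<rho>h h))\<^sup>2 \<le> (C * h)\<^sup>2" using h W2_nonneg by (intro power_mono) auto
    then show "cost (p h) \<le> (K * h)\<^sup>2" using pc[OF h(2)] by (simp add: power_mult_distrib K algebra_simps)
  qed
  define L where "L \<zeta> h = (\<integral>z. \<zeta> (fst z) \<bullet> (snd z - fst z) \<partial>p h) / h" for \<zeta> h
  define Good where "Good b \<longleftrightarrow> ((\<lambda>h. L (\<lambda>x. x - b x) h) \<longlongrightarrow> (\<integral>x. (x - b x) \<bullet> v x \<partial>\<rho>)) (at_right 0)" for b
  \<comment> \<open>Kernels of deficit at most \<open>d\<close> whose displacement field is known to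
    have the expected limit. Gibbs kernels have this property, and midpoints inherit it, although a
    midpoint is no longer a Gibbs kernel.\<close>
  define A where "A d = {k. kcoup \<rho> \<nu> k \<and> kcost \<rho> \<nu> k \<le> (W2 \<rho> \<nu>)\<^sup>2 + d \<and> Good (bary \<nu> k)}" for d
  define nb where "nb k = (\<integral>x. (norm (bary \<nu> k x))\<^sup>2 \<partial>\<rho>)" for k
  have nb0: "0 \<le> nb k" for k by (simp add: nb_def)
  have ne: "A d \<noteq> {}" if d: "0 < d" for d
  proof -
    obtain \<kappa> N :: nat and y w k where k: "0 < \<kappa>" "0 < N" "kcoup \<rho> \<nu> k" "bary \<nu> k = gibbs_mean (real \<kappa>) N y w"
      "kcost \<rho> \<nu> k \<le> (W2 \<rho> \<nu>)\<^sup>2 + d"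
      by (rule ex_gibbs_near_optimal[OF Pr Pn d]) (rule that)
    have "Good (bary \<nu> k)" unfolding Good_def L_def k(4) by (rule good[OF k(1,2) p pK])
    then show ?thesis using k by (auto simp: A_def)
  qed
  \<comment> \<open>Infimum of the squared norms of barycentres at tolerance \<open>d\<close>. It
    grows as \<open>d\<close> shrinks and stays below the second moment of \<nu>, so its supremum
    \<open>J\<close> is the limit at zero tolerance.\<close>
  define I where "I d = Inf (nb ` A d)" for d
  have bdd: "bdd_below (nb ` A d)" for d using nb0 by (intro bdd_belowI[of _ 0]) auto
  have I_le: "I d \<le> nb k" if "k \<in> A d" for d k unfolding I_def using that bdd by (intro cInf_lower) auto
  have Aanti: "A d \<subseteq> A d'" if "d \<le> d'" for d d' using that by (auto simp: A_def)
  have Ianti: "I d' \<le> I d" if "0 < d" "d \<le> d'" for d d'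
    unfolding I_def using ne[OF that(1)] Aanti[OF that(2)] bdd by (intro cInf_superset_mono) auto
  have Iub: "I d \<le> (\<integral>y. (norm y)\<^sup>2 \<partial>\<nu>)" if d: "0 < d" for d
  proof -
    obtain k where k: "k \<in> A d" using ne[OF d] by blast
    then have "nb k \<le> (\<integral>y. (norm y)\<^sup>2 \<partial>\<nu>)" unfolding nb_def by (intro bary_facts(3)[OF Pr Pn]) (simp add: A_def)
    then show ?thesis using I_le[OF k] by simp
  qed
  define J where "J = Sup (I ` {0<..})"
  have bJ: "bdd_above (I ` {0<..})" using Iub by (intro bdd_aboveI[of _ "\<integral>y. (norm y)\<^sup>2 \<partial>\<nu>"]) auto
  have IJ: "I d \<le> J" if "0 < d" for d unfolding J_def using bJ that by (intro cSup_upper) auto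
  \<comment> \<open>Chosen so that \<open>2 \<epsilon> + K sqrt (8 \<epsilon>) \<le> e\<close>: the
    square root is the cost of replacing a varying barycentre by a fixed one, along plans of length
    at most \<open>K h\<close>.\<close>
  define \<epsilon> where "\<epsilon> = min (e / 4) (e\<^sup>2 / (32 * K\<^sup>2))"
  have eps: "0 < \<epsilon>" unfolding \<epsilon>_def using e K(1) by (intro min_less_iff_conj[THEN iffD2] conjI divide_pos_pos mult_pos_pos zero_less_power) auto
  have eps1: "2 * \<epsilon> + K * sqrt (8 * \<epsilon>) \<le> e"
  proof -
    have "\<epsilon> \<le> e\<^sup>2 / (32 * K\<^sup>2)" by (simp add: \<epsilon>_def)
    moreover have "8 * (e\<^sup>2 / (32 * K\<^sup>2)) = (e / (2 * K))\<^sup>2" by (simp add: power_divide power_mult_distrib)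
    ultimately have "8 * \<epsilon> \<le> (e / (2 * K))\<^sup>2" by linarith
    then have "sqrt (8 * \<epsilon>) \<le> e / (2 * K)" using e K(1) by (intro real_le_lsqrt) auto
    then have "K * sqrt (8 * \<epsilon>) \<le> e / 2" using K(1) by (simp add: field_simps)
    moreover have "2 * \<epsilon> \<le> e / 2" by (simp add: \<epsilon>_def min_def)
    ultimately show ?thesis by simp
  qed
  have "\<exists>y\<in>I ` {0<..}. J - \<epsilon> < y"
    unfolding J_def using eps by (intro less_cSupD) (auto intro!: exI[of _ 1])
  then obtain e1 where e1: "0 < e1" "J - \<epsilon> < I e1" by auto
  define e0 where "e0 = min e e1"
  have e0: "0 < e0" "e0 \<le> e" "J - \<epsilon> < I e0" using e e1 Ianti[of e0 e1] by (auto simp: e0_def)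
  have ex: "\<exists>k\<in>A d. nb k < J + \<epsilon>" if d: "0 < d" for d
  proof -
    have "Inf (nb ` A d) < J + \<epsilon>" using IJ[OF d] eps by (simp add: I_def)
    then obtain y where "y \<in> nb ` A d" "y < J + \<epsilon>" using cInf_lessD[of "nb ` A d"] ne[OF d] by blast
    then show ?thesis by blast
  qed
  obtain k0 where k0: "k0 \<in> A e0" "nb k0 < J + \<epsilon>" using ex[OF e0(1)] by blast
  have k0c: "kcoup \<rho> \<nu> k0" using k0 by (simp add: A_def)
  \<comment> \<open>The midpoint belongs to the same class, so its squared norm exceeds
    \<open>J - \<epsilon>\<close>; the parallelogram law gives \<open>2 (J + \<epsilon>) + 2 (J +
    \<epsilon>) - 4 (J - \<epsilon>) = 8 \<epsilon>\<close>.\<close>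
  have close: "(\<integral>x. (norm (bary \<nu> k0 x - bary \<nu> k x))\<^sup>2 \<partial>\<rho>) \<le> 8 * \<epsilon>" if k: "k \<in> A e0" "nb k < J + \<epsilon>" for k
  proof -
    have kc: "kcoup \<rho> \<nu> k" using k by (simp add: A_def)
    let ?bz = "bary \<nu> k0" and ?b = "bary \<nu> k"
    define km where "km = (\<lambda>x y. (k0 x y + k x y) / 2)"
    note mid = kcoup_midpoint[OF Pr Pn k0c kc, folded km_def]
    note [measurable] = bary_facts(1)[OF Pr Pn k0c] bary_facts(1)[OF Pr Pn kc]
    obtain M0 where M0: "\<And>x. norm (?bz x) \<le> M0" using bary_facts(2)[OF Pr Pn k0c] by blast
    obtain M where M: "\<And>x. norm (?b x) \<le> M" using bary_facts(2)[OF Pr Pn kc] by blast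
    have zb: "norm (x - b x) \<le> B + 1 * norm x" if "\<And>x. norm (b x) \<le> B" for b :: "'x \<Rightarrow> 'x" and B x
      using norm_triangle_ineq4[of x "b x"] that[of x] by linarith
    have z0: "(\<lambda>x. x - ?bz x) \<in> borel_measurable borel" "(\<lambda>x. x - ?b x) \<in> borel_measurable borel" by measurable
    have "Good (bary \<nu> km)"
    proof -
      have g0: "((\<lambda>h. L (\<lambda>x. x - ?bz x) h) \<longlongrightarrow> (\<integral>x. (x - ?bz x) \<bullet> v x \<partial>\<rho>)) (at_right 0)"
        "((\<lambda>h. L (\<lambda>x. x - ?b x) h) \<longlongrightarrow> (\<integral>x. (x - ?b x) \<bullet> v x \<partial>\<rho>)) (at_right 0)"
        using k0 k by (auto simp: A_def Good_def)
      have iv: "integrable \<rho> (\<lambda>x. (x - b x) \<bullet> v x)" if b: "b \<in> borel_measurable borel" "\<And>x. norm (b x) \<le> B" for b :: "'x \<Rightarrow> 'x" and B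
      proof (rule P2_integrable_linear[OF Pr, of _ "B * V" V])
        note [measurable] = b(1) v(1)
        show "(\<lambda>x. (x - b x) \<bullet> v x) \<in> borel_measurable borel" by measurable
        fix x
        have V0: "0 \<le> V" using norm_ge_zero[of "v x"] v(2)[of x] by linarith
        have "\<bar>(x - b x) \<bullet> v x\<bar> \<le> norm (x - b x) * norm (v x)" by (rule Cauchy_Schwarz_ineq2)
        also have "\<dots> \<le> (B + 1 * norm x) * V"
        proof (rule mult_mono[OF zb[OF b(2)] v(2)])
          show "0 \<le> B + 1 * norm x" using order_trans[OF norm_ge_zero zb[OF b(2), of x]] .
        qed simp
        finally show "norm ((x - b x) \<bullet> v x) \<le> B * V + V * norm x" by (simp add: algebra_simps)
      qed
      have Leq: "L (\<lambda>x. x - bary \<nu> km x) h = (L (\<lambda>x. x - ?bz x) h + L (\<lambda>x. x - ?b x) h) / 2" if h: "0 < h" for h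
      proof -
        have i: "integrable (p h) (\<lambda>z. (fst z - ?bz (fst z)) \<bullet> (snd z - fst z))" "integrable (p h) (\<lambda>z. (fst z - ?b (fst z)) \<bullet> (snd z - fst z))"
          using coupling_pairing_bound(1)[OF Pr Ph[OF h] p[OF h] z0(1) zb[where b="?bz", OF M0]]
            coupling_pairing_bound(1)[OF Pr Ph[OF h] p[OF h] z0(2) zb[where b="?b", OF M]] by auto
        have "(\<integral>z. (fst z - bary \<nu> km (fst z)) \<bullet> (snd z - fst z) \<partial>p h) =
          (\<integral>z. ((fst z - ?bz (fst z)) \<bullet> (snd z - fst z) + (fst z - ?b (fst z)) \<bullet> (snd z - fst z)) / 2 \<partial>p h)"
          unfolding mid(2) by (intro Bochner_Integration.integral_cong refl) (simp add: inner_diff_left inner_add_left inner_diff_right field_simps)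
        also have "\<dots> = ((\<integral>z. (fst z - ?bz (fst z)) \<bullet> (snd z - fst z) \<partial>p h) + (\<integral>z. (fst z - ?b (fst z)) \<bullet> (snd z - fst z) \<partial>p h)) / 2"
          using i by simp
        finally show ?thesis by (simp add: L_def add_divide_distrib)
      qed
      have "(\<integral>x. (x - bary \<nu> km x) \<bullet> v x \<partial>\<rho>) = (\<integral>x. ((x - ?bz x) \<bullet> v x + (x - ?b x) \<bullet> v x) / 2 \<partial>\<rho>)"
        unfolding mid(2) by (intro Bochner_Integration.integral_cong refl) (simp add: inner_diff_left inner_add_left field_simps)
      also have "\<dots> = ((\<integral>x. (x - ?bz x) \<bullet> v x \<partial>\<rho>) + (\<integral>x. (x - ?b x) \<bullet> v x \<partial>\<rho>)) / 2"
        using iv[OF _ M0] iv[OF _ M] by simp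
      finally have ieq: "(\<integral>x. (x - bary \<nu> km x) \<bullet> v x \<partial>\<rho>) = ((\<integral>x. (x - ?bz x) \<bullet> v x \<partial>\<rho>) + (\<integral>x. (x - ?b x) \<bullet> v x \<partial>\<rho>)) / 2" .
      have "((\<lambda>h. (L (\<lambda>x. x - ?bz x) h + L (\<lambda>x. x - ?b x) h) / 2) \<longlongrightarrow> ((\<integral>x. (x - ?bz x) \<bullet> v x \<partial>\<rho>) + (\<integral>x. (x - ?b x) \<bullet> v x \<partial>\<rho>)) / 2) (at_right 0)"
        by (intro tendsto_intros g0) auto
      moreover have "\<forall>\<^sub>F h in at_right 0. (L (\<lambda>x. x - ?bz x) h + L (\<lambda>x. x - ?b x) h) / 2 = L (\<lambda>x. x - bary \<nu> km x) h"
        using hpos by eventually_elim (simp add: Leq)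
      ultimately show ?thesis unfolding Good_def ieq by (rule Lim_transform_eventually)
    qed
    then have "km \<in> A e0" using mid(1,3) k0(1) k(1) by (simp add: A_def)
    then have nm: "J - \<epsilon> < nb km" using I_le[of km e0] e0(3) by linarith
    have sq: "(norm (?bz x - ?b x))\<^sup>2 = 2 * (norm (?bz x))\<^sup>2 + 2 * (norm (?b x))\<^sup>2 - 4 * (norm (bary \<nu> km x))\<^sup>2" for x
      unfolding mid(2) power2_norm_eq_inner by (simp add: inner_diff_left inner_diff_right inner_add_left inner_add_right inner_commute field_simps)
    have ib: "integrable \<rho> (\<lambda>x. (norm (b x))\<^sup>2)" if "b \<in> borel_measurable borel" "\<And>x. norm (b x) \<le> B" for b :: "'x \<Rightarrow> 'x" and B
      by (rule P2_integrable_sq_linear[OF Pr that(1), of B 0]) (use that in auto)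
    obtain Mm where Mm: "\<And>x. norm (bary \<nu> km x) \<le> Mm" using bary_facts(2)[OF Pr Pn mid(1)] by blast
    have "(\<integral>x. (norm (?bz x - ?b x))\<^sup>2 \<partial>\<rho>) = 2 * nb k0 + 2 * nb k - 4 * nb km"
      unfolding sq nb_def using ib[OF bary_facts(1)[OF Pr Pn k0c] M0] ib[OF bary_facts(1)[OF Pr Pn kc] M] ib[OF bary_facts(1)[OF Pr Pn mid(1)] Mm]
      by simp
    then show ?thesis using nm k(2) k0(2) by linarith
  qed
  \<comment> \<open>The plan that is returned belongs to the fixed kernel \<open>k0\<close>, so it
    does not depend on \<open>h\<close>.\<close>
  obtain \<gamma> where g: "\<gamma> \<in> couplings \<rho> \<nu>" "cost \<gamma> = kcost \<rho> \<nu> k0"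
    and gv: "\<forall>v C. v \<in> borel_measurable borel \<longrightarrow> (\<forall>x. norm (v x) \<le> C) \<longrightarrow>
       (\<integral>z. (fst z - snd z) \<bullet> v (fst z) \<partial>\<gamma>) = (\<integral>x. (x - bary \<nu> k0 x) \<bullet> v x \<partial>\<rho>)"
    by (rule kcost_coupling[OF Pr Pn k0c]) (rule that)
  define X where "X = (\<integral>z. (fst z - snd z) \<bullet> v (fst z) \<partial>\<gamma>)"
  have X: "X = (\<integral>x. (x - bary \<nu> k0 x) \<bullet> v x \<partial>\<rho>)" unfolding X_def using gv v by blast
  have "((\<lambda>h. L (\<lambda>x. x - bary \<nu> k0 x) h) \<longlongrightarrow> X) (at_right 0)" unfolding X using k0(1) by (simp add: A_def Good_def)
  then have ev1: "\<forall>\<^sub>F h in at_right 0. L (\<lambda>x. x - bary \<nu> k0 x) h < X + \<epsilon>"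
    using eps by (intro order_tendstoD) auto
  have ev2: "\<forall>\<^sub>F h in at_right 0. h < 2 * \<epsilon> / (C\<^sup>2 + 2)"
    by (rule eventually_mono[OF eventually_at_right_real[of 0 "2 * \<epsilon> / (C\<^sup>2 + 2)"]])
      (use eps in \<open>auto intro!: divide_pos_pos add_nonneg_pos\<close>)
  have "\<forall>\<^sub>F h in at_right 0. (W2 (\<rho>h h) \<nu>)\<^sup>2 \<le> (W2 \<rho> \<nu>)\<^sup>2 + 2 * h * (X + e)"
    using hpos pK ev1 ev2
  proof eventually_elim
    fix h :: real assume h: "0 < h" "cost (p h) \<le> (K * h)\<^sup>2" "L (\<lambda>x. x - bary \<nu> k0 x) h < X + \<epsilon>" "h < 2 * \<epsilon> / (C\<^sup>2 + 2)"
    \<comment> \<open>The kernel used at step \<open>h\<close> has deficit at most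
      \<open>h^2\<close>, negligible after division by \<open>h\<close>. It varies with
      \<open>h\<close>, but its barycentre stays close to that of \<open>k0\<close>, for which the
      limit is known.\<close>
    have d: "0 < min e0 (h\<^sup>2)" using e0 h by simp
    obtain k where k: "k \<in> A (min e0 (h\<^sup>2))" "nb k < J + \<epsilon>" using ex[OF d] by blast
    have kA: "k \<in> A e0" using k(1) Aanti[of "min e0 (h\<^sup>2)" e0] by auto
    have kc: "kcoup \<rho> \<nu> k" using k by (simp add: A_def)
    have kcost: "kcost \<rho> \<nu> k \<le> (W2 \<rho> \<nu>)\<^sup>2 + h\<^sup>2" using k(1) by (auto simp: A_def)
    let ?bz = "bary \<nu> k0" and ?b = "bary \<nu> k"
    note [measurable] = bary_facts(1)[OF Pr Pn k0c] bary_facts(1)[OF Pr Pn kc]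
    obtain M0 where M0: "\<And>x. norm (?bz x) \<le> M0" using bary_facts(2)[OF Pr Pn k0c] by blast
    obtain M where M: "\<And>x. norm (?b x) \<le> M" using bary_facts(2)[OF Pr Pn kc] by blast
    have zb0: "norm (x - ?bz x) \<le> M0 + 1 * norm x" for x using norm_triangle_ineq4[of x "?bz x"] M0[of x] by linarith
    have zb: "norm (?bz x - ?b x) \<le> (M0 + M) + 0 * norm x" for x using norm_triangle_ineq4[of "?bz x" "?b x"] M0[of x] M[of x] by linarith
    note i0 = coupling_pairing_bound[OF Pr Ph[OF h(1)] p[OF h(1)], of "\<lambda>x. x - ?bz x", OF _ zb0]
    note i1 = coupling_pairing_bound[OF Pr Ph[OF h(1)] p[OF h(1)], of "\<lambda>x. ?bz x - ?b x", OF _ zb]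
    have i0': "integrable (p h) (\<lambda>z. (fst z - ?bz (fst z)) \<bullet> (snd z - fst z))" by (rule i0(1)) measurable
    have i1': "integrable (p h) (\<lambda>z. (?bz (fst z) - ?b (fst z)) \<bullet> (snd z - fst z))" by (rule i1(1)) measurable
    have "(\<integral>z. (fst z - ?b (fst z)) \<bullet> (snd z - fst z) \<partial>p h) =
       (\<integral>z. (fst z - ?bz (fst z)) \<bullet> (snd z - fst z) + (?bz (fst z) - ?b (fst z)) \<bullet> (snd z - fst z) \<partial>p h)"
      by (intro Bochner_Integration.integral_cong refl) (simp add: inner_diff_left)
    also have "\<dots> = h * L (\<lambda>x. x - ?bz x) h + (\<integral>z. (?bz (fst z) - ?b (fst z)) \<bullet> (snd z - fst z) \<partial>p h)"
      using i0' i1' h by (simp add: L_def)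
    also have "(\<integral>z. (?bz (fst z) - ?b (fst z)) \<bullet> (snd z - fst z) \<partial>p h) \<le> sqrt (\<integral>x. (norm (?bz x - ?b x))\<^sup>2 \<partial>\<rho>) * sqrt (cost (p h))"
      by (rule order_trans[OF abs_ge_self i1(2)]) measurable
    also have "\<dots> \<le> sqrt (8 * \<epsilon>) * (K * h)"
    proof (rule mult_mono)
      show "sqrt (\<integral>x. (norm (?bz x - ?b x))\<^sup>2 \<partial>\<rho>) \<le> sqrt (8 * \<epsilon>)" using close[OF kA k(2)] by simp
      show "sqrt (cost (p h)) \<le> K * h" using h K by (intro real_le_lsqrt) auto
    qed (use eps in \<open>auto simp: cost_nonneg\<close>)
    also have "h * L (\<lambda>x. x - ?bz x) h \<le> h * (X + \<epsilon>)" using h by (intro mult_left_mono) auto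
    finally have pr: "(\<integral>z. (fst z - ?b (fst z)) \<bullet> (snd z - fst z) \<partial>p h) \<le> h * (X + \<epsilon> + K * sqrt (8 * \<epsilon>))"
      by (simp add: algebra_simps)
    have "(W2 (\<rho>h h) \<nu>)\<^sup>2 \<le> kcost \<rho> \<nu> k + cost (p h) + 2 * (\<integral>z. (fst z - ?b (fst z)) \<bullet> (snd z - fst z) \<partial>p h)"
      by (rule W2_glue_bound[OF Pr Ph[OF h(1)] Pn p[OF h(1)] kc])
    also have "\<dots> \<le> (W2 \<rho> \<nu>)\<^sup>2 + h\<^sup>2 + (K * h)\<^sup>2 + 2 * (h * (X + \<epsilon> + K * sqrt (8 * \<epsilon>)))"
      using kcost h(2) pr by linarith
    also have "\<dots> = (W2 \<rho> \<nu>)\<^sup>2 + 2 * h * ((C\<^sup>2 + 2) * h / 2 + X + \<epsilon> + K * sqrt (8 * \<epsilon>))"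
      unfolding power_mult_distrib K(2) by (simp add: power2_eq_square field_simps)
    also have "\<dots> \<le> (W2 \<rho> \<nu>)\<^sup>2 + 2 * h * (X + e)"
    proof -
      have "0 < C\<^sup>2 + 2" by (intro add_nonneg_pos) auto
      then have "(C\<^sup>2 + 2) * h / 2 \<le> \<epsilon>" using h(4) by (simp add: field_simps)
      then have "(C\<^sup>2 + 2) * h / 2 + X + \<epsilon> + K * sqrt (8 * \<epsilon>) \<le> X + e" using eps1 by linarith
      then show ?thesis using h(1) by (intro add_left_mono mult_left_mono) auto
    qed
    finally show "(W2 (\<rho>h h) \<nu>)\<^sup>2 \<le> (W2 \<rho> \<nu>)\<^sup>2 + 2 * h * (X + e)" .
  qed
  moreover have "cost \<gamma> \<le> (W2 \<rho> \<nu>)\<^sup>2 + e" using k0(1) e0(2) g(2) by (auto simp: A_def)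
  ultimately show ?thesis using g(1) that[of \<gamma>] by (simp add: X_def)
qed

section \<open>Compactly supported test functions and the limit of the pairing\<close>

lemma DERIV_max0_sq: "((\<lambda>u::real. (max 0 u)\<^sup>2) has_real_derivative 2 * max 0 u) (at u)"
proof -
  consider "u > 0" | "u < 0" | "u = 0" by linarith
  then show ?thesis
  proof cases
    case 1
    have "((\<lambda>u::real. u\<^sup>2) has_real_derivative 2 * u) (at u)" by (auto intro!: derivative_eq_intros)
    then have "((\<lambda>u::real. (max 0 u)\<^sup>2) has_real_derivative 2 * u) (at u)"
      by (rule has_field_derivative_transform_within_open[of _ _ _ "{0<..}"]) (use 1 in auto)
    then show ?thesis using 1 by (simp add: max_def)
  next
    case 2
    have "((\<lambda>u::real. 0) has_real_derivative 0) (at u)" by simp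
    then have "((\<lambda>u::real. (max 0 u)\<^sup>2) has_real_derivative 0) (at u)"
      by (rule has_field_derivative_transform_within_open[of _ _ _ "{..<0}"]) (use 2 in \<open>auto simp: max_def\<close>)
    then show ?thesis using 2 by (simp add: max_def)
  next
    case 3
    have t: "((\<lambda>h::real. max 0 h) \<longlongrightarrow> max 0 0) (at 0)" by (intro tendsto_intros)
    have "max 0 h = ((max 0 (0 + h))\<^sup>2 - (max 0 0)\<^sup>2) / h" if "h \<noteq> 0" for h :: real
      using that by (cases "0 < h") (auto simp: max_def power2_eq_square)
    then have "\<forall>\<^sub>F h in at 0. max 0 h = ((max 0 (0 + h))\<^sup>2 - (max 0 (0::real))\<^sup>2) / h"
      by (auto simp: eventually_at_filter)
    from Lim_transform_eventually[OF t this]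
    have "((\<lambda>h::real. ((max 0 (0 + h))\<^sup>2 - (max 0 0)\<^sup>2) / h) \<longlongrightarrow> 0) (at 0)" by simp
    then show ?thesis using 3 by (simp add: DERIV_def)
  qed
qed

text \<open>A bump of class \<open>C^1\<close> in closed form: squaring the positive part is just
  enough for a continuous gradient, which is all that the weak continuity equation asks of a test
  function besides bounded support.\<close>

definition cutoff :: "real \<Rightarrow> 'x::euclidean_space \<Rightarrow> real" where
  "cutoff R x = (max 0 (1 - (norm x)\<^sup>2 / R\<^sup>2))\<^sup>2"

definition cutoff_grad :: "real \<Rightarrow> 'x::euclidean_space \<Rightarrow> 'x" where
  "cutoff_grad R x = (- (4 / R\<^sup>2) * max 0 (1 - (norm x)\<^sup>2 / R\<^sup>2)) *\<^sub>R x"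

lemma cutoff_has_derivative:
  "(cutoff R has_derivative (\<lambda>h. cutoff_grad R x \<bullet> h)) (at (x :: 'x::euclidean_space))"
proof -
  have "((\<lambda>x::'x. 1 - (x \<bullet> x) / R\<^sup>2) has_derivative (\<lambda>h. - ((x \<bullet> h + h \<bullet> x) / R\<^sup>2))) (at x)"
    by (auto intro!: derivative_eq_intros simp: divide_inverse)
  then have "((\<lambda>x::'x. (max 0 (1 - (x \<bullet> x) / R\<^sup>2))\<^sup>2) has_derivative
      (\<lambda>h. - ((x \<bullet> h + h \<bullet> x) / R\<^sup>2) * (2 * max 0 (1 - (x \<bullet> x) / R\<^sup>2)))) (at x)"
    by (rule DERIV_compose_FDERIV[OF DERIV_max0_sq])
  then show ?thesis
    unfolding cutoff_def[abs_def] cutoff_grad_def power2_norm_eq_inner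
    by (rule has_derivative_eq_rhs) (auto simp: fun_eq_iff inner_commute field_simps)
qed

lemma cutoff_bounds: "0 \<le> cutoff R x" "cutoff R x \<le> 1"
proof -
  show "0 \<le> cutoff R x" by (simp add: cutoff_def)
  have "max 0 (1 - (norm x)\<^sup>2 / R\<^sup>2) \<le> 1" by (simp add: max_def)
  then show "cutoff R x \<le> 1" unfolding cutoff_def by (intro power_le_one) auto
qed

lemma cutoff_vanish: "0 < R \<Longrightarrow> R \<le> norm x \<Longrightarrow> cutoff R x = 0" "0 < R \<Longrightarrow> R \<le> norm x \<Longrightarrow> cutoff_grad R x = 0"
proof -
  assume R: "0 < R" "R \<le> norm x"
  then have "R\<^sup>2 \<le> (norm x)\<^sup>2" by (intro power_mono) auto
  then have "1 - (norm x)\<^sup>2 / R\<^sup>2 \<le> 0" using R by (simp add: field_simps)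
  then show "cutoff R x = 0" "cutoff_grad R x = 0" by (auto simp: cutoff_def cutoff_grad_def max_def)
qed

lemma cutoff_continuous: "continuous_on UNIV (cutoff R)" "continuous_on UNIV (cutoff_grad R)"
  unfolding cutoff_def cutoff_grad_def divide_inverse by (intro continuous_intros)+

text \<open>The potential of the displacement field \<open>x - gibbs_mean\<close>, cut off at radius
  \<open>R\<close> because the potential grows quadratically.\<close>

definition tfun :: "real \<Rightarrow> real \<Rightarrow> nat \<Rightarrow> (nat \<Rightarrow> 'x::euclidean_space) \<Rightarrow> (nat \<Rightarrow> real) \<Rightarrow> 'x \<Rightarrow> real" where
  "tfun R \<kappa> N y w x = cutoff R x * ((norm x)\<^sup>2 / 2 - lse \<kappa> N y w x)"

definition tgrad :: "real \<Rightarrow> real \<Rightarrow> nat \<Rightarrow> (nat \<Rightarrow> 'x::euclidean_space) \<Rightarrow> (nat \<Rightarrow> real) \<Rightarrow> 'x \<Rightarrow> 'x" where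
  "tgrad R \<kappa> N y w x = cutoff R x *\<^sub>R (x - gibbs_mean \<kappa> N y w x) + ((norm x)\<^sup>2 / 2 - lse \<kappa> N y w x) *\<^sub>R cutoff_grad R x"

lemma tfun_has_derivative:
  assumes "0 < N" "0 < \<kappa>"
  shows "(tfun R \<kappa> N y w has_derivative (\<lambda>h. tgrad R \<kappa> N y w x \<bullet> h)) (at x)"
proof -
  have "((\<lambda>x. (x \<bullet> x) / 2) has_derivative (\<lambda>h. x \<bullet> h)) (at x)"
    by (auto intro!: derivative_eq_intros simp: inner_commute)
  then have 1: "((\<lambda>x. (norm x)\<^sup>2 / 2) has_derivative (\<lambda>h. x \<bullet> h)) (at x)" by (simp add: power2_norm_eq_inner)
  have "((\<lambda>x. cutoff R x * ((norm x)\<^sup>2 / 2 - lse \<kappa> N y w x)) has_derivative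
    (\<lambda>h. cutoff R x * (x \<bullet> h - gibbs_mean \<kappa> N y w x \<bullet> h) + (cutoff_grad R x \<bullet> h) * ((norm x)\<^sup>2 / 2 - lse \<kappa> N y w x))) (at x)"
    by (rule has_derivative_mult[OF cutoff_has_derivative has_derivative_diff[OF 1 lse_has_derivative[OF assms]]])
  then show ?thesis unfolding tfun_def[abs_def] tgrad_def
    by (rule has_derivative_eq_rhs) (auto simp: fun_eq_iff inner_add_left inner_diff_left algebra_simps)
qed

lemma tgrad_continuous: "0 < N \<Longrightarrow> continuous_on UNIV (tgrad R \<kappa> N y w)"
  unfolding tgrad_def by (intro continuous_intros cutoff_continuous gibbs_mean_continuous lse_continuous) auto

lemma tfun_vanish: "0 < R \<Longrightarrow> R \<le> norm x \<Longrightarrow> tfun R \<kappa> N y w x = 0" "0 < R \<Longrightarrow> R \<le> norm x \<Longrightarrow> tgrad R \<kappa> N y w x = 0"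
  by (auto simp: tfun_def tgrad_def cutoff_vanish)

lemma tfun_support: "0 < R \<Longrightarrow> bounded {x. tfun R \<kappa> N y w x \<noteq> 0}"
proof (rule bounded_subset[OF bounded_ball[of 0 R]])
  assume R: "0 < R"
  show "{x. tfun R \<kappa> N y w x \<noteq> 0} \<subseteq> ball 0 R"
  proof
    fix x assume "x \<in> {x. tfun R \<kappa> N y w x \<noteq> 0}"
    then have "\<not> R \<le> norm x" using tfun_vanish(1)[OF R, of x \<kappa> N y w] by blast
    then show "x \<in> ball 0 R" by simp
  qed
qed

text \<open>The bound does not depend on \<open>R\<close>: inside the support \<open>norm x\<close>
  is below \<open>R\<close>, so the quadratic growth of the potential is paid for by the cutoff
  gradient, of size at most \<open>4 * norm x / R^2\<close>. Nor does it depend on the parameters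
  beyond \<open>A\<close> and \<open>Y\<close>. Dominated convergence can thus be applied while
  radius and parameters vary together.\<close>

lemma tgrad_bound:
  assumes N: "0 < N" and k: "0 < \<kappa>" and R: "1 \<le> R"
    and A: "ln (real N) / \<kappa> + (\<Sum>i<N. \<bar>w i\<bar>) \<le> A" and Y: "(\<Sum>i<N. norm (y i)) \<le> Y"
  shows "norm (tgrad R \<kappa> N y w x) \<le> 5 * Y + (3 + 4 * A) * norm x"
proof -
  have Y0: "0 \<le> Y" using Y sum_nonneg[of "{..<N}" "\<lambda>i. norm (y i)"] by auto
  have A0: "0 \<le> A"
  proof -
    have "0 \<le> ln (real N) / \<kappa>" using N k by simp
    moreover have "0 \<le> (\<Sum>i<N. \<bar>w i\<bar>)" by (intro sum_nonneg) auto
    ultimately show ?thesis using A by linarith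
  qed
  show ?thesis
  proof (cases "norm x < R")
    case False
    then have "tgrad R \<kappa> N y w x = 0" using R by (intro tfun_vanish) auto
    then show ?thesis using Y0 A0 by simp
  next
    case True
    let ?n = "norm x"
    have g: "norm (gibbs_mean \<kappa> N y w x) \<le> Y" using gibbs_mean_bound[OF N, of \<kappa> y w x] Y by linarith
    have l: "\<bar>lse \<kappa> N y w x\<bar> \<le> A + Y * ?n"
      using lse_bound[OF N k, of y w x] A mult_right_mono[OF Y norm_ge_zero[of x]] by linarith
    have 1: "norm (cutoff R x *\<^sub>R (x - gibbs_mean \<kappa> N y w x)) \<le> 1 * (?n + Y)"
      unfolding norm_scaleR using cutoff_bounds[of R x] g norm_triangle_ineq4[of x "gibbs_mean \<kappa> N y w x"]
      by (intro mult_mono) auto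
    have m: "0 \<le> max 0 (1 - ?n\<^sup>2 / R\<^sup>2)" "max 0 (1 - ?n\<^sup>2 / R\<^sup>2) \<le> 1" by (auto simp: max_def)
    have cg: "norm (cutoff_grad R x) \<le> 4 / R\<^sup>2 * ?n"
    proof -
      have "norm (cutoff_grad R x) = (4 / R\<^sup>2) * max 0 (1 - ?n\<^sup>2 / R\<^sup>2) * ?n"
        unfolding cutoff_grad_def norm_scaleR using m by (simp add: abs_mult)
      also have "\<dots> \<le> (4 / R\<^sup>2) * 1 * ?n" using m by (intro mult_right_mono mult_left_mono) auto
      finally show ?thesis by simp
    qed
    have "norm (((norm x)\<^sup>2 / 2 - lse \<kappa> N y w x) *\<^sub>R cutoff_grad R x) \<le> (?n\<^sup>2 / 2 + (A + Y * ?n)) * (4 / R\<^sup>2 * ?n)"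
      unfolding norm_scaleR
    proof (rule mult_mono)
      show "\<bar>?n\<^sup>2 / 2 - lse \<kappa> N y w x\<bar> \<le> ?n\<^sup>2 / 2 + (A + Y * ?n)"
        using l abs_triangle_ineq4[of "?n\<^sup>2 / 2" "lse \<kappa> N y w x"] by (simp add: abs_div)
    qed (use cg A0 Y0 in auto)
    also have "\<dots> = 2 * ((?n / R)\<^sup>2 * ?n) + 4 * A * (?n / R\<^sup>2) + 4 * Y * (?n / R)\<^sup>2"
    proof -
      have "R \<noteq> 0" using R by simp
      then show ?thesis by (simp add: power2_eq_square field_simps)
    qed
    also have "\<dots> \<le> 2 * (1 * ?n) + 4 * A * ?n + 4 * Y * 1"
    proof -
      have q: "(?n / R)\<^sup>2 \<le> 1" using True R by (intro power_le_one) auto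
      have "?n / R\<^sup>2 \<le> ?n / 1" using R by (intro divide_left_mono) (auto simp: one_le_power)
      then show ?thesis using q A0 Y0 by (intro add_mono mult_left_mono mult_right_mono) auto
    qed
    finally have 2: "norm (((norm x)\<^sup>2 / 2 - lse \<kappa> N y w x) *\<^sub>R cutoff_grad R x) \<le> 2 * ?n + 4 * A * ?n + 4 * Y" by simp
    show ?thesis
      unfolding tgrad_def using norm_triangle_ineq[of "cutoff R x *\<^sub>R (x - gibbs_mean \<kappa> N y w x)" "((norm x)\<^sup>2 / 2 - lse \<kappa> N y w x) *\<^sub>R cutoff_grad R x"] 1 2
      by (simp add: algebra_simps)
  qed
qed

lemma tgrad_tendsto:
  fixes x :: "'x::euclidean_space"
  assumes N: "0 < N" and k: "0 < \<kappa>"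
    and y: "\<And>i. i < N \<Longrightarrow> (\<lambda>n. yy n i) \<longlonglongrightarrow> y i" and w: "\<And>i. i < N \<Longrightarrow> (\<lambda>n. ww n i) \<longlonglongrightarrow> w i"
  shows "(\<lambda>n. tgrad (real (Suc n)) \<kappa> N (yy n) (ww n) x) \<longlonglongrightarrow> x - gibbs_mean \<kappa> N y w x"
proof -
  have Z: "(\<lambda>n. gibbs_Z \<kappa> N (yy n) (ww n) x) \<longlonglongrightarrow> gibbs_Z \<kappa> N y w x"
    unfolding gibbs_Z_def by (intro tendsto_intros y w) auto
  have Z0: "gibbs_Z \<kappa> N y w x \<noteq> 0" using gibbs_Z_pos[OF N, of \<kappa> y w x] by simp
  have l: "(\<lambda>n. lse \<kappa> N (yy n) (ww n) x) \<longlonglongrightarrow> lse \<kappa> N y w x"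
    unfolding lse_def using k by (intro tendsto_intros Z Z0) auto
  have g: "(\<lambda>n. gibbs_mean \<kappa> N (yy n) (ww n) x) \<longlonglongrightarrow> gibbs_mean \<kappa> N y w x"
    unfolding gibbs_mean_def gibbs_def by (intro tendsto_intros Z Z0 y w) auto
  have inv: "(\<lambda>n. inverse (real (Suc n))) \<longlonglongrightarrow> 0" by (rule LIMSEQ_inverse_real_of_nat)
  have "(\<lambda>n. (norm x)\<^sup>2 * (inverse (real (Suc n)))\<^sup>2) \<longlonglongrightarrow> (norm x)\<^sup>2 * 0\<^sup>2" by (intro tendsto_intros inv)
  then have u: "(\<lambda>n. (norm x)\<^sup>2 / (real (Suc n))\<^sup>2) \<longlonglongrightarrow> 0" by (simp add: divide_inverse power_inverse)
  have "(\<lambda>n. cutoff (real (Suc n)) x) \<longlonglongrightarrow> (max 0 (1 - 0))\<^sup>2" unfolding cutoff_def by (intro tendsto_intros u)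
  then have c: "(\<lambda>n. cutoff (real (Suc n)) x) \<longlonglongrightarrow> 1" by simp
  have "(\<lambda>n. 4 * (inverse (real (Suc n)))\<^sup>2) \<longlonglongrightarrow> 4 * 0\<^sup>2" by (intro tendsto_intros inv)
  then have q: "(\<lambda>n. 4 / (real (Suc n))\<^sup>2) \<longlonglongrightarrow> 0" by (simp add: divide_inverse power_inverse)
  have "(\<lambda>n. cutoff_grad (real (Suc n)) x) \<longlonglongrightarrow> (- 0 * max 0 (1 - 0)) *\<^sub>R x"
    unfolding cutoff_grad_def by (intro tendsto_intros u q)
  then have cg: "(\<lambda>n. cutoff_grad (real (Suc n)) x) \<longlonglongrightarrow> 0" by simp
  have "(\<lambda>n. tgrad (real (Suc n)) \<kappa> N (yy n) (ww n) x) \<longlonglongrightarrow> 1 *\<^sub>R (x - gibbs_mean \<kappa> N y w x) + ((norm x)\<^sup>2 / 2 - lse \<kappa> N y w x) *\<^sub>R 0"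
    unfolding tgrad_def by (intro tendsto_intros c cg l g)
  then show ?thesis by simp
qed

text \<open>The ball of radius \<open>R + 1\<close> leaves room: if one of two points at distance
  below 1 lies outside it, both lie where \<open>G\<close> vanishes.\<close>

lemma uniformly_continuous_compact_support:
  fixes G :: "'x::euclidean_space \<Rightarrow> 'y::real_normed_vector"
  assumes c: "continuous_on UNIV G" and z: "\<And>x. R \<le> norm x \<Longrightarrow> G x = 0" and e: "0 < e"
  obtains d where "0 < d" "\<And>x y. norm (x - y) < d \<Longrightarrow> norm (G x - G y) < e"
proof -
  have "uniformly_continuous_on (cball 0 (R + 1)) G"
    by (rule compact_uniformly_continuous[OF continuous_on_subset[OF c]]) auto
  then obtain d where d: "0 < d" "\<And>x y. x \<in> cball 0 (R + 1) \<Longrightarrow> y \<in> cball 0 (R + 1) \<Longrightarrow> dist y x < d \<Longrightarrow> dist (G y) (G x) < e"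
    using e unfolding uniformly_continuous_on_def by blast
  have "norm (G x - G y) < e" if xy: "norm (x - y) < min d 1" for x y
  proof (cases "norm x \<le> R + 1 \<and> norm y \<le> R + 1")
    case True then show ?thesis using d(2)[of y x] xy by (simp add: dist_norm)
  next
    case False
    have "norm x \<le> norm y + norm (x - y)" "norm y \<le> norm x + norm (x - y)"
      using norm_triangle_ineq[of y "x - y"] norm_triangle_ineq[of x "y - x"] by (auto simp: norm_minus_commute)
    then have "R \<le> norm x" "R \<le> norm y" using False xy by auto
    then show ?thesis using z e by simp
  qed
  then show ?thesis using d(1) by (intro that[of "min d 1"]) auto
qed

text \<open>Mean value theorem on the segment. Within distance \<open>d\<close> the gradient varies
  by less than \<open>e\<close>; beyond it, \<open>norm (z - x)\<close> is at most its square
  divided by \<open>d\<close>, so boundedness of the gradient suffices. The error is stated in this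
  form so that its integral over a plan involves only the cost.\<close>

lemma first_order_expansion:
  fixes f :: "'x::euclidean_space \<Rightarrow> real"
  assumes f: "\<And>x. (f has_derivative (\<lambda>h. G x \<bullet> h)) (at x)"
    and M: "\<And>x. norm (G x) \<le> M" and d: "0 < d" "\<And>x y. norm (x - y) < d \<Longrightarrow> norm (G x - G y) < e"
  shows "\<bar>f z - f x - G x \<bullet> (z - x)\<bar> \<le> e * norm (z - x) + (2 * M / d) * (norm (z - x))\<^sup>2"
proof -
  have "\<exists>\<xi>. \<xi> \<in> closed_segment x z \<and> f z - f x = G \<xi> \<bullet> (z - x)"
  proof -
    have "((\<lambda>s. f (x + s *\<^sub>R (z - x))) has_real_derivative G (x + s *\<^sub>R (z - x)) \<bullet> (z - x)) (at s)" for s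
    proof -
      have "((\<lambda>s. x + s *\<^sub>R (z - x)) has_derivative (\<lambda>h. h *\<^sub>R (z - x))) (at s)" by (auto intro!: derivative_eq_intros)
      from has_derivative_compose[OF this f] show ?thesis
        unfolding has_field_derivative_def by (rule has_derivative_eq_rhs) (auto simp: fun_eq_iff)
    qed
    then obtain s where s: "0 < s" "s < 1" "f (x + 1 *\<^sub>R (z - x)) - f (x + 0 *\<^sub>R (z - x)) = (1 - 0) * (G (x + s *\<^sub>R (z - x)) \<bullet> (z - x))"
      using MVT2[of 0 1 "\<lambda>s. f (x + s *\<^sub>R (z - x))" "\<lambda>s. G (x + s *\<^sub>R (z - x)) \<bullet> (z - x)"] by auto
    have "x + s *\<^sub>R (z - x) = (1 - s) *\<^sub>R x + s *\<^sub>R z" by (simp add: algebra_simps)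
    then have "x + s *\<^sub>R (z - x) \<in> closed_segment x z" using s unfolding in_segment by (intro exI[of _ s]) auto
    then show ?thesis using s by auto
  qed
  then obtain \<xi> where xi: "\<xi> \<in> closed_segment x z" "f z - f x = G \<xi> \<bullet> (z - x)" by blast
  have nx: "norm (\<xi> - x) \<le> norm (z - x)" using segment_bound(1)[OF xi(1)] by (simp add: norm_minus_commute)
  have M0: "0 \<le> M" using norm_ge_zero[of "G x"] M[of x] by linarith
  have "\<bar>f z - f x - G x \<bullet> (z - x)\<bar> = \<bar>(G \<xi> - G x) \<bullet> (z - x)\<bar>" by (simp add: xi(2) inner_diff_left)
  also have "\<dots> \<le> norm (G \<xi> - G x) * norm (z - x)" by (rule Cauchy_Schwarz_ineq2)
  also have "\<dots> \<le> e * norm (z - x) + (2 * M / d) * (norm (z - x))\<^sup>2"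
  proof (cases "norm (z - x) < d")
    case True
    then have "norm (G \<xi> - G x) < e" using nx by (intro d(2)) auto
    then have "norm (G \<xi> - G x) * norm (z - x) \<le> e * norm (z - x)" by (intro mult_right_mono) auto
    moreover have "0 \<le> (2 * M / d) * (norm (z - x))\<^sup>2" using M0 d by auto
    ultimately show ?thesis by linarith
  next
    case False
    have e0: "0 \<le> e" using d(2)[of x x] d(1) by simp
    have "norm (G \<xi> - G x) \<le> 2 * M" using norm_triangle_ineq4[of "G \<xi>" "G x"] M[of \<xi>] M[of x] by linarith
    also have "\<dots> \<le> (2 * M / d) * norm (z - x)" using False M0 d by (simp add: field_simps mult_left_mono)
    finally have "norm (G \<xi> - G x) * norm (z - x) \<le> (2 * M / d) * norm (z - x) * norm (z - x)" by (intro mult_right_mono) auto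
    then show ?thesis using e0 by (simp add: power2_eq_square mult.assoc add_increasing)
  qed
  finally show ?thesis .
qed

text \<open>The plans have length of order \<open>h\<close>. In the expansion of the test function
  the uniform modulus contributes an arbitrarily small multiple of \<open>h\<close> and the
  quadratic remainder is of order \<open>h^2\<close>, so increment and pairing agree up to
  \<open>o(h)\<close>.\<close>

lemma coupling_test_function_increment:
  fixes \<rho> :: "'x::euclidean_space measure"
  assumes Pr: "P2 \<rho>" and Ph: "\<And>h. 0 < h \<Longrightarrow> P2 (\<rho>h h)"
    and p: "\<And>h. 0 < h \<Longrightarrow> p h \<in> couplings \<rho> (\<rho>h h)" and pc: "\<forall>\<^sub>F h in at_right 0. cost (p h) \<le> (K * h)\<^sup>2"
    and f: "\<And>x. (f has_derivative (\<lambda>h. G x \<bullet> h)) (at x)" and Gc: "continuous_on UNIV G"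
    and z: "0 < R" "\<And>x. R \<le> norm x \<Longrightarrow> f x = 0" "\<And>x. R \<le> norm x \<Longrightarrow> G x = 0"
  shows "((\<lambda>h. ((\<integral>x. f x \<partial>\<rho>h h) - (\<integral>x. f x \<partial>\<rho>)) / h - (\<integral>z. G (fst z) \<bullet> (snd z - fst z) \<partial>p h) / h) \<longlongrightarrow> 0) (at_right 0)"
proof (rule tendstoI)
  fix \<epsilon> :: real assume eps: "0 < \<epsilon>"
  \<comment> \<open>Shifted by 1 so that \<open>L * h\<close> is positive and may be divided
    by.\<close>
  define L where "L = \<bar>K\<bar> + 1"
  have L: "0 < L" by (simp add: L_def)
  have fc: "continuous_on UNIV f" using f by (meson has_derivative_continuous continuous_at_imp_continuous_on)
  have fm[measurable]: "f \<in> borel_measurable borel" "G \<in> borel_measurable borel"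
    using fc Gc by (auto intro: borel_measurable_continuous_onI)
  have bd: "\<exists>B. \<forall>x. norm (F x) \<le> B" if "continuous_on UNIV F" "\<And>x. R \<le> norm x \<Longrightarrow> F x = 0" for F :: "'x \<Rightarrow> 'c::real_normed_vector"
  proof -
    have "bounded (F ` cball 0 R)" by (intro compact_imp_bounded compact_continuous_image continuous_on_subset[OF that(1)]) auto
    then obtain B where "\<forall>x\<in>cball 0 R. norm (F x) \<le> B" by (auto simp: bounded_iff)
    then have B: "norm (F x) \<le> B" if "norm x \<le> R" for x using that by simp
    have "norm (F x) \<le> max B 0" for x using B[of x] that(2)[of x] by (cases "norm x \<le> R") auto
    then show ?thesis by blast
  qed
  obtain M where M: "\<And>x. norm (G x) \<le> M" using bd[OF Gc z(3)] by blast
  obtain B where B: "\<And>x. norm (f x) \<le> B" using bd[OF fc z(2)] by blast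
  have M0: "0 \<le> M" using norm_ge_zero[of "G 0"] M[of 0] by linarith
  define e where "e = \<epsilon> / (4 * L)"
  have e: "0 < e" using eps L by (simp add: e_def)
  obtain d where d: "0 < d" "\<And>x y. norm (x - y) < d \<Longrightarrow> norm (G x - G y) < e"
    by (rule uniformly_continuous_compact_support[OF Gc z(3) e]) auto
  define Q where "Q = 2 * M / d * L\<^sup>2"
  have Q: "0 \<le> Q" using M0 d by (simp add: Q_def)
  have ev: "\<forall>\<^sub>F h in at_right 0. h < \<epsilon> / (4 * (Q + 1))"
    by (rule eventually_mono[OF eventually_at_right_real[of 0 "\<epsilon> / (4 * (Q + 1))"]]) (use eps Q in auto)
  have hpos: "\<forall>\<^sub>F h in at_right (0::real). 0 < h" by (simp add: eventually_at_right_less)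
  show "\<forall>\<^sub>F h in at_right 0. dist (((\<integral>x. f x \<partial>\<rho>h h) - (\<integral>x. f x \<partial>\<rho>)) / h - (\<integral>z. G (fst z) \<bullet> (snd z - fst z) \<partial>p h) / h) 0 < \<epsilon>"
    using hpos pc ev
  proof eventually_elim
    fix h :: real assume h: "0 < h" "cost (p h) \<le> (K * h)\<^sup>2" "h < \<epsilon> / (4 * (Q + 1))"
    have Pp: "P2 (p h)" by (rule couplings_P2[OF p[OF h(1)] Pr Ph[OF h(1)]])
    interpret prob_space "p h" by (rule P2_prob[OF Pp])
    have cL: "cost (p h) \<le> (L * h)\<^sup>2"
    proof -
      have "(K * h)\<^sup>2 \<le> (L * h)\<^sup>2" using h(1) by (simp add: power_mult_distrib L_def abs_le_square_iff[symmetric])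
      then show ?thesis using h(2) by simp
    qed
    have i1: "integrable (p h) (\<lambda>z. f (fst z))" "integrable (p h) (\<lambda>z. f (snd z))"
      by (rule P2_integrable[OF Pp, of _ B 0]; use B in simp)+
    have i2: "integrable (p h) (\<lambda>z. G (fst z) \<bullet> (snd z - fst z))"
      by (rule coupling_pairing_bound(1)[OF Pr Ph[OF h(1)] p[OF h(1)], of _ M 0]) (use M in auto)
    have i3: "integrable (p h) (\<lambda>z. (norm (snd z - fst z))\<^sup>2)" using integrable_cost[OF Pp] by (simp add: norm_minus_commute)
    have c3: "(\<integral>z. (norm (snd z - fst z))\<^sup>2 \<partial>p h) = cost (p h)" by (simp add: cost_def norm_minus_commute)
    have Lh: "0 < L * h" using L h by simp
    \<comment> \<open>Trades the first moment of the displacement for the cost; the parameter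
      \<open>L * h\<close> is of the order of the displacement itself.\<close>
    have n1: "norm u \<le> L * h / 2 + (norm u)\<^sup>2 / (2 * (L * h))" for u :: 'x
    proof -
      have "0 \<le> (norm u - L * h)\<^sup>2" by simp
      then have "2 * (L * h) * norm u \<le> (L * h)\<^sup>2 + (norm u)\<^sup>2" by (simp add: power2_diff algebra_simps)
      then have "norm u \<le> ((L * h)\<^sup>2 + (norm u)\<^sup>2) / (2 * (L * h))" using Lh by (subst pos_le_divide_eq) (auto simp: mult.commute)
      also have "\<dots> = L * h / 2 + (norm u)\<^sup>2 / (2 * (L * h))" using Lh by (simp add: add_divide_distrib power2_eq_square)
      finally show ?thesis .
    qed
    have "((\<integral>x. f x \<partial>\<rho>h h) - (\<integral>x. f x \<partial>\<rho>)) - (\<integral>z. G (fst z) \<bullet> (snd z - fst z) \<partial>p h) =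
       (\<integral>z. f (snd z) - f (fst z) - G (fst z) \<bullet> (snd z - fst z) \<partial>p h)"
      using integral_coupling[OF p[OF h(1)], of f] i1 i2 by simp
    also have "\<bar>\<dots>\<bar> \<le> (\<integral>z. \<bar>f (snd z) - f (fst z) - G (fst z) \<bullet> (snd z - fst z)\<bar> \<partial>p h)" by (rule integral_abs_bound)
    also have "\<dots> \<le> (\<integral>z. e * (L * h / 2 + (norm (snd z - fst z))\<^sup>2 / (2 * (L * h))) + (2 * M / d) * (norm (snd z - fst z))\<^sup>2 \<partial>p h)"
    proof (rule integral_mono)
      show "integrable (p h) (\<lambda>z. \<bar>f (snd z) - f (fst z) - G (fst z) \<bullet> (snd z - fst z)\<bar>)" using i1 i2 by auto
      show "integrable (p h) (\<lambda>z. e * (L * h / 2 + (norm (snd z - fst z))\<^sup>2 / (2 * (L * h))) + (2 * M / d) * (norm (snd z - fst z))\<^sup>2)"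
        using i3 by auto
      fix z :: "'x \<times> 'x"
      have "e * norm (snd z - fst z) \<le> e * (L * h / 2 + (norm (snd z - fst z))\<^sup>2 / (2 * (L * h)))"
        using n1 e by (intro mult_left_mono) auto
      then show "\<bar>f (snd z) - f (fst z) - G (fst z) \<bullet> (snd z - fst z)\<bar> \<le> e * (L * h / 2 + (norm (snd z - fst z))\<^sup>2 / (2 * (L * h))) + (2 * M / d) * (norm (snd z - fst z))\<^sup>2"
        using first_order_expansion[OF f M d, of "snd z" "fst z"] by linarith
    qed
    also have "\<dots> = e * (L * h / 2 + cost (p h) / (2 * (L * h))) + (2 * M / d) * cost (p h)"
      using i3 by (simp add: c3 prob_space)
    also have "\<dots> \<le> e * (L * h / 2 + (L * h)\<^sup>2 / (2 * (L * h))) + (2 * M / d) * (L * h)\<^sup>2"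
      using e cL L h(1) M0 d(1) by (intro add_mono mult_left_mono divide_right_mono) auto
    also have "\<dots> = h * (e * L + Q * h)"
      using Lh by (simp add: Q_def power2_eq_square field_simps)
    also have "\<dots> < h * \<epsilon>"
    proof (rule mult_strict_left_mono[OF _ h(1)])
      have "Q * h \<le> (Q + 1) * h" using h by simp
      also have "\<dots> \<le> \<epsilon> / 4" using h(3) Q by (simp add: field_simps)
      finally have "Q * h \<le> \<epsilon> / 4" .
      moreover have "e * L = \<epsilon> / 4" using L by (simp add: e_def)
      ultimately show "e * L + Q * h < \<epsilon>" using eps by simp
    qed
    finally have "\<bar>((\<integral>x. f x \<partial>\<rho>h h) - (\<integral>x. f x \<partial>\<rho>)) - (\<integral>z. G (fst z) \<bullet> (snd z - fst z) \<partial>p h)\<bar> < h * \<epsilon>" .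
    then have "\<bar>(((\<integral>x. f x \<partial>\<rho>h h) - (\<integral>x. f x \<partial>\<rho>)) - (\<integral>z. G (fst z) \<bullet> (snd z - fst z) \<partial>p h)) / h\<bar> < \<epsilon>"
      using h(1) by (simp add: abs_div field_simps)
    then show "dist (((\<integral>x. f x \<partial>\<rho>h h) - (\<integral>x. f x \<partial>\<rho>)) / h - (\<integral>z. G (fst z) \<bullet> (snd z - fst z) \<partial>p h) / h) 0 < \<epsilon>"
      by (simp add: diff_divide_distrib)
  qed
qed

text \<open>The displacement field is approximated in \<open>L^2(\<rho>)\<close> by gradients of
  test functions with growing radius and parameters from the dense set. By Cauchy-Schwarz the error
  in the pairing is at most \<open>|K|\<close> times the \<open>L^2\<close> error, uniformly in
  small \<open>h\<close>, so the limit passes over from the test functions.\<close>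

theorem gibbs_pairing_limit:
  fixes \<rho> :: "'x::euclidean_space measure" and D :: "('x \<times> real) set"
  assumes Pr: "P2 \<rho>" and Ph: "\<And>h. 0 < h \<Longrightarrow> P2 (\<rho>h h)"
    and v: "v \<in> borel_measurable borel" "\<And>x. norm (v x) \<le> V"
    and dense: "\<And>z e. 0 < e \<Longrightarrow> \<exists>d\<in>D. dist d z < e"
    and test: "\<And>(R::nat) (\<kappa>::nat) ps. 0 < R \<Longrightarrow> 0 < \<kappa> \<Longrightarrow> ps \<noteq> [] \<Longrightarrow> ps \<in> lists D \<Longrightarrow>
       ((\<lambda>h. ((\<integral>x. tfun (real R) (real \<kappa>) (length ps) (\<lambda>i. fst (ps ! i)) (\<lambda>i. snd (ps ! i)) x \<partial>\<rho>h h)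
            - (\<integral>x. tfun (real R) (real \<kappa>) (length ps) (\<lambda>i. fst (ps ! i)) (\<lambda>i. snd (ps ! i)) x \<partial>\<rho>)) / h)
          \<longlongrightarrow> (\<integral>x. tgrad (real R) (real \<kappa>) (length ps) (\<lambda>i. fst (ps ! i)) (\<lambda>i. snd (ps ! i)) x \<bullet> v x \<partial>\<rho>)) (at_right 0)"
    and k: "0 < (\<kappa>::nat)" and N: "0 < N"
    and p: "\<And>h. 0 < h \<Longrightarrow> p h \<in> couplings \<rho> (\<rho>h h)" and pc: "\<forall>\<^sub>F h in at_right 0. cost (p h) \<le> (K * h)\<^sup>2"
  shows "((\<lambda>h. (\<integral>z. (fst z - gibbs_mean (real \<kappa>) N y w (fst z)) \<bullet> (snd z - fst z) \<partial>p h) / h)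
           \<longlongrightarrow> (\<integral>x. (x - gibbs_mean (real \<kappa>) N y w x) \<bullet> v x \<partial>\<rho>)) (at_right 0)"
proof (rule tendstoI)
  fix \<epsilon> :: real assume eps: "0 < \<epsilon>"
  interpret prob_space \<rho> by (rule P2_prob[OF Pr])
  have [measurable_cong]: "sets \<rho> = sets borel" by (rule P2_sets[OF Pr])
  note [measurable] = v(1)
  have k0: "0 < real \<kappa>" using k by simp
  have V0: "0 \<le> V" using norm_ge_zero[of "v 0"] v(2)[of 0] by linarith
  \<comment> \<open>Parameters of the approximation of index \<open>n\<close>, within 1/(n+1) of the
    given ones and taken from the set for which the limit is assumed.\<close>
  define d where "d n i = (SOME d. d \<in> D \<and> dist d (y i, w i) < inverse (real (Suc n)))" for n i
  have "d n i \<in> D \<and> dist (d n i) (y i, w i) < inverse (real (Suc n))" for n i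
  proof -
    obtain d' where "d' \<in> D" "dist d' (y i, w i) < inverse (real (Suc n))" using dense[of "inverse (real (Suc n))" "(y i, w i)"] by auto
    then show ?thesis unfolding d_def by (intro someI[of "\<lambda>d. d \<in> D \<and> dist d (y i, w i) < inverse (real (Suc n))" d']) blast
  qed
  then have d: "d n i \<in> D" "dist (d n i) (y i, w i) < inverse (real (Suc n))" for n i by auto
  define ps where "ps n = map (d n) [0..<N]" for n
  have ps: "ps n \<in> lists D" "ps n \<noteq> []" "length (ps n) = N" "\<And>i. i < N \<Longrightarrow> ps n ! i = d n i" for n
    using d N by (auto simp: ps_def)
  define yy where "yy n i = fst (ps n ! i)" for n i
  define ww where "ww n i = snd (ps n ! i)" for n i
  have dl: "(\<lambda>n. d n i) \<longlonglongrightarrow> (y i, w i)" for i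
  proof (rule tendsto_dist_iff[THEN iffD2], rule Lim_null_comparison[OF _ LIMSEQ_inverse_real_of_nat])
    show "\<forall>\<^sub>F n in sequentially. norm (dist (d n i) (y i, w i)) \<le> inverse (real (Suc n))" using d(2) by (auto intro!: always_eventually less_imp_le)
  qed
  have yl: "(\<lambda>n. yy n i) \<longlonglongrightarrow> y i" and wl: "(\<lambda>n. ww n i) \<longlonglongrightarrow> w i" if "i < N" for i
    using tendsto_fst[OF dl[of i]] tendsto_snd[OF dl[of i]] that by (simp_all add: yy_def ww_def ps(4))
  have db: "norm (yy n i) \<le> norm (y i) + 1" "\<bar>ww n i\<bar> \<le> \<bar>w i\<bar> + 1" if "i < N" for n i
  proof -
    have "dist (d n i) (y i, w i) < 1" using d(2)[of n i] by (rule less_le_trans) (simp add: field_simps)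
    then have "dist (yy n i) (y i) < 1" "dist (ww n i) (w i) < 1"
      using dist_fst_le[of "d n i" "(y i, w i)"] dist_snd_le[of "d n i" "(y i, w i)"] that by (auto simp: yy_def ww_def ps(4))
    then show "norm (yy n i) \<le> norm (y i) + 1" "\<bar>ww n i\<bar> \<le> \<bar>w i\<bar> + 1"
      using norm_triangle_ineq2[of "yy n i" "y i"] by (auto simp: dist_norm)
  qed
  let ?g = "\<lambda>x. x - gibbs_mean (real \<kappa>) N y w x"
  define \<zeta> where "\<zeta> n x = tgrad (real (Suc n)) (real \<kappa>) N (yy n) (ww n) x" for n x
  have gm[measurable]: "gibbs_mean (real \<kappa>) N y w \<in> borel_measurable borel"
    by (rule borel_measurable_continuous_onI[OF gibbs_mean_continuous[OF N]])
  have zm[measurable]: "\<zeta> n \<in> borel_measurable borel" for n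
    unfolding \<zeta>_def by (rule borel_measurable_continuous_onI[OF tgrad_continuous[OF N]])
  define A where "A = ln (real N) / real \<kappa> + (\<Sum>i<N. \<bar>w i\<bar> + 1)"
  define Y where "Y = (\<Sum>i<N. norm (y i) + 1)"
  have zb: "norm (\<zeta> n x) \<le> 5 * Y + (3 + 4 * A) * norm x" for n x
    unfolding \<zeta>_def by (rule tgrad_bound[OF N k0]) (auto simp: A_def Y_def intro!: sum_mono db)
  have gb: "norm (?g x) \<le> (\<Sum>i<N. norm (y i)) + 1 * norm x" for x
    using norm_triangle_ineq4[of x "gibbs_mean (real \<kappa>) N y w x"] gibbs_mean_bound[OF N, of "real \<kappa>" y w x] by linarith
  define a b where "a = 5 * Y + (\<Sum>i<N. norm (y i))" and "b = (3 + 4 * A) + 1"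
  have db2: "norm (?g x - \<zeta> n x) \<le> a + b * norm x" for n x
    using norm_triangle_ineq4[of "?g x" "\<zeta> n x"] zb[of n x] gb[of x] by (simp add: a_def b_def algebra_simps)
  have i2: "integrable \<rho> (\<lambda>x. (norm (?g x - \<zeta> n x))\<^sup>2)" for n
    by (rule P2_integrable_sq_linear[OF Pr _ db2]) measurable
  have "(\<lambda>n. \<integral>x. (norm (?g x - \<zeta> n x))\<^sup>2 \<partial>\<rho>) \<longlonglongrightarrow> (\<integral>x. 0 \<partial>\<rho>)"
  proof (rule integral_dominated_convergence[where w="\<lambda>x. 2 * a\<^sup>2 + 2 * b\<^sup>2 * (norm x)\<^sup>2"])
    show "integrable \<rho> (\<lambda>x. 2 * a\<^sup>2 + 2 * b\<^sup>2 * (norm x)\<^sup>2)" using P2_integrable_norm_sq[OF Pr] by auto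
    show "AE x in \<rho>. (\<lambda>n. (norm (?g x - \<zeta> n x))\<^sup>2) \<longlonglongrightarrow> 0"
    proof (rule AE_I2)
      fix x
      have "(\<lambda>n. \<zeta> n x) \<longlonglongrightarrow> ?g x" unfolding \<zeta>_def by (rule tgrad_tendsto[OF N k0 yl wl])
      then have "(\<lambda>n. (norm (?g x - \<zeta> n x))\<^sup>2) \<longlonglongrightarrow> (norm (?g x - ?g x))\<^sup>2" by (intro tendsto_intros)
      then show "(\<lambda>n. (norm (?g x - \<zeta> n x))\<^sup>2) \<longlonglongrightarrow> 0" by simp
    qed
    fix n
    show "AE x in \<rho>. norm ((norm (?g x - \<zeta> n x))\<^sup>2) \<le> 2 * a\<^sup>2 + 2 * b\<^sup>2 * (norm x)\<^sup>2"
    proof (rule AE_I2)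
      fix x
      have "(norm (?g x - \<zeta> n x))\<^sup>2 \<le> (a + b * norm x)\<^sup>2" using db2 by (intro power_mono) auto
      also have "\<dots> \<le> 2 * a\<^sup>2 + 2 * (b * norm x)\<^sup>2" using sum_squares_bound[of a "b * norm x"] by (simp add: power2_sum)
      finally show "norm ((norm (?g x - \<zeta> n x))\<^sup>2) \<le> 2 * a\<^sup>2 + 2 * b\<^sup>2 * (norm x)\<^sup>2" by (simp add: power_mult_distrib)
    qed
  qed measurable
  then have lim: "(\<lambda>n. \<integral>x. (norm (?g x - \<zeta> n x))\<^sup>2 \<partial>\<rho>) \<longlonglongrightarrow> 0" by simp
  \<comment> \<open>Accounts for the error on both sides of the limit: \<open>|K|\<close> for the
    pairing with the plans and \<open>V\<close> for the pairing with the field, plus 1 for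
    positivity.\<close>
  define W where "W = \<bar>K\<bar> + V + 1"
  have W: "0 < W" using V0 by (simp add: W_def)
  have "\<forall>\<^sub>F n in sequentially. (\<integral>x. (norm (?g x - \<zeta> n x))\<^sup>2 \<partial>\<rho>) < (\<epsilon> / (3 * W))\<^sup>2"
    using lim eps W by (intro order_tendstoD(2)) auto
  then obtain n where "(\<integral>x. (norm (?g x - \<zeta> n x))\<^sup>2 \<partial>\<rho>) < (\<epsilon> / (3 * W))\<^sup>2" by (auto simp: eventually_sequentially)
  then have sq: "sqrt (\<integral>x. (norm (?g x - \<zeta> n x))\<^sup>2 \<partial>\<rho>) < \<epsilon> / (3 * W)"
    using eps W by (intro real_less_lsqrt) auto
  have "((\<lambda>h. ((\<integral>x. tfun (real (Suc n)) (real \<kappa>) N (yy n) (ww n) x \<partial>\<rho>h h) - (\<integral>x. tfun (real (Suc n)) (real \<kappa>) N (yy n) (ww n) x \<partial>\<rho>)) / h)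
          \<longlongrightarrow> (\<integral>x. \<zeta> n x \<bullet> v x \<partial>\<rho>)) (at_right 0)"
    using test[OF zero_less_Suc k ps(2,1), of n n] unfolding ps(3) yy_def ww_def \<zeta>_def by simp
  from tendsto_diff[OF this coupling_test_function_increment[OF Pr Ph p pc tfun_has_derivative[OF N k0] tgrad_continuous[OF N], of "real (Suc n)" "real (Suc n)" "yy n" "ww n"]]
  have "((\<lambda>h. (\<integral>z. \<zeta> n (fst z) \<bullet> (snd z - fst z) \<partial>p h) / h) \<longlongrightarrow> (\<integral>x. \<zeta> n x \<bullet> v x \<partial>\<rho>)) (at_right 0)"
    by (simp add: tfun_vanish \<zeta>_def)
  then have ev: "\<forall>\<^sub>F h in at_right 0. dist ((\<integral>z. \<zeta> n (fst z) \<bullet> (snd z - fst z) \<partial>p h) / h) (\<integral>x. \<zeta> n x \<bullet> v x \<partial>\<rho>) < \<epsilon> / 3"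
    using eps by (intro tendstoD) auto
  have hpos: "\<forall>\<^sub>F h in at_right (0::real). 0 < h" by (simp add: eventually_at_right_less)
  have iv: "integrable \<rho> (\<lambda>x. (norm (v x))\<^sup>2)" by (rule P2_integrable_sq_linear[OF Pr v(1), of V 0]) (use v in auto)
  have ivV: "sqrt (\<integral>x. (norm (v x))\<^sup>2 \<partial>\<rho>) \<le> V"
  proof (rule real_le_lsqrt)
    have "(\<integral>x. (norm (v x))\<^sup>2 \<partial>\<rho>) \<le> (\<integral>x. V\<^sup>2 \<partial>\<rho>)" using iv v(2) by (intro integral_mono power_mono) auto
    then show "(\<integral>x. (norm (v x))\<^sup>2 \<partial>\<rho>) \<le> V\<^sup>2" by (simp add: prob_space)
  qed (use V0 in auto)
  have dv: "\<bar>(\<integral>x. ?g x \<bullet> v x \<partial>\<rho>) - (\<integral>x. \<zeta> n x \<bullet> v x \<partial>\<rho>)\<bar> \<le> \<epsilon> / (3 * W) * V"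
  proof -
    have ig: "integrable \<rho> (\<lambda>x. (norm (?g x))\<^sup>2)" by (rule P2_integrable_sq_linear[OF Pr _ gb]) measurable
    have iz: "integrable \<rho> (\<lambda>x. (norm (\<zeta> n x))\<^sup>2)" by (rule P2_integrable_sq_linear[OF Pr _ zb]) measurable
    have m: "?g \<in> borel_measurable \<rho>" "\<zeta> n \<in> borel_measurable \<rho>" "v \<in> borel_measurable \<rho>" "(\<lambda>x. ?g x - \<zeta> n x) \<in> borel_measurable \<rho>" by measurable
    have "(\<integral>x. ?g x \<bullet> v x \<partial>\<rho>) - (\<integral>x. \<zeta> n x \<bullet> v x \<partial>\<rho>) = (\<integral>x. (?g x - \<zeta> n x) \<bullet> v x \<partial>\<rho>)"
      using L2_Cauchy_Schwarz(1)[OF m(1) ig m(3) iv] L2_Cauchy_Schwarz(1)[OF m(2) iz m(3) iv] by (simp add: inner_diff_left[of "?g _"])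
    also have "\<bar>\<dots>\<bar> \<le> sqrt (\<integral>x. (norm (?g x - \<zeta> n x))\<^sup>2 \<partial>\<rho>) * sqrt (\<integral>x. (norm (v x))\<^sup>2 \<partial>\<rho>)"
      by (rule L2_Cauchy_Schwarz(2)[OF m(4) i2 m(3) iv])
    also have "\<dots> \<le> \<epsilon> / (3 * W) * V" using sq ivV eps W by (intro mult_mono) auto
    finally show ?thesis .
  qed
  show "\<forall>\<^sub>F h in at_right 0. dist ((\<integral>z. (fst z - gibbs_mean (real \<kappa>) N y w (fst z)) \<bullet> (snd z - fst z) \<partial>p h) / h)
           (\<integral>x. (x - gibbs_mean (real \<kappa>) N y w x) \<bullet> v x \<partial>\<rho>) < \<epsilon>"
    using hpos pc ev
  proof eventually_elim
    fix h :: real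
    assume h: "0 < h" "cost (p h) \<le> (K * h)\<^sup>2"
      and dz: "dist ((\<integral>z. \<zeta> n (fst z) \<bullet> (snd z - fst z) \<partial>p h) / h) (\<integral>x. \<zeta> n x \<bullet> v x \<partial>\<rho>) < \<epsilon> / 3"
    let ?Lg = "\<integral>z. (fst z - gibbs_mean (real \<kappa>) N y w (fst z)) \<bullet> (snd z - fst z) \<partial>p h"
    let ?Lz = "\<integral>z. \<zeta> n (fst z) \<bullet> (snd z - fst z) \<partial>p h"
    have j1: "integrable (p h) (\<lambda>z. (fst z - gibbs_mean (real \<kappa>) N y w (fst z)) \<bullet> (snd z - fst z))"
      by (rule coupling_pairing_bound(1)[OF Pr Ph[OF h(1)] p[OF h(1)], of ?g, OF _ gb]) measurable
    have j2: "integrable (p h) (\<lambda>z. \<zeta> n (fst z) \<bullet> (snd z - fst z))"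
      by (rule coupling_pairing_bound(1)[OF Pr Ph[OF h(1)] p[OF h(1)] zm zb])
    have "?Lg - ?Lz = (\<integral>z. (?g (fst z) - \<zeta> n (fst z)) \<bullet> (snd z - fst z) \<partial>p h)"
      using j1 j2 by (subst Bochner_Integration.integral_diff[symmetric]) (auto simp: inner_diff_left)
    also have "\<bar>\<dots>\<bar> \<le> sqrt (\<integral>x. (norm (?g x - \<zeta> n x))\<^sup>2 \<partial>\<rho>) * sqrt (cost (p h))"
      by (rule coupling_pairing_bound(2)[OF Pr Ph[OF h(1)] p[OF h(1)], of "\<lambda>x. ?g x - \<zeta> n x", OF _ db2]) measurable
    also have "\<dots> \<le> \<epsilon> / (3 * W) * (\<bar>K\<bar> * h)"
    proof (rule mult_mono)
      show "sqrt (cost (p h)) \<le> \<bar>K\<bar> * h" using h by (intro real_le_lsqrt) (auto simp: power_mult_distrib)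
    qed (use sq eps W h in \<open>auto simp: cost_nonneg\<close>)
    finally have "\<bar>(?Lg - ?Lz) / h\<bar> \<le> \<epsilon> / (3 * W) * \<bar>K\<bar>"
      using h(1) by (simp add: abs_div field_simps)
    then have 1: "\<bar>?Lg / h - ?Lz / h\<bar> \<le> \<epsilon> / (3 * W) * \<bar>K\<bar>" by (simp add: diff_divide_distrib)
    have "\<epsilon> / (3 * W) * \<bar>K\<bar> + \<epsilon> / (3 * W) * V \<le> \<epsilon> / (3 * W) * W"
      unfolding distrib_left[symmetric] using eps W by (intro mult_left_mono) (auto simp: W_def)
    also have "\<dots> = \<epsilon> / 3" using W by simp
    finally have "\<epsilon> / (3 * W) * \<bar>K\<bar> + \<epsilon> / (3 * W) * V \<le> \<epsilon> / 3" .
    then show "dist (?Lg / h) (\<integral>x. ?g x \<bullet> v x \<partial>\<rho>) < \<epsilon>"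
      using 1 dv dz eps unfolding dist_real_def by linarith
  qed
qed

section \<open>The Markov chain of a policy\<close>

text \<open>\<open>measure_of\<close> returns the intended set function only where that function is
  countably additive. A step of the chain, the visitation measure and the initial law are all given
  in this form; homogeneity, additivity and monotone continuity of the functional on nonnegative
  functions yield additivity and the integral formula at once.\<close>

lemma measure_of_functional:
  fixes \<Phi> :: "('x::euclidean_space \<Rightarrow> ennreal) \<Rightarrow> ennreal"
  assumes cm: "\<And>c f. f \<in> borel_measurable borel \<Longrightarrow> \<Phi> (\<lambda>x. c * f x) = c * \<Phi> f"
    and ad: "\<And>f g. f \<in> borel_measurable borel \<Longrightarrow> g \<in> borel_measurable borel \<Longrightarrow> \<Phi> (\<lambda>x. f x + g x) = \<Phi> f + \<Phi> g"
    and mc: "\<And>F. (\<And>i::nat. F i \<in> borel_measurable borel) \<Longrightarrow> incseq F \<Longrightarrow> \<Phi> (\<lambda>x. SUP i. F i x) = (SUP i. \<Phi> (F i))"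
  defines "M \<equiv> measure_of UNIV (sets borel) (\<lambda>A. \<Phi> (indicator A))"
  shows "sets M = sets borel" "\<And>f. f \<in> borel_measurable borel \<Longrightarrow> (\<integral>\<^sup>+x. f x \<partial>M) = \<Phi> f"
proof -
  have z: "\<Phi> (\<lambda>x. 0) = 0" using cm[of "\<lambda>x. 0" 0] by simp
  show sM: "sets M = sets borel" unfolding M_def
    using sets.sigma_sets_eq[of "borel :: 'x measure"] by (simp add: sets_measure_of_conv)
  have ca: "countably_additive (sets borel) (\<lambda>A. \<Phi> (indicator A))"
    unfolding countably_additive_def
  proof (intro allI impI)
    fix A :: "nat \<Rightarrow> 'x set" assume A: "range A \<subseteq> sets borel" "disjoint_family A" "(\<Union>i. A i) \<in> sets borel"
    then have Am[measurable]: "A i \<in> sets borel" for i by auto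
    define F where "F n x = (\<Sum>i<n. indicator (A i) x :: ennreal)" for n x
    have Fm: "F n \<in> borel_measurable borel" for n unfolding F_def by measurable
    have inc: "incseq F" unfolding incseq_def le_fun_def F_def by (auto intro!: sum_mono2)
    have PF: "\<Phi> (F n) = (\<Sum>i<n. \<Phi> (indicator (A i)))" for n
    proof (induction n)
      case 0 then show ?case using z by (simp add: F_def[abs_def])
    next
      case (Suc n)
      have "F (Suc n) = (\<lambda>x. F n x + indicator (A n) x)" by (auto simp: F_def)
      then show ?case using ad[OF Fm, of "indicator (A n)" n] Suc by simp
    qed
    have "indicator (\<Union>i. A i) = (\<lambda>x. SUP n. F n x)"
    proof
      fix x
      have "(SUP n. F n x) = (\<Sum>i. indicator (A i) x)" unfolding F_def by (rule suminf_eq_SUP[symmetric])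
      also have "\<dots> = indicator (\<Union>i. A i) x" by (rule suminf_indicator[OF A(2)])
      finally show "indicator (\<Union>i. A i) x = (SUP n. F n x)" by simp
    qed
    then have "\<Phi> (indicator (\<Union>i. A i)) = (SUP n. \<Phi> (F n))" using mc[OF Fm inc] by simp
    also have "\<dots> = (\<Sum>i. \<Phi> (indicator (A i)))" unfolding PF by (rule suminf_eq_SUP[symmetric])
    finally show "(\<Sum>i. \<Phi> (indicator (A i))) = \<Phi> (indicator (\<Union>i. A i))" by simp
  qed
  have z': "\<Phi> (indicator {}) = 0" using z by (simp add: indicator_def[abs_def])
  have em: "emeasure M A = \<Phi> (indicator A)" if "A \<in> sets borel" for A
    unfolding M_def
  proof (rule emeasure_measure_of_sigma[OF _ _ ca that])
    show "sigma_algebra UNIV (sets (borel :: 'x measure))" using sets.sigma_algebra_axioms[of "borel :: 'x measure"] by simp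
    show "positive (sets borel) (\<lambda>A. \<Phi> (indicator A))" using z' by (simp add: positive_def)
  qed
  fix f :: "'x \<Rightarrow> ennreal" assume f: "f \<in> borel_measurable borel"
  then show "(\<integral>\<^sup>+x. f x \<partial>M) = \<Phi> f"
  proof (induction rule: borel_measurable_induct)
    case (cong f g)
    then have "f = g" by auto
    then show ?case using cong by simp
  next
    case (set A) then show ?case using em[of A] sM by simp
  next
    case (mult u c)
    then have "u \<in> borel_measurable M" using sM by (simp cong: measurable_cong_sets)
    then show ?case using mult by (simp add: nn_integral_cmult cm)
  next
    case (add u v)
    then have "u \<in> borel_measurable M" "v \<in> borel_measurable M" using sM by (simp_all cong: measurable_cong_sets)
    then show ?case using add by (simp add: nn_integral_add ad)
  next
    case (seq U)
    then have m: "U i \<in> borel_measurable M" for i using sM by (simp cong: measurable_cong_sets)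
    have e: "Sup (range U) = (\<lambda>x. SUP i. U i x)" by (auto simp: fun_eq_iff image_comp)
    show ?case unfolding e using seq m by (simp add: nn_integral_monotone_convergence_SUP mc)
  qed
qed

section \<open>Transition kernel and visitation measures of a policy\<close>

locale mdp_policy =
  fixes S :: "'s::euclidean_space set" and Act :: "'a::euclidean_space set"
    and P :: "'s \<Rightarrow> 's \<Rightarrow> 'a \<Rightarrow> real" and r :: "'s \<Rightarrow> 'a \<Rightarrow> real" and \<gamma> :: real and \<pi> :: "'s \<Rightarrow> 'a \<Rightarrow> real"
  assumes mdp: "MDP S Act P r \<gamma>" and pol: "policy S Act \<pi>"
begin

lemma gamma: "0 < \<gamma>" "\<gamma> < 1"
  using mdp by (auto simp: MDP_def)

lemma S_sets [measurable]: "S \<in> sets borel" "Act \<in> sets borel"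
  using mdp by (auto simp: MDP_def)

lemma SA_sets [measurable]: "S \<times> Act \<in> sets borel"
  unfolding borel_prod[symmetric] by measurable

lemma P_measurable:
  assumes f: "f \<in> borel_measurable M" and g: "g \<in> borel_measurable M" and h: "h \<in> borel_measurable M"
  shows "(\<lambda>w. P (f w) (g w) (h w)) \<in> borel_measurable M"
proof -
  have "(\<lambda>(s', s, a). P s' s a) \<in> borel_measurable borel" using mdp by (simp add: MDP_def)
  from measurable_compose[OF borel_measurable_Pair[OF f borel_measurable_Pair[OF g h]] this] show ?thesis by simp
qed

lemma pi_measurable:
  assumes f: "f \<in> borel_measurable M" and g: "g \<in> borel_measurable M"
  shows "(\<lambda>w. \<pi> (f w) (g w)) \<in> borel_measurable M"
proof -
  have "(\<lambda>(s, a). \<pi> s a) \<in> borel_measurable borel" using pol by (simp add: policy_def)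
  from measurable_compose[OF borel_measurable_Pair[OF f g] this] show ?thesis by simp
qed

text \<open>Density of the next state-action pair with respect to Lebesgue measure on the product
  space; it merges the iterated integrals over states and actions into one.\<close>

definition ker :: "'s \<times> 'a \<Rightarrow> 's \<times> 'a \<Rightarrow> real" where
  "ker x z = indicator S (fst z) * P (fst z) (fst x) (snd x) * (indicator Act (snd z) * \<pi> (fst z) (snd z))"

text \<open>Counterpart of \<open>Pt\<close> on nonnegative functions, free of integrability
  conditions. The measures of the chain are defined through it, whereas \<open>Pt\<close> acts on
  the real functions produced by the network.\<close>

definition Kf :: "('s \<times> 'a \<Rightarrow> ennreal) \<Rightarrow> 's \<times> 'a \<Rightarrow> ennreal" where
  "Kf f x = (\<integral>\<^sup>+ s'. indicator S s' * ennreal (P s' (fst x) (snd x)) *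
          (\<integral>\<^sup>+ a'. indicator Act a' * ennreal (\<pi> s' a') * f (s', a') \<partial>lborel) \<partial>lborel)"

lemma inner_measurable:
  assumes f: "f \<in> borel_measurable borel"
  shows "(\<lambda>s'. \<integral>\<^sup>+ a'. indicator Act a' * ennreal (\<pi> s' a') * f (s', a') \<partial>lborel) \<in> borel_measurable borel"
proof -
  have [measurable]: "(\<lambda>z. \<pi> (fst z) (snd z)) \<in> borel_measurable (borel \<Otimes>\<^sub>M lborel)" by (rule pi_measurable) measurable
  have "(\<lambda>z. f (fst z, snd z)) \<in> borel_measurable (borel \<Otimes>\<^sub>M lborel)"
    by (rule measurable_compose[OF _ f]) measurable
  then have [measurable]: "f \<in> borel_measurable (borel \<Otimes>\<^sub>M lborel)" by simp
  have "(\<lambda>s'. \<integral>\<^sup>+ a'. (\<lambda>(s', a'). indicator Act a' * ennreal (\<pi> s' a') * f (s', a')) (s', a') \<partial>lborel) \<in> borel_measurable borel"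
    by (rule lborel.borel_measurable_nn_integral) (simp add: split_beta')
  then show ?thesis by simp
qed

lemma Kf_measurable:
  assumes f: "f \<in> borel_measurable borel"
  shows "Kf f \<in> borel_measurable borel"
proof -
  note [measurable] = inner_measurable[OF f]
  have [measurable]: "(\<lambda>z. P (snd z) (fst (fst z)) (snd (fst z))) \<in> borel_measurable (borel \<Otimes>\<^sub>M lborel)" by (rule P_measurable) measurable
  have "(\<lambda>x. \<integral>\<^sup>+ s'. (\<lambda>(x, s'). indicator S s' * ennreal (P s' (fst x) (snd x)) *
          (\<integral>\<^sup>+ a'. indicator Act a' * ennreal (\<pi> s' a') * f (s', a') \<partial>lborel)) (x, s') \<partial>lborel) \<in> borel_measurable borel"
    by (rule lborel.borel_measurable_nn_integral) (simp add: split_beta')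
  then show ?thesis by (simp add: Kf_def[abs_def])
qed

lemma Kf_cmult:
  assumes f: "f \<in> borel_measurable borel"
  shows "Kf (\<lambda>x. c * f x) = (\<lambda>x. c * Kf f x)"
proof
  fix x
  have [measurable]: "(\<lambda>a'. \<pi> s' a') \<in> borel_measurable lborel" for s' by (rule pi_measurable) measurable
  have [measurable]: "(\<lambda>a'. f (s', a')) \<in> borel_measurable lborel" for s' by (rule measurable_compose[OF _ f]) measurable
  note [measurable] = inner_measurable[OF f]
  have [measurable]: "(\<lambda>s'. P s' (fst x) (snd x)) \<in> borel_measurable lborel" by (rule P_measurable) measurable
  have "Kf (\<lambda>x. c * f x) x = (\<integral>\<^sup>+ s'. indicator S s' * ennreal (P s' (fst x) (snd x)) *
          (\<integral>\<^sup>+ a'. c * (indicator Act a' * ennreal (\<pi> s' a') * f (s', a')) \<partial>lborel) \<partial>lborel)"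
    by (simp add: Kf_def mult_ac)
  also have "\<dots> = (\<integral>\<^sup>+ s'. indicator S s' * ennreal (P s' (fst x) (snd x)) *
          (c * (\<integral>\<^sup>+ a'. indicator Act a' * ennreal (\<pi> s' a') * f (s', a') \<partial>lborel)) \<partial>lborel)"
    by (subst nn_integral_cmult) auto
  also have "\<dots> = (\<integral>\<^sup>+ s'. c * (indicator S s' * ennreal (P s' (fst x) (snd x)) *
          (\<integral>\<^sup>+ a'. indicator Act a' * ennreal (\<pi> s' a') * f (s', a') \<partial>lborel)) \<partial>lborel)"
    by (simp add: mult_ac)
  also have "\<dots> = c * Kf f x" unfolding Kf_def by (rule nn_integral_cmult) measurable
  finally show "Kf (\<lambda>x. c * f x) x = c * Kf f x" .
qed

lemma Kf_add:
  assumes f: "f \<in> borel_measurable borel" and g: "g \<in> borel_measurable borel"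
  shows "Kf (\<lambda>x. f x + g x) = (\<lambda>x. Kf f x + Kf g x)"
proof
  fix x
  have [measurable]: "(\<lambda>a'. \<pi> s' a') \<in> borel_measurable lborel" for s' by (rule pi_measurable) measurable
  have [measurable]: "(\<lambda>a'. f (s', a')) \<in> borel_measurable lborel" for s' by (rule measurable_compose[OF _ f]) measurable
  have [measurable]: "(\<lambda>a'. g (s', a')) \<in> borel_measurable lborel" for s' by (rule measurable_compose[OF _ g]) measurable
  note [measurable] = inner_measurable[OF f] inner_measurable[OF g]
  have [measurable]: "(\<lambda>s'. P s' (fst x) (snd x)) \<in> borel_measurable lborel" by (rule P_measurable) measurable
  have "Kf (\<lambda>x. f x + g x) x = (\<integral>\<^sup>+ s'. indicator S s' * ennreal (P s' (fst x) (snd x)) *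
          (\<integral>\<^sup>+ a'. indicator Act a' * ennreal (\<pi> s' a') * f (s', a') + indicator Act a' * ennreal (\<pi> s' a') * g (s', a') \<partial>lborel) \<partial>lborel)"
    by (simp add: Kf_def distrib_left)
  also have "\<dots> = (\<integral>\<^sup>+ s'. indicator S s' * ennreal (P s' (fst x) (snd x)) *
          ((\<integral>\<^sup>+ a'. indicator Act a' * ennreal (\<pi> s' a') * f (s', a') \<partial>lborel) + (\<integral>\<^sup>+ a'. indicator Act a' * ennreal (\<pi> s' a') * g (s', a') \<partial>lborel)) \<partial>lborel)"
    by (subst nn_integral_add) auto
  also have "\<dots> = (\<integral>\<^sup>+ s'. indicator S s' * ennreal (P s' (fst x) (snd x)) * (\<integral>\<^sup>+ a'. indicator Act a' * ennreal (\<pi> s' a') * f (s', a') \<partial>lborel)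
      + indicator S s' * ennreal (P s' (fst x) (snd x)) * (\<integral>\<^sup>+ a'. indicator Act a' * ennreal (\<pi> s' a') * g (s', a') \<partial>lborel) \<partial>lborel)"
    by (simp add: distrib_left)
  also have "\<dots> = Kf f x + Kf g x" unfolding Kf_def by (rule nn_integral_add) measurable
  finally show "Kf (\<lambda>x. f x + g x) x = Kf f x + Kf g x" .
qed

lemma Kf_mono: "(\<And>x. f x \<le> g x) \<Longrightarrow> Kf f x \<le> Kf g x"
  unfolding Kf_def by (intro nn_integral_mono mult_left_mono) auto

lemma Kf_SUP:
  assumes F: "\<And>i::nat. F i \<in> borel_measurable borel" and inc: "incseq F"
  shows "Kf (\<lambda>x. SUP i. F i x) x = (SUP i. Kf (F i) x)"
proof -
  have [measurable]: "(\<lambda>a'. \<pi> s' a') \<in> borel_measurable lborel" for s' by (rule pi_measurable) measurable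
  have [measurable]: "(\<lambda>a'. F i (s', a')) \<in> borel_measurable lborel" for s' i by (rule measurable_compose[OF _ F]) measurable
  note [measurable] = inner_measurable[OF F]
  have [measurable]: "(\<lambda>s'. P s' (fst x) (snd x)) \<in> borel_measurable lborel" by (rule P_measurable) measurable
  have le: "F i z \<le> F j z" if "i \<le> j" for i j z by (rule le_funD[OF incseqD[OF inc that]])
  let ?I = "\<lambda>f s'. \<integral>\<^sup>+ a'. indicator Act a' * ennreal (\<pi> s' a') * f (s', a') \<partial>lborel"
  have "?I (\<lambda>x. SUP i. F i x) s' = (SUP i. ?I (F i) s')" for s'
  proof -
    have "?I (\<lambda>x. SUP i. F i x) s' = (\<integral>\<^sup>+ a'. (SUP i. indicator Act a' * ennreal (\<pi> s' a') * F i (s', a')) \<partial>lborel)"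
      by (simp add: SUP_mult_left_ennreal)
    also have "\<dots> = (SUP i. ?I (F i) s')"
      by (rule nn_integral_monotone_convergence_SUP) (auto simp: incseq_def le_fun_def intro!: mult_left_mono le)
    finally show ?thesis .
  qed
  then have "Kf (\<lambda>x. SUP i. F i x) x = (\<integral>\<^sup>+ s'. (SUP i. indicator S s' * ennreal (P s' (fst x) (snd x)) * ?I (F i) s') \<partial>lborel)"
    by (simp add: Kf_def SUP_mult_left_ennreal)
  also have "\<dots> = (SUP i. Kf (F i) x)" unfolding Kf_def
    by (rule nn_integral_monotone_convergence_SUP) (auto simp: incseq_def le_fun_def intro!: mult_left_mono nn_integral_mono le)
  finally show ?thesis .
qed

lemma chain_step:
  assumes M: "sets M = sets borel"
  shows "sets (chain_step S Act P \<pi> M) = sets borel"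
    "f \<in> borel_measurable borel \<Longrightarrow> (\<integral>\<^sup>+x. f x \<partial>chain_step S Act P \<pi> M) = (\<integral>\<^sup>+x. Kf f x \<partial>M)"
proof -
  have [measurable_cong]: "sets M = sets borel" by (rule M)
  have m: "Kf f \<in> borel_measurable M" if "f \<in> borel_measurable borel" for f using Kf_measurable[OF that] by measurable
  let ?F = "\<lambda>f. \<integral>\<^sup>+x. Kf f x \<partial>M"
  have eq: "chain_step S Act P \<pi> M = measure_of UNIV (sets borel) (\<lambda>A. ?F (indicator A))"
    by (simp add: chain_step_def Kf_def)
  have 1: "?F (\<lambda>x. c * f x) = c * ?F f" if "f \<in> borel_measurable borel" for c f
    unfolding Kf_cmult[OF that] by (rule nn_integral_cmult[OF m[OF that]])
  have 2: "?F (\<lambda>x. f x + g x) = ?F f + ?F g" if "f \<in> borel_measurable borel" "g \<in> borel_measurable borel" for f g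
    unfolding Kf_add[OF that] by (rule nn_integral_add[OF m m]) (use that in auto)
  have 3: "?F (\<lambda>x. SUP i. F i x) = (SUP i. ?F (F i))" if F: "\<And>i::nat. F i \<in> borel_measurable borel" "incseq F" for F
    unfolding Kf_SUP[OF F]
    by (rule nn_integral_monotone_convergence_SUP) (use F m in \<open>auto simp: incseq_def le_fun_def intro!: Kf_mono\<close>)
  note * = measure_of_functional[of ?F, OF 1 2 3, folded eq]
  show "sets (chain_step S Act P \<pi> M) = sets borel" by (rule *(1))
  show "f \<in> borel_measurable borel \<Longrightarrow> (\<integral>\<^sup>+x. f x \<partial>chain_step S Act P \<pi> M) = (\<integral>\<^sup>+x. Kf f x \<partial>M)" by (rule *(2))
qed

abbreviation chain where "chain m D \<equiv> (chain_step S Act P \<pi> ^^ m) D"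

lemma sets_chain: "sets D = sets borel \<Longrightarrow> sets (chain m D) = sets borel"
  by (induction m) (auto simp: chain_step)

lemma visit:
  assumes D: "sets D = sets borel"
  shows "sets (visit S Act P \<gamma> \<pi> D) = sets borel"
    "f \<in> borel_measurable borel \<Longrightarrow> (\<integral>\<^sup>+x. f x \<partial>visit S Act P \<gamma> \<pi> D) =
       ennreal (1 - \<gamma>) * (\<Sum>m. ennreal (\<gamma> ^ m) * (\<integral>\<^sup>+x. f x \<partial>chain m D))"
proof -
  let ?F = "\<lambda>f. ennreal (1 - \<gamma>) * (\<Sum>m. ennreal (\<gamma> ^ m) * (\<integral>\<^sup>+x. f x \<partial>chain m D))"
  have sc[measurable_cong]: "sets (chain m D) = sets borel" for m by (rule sets_chain[OF D])
  have m: "f \<in> borel_measurable (chain m D)" if "f \<in> borel_measurable borel" for f :: "'s \<times> 'a \<Rightarrow> ennreal" and m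
    using that by measurable
  have "(\<lambda>A. ?F (indicator A)) A = ennreal (1 - \<gamma>) * (\<Sum>m. ennreal (\<gamma> ^ m) * emeasure (chain m D) A)" if "A \<in> sets borel" for A
    using that sc by simp
  then have eq: "visit S Act P \<gamma> \<pi> D = measure_of UNIV (sets borel) (\<lambda>A. ?F (indicator A))"
    unfolding visit_def by (intro measure_of_eq) (auto simp: sets.sigma_sets_eq[of borel, simplified])
  have 1: "?F (\<lambda>x. c * f x) = c * ?F f" if f: "f \<in> borel_measurable borel" for c f
    using m[OF f] by (simp add: nn_integral_cmult mult.left_commute[of _ c] ennreal_suminf_cmult)
  have 2: "?F (\<lambda>x. f x + g x) = ?F f + ?F g" if f: "f \<in> borel_measurable borel" and g: "g \<in> borel_measurable borel" for f g
    using m[OF f] m[OF g] by (simp add: nn_integral_add distrib_left suminf_add[symmetric])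
  have 3: "?F (\<lambda>x. SUP i. F i x) = (SUP i. ?F (F i))" if F: "\<And>i::nat. F i \<in> borel_measurable borel" "incseq F" for F
  proof -
    have le: "F i z \<le> F j z" if "i \<le> j" for i j z by (rule le_funD[OF incseqD[OF F(2) that]])
    have "(\<integral>\<^sup>+x. (SUP i. F i x) \<partial>chain m D) = (SUP i. \<integral>\<^sup>+x. F i x \<partial>chain m D)" for m
      by (rule nn_integral_monotone_convergence_SUP[OF F(2)]) (rule m[OF F(1)])
    then have "(\<Sum>m. ennreal (\<gamma> ^ m) * (\<integral>\<^sup>+x. (SUP i. F i x) \<partial>chain m D)) = (\<Sum>m. SUP i. ennreal (\<gamma> ^ m) * (\<integral>\<^sup>+x. F i x \<partial>chain m D))"
      by (simp add: SUP_mult_left_ennreal)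
    also have "\<dots> = (SUP i. \<Sum>m. ennreal (\<gamma> ^ m) * (\<integral>\<^sup>+x. F i x \<partial>chain m D))"
      by (rule ennreal_suminf_SUP_eq) (auto simp: incseq_def intro!: mult_left_mono nn_integral_mono le)
    finally show ?thesis by (simp add: SUP_mult_left_ennreal)
  qed
  note * = measure_of_functional[of ?F, OF 1 2 3, folded eq]
  show "sets (visit S Act P \<gamma> \<pi> D) = sets borel" by (rule *(1))
  show "f \<in> borel_measurable borel \<Longrightarrow> (\<integral>\<^sup>+x. f x \<partial>visit S Act P \<gamma> \<pi> D) = ?F f" by (rule *(2))
qed

text \<open>Splitting off the first term of the geometric series leaves \<gamma> times the same
  series after one more step of the chain.\<close>

lemma visit_fixpoint:
  assumes D: "sets D = sets borel" and f: "f \<in> borel_measurable borel"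
  shows "(\<integral>\<^sup>+x. f x \<partial>visit S Act P \<gamma> \<pi> D) =
     ennreal (1 - \<gamma>) * (\<integral>\<^sup>+x. f x \<partial>D) + ennreal \<gamma> * (\<integral>\<^sup>+x. Kf f x \<partial>visit S Act P \<gamma> \<pi> D)"
proof -
  let ?a = "\<lambda>m. ennreal (\<gamma> ^ m) * (\<integral>\<^sup>+x. f x \<partial>chain m D)"
  have a: "?a (Suc m) = ennreal \<gamma> * (ennreal (\<gamma> ^ m) * (\<integral>\<^sup>+x. Kf f x \<partial>chain m D))" for m
    using chain_step(2)[OF sets_chain[OF D, of m] f] gamma by (simp add: ennreal_mult mult.assoc)
  have "(\<Sum>m. ?a m) = ?a 0 + (\<Sum>m. ?a (Suc m))"
    using suminf_offset[of ?a 1] by (simp add: add.commute)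
  also have "(\<Sum>m. ?a (Suc m)) = ennreal \<gamma> * (\<Sum>m. ennreal (\<gamma> ^ m) * (\<integral>\<^sup>+x. Kf f x \<partial>chain m D))"
    unfolding a by (rule ennreal_suminf_cmult)
  finally show ?thesis
    unfolding visit(2)[OF D f] visit(2)[OF D Kf_measurable[OF f]] by (simp add: distrib_left mult.left_commute)
qed

lemma pi_nonneg: "s \<in> S \<Longrightarrow> a \<in> Act \<Longrightarrow> 0 \<le> \<pi> s a"
  using pol by (auto simp: policy_def)

lemma P_nonneg: "s \<in> S \<Longrightarrow> a \<in> Act \<Longrightarrow> 0 \<le> P s' s a"
  using mdp by (auto simp: MDP_def)

lemma pi_nn: "s \<in> S \<Longrightarrow> (\<integral>\<^sup>+a'. indicator Act a' * ennreal (\<pi> s a') \<partial>lborel) = 1"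
proof -
  assume s: "s \<in> S"
  have "(\<integral>\<^sup>+a'. indicator Act a' * ennreal (\<pi> s a') \<partial>lborel) = (\<integral>\<^sup>+a'. ennreal (indicator Act a' * \<pi> s a') \<partial>lborel)"
    by (intro nn_integral_cong) (auto simp: indicator_def)
  also have "\<dots> = ennreal (\<integral>a'. indicator Act a' * \<pi> s a' \<partial>lborel)"
    using pol s by (intro nn_integral_eq_integral) (auto simp: policy_def indicator_def)
  finally show ?thesis using pol s by (simp add: policy_def)
qed

lemma P_nn: "x \<in> S \<times> Act \<Longrightarrow> (\<integral>\<^sup>+s'. indicator S s' * ennreal (P s' (fst x) (snd x)) \<partial>lborel) = 1"
proof -
  assume x: "x \<in> S \<times> Act"
  then have x': "fst x \<in> S" "snd x \<in> Act" by auto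
  have "(\<integral>\<^sup>+s'. indicator S s' * ennreal (P s' (fst x) (snd x)) \<partial>lborel) = (\<integral>\<^sup>+s'. ennreal (indicator S s' * P s' (fst x) (snd x)) \<partial>lborel)"
    by (intro nn_integral_cong) (auto simp: indicator_def)
  also have "\<dots> = ennreal (\<integral>s'. indicator S s' * P s' (fst x) (snd x) \<partial>lborel)"
    using mdp x' by (intro nn_integral_eq_integral) (auto simp: MDP_def indicator_def)
  finally show ?thesis using mdp x' by (simp add: MDP_def)
qed

lemma Kf_indicator_SA:
  assumes x: "x \<in> S \<times> Act" shows "Kf (indicator (S \<times> Act)) x = 1" "Kf (\<lambda>_. 1) x = 1"
proof -
  have "Kf (indicator (S \<times> Act)) x = (\<integral>\<^sup>+ s'. indicator S s' * ennreal (P s' (fst x) (snd x)) \<partial>lborel)"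
    unfolding Kf_def
  proof (intro nn_integral_cong)
    fix s'
    show "indicator S s' * ennreal (P s' (fst x) (snd x)) * (\<integral>\<^sup>+ a'. indicator Act a' * ennreal (\<pi> s' a') * indicator (S \<times> Act) (s', a') \<partial>lborel)
      = indicator S s' * ennreal (P s' (fst x) (snd x))"
    proof (cases "s' \<in> S")
      case True
      have "(\<integral>\<^sup>+ a'. indicator Act a' * ennreal (\<pi> s' a') * indicator (S \<times> Act) (s', a') \<partial>lborel) = (\<integral>\<^sup>+ a'. indicator Act a' * ennreal (\<pi> s' a') \<partial>lborel)"
        using True by (intro nn_integral_cong) (auto simp: indicator_def)
      then show ?thesis using pi_nn[OF True] by simp
    qed simp
  qed
  then show "Kf (indicator (S \<times> Act)) x = 1" using P_nn[OF x] by simp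
  have "Kf (\<lambda>_. 1) x = (\<integral>\<^sup>+ s'. indicator S s' * ennreal (P s' (fst x) (snd x)) \<partial>lborel)"
    unfolding Kf_def
  proof (intro nn_integral_cong)
    fix s'
    show "indicator S s' * ennreal (P s' (fst x) (snd x)) * (\<integral>\<^sup>+ a'. indicator Act a' * ennreal (\<pi> s' a') * 1 \<partial>lborel)
      = indicator S s' * ennreal (P s' (fst x) (snd x))"
      using pi_nn[of s'] by (cases "s' \<in> S") simp_all
  qed
  then show "Kf (\<lambda>_. 1) x = 1" using P_nn[OF x] by simp
qed

text \<open>Kernel and policy are normalised only on \<open>S \<times> Act\<close>, so conservation
  of mass along the chain is available for measures concentrated there.\<close>

definition onSA :: "('s \<times> 'a) measure \<Rightarrow> bool" where
  "onSA M \<longleftrightarrow> prob_space M \<and> sets M = sets borel \<and> emeasure M (S \<times> Act) = 1"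

lemma onSA_AE: "onSA M \<Longrightarrow> AE x in M. x \<in> S \<times> Act"
proof -
  assume M: "onSA M"
  interpret prob_space M using M by (simp add: onSA_def)
  show ?thesis using M prob_space.prob_Collect_eq_1[OF prob_space_axioms, of "\<lambda>x. x \<in> S \<times> Act"]
    AE_in_set_eq_1[of "S \<times> Act"] by (simp add: onSA_def emeasure_eq_measure)
qed

lemma onSA_I:
  assumes s: "sets M = sets borel" and 1: "(\<integral>\<^sup>+x. 1 \<partial>M) = 1" and 2: "(\<integral>\<^sup>+x. indicator (S \<times> Act) x \<partial>M) = 1"
  shows "onSA M"
proof -
  have "prob_space M" by standard (use 1 in simp)
  then show ?thesis using s 2 by (simp add: onSA_def)
qed

lemma onSA_chain_step: "onSA M \<Longrightarrow> onSA (chain_step S Act P \<pi> M)"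
proof -
  assume M: "onSA M"
  interpret prob_space M using M by (simp add: onSA_def)
  have s: "sets M = sets borel" using M by (simp add: onSA_def)
  have "(\<integral>\<^sup>+x. Kf (indicator (S \<times> Act)) x \<partial>M) = (\<integral>\<^sup>+x. 1 \<partial>M)" "(\<integral>\<^sup>+x. Kf (\<lambda>_. 1) x \<partial>M) = (\<integral>\<^sup>+x. 1 \<partial>M)"
    by (rule nn_integral_cong_AE; use onSA_AE[OF M] in eventually_elim; simp add: Kf_indicator_SA)+
  note * = this
  show ?thesis
  proof (rule onSA_I[OF chain_step(1)[OF s]])
    show "(\<integral>\<^sup>+x. 1 \<partial>chain_step S Act P \<pi> M) = 1"
      by (subst chain_step(2)[OF s]) (auto simp: * emeasure_space_1)
    show "(\<integral>\<^sup>+x. indicator (S \<times> Act) x \<partial>chain_step S Act P \<pi> M) = 1"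
      by (subst chain_step(2)[OF s]) (auto simp: * emeasure_space_1)
  qed
qed

lemma onSA_chain: "onSA D \<Longrightarrow> onSA (chain m D)"
  by (induction m) (auto intro: onSA_chain_step)

lemma geom_ennreal: "ennreal (1 - \<gamma>) * (\<Sum>m. ennreal (\<gamma> ^ m)) = 1"
proof -
  have "(\<Sum>m. ennreal (\<gamma> ^ m)) = ennreal (1 / (1 - \<gamma>))"
    using gamma by (intro suminf_ennreal_eq geometric_sums) auto
  then show ?thesis using gamma by (simp add: ennreal_mult[symmetric])
qed

lemma onSA_visit: assumes D: "onSA D" shows "onSA (visit S Act P \<gamma> \<pi> D)"
proof -
  have s: "sets D = sets borel" using D by (simp add: onSA_def)
  have 1: "emeasure (chain m D) (S \<times> Act) = 1" "emeasure (chain m D) (space (chain m D)) = 1" for m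
    using onSA_chain[OF D, of m] by (auto simp: onSA_def prob_space.emeasure_space_1)
  show ?thesis
  proof (rule onSA_I[OF visit(1)[OF s]])
    show "(\<integral>\<^sup>+x. 1 \<partial>visit S Act P \<gamma> \<pi> D) = 1"
      by (subst visit(2)[OF s]) (auto simp: 1 geom_ennreal)
    show "(\<integral>\<^sup>+x. indicator (S \<times> Act) x \<partial>visit S Act P \<gamma> \<pi> D) = 1"
      by (subst visit(2)[OF s]) (auto simp: 1 geom_ennreal sets_chain[OF s])
  qed
qed

lemma init_at:
  assumes s: "s \<in> S" shows "onSA (init_at Act \<pi> s)"
proof -
  have [measurable]: "(\<lambda>a'. \<pi> s a') \<in> borel_measurable lborel" by (rule pi_measurable) measurable
  have m[measurable]: "(\<lambda>a. f (s, a)) \<in> borel_measurable lborel" if "f \<in> borel_measurable borel" for f :: "'s \<times> 'a \<Rightarrow> ennreal"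
    by (rule measurable_compose[OF _ that]) measurable
  let ?F = "\<lambda>f. \<integral>\<^sup>+ a. indicator Act a * ennreal (\<pi> s a) * f (s, a) \<partial>lborel"
  have 1: "?F (\<lambda>x. c * f x) = c * ?F f" if f: "f \<in> borel_measurable borel" for c f
    using m[OF f] by (simp add: nn_integral_cmult[symmetric] mult_ac)
  have 2: "?F (\<lambda>x. f x + g x) = ?F f + ?F g" if f: "f \<in> borel_measurable borel" and g: "g \<in> borel_measurable borel" for f g
    using m[OF f] m[OF g] by (simp add: nn_integral_add[symmetric] distrib_left)
  have 3: "?F (\<lambda>x. SUP i. F i x) = (SUP i. ?F (F i))" if F: "\<And>i::nat. F i \<in> borel_measurable borel" "incseq F" for F
  proof -
    have le: "F i z \<le> F j z" if "i \<le> j" for i j z by (rule le_funD[OF incseqD[OF F(2) that]])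
    note [measurable] = m[OF F(1)]
    have "?F (\<lambda>x. SUP i. F i x) = (\<integral>\<^sup>+ a. (SUP i. indicator Act a * ennreal (\<pi> s a) * F i (s, a)) \<partial>lborel)"
      by (simp add: SUP_mult_left_ennreal)
    also have "\<dots> = (SUP i. ?F (F i))"
      by (rule nn_integral_monotone_convergence_SUP) (auto simp: incseq_def le_fun_def intro!: mult_left_mono le)
    finally show ?thesis .
  qed
  let ?M = "measure_of UNIV (sets borel) (\<lambda>A. ?F (indicator A))"
  have *: "sets ?M = sets borel" by (rule measure_of_functional(1)[of ?F, OF 1 2 3])
  have nn: "f \<in> borel_measurable borel \<Longrightarrow> (\<integral>\<^sup>+x. f x \<partial>?M) = ?F f" for f
    by (rule measure_of_functional(2)[of ?F, OF 1 2 3])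
  have eq: "init_at Act \<pi> s = measure_of UNIV (sets borel) (\<lambda>A. ?F (indicator A))" by (simp add: init_at_def)
  show ?thesis unfolding eq
  proof (rule onSA_I)
    have "?F (indicator (S \<times> Act)) = (\<integral>\<^sup>+ a. indicator Act a * ennreal (\<pi> s a) \<partial>lborel)"
      using s by (intro nn_integral_cong) (auto simp: indicator_def)
    then have i1: "?F (indicator (S \<times> Act)) = 1" using pi_nn[OF s] by simp
    have i2: "?F (\<lambda>_. 1) = 1" using pi_nn[OF s] by simp
    show "sets (measure_of UNIV (sets borel) (\<lambda>A. ?F (indicator A))) = sets borel" by (rule *)
    show "(\<integral>\<^sup>+x. 1 \<partial>measure_of UNIV (sets borel) (\<lambda>A. ?F (indicator A))) = 1" by (rule trans[OF nn[OF borel_measurable_const] i2])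
    show "(\<integral>\<^sup>+x. indicator (S \<times> Act) x \<partial>measure_of UNIV (sets borel) (\<lambda>A. ?F (indicator A))) = 1"
      by (rule trans[OF nn[OF borel_measurable_indicator[OF SA_sets]] i1])
  qed
qed

end

section \<open>Transition operator on bounded functions, Bellman equation and coercivity\<close>

context mdp_policy
begin

lemma ker_nonneg: "x \<in> S \<times> Act \<Longrightarrow> 0 \<le> ker x z"
  unfolding ker_def using pi_nonneg[of "fst z" "snd z"] P_nonneg[of "fst x" "snd x" "fst z"] by (auto simp: indicator_def)

lemma ker_outside: "z \<notin> S \<times> Act \<Longrightarrow> ker x z = 0"
  unfolding ker_def by (auto simp: indicator_def mem_Times_iff)

lemma ker_measurable: "ker x \<in> borel_measurable borel"
proof -
  have [measurable]: "(\<lambda>z :: 's \<times> 'a. P (fst z) (fst x) (snd x)) \<in> borel_measurable borel" by (rule P_measurable) measurable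
  have [measurable]: "(\<lambda>z. \<pi> (fst z) (snd z)) \<in> borel_measurable borel" by (rule pi_measurable) measurable
  show ?thesis unfolding ker_def[abs_def] by measurable
qed

lemma ennreal_ker:
  assumes "x \<in> S \<times> Act"
  shows "ennreal (ker x (s', a')) = indicator S s' * ennreal (P s' (fst x) (snd x)) * (indicator Act a' * ennreal (\<pi> s' a'))"
  using assms pi_nonneg[of s' a'] P_nonneg[of "fst x" "snd x" s']
  by (auto simp: ker_def indicator_def ennreal_mult)

lemma Kf_ker:
  assumes x: "x \<in> S \<times> Act" and f: "f \<in> borel_measurable borel"
  shows "Kf f x = (\<integral>\<^sup>+z. ennreal (ker x z) * f z \<partial>lborel)"
proof -
  note [measurable] = ker_measurable f
  have [measurable]: "(\<lambda>a'. \<pi> s' a') \<in> borel_measurable lborel" for s' by (rule pi_measurable) measurable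
  have [measurable]: "(\<lambda>a'. f (s', a')) \<in> borel_measurable lborel" for s' by (rule measurable_compose[OF _ f]) measurable
  have m: "(\<lambda>z. ennreal (ker x z) * f z) \<in> borel_measurable (lborel \<Otimes>\<^sub>M lborel)"
    unfolding lborel_prod by measurable
  have "(\<integral>\<^sup>+z. ennreal (ker x z) * f z \<partial>lborel) = (\<integral>\<^sup>+z. ennreal (ker x z) * f z \<partial>(lborel \<Otimes>\<^sub>M lborel))"
    unfolding lborel_prod ..
  also have "\<dots> = (\<integral>\<^sup>+s'. \<integral>\<^sup>+a'. ennreal (ker x (s', a')) * f (s', a') \<partial>lborel \<partial>lborel)"
    by (rule lborel.nn_integral_fst[OF m, symmetric])
  also have "\<dots> = Kf f x" unfolding Kf_def
  proof (rule nn_integral_cong)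
    fix s'
    have "(\<integral>\<^sup>+a'. ennreal (ker x (s', a')) * f (s', a') \<partial>lborel) =
      (\<integral>\<^sup>+a'. (indicator S s' * ennreal (P s' (fst x) (snd x))) * (indicator Act a' * ennreal (\<pi> s' a') * f (s', a')) \<partial>lborel)"
      unfolding ennreal_ker[OF x] by (simp add: mult.assoc)
    also have "\<dots> = indicator S s' * ennreal (P s' (fst x) (snd x)) * (\<integral>\<^sup>+a'. indicator Act a' * ennreal (\<pi> s' a') * f (s', a') \<partial>lborel)"
      by (rule nn_integral_cmult) measurable
    finally show "(\<integral>\<^sup>+a'. ennreal (ker x (s', a')) * f (s', a') \<partial>lborel) =
      indicator S s' * ennreal (P s' (fst x) (snd x)) * (\<integral>\<^sup>+a'. indicator Act a' * ennreal (\<pi> s' a') * f (s', a') \<partial>lborel)" .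
  qed
  finally show ?thesis by simp
qed

lemma ker_nn: "x \<in> S \<times> Act \<Longrightarrow> (\<integral>\<^sup>+z. ennreal (ker x z) \<partial>lborel) = 1"
  using Kf_ker[of x "\<lambda>_. 1"] Kf_indicator_SA(2)[of x] by simp

lemma ker_integrable: "x \<in> S \<times> Act \<Longrightarrow> integrable lborel (ker x)"
  by (rule integrableI_nonneg) (use ker_measurable ker_nonneg ker_nn in auto)

lemma ker_integral: "x \<in> S \<times> Act \<Longrightarrow> (\<integral>z. ker x z \<partial>lborel) = 1"
proof -
  assume x: "x \<in> S \<times> Act"
  have "ennreal (\<integral>z. ker x z \<partial>lborel) = 1"
    using nn_integral_eq_integral[OF ker_integrable[OF x]] ker_nonneg[OF x] ker_nn[OF x] by simp
  then show ?thesis by simp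
qed

lemma ker_mult_integrable:
  assumes x: "x \<in> S \<times> Act" and f: "f \<in> borel_measurable borel" and B: "\<And>z. z \<in> S \<times> Act \<Longrightarrow> \<bar>f z\<bar> \<le> B"
  shows "integrable lborel (\<lambda>z. ker x z * f z)" "\<bar>\<integral>z. ker x z * f z \<partial>lborel\<bar> \<le> B"
proof -
  note [measurable] = ker_measurable f
  have b: "\<bar>ker x z * f z\<bar> \<le> B * ker x z" for z
  proof (cases "z \<in> S \<times> Act")
    case True
    have "ker x z * \<bar>f z\<bar> \<le> ker x z * B" using B[OF True] ker_nonneg[OF x] by (intro mult_left_mono) auto
    then show ?thesis using ker_nonneg[OF x, of z] by (simp add: abs_mult mult.commute)
  next
    case False then show ?thesis using ker_outside[of z x] by simp
  qed
  have iB: "integrable lborel (\<lambda>z. B * ker x z)" using ker_integrable[OF x] by simp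
  show i: "integrable lborel (\<lambda>z. ker x z * f z)"
    by (rule Bochner_Integration.integrable_bound[OF iB]) (measurable, intro AE_I2, use b in \<open>simp only: real_norm_def order_trans[OF _ abs_ge_self]\<close>)
  have "\<bar>\<integral>z. ker x z * f z \<partial>lborel\<bar> \<le> (\<integral>z. \<bar>ker x z * f z\<bar> \<partial>lborel)" by (rule integral_abs_bound)
  also have "\<dots> \<le> (\<integral>z. B * ker x z \<partial>lborel)" using i iB b by (intro integral_mono) auto
  also have "\<dots> = B" using ker_integral[OF x] by simp
  finally show "\<bar>\<integral>z. ker x z * f z \<partial>lborel\<bar> \<le> B" .
qed

text \<open>Fubini merges the two integrals into one against the probability density
  \<open>ker x\<close>. Boundedness of \<open>f\<close> on \<open>S \<times> Act\<close> supplies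
  the integrability, and values of \<open>f\<close> elsewhere are annihilated by the
  density.\<close>

lemma Pt_ker:
  assumes x: "x \<in> S \<times> Act" and f: "f \<in> borel_measurable borel" and B: "\<And>z. z \<in> S \<times> Act \<Longrightarrow> \<bar>f z\<bar> \<le> B"
  shows "Pt S Act P \<pi> f x = (\<integral>z. ker x z * f z \<partial>lborel)"
proof -
  have i: "integrable (lborel \<Otimes>\<^sub>M lborel) (\<lambda>z. ker x z * f z)" unfolding lborel_prod by (rule ker_mult_integrable(1)[OF x f B])
  have "(\<integral>z. ker x z * f z \<partial>lborel) = (\<integral>z. ker x z * f z \<partial>(lborel \<Otimes>\<^sub>M lborel))" unfolding lborel_prod ..
  also have "\<dots> = (\<integral>s'. \<integral>a'. ker x (s', a') * f (s', a') \<partial>lborel \<partial>lborel)"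
    by (rule lborel_pair.integral_fst'[OF i, symmetric])
  also have "\<dots> = (\<integral>s'. indicator S s' * P s' (fst x) (snd x) * (\<integral>a'. indicator Act a' * \<pi> s' a' * f (s', a') \<partial>lborel) \<partial>lborel)"
    unfolding ker_def fst_conv snd_conv mult.assoc integral_mult_right_zero ..
  finally show ?thesis by (simp add: Pt_def split_beta')
qed

lemma Pt_bound:
  assumes "x \<in> S \<times> Act" "f \<in> borel_measurable borel" "\<And>z. z \<in> S \<times> Act \<Longrightarrow> \<bar>f z\<bar> \<le> B"
  shows "\<bar>Pt S Act P \<pi> f x\<bar> \<le> B"
  using ker_mult_integrable(2)[OF assms] Pt_ker[OF assms] by simp

text \<open>Allows the network at the target measure to stand in for the action-value function, with
  which it is known to agree only on \<open>S \<times> Act\<close>.\<close>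

lemma Pt_cong:
  assumes "\<And>z. z \<in> S \<times> Act \<Longrightarrow> f z = g z"
  shows "Pt S Act P \<pi> f = Pt S Act P \<pi> g"
proof -
  have "indicator S s' * p * (\<integral>a'. indicator Act a' * \<pi> s' a' * f (s', a') \<partial>lborel) =
      indicator S s' * p * (\<integral>a'. indicator Act a' * \<pi> s' a' * g (s', a') \<partial>lborel)" for s' and p :: real
  proof (cases "s' \<in> S")
    case True
    have "(\<integral>a'. indicator Act a' * \<pi> s' a' * f (s', a') \<partial>lborel) = (\<integral>a'. indicator Act a' * \<pi> s' a' * g (s', a') \<partial>lborel)"
      by (intro Bochner_Integration.integral_cong refl) (use assms True in \<open>auto simp: indicator_def\<close>)
    then show ?thesis by simp
  qed simp
  then show ?thesis unfolding Pt_def by (simp only:)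
qed

lemma Pt_measurable:
  assumes f: "f \<in> borel_measurable borel"
  shows "Pt S Act P \<pi> f \<in> borel_measurable borel"
proof -
  have [measurable]: "(\<lambda>z. \<pi> (fst z) (snd z)) \<in> borel_measurable (borel \<Otimes>\<^sub>M lborel)" by (rule pi_measurable) measurable
  have "(\<lambda>z. f (fst z, snd z)) \<in> borel_measurable (borel \<Otimes>\<^sub>M lborel)"
    by (rule measurable_compose[OF _ f]) measurable
  then have [measurable]: "f \<in> borel_measurable (borel \<Otimes>\<^sub>M lborel)" by simp
  have "(\<lambda>s'. \<integral>a'. (\<lambda>(s', a'). indicator Act a' * \<pi> s' a' * f (s', a')) (s', a') \<partial>lborel) \<in> borel_measurable borel"
    by (rule lborel.borel_measurable_lebesgue_integral) (simp add: split_beta')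
  then have [measurable]: "(\<lambda>s'. \<integral>a'. indicator Act a' * \<pi> s' a' * f (s', a') \<partial>lborel) \<in> borel_measurable borel" by simp
  have [measurable]: "(\<lambda>z. P (snd z) (fst (fst z)) (snd (fst z))) \<in> borel_measurable (borel \<Otimes>\<^sub>M lborel)" by (rule P_measurable) measurable
  have "(\<lambda>x. \<integral>s'. (\<lambda>(x, s'). indicator S s' * P s' (fst x) (snd x) * (\<integral>a'. indicator Act a' * \<pi> s' a' * f (s', a') \<partial>lborel)) (x, s') \<partial>lborel) \<in> borel_measurable borel"
    by (rule lborel.borel_measurable_lebesgue_integral) (simp add: split_beta')
  then show ?thesis by (simp add: Pt_def split_beta')
qed

lemma Pt_diff:
  assumes x: "x \<in> S \<times> Act" and f: "f \<in> borel_measurable borel" "\<And>z. z \<in> S \<times> Act \<Longrightarrow> \<bar>f z\<bar> \<le> B"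
    and g: "g \<in> borel_measurable borel" "\<And>z. z \<in> S \<times> Act \<Longrightarrow> \<bar>g z\<bar> \<le> C"
  shows "Pt S Act P \<pi> (\<lambda>z. f z - g z) x = Pt S Act P \<pi> f x - Pt S Act P \<pi> g x"
proof -
  have b: "\<And>z. z \<in> S \<times> Act \<Longrightarrow> \<bar>f z - g z\<bar> \<le> B + C" using f(2) g(2) by (meson abs_triangle_ineq4 add_mono order_trans)
  have m: "(\<lambda>z. f z - g z) \<in> borel_measurable borel" using f g by measurable
  have "Pt S Act P \<pi> (\<lambda>z. f z - g z) x = (\<integral>z. ker x z * (f z - g z) \<partial>lborel)" by (rule Pt_ker[OF x m b])
  also have "\<dots> = (\<integral>z. ker x z * f z \<partial>lborel) - (\<integral>z. ker x z * g z \<partial>lborel)"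
    unfolding right_diff_distrib
    by (rule Bochner_Integration.integral_diff) (rule ker_mult_integrable(1)[OF x f] ker_mult_integrable(1)[OF x g], assumption)+
  also have "(\<integral>z. ker x z * f z \<partial>lborel) = Pt S Act P \<pi> f x" by (rule Pt_ker[OF x f, symmetric])
  also have "(\<integral>z. ker x z * g z \<partial>lborel) = Pt S Act P \<pi> g x" by (rule Pt_ker[OF x g, symmetric])
  finally show ?thesis .
qed

text \<open>Nonnegativity of the variance of \<open>f\<close> under the probability density
  \<open>ker x\<close>. The right-hand side is written with \<open>Kf\<close> so that it can be
  inserted into the fixed-point equation of the visitation measure.\<close>

lemma Pt_Jensen:
  assumes x: "x \<in> S \<times> Act" and f: "f \<in> borel_measurable borel" and B: "\<And>z. z \<in> S \<times> Act \<Longrightarrow> \<bar>f z\<bar> \<le> B"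
  shows "ennreal ((Pt S Act P \<pi> f x)\<^sup>2) \<le> Kf (\<lambda>z. ennreal ((f z)\<^sup>2)) x"
proof -
  note [measurable] = ker_measurable f
  define c where "c = Pt S Act P \<pi> f x"
  have c: "c = (\<integral>z. ker x z * f z \<partial>lborel)" unfolding c_def by (rule Pt_ker[OF x f B])
  have i1: "integrable lborel (\<lambda>z. ker x z * f z)" by (rule ker_mult_integrable(1)[OF x f B])
  have B2: "\<bar>(f z)\<^sup>2\<bar> \<le> B\<^sup>2" if "z \<in> S \<times> Act" for z using B[OF that] by (simp add: abs_le_square_iff[symmetric])
  have i2: "integrable lborel (\<lambda>z. ker x z * (f z)\<^sup>2)" by (rule ker_mult_integrable(1)[OF x _ B2]) measurable
  have "0 \<le> (\<integral>z. ker x z * (f z - c)\<^sup>2 \<partial>lborel)" using ker_nonneg[OF x] by (intro integral_nonneg_AE AE_I2) auto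
  also have "\<dots> = (\<integral>z. ker x z * (f z)\<^sup>2 - 2 * c * (ker x z * f z) + c\<^sup>2 * ker x z \<partial>lborel)"
    by (intro Bochner_Integration.integral_cong refl) (simp add: power2_diff algebra_simps)
  also have "\<dots> = (\<integral>z. ker x z * (f z)\<^sup>2 \<partial>lborel) - 2 * c * c + c\<^sup>2 * 1"
    using i1 i2 ker_integrable[OF x] ker_integral[OF x] c by simp
  finally have "c\<^sup>2 \<le> (\<integral>z. ker x z * (f z)\<^sup>2 \<partial>lborel)" by (simp add: power2_eq_square)
  then have "ennreal (c\<^sup>2) \<le> ennreal (\<integral>z. ker x z * (f z)\<^sup>2 \<partial>lborel)" by (rule ennreal_leI)
  also have "\<dots> = (\<integral>\<^sup>+z. ennreal (ker x z * (f z)\<^sup>2) \<partial>lborel)"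
    using ker_nonneg[OF x] by (intro nn_integral_eq_integral[symmetric] i2) auto
  also have "\<dots> = Kf (\<lambda>z. ennreal ((f z)\<^sup>2)) x"
    using ker_nonneg[OF x] by (subst Kf_ker[OF x]) (auto simp: ennreal_mult)
  finally show ?thesis by (simp add: c_def)
qed

lemma Bellman:
  assumes rB: "\<And>s a. s \<in> S \<Longrightarrow> a \<in> Act \<Longrightarrow> \<bar>r s a\<bar> \<le> Br" and x: "x \<in> S \<times> Act"
  shows "Qpi S Act P r \<gamma> \<pi> x = r (fst x) (snd x) + \<gamma> * Pt S Act P \<pi> (Qpi S Act P r \<gamma> \<pi>) x"
    "Qpi S Act P r \<gamma> \<pi> \<in> borel_measurable borel"
    "\<bar>Qpi S Act P r \<gamma> \<pi> x\<bar> \<le> Br / (1 - \<gamma>)"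
proof -
  define u where "u m = (Pt S Act P \<pi> ^^ m) (\<lambda>(s, a). r s a)" for m
  have um[measurable]: "u m \<in> borel_measurable borel" for m
  proof (induction m)
    case 0 show ?case using mdp by (simp add: u_def MDP_def)
  next
    case (Suc m) then show ?case using Pt_measurable[of "u m"] by (simp add: u_def)
  qed
  have ub: "\<bar>u m z\<bar> \<le> Br" if "z \<in> S \<times> Act" for m z
    using that
  proof (induction m arbitrary: z)
    case 0 then show ?case using rB by (auto simp: u_def)
  next
    case (Suc m)
    have "\<bar>Pt S Act P \<pi> (u m) z\<bar> \<le> Br" by (rule Pt_bound[OF Suc.prems um Suc.IH])
    then show ?case by (simp add: u_def)
  qed
  have Br0: "0 \<le> Br" using ub[OF x, of 0] by simp
  have Q: "Qpi S Act P r \<gamma> \<pi> z = (\<Sum>m. \<gamma> ^ m * u m z)" for z by (simp add: Qpi_def u_def)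
  have geo: "summable (\<lambda>m. \<gamma> ^ m * Br)" "(\<Sum>m. \<gamma> ^ m * Br) = Br / (1 - \<gamma>)"
    using gamma by (auto intro!: summable_mult2 summable_geometric simp: suminf_mult2[symmetric] suminf_geometric)
  have nb: "norm (\<gamma> ^ m * u m z) \<le> \<gamma> ^ m * Br" if "z \<in> S \<times> Act" for m z
    using ub[OF that, of m] gamma by (simp add: abs_mult mult_left_mono)
  have sm: "summable (\<lambda>m. norm (\<gamma> ^ m * u m z))" if "z \<in> S \<times> Act" for z
    by (rule summable_comparison_test[OF _ geo(1)]) (use nb[OF that] in auto)
  show Qm: "Qpi S Act P r \<gamma> \<pi> \<in> borel_measurable borel"
    unfolding Q[abs_def] by measurable
  have Qb: "\<bar>Qpi S Act P r \<gamma> \<pi> z\<bar> \<le> Br / (1 - \<gamma>)" if "z \<in> S \<times> Act" for z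
  proof -
    have "\<bar>\<Sum>m. \<gamma> ^ m * u m z\<bar> \<le> (\<Sum>m. norm (\<gamma> ^ m * u m z))" using summable_norm[OF sm[OF that]] by simp
    also have "\<dots> \<le> (\<Sum>m. \<gamma> ^ m * Br)" by (rule suminf_le[OF nb[OF that] sm[OF that] geo(1)])
    finally show ?thesis using geo Q by simp
  qed
  show "\<bar>Qpi S Act P r \<gamma> \<pi> x\<bar> \<le> Br / (1 - \<gamma>)" by (rule Qb[OF x])
  note [measurable] = ker_measurable
  have "Pt S Act P \<pi> (Qpi S Act P r \<gamma> \<pi>) x = (\<integral>z. ker x z * Qpi S Act P r \<gamma> \<pi> z \<partial>lborel)" by (rule Pt_ker[OF x Qm Qb])
  also have "\<dots> = (\<integral>z. (\<Sum>m. ker x z * (\<gamma> ^ m * u m z)) \<partial>lborel)"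
  proof (rule Bochner_Integration.integral_cong[OF refl])
    fix z show "ker x z * Qpi S Act P r \<gamma> \<pi> z = (\<Sum>m. ker x z * (\<gamma> ^ m * u m z))"
    proof (cases "z \<in> S \<times> Act")
      case True
      then show ?thesis unfolding Q by (intro suminf_mult[symmetric] summable_norm_cancel[OF sm])
    next
      case False then show ?thesis using ker_outside[of z x] by simp
    qed
  qed
  \<comment> \<open>Sum and integral are exchanged under the summable bound
    \<open>\<gamma> ^ m * Br\<close>, which is valid because \<open>Pt\<close> does not increase a
    bound on \<open>S \<times> Act\<close>.\<close>
  also have "\<dots> = (\<Sum>m. \<integral>z. ker x z * (\<gamma> ^ m * u m z) \<partial>lborel)"
  proof (rule integral_suminf)
    have gb: "\<bar>\<gamma> ^ m * u m z\<bar> \<le> \<gamma> ^ m * Br" if "z \<in> S \<times> Act" for m z using nb[OF that] by simp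
    show i: "integrable lborel (\<lambda>z. ker x z * (\<gamma> ^ m * u m z))" for m
      by (rule ker_mult_integrable(1)[OF x _ gb]) measurable
    show "AE z in lborel. summable (\<lambda>m. norm (ker x z * (\<gamma> ^ m * u m z)))"
    proof (rule AE_I2)
      fix z show "summable (\<lambda>m. norm (ker x z * (\<gamma> ^ m * u m z)))"
      proof (cases "z \<in> S \<times> Act")
        case True
        then show ?thesis unfolding norm_mult[of "ker x z"] by (intro summable_mult sm)
      next
        case False then show ?thesis using ker_outside[of z x] by simp
      qed
    qed
    show "summable (\<lambda>m. \<integral>z. norm (ker x z * (\<gamma> ^ m * u m z)) \<partial>lborel)"
    proof (rule summable_comparison_test[OF _ geo(1)], intro exI allI impI)
      fix m :: nat
      have "(\<integral>z. norm (ker x z * (\<gamma> ^ m * u m z)) \<partial>lborel) = (\<integral>z. ker x z * \<bar>\<gamma> ^ m * u m z\<bar> \<partial>lborel)"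
        using ker_nonneg[OF x] by (simp add: abs_mult)
      moreover have "\<bar>\<integral>z. ker x z * \<bar>\<gamma> ^ m * u m z\<bar> \<partial>lborel\<bar> \<le> \<gamma> ^ m * Br"
        by (rule ker_mult_integrable(2)[OF x]) (use gb in auto)
      ultimately show "norm (\<integral>z. norm (ker x z * (\<gamma> ^ m * u m z)) \<partial>lborel) \<le> \<gamma> ^ m * Br" by simp
    qed
  qed
  also have "\<dots> = (\<Sum>m. \<gamma> ^ m * u (Suc m) x)"
  proof (rule suminf_cong)
    fix m
    have "(\<integral>z. ker x z * (\<gamma> ^ m * u m z) \<partial>lborel) = \<gamma> ^ m * (\<integral>z. ker x z * u m z \<partial>lborel)"
      by (simp add: mult.left_commute)
    also have "(\<integral>z. ker x z * u m z \<partial>lborel) = u (Suc m) x" using Pt_ker[OF x um ub, of m] by (simp add: u_def)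
    finally show "(\<integral>z. ker x z * (\<gamma> ^ m * u m z) \<partial>lborel) = \<gamma> ^ m * u (Suc m) x" .
  qed
  finally have Pt: "Pt S Act P \<pi> (Qpi S Act P r \<gamma> \<pi>) x = (\<Sum>m. \<gamma> ^ m * u (Suc m) x)" .
  have s1: "summable (\<lambda>m. \<gamma> ^ m * u (Suc m) x)"
    by (rule summable_norm_cancel, rule summable_comparison_test[OF _ geo(1)])
       (use ub[OF x] gamma in \<open>auto simp: abs_mult intro!: exI[of _ 0] mult_left_mono\<close>)
  have "Qpi S Act P r \<gamma> \<pi> x = (\<Sum>m. \<gamma> ^ m * u m x)" by (rule Q)
  also have "\<dots> = \<gamma> ^ 0 * u 0 x + (\<Sum>m. \<gamma> ^ Suc m * u (Suc m) x)"
    using suminf_split_head[OF summable_norm_cancel[OF sm[OF x]]] by simp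
  also have "(\<Sum>m. \<gamma> ^ Suc m * u (Suc m) x) = \<gamma> * (\<Sum>m. \<gamma> ^ m * u (Suc m) x)"
    using suminf_mult[OF s1, of \<gamma>] by (simp add: mult.assoc)
  finally show "Qpi S Act P r \<gamma> \<pi> x = r (fst x) (snd x) + \<gamma> * Pt S Act P \<pi> (Qpi S Act P r \<gamma> \<pi>) x"
    unfolding Pt by (simp add: u_def split_beta')
qed

text \<open>The visitation measure satisfies \<open>\<Phi> = (1 - \<gamma>) D + \<gamma> \<Phi> P\<close>, so the second moment of \<open>P e\<close>
  is controlled by Jensen's inequality.\<close>

lemma TD_coercive:
  assumes D: "onSA D" and em: "f \<in> borel_measurable borel" and B: "\<And>z. \<bar>f z\<bar> \<le> B"
  shows "(1 - sqrt \<gamma>) * (\<integral>x. (f x)\<^sup>2 \<partial>D) \<le> (\<integral>x. (f x - \<gamma> * Pt S Act P \<pi> f x) * f x \<partial>visit S Act P \<gamma> \<pi> D)"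
proof -
  let ?\<Phi> = "visit S Act P \<gamma> \<pi> D"
  have \<Phi>: "onSA ?\<Phi>" by (rule onSA_visit[OF D])
  interpret d: prob_space D using D by (simp add: onSA_def)
  interpret p: prob_space ?\<Phi> using \<Phi> by (simp add: onSA_def)
  have sD: "sets D = sets borel" using D by (simp add: onSA_def)
  have [measurable_cong]: "sets D = sets borel" by (rule sD)
  have [measurable_cong]: "sets ?\<Phi> = sets borel" using \<Phi> by (simp add: onSA_def)
  note [measurable] = em Pt_measurable[OF em]
  have f2: "(f z)\<^sup>2 \<le> B\<^sup>2" for z using B[of z] by (simp add: abs_le_square_iff[symmetric])
  have Pb: "\<bar>Pt S Act P \<pi> f x\<bar> \<le> B" if "x \<in> S \<times> Act" for x by (rule Pt_bound[OF that em B])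
  have ip: "integrable ?\<Phi> (\<lambda>x. (f x)\<^sup>2)" "integrable D (\<lambda>x. (f x)\<^sup>2)"
    by (rule p.integrable_const_bound[of _ "B\<^sup>2"], use f2 in auto)
       (rule d.integrable_const_bound[of _ "B\<^sup>2"], use f2 in auto)
  have AEb: "AE x in ?\<Phi>. \<bar>Pt S Act P \<pi> f x\<bar> \<le> B" using onSA_AE[OF \<Phi>] by eventually_elim (rule Pb)
  have iP2: "integrable ?\<Phi> (\<lambda>x. (Pt S Act P \<pi> f x)\<^sup>2)"
  proof (rule p.integrable_const_bound[of _ "B\<^sup>2"])
    show "AE x in ?\<Phi>. norm ((Pt S Act P \<pi> f x)\<^sup>2) \<le> B\<^sup>2" using AEb
    proof eventually_elim
      case (elim x)
      then show ?case using abs_le_square_iff[of "Pt S Act P \<pi> f x" B] by auto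
    qed
  qed measurable
  have iPf: "integrable ?\<Phi> (\<lambda>x. Pt S Act P \<pi> f x * f x)"
  proof (rule p.integrable_const_bound[of _ "B * B"])
    show "AE x in ?\<Phi>. norm (Pt S Act P \<pi> f x * f x) \<le> B * B"
      using AEb by eventually_elim (use B in \<open>auto simp: abs_mult intro!: mult_mono order_trans[OF abs_ge_zero]\<close>)
  qed measurable
  define a b c where "a = (\<integral>x. (f x)\<^sup>2 \<partial>?\<Phi>)" and "b = (\<integral>x. (Pt S Act P \<pi> f x)\<^sup>2 \<partial>?\<Phi>)" and "c = (\<integral>x. (f x)\<^sup>2 \<partial>D)"
  have nn: "0 \<le> a" "0 \<le> b" "0 \<le> c" by (auto simp: a_def b_def c_def)
  \<comment> \<open>Second moments on both sides of the fixed-point equation, with Jensen bounding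
    from below the part that comes from \<open>\<Phi> P\<close>.\<close>
  have ab: "(1 - \<gamma>) * c + \<gamma> * b \<le> a"
  proof -
    have e1: "ennreal a = (\<integral>\<^sup>+x. ennreal ((f x)\<^sup>2) \<partial>?\<Phi>)" "ennreal c = (\<integral>\<^sup>+x. ennreal ((f x)\<^sup>2) \<partial>D)"
      "ennreal b = (\<integral>\<^sup>+x. ennreal ((Pt S Act P \<pi> f x)\<^sup>2) \<partial>?\<Phi>)"
      unfolding a_def b_def c_def by (rule nn_integral_eq_integral[symmetric]; use ip iP2 in simp)+
    have "ennreal b \<le> (\<integral>\<^sup>+x. Kf (\<lambda>z. ennreal ((f z)\<^sup>2)) x \<partial>?\<Phi>)"
      unfolding e1
    proof (rule nn_integral_mono_AE)
      show "AE x in ?\<Phi>. ennreal ((Pt S Act P \<pi> f x)\<^sup>2) \<le> Kf (\<lambda>z. ennreal ((f z)\<^sup>2)) x"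
        using onSA_AE[OF \<Phi>] by eventually_elim (rule Pt_Jensen[OF _ em B])
    qed
    then have "ennreal (1 - \<gamma>) * ennreal c + ennreal \<gamma> * ennreal b \<le> ennreal (1 - \<gamma>) * ennreal c + ennreal \<gamma> * (\<integral>\<^sup>+x. Kf (\<lambda>z. ennreal ((f z)\<^sup>2)) x \<partial>?\<Phi>)"
      by (intro add_left_mono mult_left_mono) auto
    also have "\<dots> = ennreal a" unfolding e1 by (rule visit_fixpoint[OF sD, symmetric]) measurable
    finally have "ennreal ((1 - \<gamma>) * c + \<gamma> * b) \<le> ennreal a"
      using gamma nn by (simp add: ennreal_mult ennreal_plus)
    then show ?thesis using nn by (simp add: ennreal_le_iff)
  qed
  \<comment> \<open>The weight \<open>sqrt \<gamma>\<close> in Young's inequality turns the cross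
    term into \<open>g (a + \<gamma> b) / 2\<close>, the combination that the moment inequality
    \<open>(1 - \<gamma>) c + \<gamma> b \<le> a\<close> controls.\<close>
  define g where "g = sqrt \<gamma>"
  have g: "0 < g" "g < 1" "g * g = \<gamma>" using gamma by (auto simp: g_def)
  have "(\<integral>x. \<gamma> * (Pt S Act P \<pi> f x * f x) \<partial>?\<Phi>) \<le> (\<integral>x. g * ((f x)\<^sup>2 + \<gamma> * (Pt S Act P \<pi> f x)\<^sup>2) / 2 \<partial>?\<Phi>)"
  proof (rule integral_mono)
    fix x
    have "0 \<le> g * (f x - g * Pt S Act P \<pi> f x)\<^sup>2" using g by simp
    then show "\<gamma> * (Pt S Act P \<pi> f x * f x) \<le> g * ((f x)\<^sup>2 + \<gamma> * (Pt S Act P \<pi> f x)\<^sup>2) / 2"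
      unfolding g(3)[symmetric] by (simp add: power2_eq_square algebra_simps)
  qed (use ip iP2 iPf in auto)
  also have "\<dots> = g * (a + \<gamma> * b) / 2" using ip iP2 by (simp add: a_def b_def)
  finally have h: "\<gamma> * (\<integral>x. Pt S Act P \<pi> f x * f x \<partial>?\<Phi>) \<le> g * (a + \<gamma> * b) / 2" by simp
  have "(\<integral>x. (f x - \<gamma> * Pt S Act P \<pi> f x) * f x \<partial>?\<Phi>) = (\<integral>x. (f x)\<^sup>2 - \<gamma> * (Pt S Act P \<pi> f x * f x) \<partial>?\<Phi>)"
    by (intro Bochner_Integration.integral_cong refl) (simp add: power2_eq_square algebra_simps)
  also have "\<dots> = a - \<gamma> * (\<integral>x. Pt S Act P \<pi> f x * f x \<partial>?\<Phi>)" using ip iPf by (simp add: a_def)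
  finally have I: "(\<integral>x. (f x - \<gamma> * Pt S Act P \<pi> f x) * f x \<partial>?\<Phi>) \<ge> a - g * (a + \<gamma> * b) / 2" using h by simp
  \<comment> \<open>The moment inequality is used twice, once to eliminate \<open>b\<close> and once
    to pass from \<open>a\<close> to \<open>c\<close>. The lower bound so obtained exceeds
    \<open>(1 - g) c\<close> by \<open>c g (1 - g)^2 / 2\<close>, which is nonnegative.\<close>
  have ca: "(1 - \<gamma>) * c \<le> a" using ab nn gamma by (smt (verit) mult_nonneg_nonneg)
  have "g * (a + \<gamma> * b) \<le> g * (2 * a - (1 - \<gamma>) * c)" using ab g by (intro mult_left_mono) auto
  then have "a - g * (a + \<gamma> * b) / 2 \<ge> a * (1 - g) + g * ((1 - \<gamma>) * c) / 2" by (simp add: field_simps)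
  moreover have "a * (1 - g) \<ge> ((1 - \<gamma>) * c) * (1 - g)" using ca g by (intro mult_right_mono) auto
  moreover have "((1 - \<gamma>) * c) * (1 - g) + g * ((1 - \<gamma>) * c) / 2 - (1 - g) * c = (1 - g) * c * (g * (1 - g) / 2)"
    unfolding g(3)[symmetric] by (simp add: field_simps)
  moreover have "0 \<le> (1 - g) * c * (g * (1 - g) / 2)" using g nn by (intro mult_nonneg_nonneg) auto
  ultimately show ?thesis using I unfolding c_def g_def by linarith
qed

end

section \<open>The network\<close>

lemma deriv_le_lipschitz:
  fixes f :: "real \<Rightarrow> real"
  assumes l: "lipschitz_on L UNIV f" and D: "(f has_real_derivative D) (at x)"
  shows "\<bar>D\<bar> \<le> L"
proof (rule tendsto_upperbound)
  show "((\<lambda>h. \<bar>(f (x + h) - f x) / h\<bar>) \<longlongrightarrow> \<bar>D\<bar>) (at 0)"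
    using D by (intro tendsto_rabs) (simp add: DERIV_def)
  show "\<forall>\<^sub>F h in at 0. \<bar>(f (x + h) - f x) / h\<bar> \<le> L"
    unfolding eventually_at_filter
  proof (intro always_eventually allI impI)
    fix h :: real assume h: "h \<noteq> 0"
    have "\<bar>f (x + h) - f x\<bar> \<le> L * \<bar>h\<bar>" using lipschitz_onD[OF l, of "x + h" x] by (simp add: dist_real_def)
    then show "\<bar>(f (x + h) - f x) / h\<bar> \<le> L" using h by (simp add: abs_div field_simps)
  qed
qed auto

text \<open>The Frobenius norm of a symmetric 2 by 2 matrix bounds its quadratic form; the
  difference of the squared sides is itself a sum of squares.\<close>

lemma quadratic_form_Cauchy_Schwarz:
  fixes A B C p q :: real
  shows "\<bar>A * p\<^sup>2 + 2 * B * (p * q) + C * q\<^sup>2\<bar> \<le> sqrt (A\<^sup>2 + 2 * B\<^sup>2 + C\<^sup>2) * (p\<^sup>2 + q\<^sup>2)"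
proof (rule power2_le_imp_le)
  have "(A\<^sup>2 + 2 * B\<^sup>2 + C\<^sup>2) * (p\<^sup>2 + q\<^sup>2)\<^sup>2 - (A * p\<^sup>2 + 2 * B * (p * q) + C * q\<^sup>2)\<^sup>2 =
    2 * (A * (p * q) - B * p\<^sup>2)\<^sup>2 + (A * q\<^sup>2 - C * p\<^sup>2)\<^sup>2 + 2 * (B * q\<^sup>2 - C * (p * q))\<^sup>2" (is "?l = ?r")
    by algebra
  moreover have "0 \<le> ?r" by (intro add_nonneg_nonneg mult_nonneg_nonneg zero_le_power2) auto
  ultimately have "0 \<le> ?l" by simp
  then have "(A * p\<^sup>2 + 2 * B * (p * q) + C * q\<^sup>2)\<^sup>2 \<le> (A\<^sup>2 + 2 * B\<^sup>2 + C\<^sup>2) * (p\<^sup>2 + q\<^sup>2)\<^sup>2"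
    by (rule diff_ge_0_iff_ge[THEN iffD1])
  then show "\<bar>A * p\<^sup>2 + 2 * B * (p * q) + C * q\<^sup>2\<bar>\<^sup>2 \<le> (sqrt (A\<^sup>2 + 2 * B\<^sup>2 + C\<^sup>2) * (p\<^sup>2 + q\<^sup>2))\<^sup>2"
    by (simp add: power_mult_distrib)
qed simp

locale network =
  fixes S :: "'s::euclidean_space set" and Act :: "'a::euclidean_space set"
    and \<beta> \<sigma>t :: "real \<Rightarrow> real" and L0 L1 l B\<beta> :: real
  assumes A1: "Assumption1 \<beta> \<sigma>t L0 L1 l"
    and SA_norm: "\<And>s a. s \<in> S \<Longrightarrow> a \<in> Act \<Longrightarrow> norm (s, a) \<le> 1"
    and SA_ne: "S \<noteq> {}" "Act \<noteq> {}"
begin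

abbreviation "sg \<equiv> sig B\<beta> \<beta> \<sigma>t :: 's \<times> 'a \<Rightarrow> real \<times> 's \<times> 'a \<times> real \<Rightarrow> real"
abbreviation "gs \<equiv> grad_sig B\<beta> \<beta> \<sigma>t :: 's \<times> 'a \<Rightarrow> real \<times> 's \<times> 'a \<times> real \<Rightarrow> real \<times> 's \<times> 'a \<times> real"
abbreviation "B1 \<equiv> B1c S Act B\<beta> \<beta> \<sigma>t"
abbreviation "B2 \<equiv> B2c S Act B\<beta> \<beta> \<sigma>t"

definition lift :: "'s \<times> 'a \<Rightarrow> 's \<times> 'a \<times> real" where "lift x = (fst x, snd x, 1)"

lemma beta_deriv: "(\<beta> has_real_derivative deriv \<beta> b) (at b)" "(deriv \<beta> has_real_derivative deriv (deriv \<beta>) b) (at b)"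
  "(\<sigma>t has_real_derivative deriv \<sigma>t b) (at b)" "(deriv \<sigma>t has_real_derivative deriv (deriv \<sigma>t) b) (at b)"
proof -
  have "\<beta> differentiable at b" "deriv \<beta> differentiable at b" "\<sigma>t differentiable at b" "deriv \<sigma>t differentiable at b"
    using A1 by (auto simp: Assumption1_def smooth_with_def)
  then show "(\<beta> has_real_derivative deriv \<beta> b) (at b)" "(deriv \<beta> has_real_derivative deriv (deriv \<beta>) b) (at b)"
    "(\<sigma>t has_real_derivative deriv \<sigma>t b) (at b)" "(deriv \<sigma>t has_real_derivative deriv (deriv \<sigma>t) b) (at b)"
    using DERIV_deriv_iff_real_differentiable by blast+
qed

lemma bounds:
  obtains M where "0 \<le> M" "\<And>b. \<bar>\<beta> b\<bar> \<le> M" "\<And>b. \<bar>deriv \<beta> b\<bar> \<le> M" "\<And>b. \<bar>deriv (deriv \<beta>) b\<bar> \<le> M"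
    "\<And>b. \<bar>\<sigma>t b\<bar> \<le> M" "\<And>b. \<bar>deriv \<sigma>t b\<bar> \<le> M" "\<And>b. \<bar>deriv (deriv \<sigma>t) b\<bar> \<le> M"
proof -
  note A = A1[unfolded Assumption1_def smooth_with_def]
  have "\<beta> b \<in> {-1<..<1}" for b using A by (auto simp: bij_betw_def)
  then have "-1 < \<beta> b" "\<beta> b < 1" for b by simp_all
  then have 1: "\<bar>\<beta> b\<bar> \<le> 1" for b by (simp add: abs_le_iff less_imp_le)
  have "lipschitz_on L0 UNIV \<beta>" "lipschitz_on L1 UNIV (deriv \<beta>)" using A by blast+
  then have 2: "\<bar>deriv \<beta> b\<bar> \<le> L0" and 3: "\<bar>deriv (deriv \<beta>) b\<bar> \<le> L1" for b
    using deriv_le_lipschitz beta_deriv(1,2) by blast+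
  have "bounded (range \<sigma>t)" using A by blast
  then obtain C where "\<forall>b. \<bar>\<sigma>t b\<bar> \<le> C" by (auto simp: bounded_iff)
  then have 4: "\<bar>\<sigma>t b\<bar> \<le> C" for b by blast
  obtain La where La: "lipschitz_on La UNIV \<sigma>t" using A by blast
  obtain Lb where Lb: "lipschitz_on Lb UNIV (deriv \<sigma>t)" using A by blast
  have 5: "\<bar>deriv \<sigma>t b\<bar> \<le> La" for b by (rule deriv_le_lipschitz[OF La beta_deriv(3)])
  have 6: "\<bar>deriv (deriv \<sigma>t) b\<bar> \<le> Lb" for b by (rule deriv_le_lipschitz[OF Lb beta_deriv(4)])
  have nn: "0 \<le> L0" "0 \<le> L1" "0 \<le> C" "0 \<le> La" "0 \<le> Lb"
    using order_trans[OF abs_ge_zero 2] order_trans[OF abs_ge_zero 3] order_trans[OF abs_ge_zero 4] order_trans[OF abs_ge_zero 5] order_trans[OF abs_ge_zero 6] by auto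
  show ?thesis
  proof (rule that[of "1 + L0 + L1 + C + La + Lb"])
    fix b
    show "\<bar>\<beta> b\<bar> \<le> 1 + L0 + L1 + C + La + Lb" using 1[of b] nn by linarith
    show "\<bar>deriv \<beta> b\<bar> \<le> 1 + L0 + L1 + C + La + Lb" using 2[of b] nn by linarith
    show "\<bar>deriv (deriv \<beta>) b\<bar> \<le> 1 + L0 + L1 + C + La + Lb" using 3[of b] nn by linarith
    show "\<bar>\<sigma>t b\<bar> \<le> 1 + L0 + L1 + C + La + Lb" using 4[of b] nn by linarith
    show "\<bar>deriv \<sigma>t b\<bar> \<le> 1 + L0 + L1 + C + La + Lb" using 5[of b] nn by linarith
    show "\<bar>deriv (deriv \<sigma>t) b\<bar> \<le> 1 + L0 + L1 + C + La + Lb" using 6[of b] nn by linarith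
  qed (use nn in auto)
qed

lemma beta_continuous: "continuous_on UNIV \<beta>" "continuous_on UNIV (deriv \<beta>)" "continuous_on UNIV \<sigma>t" "continuous_on UNIV (deriv \<sigma>t)"
  using beta_deriv by (auto intro!: continuous_at_imp_continuous_on DERIV_isCont)

lemma beta_measurable [measurable]: "\<beta> \<in> borel_measurable borel" "deriv \<beta> \<in> borel_measurable borel"
  "\<sigma>t \<in> borel_measurable borel" "deriv \<sigma>t \<in> borel_measurable borel"
  using beta_continuous by (auto intro: borel_measurable_continuous_onI)

lemma lift_norm: "x \<in> S \<times> Act \<Longrightarrow> norm (lift x) \<le> 2" "1 \<le> norm (lift x)"
proof -
  have n: "(norm (lift x))\<^sup>2 = (norm (fst x))\<^sup>2 + ((norm (snd x))\<^sup>2 + 1)"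
    by (simp add: lift_def norm_pair_sq[of "(fst x, snd x, 1::real)"] norm_pair_sq[of "(snd x, 1::real)"])
  show "1 \<le> norm (lift x)" by (rule power2_le_imp_le) (simp_all add: n)
  assume "x \<in> S \<times> Act"
  then have "norm (fst x, snd x) \<le> 1" using SA_norm by auto
  then have "(norm x)\<^sup>2 \<le> 1" by (simp add: power_le_one)
  then have "(norm (lift x))\<^sup>2 \<le> 2\<^sup>2" by (simp add: n norm_pair_sq[of x])
  then show "norm (lift x) \<le> 2" by (rule power2_le_imp_le) simp
qed

lemma sg_eq: "sg x \<theta> = B\<beta> * \<beta> (fst \<theta>) * \<sigma>t (snd \<theta> \<bullet> lift x)"
  by (simp add: sig_def lift_def)

lemma gs_eq: "gs x \<theta> = (B\<beta> * deriv \<beta> (fst \<theta>) * \<sigma>t (snd \<theta> \<bullet> lift x), (B\<beta> * \<beta> (fst \<theta>) * deriv \<sigma>t (snd \<theta> \<bullet> lift x)) *\<^sub>R lift x)"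
  by (simp add: grad_sig_def Let_def lift_def)

lemma sg_bound: "\<exists>M\<ge>0. \<forall>x \<theta>. \<bar>sg x \<theta>\<bar> \<le> M"
proof -
  obtain M where M: "0 \<le> M" "\<And>b. \<bar>\<beta> b\<bar> \<le> M" "\<And>b. \<bar>\<sigma>t b\<bar> \<le> M" using bounds by metis
  have "\<bar>sg x \<theta>\<bar> \<le> \<bar>B\<beta>\<bar> * M * M" for x \<theta>
    unfolding sg_eq abs_mult using M by (intro mult_mono) auto
  then show ?thesis using M by (intro exI[of _ "\<bar>B\<beta>\<bar> * M * M"]) auto
qed

lemma sg_measurable:
  assumes [measurable]: "f \<in> borel_measurable M" "g \<in> borel_measurable M"
  shows "(\<lambda>w. sg (f w) (g w)) \<in> borel_measurable M"
  unfolding sig_def by measurable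

lemma gs_measurable:
  assumes [measurable]: "f \<in> borel_measurable M" "g \<in> borel_measurable M"
  shows "(\<lambda>w. gs (f w) (g w)) \<in> borel_measurable M"
  unfolding gs_eq lift_def by measurable

text \<open>Product and chain rule; it identifies the explicit formula \<open>grad_sig\<close> as
  the gradient in the parameter.\<close>

lemma sg_has_derivative: "(sg x has_derivative (\<lambda>h. gs x \<theta> \<bullet> h)) (at \<theta>)"
proof -
  have 1: "((\<lambda>\<theta>::real \<times> 's \<times> 'a \<times> real. \<beta> (fst \<theta>)) has_derivative (\<lambda>h. fst h * deriv \<beta> (fst \<theta>))) (at \<theta>)"
    by (rule DERIV_compose_FDERIV[OF beta_deriv(1)]) (auto intro!: derivative_eq_intros)
  have 2: "((\<lambda>\<theta>::real \<times> 's \<times> 'a \<times> real. \<sigma>t (snd \<theta> \<bullet> lift x)) has_derivative (\<lambda>h. (snd h \<bullet> lift x) * deriv \<sigma>t (snd \<theta> \<bullet> lift x))) (at \<theta>)"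
    by (rule DERIV_compose_FDERIV[OF beta_deriv(3)]) (auto intro!: derivative_eq_intros)
  have "((\<lambda>\<theta>. B\<beta> * \<beta> (fst \<theta>) * \<sigma>t (snd \<theta> \<bullet> lift x)) has_derivative
     (\<lambda>h. B\<beta> * \<beta> (fst \<theta>) * ((snd h \<bullet> lift x) * deriv \<sigma>t (snd \<theta> \<bullet> lift x)) + B\<beta> * (fst h * deriv \<beta> (fst \<theta>)) * \<sigma>t (snd \<theta> \<bullet> lift x))) (at \<theta>)"
    by (intro has_derivative_mult 2 has_derivative_mult_right 1)
  then show ?thesis unfolding sg_eq[abs_def]
    by (rule has_derivative_eq_rhs) (auto simp: fun_eq_iff gs_eq inner_prod_def inner_commute algebra_simps)
qed

text \<open>A real supremum is an upper bound of its family only if the family is bounded above;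
  this is what gives \<open>B1\<close> its meaning.\<close>

lemma gs_bdd: "bdd_above ((\<lambda>p. norm (gs (fst p) (snd p))) ` ((S \<times> Act) \<times> UNIV))"
proof -
  obtain M where M: "0 \<le> M" "\<And>b. \<bar>\<beta> b\<bar> \<le> M" "\<And>b. \<bar>deriv \<beta> b\<bar> \<le> M" "\<And>b. \<bar>\<sigma>t b\<bar> \<le> M" "\<And>b. \<bar>deriv \<sigma>t b\<bar> \<le> M" using bounds by metis
  have "norm (gs x \<theta>) \<le> \<bar>B\<beta>\<bar> * M * M + \<bar>B\<beta>\<bar> * M * M * 2" if x: "x \<in> S \<times> Act" for x \<theta>
  proof -
    have "norm (gs x \<theta>) \<le> norm (B\<beta> * deriv \<beta> (fst \<theta>) * \<sigma>t (snd \<theta> \<bullet> lift x)) + norm ((B\<beta> * \<beta> (fst \<theta>) * deriv \<sigma>t (snd \<theta> \<bullet> lift x)) *\<^sub>R lift x)"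
      unfolding gs_eq by (rule norm_Pair_le)
    also have "\<dots> \<le> \<bar>B\<beta>\<bar> * M * M + \<bar>B\<beta>\<bar> * M * M * 2"
      unfolding norm_scaleR real_norm_def abs_mult using M lift_norm(1)[OF x] by (intro add_mono mult_mono) auto
    finally show ?thesis .
  qed
  then show ?thesis by (intro bdd_aboveI[of _ "\<bar>B\<beta>\<bar> * M * M + \<bar>B\<beta>\<bar> * M * M * 2"]) auto
qed

lemma gs_le_B1: "x \<in> S \<times> Act \<Longrightarrow> norm (gs x \<theta>) \<le> B1"
  unfolding B1c_def using cSUP_upper[OF _ gs_bdd, of "(x, \<theta>)"] by simp

lemma B1_nonneg: "0 \<le> B1"
proof -
  obtain s a where "s \<in> S" "a \<in> Act" using SA_ne by blast
  then show ?thesis using order_trans[OF norm_ge_zero gs_le_B1[of "(s, a)" 0]] by simp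
qed

lemma hess_bdd: "bdd_above ((\<lambda>p. hess_sig_F B\<beta> \<beta> \<sigma>t (fst p) (snd p)) ` ((S \<times> Act) \<times> (UNIV :: (real \<times> 's \<times> 'a \<times> real) set)))"
proof -
  obtain M where M: "0 \<le> M" "\<And>b. \<bar>\<beta> b\<bar> \<le> M" "\<And>b. \<bar>deriv \<beta> b\<bar> \<le> M" "\<And>b. \<bar>deriv (deriv \<beta>) b\<bar> \<le> M"
    "\<And>b. \<bar>\<sigma>t b\<bar> \<le> M" "\<And>b. \<bar>deriv \<sigma>t b\<bar> \<le> M" "\<And>b. \<bar>deriv (deriv \<sigma>t) b\<bar> \<le> M" by (rule bounds) (rule that)
  have sq: "(u * v)\<^sup>2 \<le> (M * M)\<^sup>2" if "\<bar>u\<bar> \<le> M" "\<bar>v\<bar> \<le> M" for u v :: real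
    using that M(1) by (simp add: abs_le_square_iff[symmetric] abs_mult mult_mono)
  have "hess_sig_F B\<beta> \<beta> \<sigma>t x \<theta> \<le> \<bar>B\<beta>\<bar> * sqrt ((M * M)\<^sup>2 + 2 * (M * M)\<^sup>2 * 2\<^sup>2 + (M * M)\<^sup>2 * 2 ^ 4)" if x: "x \<in> S \<times> Act" for x and \<theta> :: "real \<times> 's \<times> 'a \<times> real"
  proof -
    have n: "norm (fst x, snd x, 1::real) \<le> 2" using lift_norm(1)[OF x] by (simp add: lift_def)
    show ?thesis unfolding hess_sig_F_def Let_def
      using n M by (intro mult_left_mono real_sqrt_le_mono add_mono mult_mono sq power_mono) auto
  qed
  then show ?thesis by (intro bdd_aboveI[of _ "\<bar>B\<beta>\<bar> * sqrt ((M * M)\<^sup>2 + 2 * (M * M)\<^sup>2 * 2\<^sup>2 + (M * M)\<^sup>2 * 2 ^ 4)"]) auto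
qed

lemma hess_le_B2: "x \<in> S \<times> Act \<Longrightarrow> hess_sig_F B\<beta> \<beta> \<sigma>t x \<theta> \<le> B2"
  unfolding B2c_def using cSUP_upper[OF _ hess_bdd, of "(x, \<theta>)"] by simp

lemma B2_nonneg: "0 \<le> B2"
proof -
  obtain s a where "s \<in> S" "a \<in> Act" using SA_ne by blast
  moreover have "0 \<le> hess_sig_F B\<beta> \<beta> \<sigma>t (s, a) (0 :: real \<times> 's \<times> 'a \<times> real)" by (simp add: hess_sig_F_def Let_def)
  ultimately show ?thesis using order_trans[OF _ hess_le_B2[of "(s, a)"]] by blast
qed

lemma sg_lipschitz:
  assumes x: "x \<in> S \<times> Act" shows "\<bar>sg x \<theta> - sg x \<theta>'\<bar> \<le> B1 * norm (\<theta> - \<theta>')"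
proof -
  have "norm (sg x \<theta> - sg x \<theta>') \<le> B1 * norm (\<theta> - \<theta>')"
  proof (rule differentiable_bound[of UNIV])
    fix \<xi> :: "real \<times> 's \<times> 'a \<times> real"
    show "(sg x has_derivative (\<lambda>h. gs x \<xi> \<bullet> h)) (at \<xi> within UNIV)" using sg_has_derivative by simp
    show "onorm (\<lambda>h. gs x \<xi> \<bullet> h) \<le> B1"
    proof (rule onorm_bound[OF B1_nonneg])
      fix h :: "real \<times> 's \<times> 'a \<times> real"
      have "norm (gs x \<xi> \<bullet> h) \<le> norm (gs x \<xi>) * norm h" using Cauchy_Schwarz_ineq2[of "gs x \<xi>" h] by simp
      also have "\<dots> \<le> B1 * norm h" by (intro mult_right_mono gs_le_B1[OF x]) auto
      finally show "norm (gs x \<xi> \<bullet> h) \<le> B1 * norm h" .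
    qed
  qed auto
  then show ?thesis by simp
qed

text \<open>Along a segment the network is a product of two functions of one variable, and its
  second derivative is a quadratic form in the change of \<open>b\<close> and the change of
  \<open>w\<close> along \<open>lift x\<close>. The Hessian acts on \<open>w\<close> only through
  that direction, so after normalisation by \<open>norm (lift x)\<close> the Frobenius norm of the 2
  by 2 form is that of the full Hessian. The Lagrange remainder requires the second derivatives of
  \<beta> and \<open>\<sigma>t\<close> to exist, not to be continuous.\<close>

lemma sg_Taylor:
  assumes x: "x \<in> S \<times> Act" shows "\<bar>sg x \<theta>' - sg x \<theta> - gs x \<theta> \<bullet> (\<theta>' - \<theta>)\<bar> \<le> B2 / 2 * (norm (\<theta>' - \<theta>))\<^sup>2"
proof -
  define d where "d = \<theta>' - \<theta>"
  define db du where "db = fst d" and "du = snd d \<bullet> lift x"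
  define b u where "b s = fst \<theta> + s * db" and "u s = snd \<theta> \<bullet> lift x + s * du" for s
  define f0 where "f0 s = B\<beta> * (\<beta> (b s) * \<sigma>t (u s))" for s
  define f1 where "f1 s = B\<beta> * (db * deriv \<beta> (b s) * \<sigma>t (u s) + du * \<beta> (b s) * deriv \<sigma>t (u s))" for s
  define f2 where "f2 s = B\<beta> * (deriv (deriv \<beta>) (b s) * \<sigma>t (u s) * db\<^sup>2 + 2 * (deriv \<beta> (b s) * deriv \<sigma>t (u s)) * (db * du) + \<beta> (b s) * deriv (deriv \<sigma>t) (u s) * du\<^sup>2)" for s
  have bs: "(b has_real_derivative db) (at s)" "(u has_real_derivative du) (at s)" for s
    unfolding b_def u_def by (auto intro!: derivative_eq_intros)
  have c: "((\<lambda>s. \<beta> (b s)) has_real_derivative deriv \<beta> (b s) * db) (at s)" "((\<lambda>s. deriv \<beta> (b s)) has_real_derivative deriv (deriv \<beta>) (b s) * db) (at s)"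
    "((\<lambda>s. \<sigma>t (u s)) has_real_derivative deriv \<sigma>t (u s) * du) (at s)" "((\<lambda>s. deriv \<sigma>t (u s)) has_real_derivative deriv (deriv \<sigma>t) (u s) * du) (at s)" for s
    by (rule DERIV_chain2[OF _ bs(1)] DERIV_chain2[OF _ bs(2)], rule beta_deriv)+
  have d0: "(f0 has_real_derivative f1 s) (at s)" for s
    unfolding f0_def f1_def by (rule derivative_eq_intros c refl | simp add: algebra_simps)+
  have d1: "(f1 has_real_derivative f2 s) (at s)" for s
    unfolding f1_def f2_def by (rule derivative_eq_intros c refl | simp add: algebra_simps power2_eq_square)+
  define df where "df = (\<lambda>m::nat. if m = 0 then f0 else if m = 1 then f1 else f2)"
  have "\<exists>t>0. t < 1 \<and> f0 1 = (\<Sum>m<2. df m 0 / fact m * 1 ^ m) + df 2 t / fact 2 * 1 ^ 2"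
  proof (rule Maclaurin)
    show "\<forall>m t. m < 2 \<and> 0 \<le> t \<and> t \<le> 1 \<longrightarrow> (df m has_real_derivative df (Suc m) t) (at t)"
      using d0 d1 by (auto simp: df_def less_2_cases_iff)
  qed (auto simp: df_def)
  then obtain t where t: "f0 1 = f0 0 + f1 0 + f2 t / 2"
    by (auto simp: df_def numeral_2_eq_2)
  have e0: "f0 0 = sg x \<theta>" by (simp add: f0_def b_def u_def sg_eq)
  have e1: "f0 1 = sg x \<theta>'"
    by (simp add: f0_def b_def u_def sg_eq db_def du_def d_def inner_diff_left)
  have e2: "f1 0 = gs x \<theta> \<bullet> d"
    by (simp add: f1_def b_def u_def gs_eq inner_prod_def db_def du_def inner_commute algebra_simps)
  define z where "z = norm (lift x)"
  have z: "0 < z" unfolding z_def using lift_norm(2)[of x] by linarith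
  define ts where "ts = (b t, snd \<theta> + t *\<^sub>R snd d)"
  have ut: "u t = snd ts \<bullet> lift x" by (simp add: u_def ts_def du_def inner_add_left)
  define A B C where "A = deriv (deriv \<beta>) (b t) * \<sigma>t (u t)" and "B = deriv \<beta> (b t) * deriv \<sigma>t (u t)" and "C = \<beta> (b t) * deriv (deriv \<sigma>t) (u t)"
  have H: "hess_sig_F B\<beta> \<beta> \<sigma>t x ts = \<bar>B\<beta>\<bar> * sqrt (A\<^sup>2 + 2 * (B * z)\<^sup>2 + (C * z\<^sup>2)\<^sup>2)"
    unfolding hess_sig_F_def Let_def A_def B_def C_def ut z_def by (simp add: ts_def lift_def power_mult_distrib algebra_simps flip: power_mult)
  have "\<bar>f2 t\<bar> = \<bar>B\<beta>\<bar> * \<bar>A * db\<^sup>2 + 2 * (B * z) * (db * (du / z)) + (C * z\<^sup>2) * (du / z)\<^sup>2\<bar>"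
    
  proof -
    have "f2 t = B\<beta> * (A * db\<^sup>2 + 2 * (B * z) * (db * (du / z)) + (C * z\<^sup>2) * (du / z)\<^sup>2)"
      using z by (simp add: f2_def A_def B_def C_def power_divide algebra_simps)
    then show ?thesis by (simp only: abs_mult)
  qed
  also have "\<dots> \<le> \<bar>B\<beta>\<bar> * (sqrt (A\<^sup>2 + 2 * (B * z)\<^sup>2 + (C * z\<^sup>2)\<^sup>2) * (db\<^sup>2 + (du / z)\<^sup>2))"
    by (intro mult_left_mono quadratic_form_Cauchy_Schwarz) auto
  also have "\<dots> = hess_sig_F B\<beta> \<beta> \<sigma>t x ts * (db\<^sup>2 + (du / z)\<^sup>2)" unfolding H by simp
  also have "\<dots> \<le> B2 * (norm d)\<^sup>2"
  proof (rule mult_mono)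
    show "hess_sig_F B\<beta> \<beta> \<sigma>t x ts \<le> B2" by (rule hess_le_B2[OF x])
    have "\<bar>du\<bar> \<le> norm (snd d) * z" unfolding du_def z_def by (rule Cauchy_Schwarz_ineq2)
    then have "\<bar>du / z\<bar> \<le> norm (snd d)" using z by (simp add: abs_div field_simps)
    then have "(du / z)\<^sup>2 \<le> (norm (snd d))\<^sup>2" by (simp add: abs_le_square_iff[symmetric])
    then show "db\<^sup>2 + (du / z)\<^sup>2 \<le> (norm d)\<^sup>2" by (simp add: norm_pair_sq[of d] db_def)
  qed (use B2_nonneg in auto)
  finally have le: "\<bar>f2 t\<bar> \<le> B2 * (norm d)\<^sup>2" .
  have eq: "sg x \<theta>' - sg x \<theta> - gs x \<theta> \<bullet> (\<theta>' - \<theta>) = f2 t / 2" using t by (simp add: e0 e1 e2 d_def)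
  show ?thesis unfolding eq using le by (simp add: d_def)
qed

lemma Qnet_bound: "prob_space \<rho> \<Longrightarrow> \<exists>M. \<forall>x. \<bar>Qnet \<alpha> B\<beta> \<beta> \<sigma>t \<rho> (x :: 's \<times> 'a)\<bar> \<le> M"
proof -
  assume "prob_space \<rho>"
  then interpret prob_space \<rho> .
  obtain M where M: "0 \<le> M" "\<And>x \<theta>. \<bar>sg x \<theta>\<bar> \<le> M" using sg_bound by blast
  have "\<bar>Qnet \<alpha> B\<beta> \<beta> \<sigma>t \<rho> x\<bar> \<le> \<bar>\<alpha>\<bar> * M" for x
  proof -
    have "\<bar>\<integral>\<theta>. sg x \<theta> \<partial>\<rho>\<bar> \<le> M"
    proof (cases "integrable \<rho> (sg x)")
      case True
      then have "\<bar>\<integral>\<theta>. sg x \<theta> \<partial>\<rho>\<bar> \<le> (\<integral>\<theta>. M \<partial>\<rho>)"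
        using M by (intro order_trans[OF integral_abs_bound] integral_mono) auto
      then show ?thesis by (simp add: prob_space)
    next
      case False then show ?thesis using M by (simp add: not_integrable_integral_eq)
    qed
    then show ?thesis by (simp add: Qnet_def abs_mult mult_left_mono)
  qed
  then show ?thesis by blast
qed

lemma sg_integrable: "P2 \<rho> \<Longrightarrow> integrable \<rho> (sg x)"
proof -
  assume P: "P2 \<rho>"
  obtain M where M: "0 \<le> M" "\<And>x \<theta>. \<bar>sg x \<theta>\<bar> \<le> M" using sg_bound by blast
  show ?thesis by (rule P2_integrable[OF P _, of _ M 0]) (use M sg_measurable[of "\<lambda>_. x" borel "\<lambda>y. y"] in auto)
qed

lemma Qnet_measurable: "P2 \<rho> \<Longrightarrow> Qnet \<alpha> B\<beta> \<beta> \<sigma>t \<rho> \<in> borel_measurable (borel :: ('s \<times> 'a) measure)"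
proof -
  assume P: "P2 \<rho>"
  interpret prob_space \<rho> using P by (simp add: P2_def)
  have [measurable_cong]: "sets \<rho> = sets borel" using P by (simp add: P2_def)
  have "(\<lambda>x. \<integral>\<theta>. (\<lambda>(x, \<theta>). sg x \<theta>) (x, \<theta>) \<partial>\<rho>) \<in> borel_measurable borel"
    by (rule borel_measurable_lebesgue_integral) (unfold split_beta', rule sg_measurable, measurable)
  then show ?thesis by (simp add: Qnet_def[abs_def])
qed

text \<open>The network is \<open>B1\<close>-Lipschitz in its parameter, and the mean displacement
  of a plan is at most the square root of its cost.\<close>

lemma Qnet_W2:
  assumes P: "P2 \<rho>" "P2 \<rho>'" and x: "x \<in> S \<times> Act" and a: "0 \<le> \<alpha>"
  shows "\<bar>Qnet \<alpha> B\<beta> \<beta> \<sigma>t \<rho> x - Qnet \<alpha> B\<beta> \<beta> \<sigma>t \<rho>' x\<bar> \<le> \<alpha> * B1 * W2 \<rho> \<rho>'"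
proof -
  have "\<bar>(\<integral>\<theta>. sg x \<theta> \<partial>\<rho>) - (\<integral>\<theta>. sg x \<theta> \<partial>\<rho>')\<bar> \<le> B1 * W2 \<rho> \<rho>'"
  proof (rule field_le_epsilon)
    fix \<epsilon> :: real assume eps: "0 < \<epsilon>"
    \<comment> \<open>The 1 is added because \<open>B1\<close> may vanish;
      \<open>B1 * sqrt e\<close> stays below the tolerance.\<close>
    define e where "e = (\<epsilon> / (B1 + 1))\<^sup>2"
    have e: "0 < e" "sqrt e = \<epsilon> / (B1 + 1)" using eps B1_nonneg by (auto simp: e_def)
    obtain p where p: "p \<in> couplings \<rho> \<rho>'" "cost p \<le> (W2 \<rho> \<rho>')\<^sup>2 + e" by (rule ex_near_optimal_coupling[OF P e(1)])
    have Pp: "P2 p" by (rule couplings_P2[OF p(1) P])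
    interpret prob_space p using Pp by (simp add: P2_def)
    have sm: "sg x \<in> borel_measurable borel" using sg_measurable[of "\<lambda>_. x" borel "\<lambda>y. y"] by simp
    obtain M where M: "0 \<le> M" "\<And>x \<theta>. \<bar>sg x \<theta>\<bar> \<le> M" using sg_bound by blast
    have i: "integrable p (\<lambda>z. sg x (fst z))" "integrable p (\<lambda>z. sg x (snd z))"
      by (rule P2_integrable[OF Pp, of _ M 0]; use M in \<open>simp add: sg_measurable\<close>)+
    have ic: "integrable p (\<lambda>z. (norm (fst z - snd z))\<^sup>2)" by (rule integrable_cost[OF Pp])
    define c where "c = sqrt ((W2 \<rho> \<rho>')\<^sup>2 + e)"
    have c: "0 < c" "c\<^sup>2 = (W2 \<rho> \<rho>')\<^sup>2 + e" using e by (auto simp: c_def intro!: add_nonneg_pos)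
    have n1: "norm u \<le> c / 2 + (norm u)\<^sup>2 / (2 * c)" for u :: "real \<times> 's \<times> 'a \<times> real"
    proof -
      have "0 \<le> (norm u - c)\<^sup>2" by simp
      then have "2 * c * norm u \<le> c\<^sup>2 + (norm u)\<^sup>2" by (simp add: power2_diff algebra_simps)
      then show ?thesis using c by (simp add: field_simps power2_eq_square)
    qed
    have "(\<integral>\<theta>. sg x \<theta> \<partial>\<rho>) - (\<integral>\<theta>. sg x \<theta> \<partial>\<rho>') = (\<integral>z. sg x (fst z) - sg x (snd z) \<partial>p)"
      using integral_coupling[OF p(1) sm] i by simp
    also have "\<bar>\<dots>\<bar> \<le> (\<integral>z. \<bar>sg x (fst z) - sg x (snd z)\<bar> \<partial>p)" by (rule integral_abs_bound)
    also have "\<dots> \<le> (\<integral>z. B1 * (c / 2 + (norm (fst z - snd z))\<^sup>2 / (2 * c)) \<partial>p)"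
    proof (rule integral_mono)
      fix z :: "(real \<times> 's \<times> 'a \<times> real) \<times> (real \<times> 's \<times> 'a \<times> real)"
      have "\<bar>sg x (fst z) - sg x (snd z)\<bar> \<le> B1 * norm (fst z - snd z)" by (rule sg_lipschitz[OF x])
      also have "\<dots> \<le> B1 * (c / 2 + (norm (fst z - snd z))\<^sup>2 / (2 * c))" by (intro mult_left_mono n1 B1_nonneg)
      finally show "\<bar>sg x (fst z) - sg x (snd z)\<bar> \<le> B1 * (c / 2 + (norm (fst z - snd z))\<^sup>2 / (2 * c))" .
    qed (use i ic in auto)
    also have "\<dots> = B1 * (c / 2 + cost p / (2 * c))" using ic by (simp add: cost_def prob_space)
    also have "\<dots> \<le> B1 * (c / 2 + c\<^sup>2 / (2 * c))"
      using p(2) c B1_nonneg by (intro mult_left_mono add_left_mono divide_right_mono) auto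
    also have "\<dots> = B1 * c" using c(1) by (simp add: power2_eq_square)
    also have "\<dots> \<le> B1 * (W2 \<rho> \<rho>' + \<epsilon> / (B1 + 1))"
      unfolding c_def using sqrt_add_le_add_sqrt[of "(W2 \<rho> \<rho>')\<^sup>2" e] e W2_nonneg[of \<rho> \<rho>'] B1_nonneg by (intro mult_left_mono) auto
    also have "\<dots> \<le> B1 * W2 \<rho> \<rho>' + \<epsilon>"
    proof -
      have "B1 * (\<epsilon> / (B1 + 1)) \<le> \<epsilon>" using B1_nonneg eps by (simp add: field_simps)
      then show ?thesis by (simp add: distrib_left)
    qed
    finally show "\<bar>(\<integral>\<theta>. sg x \<theta> \<partial>\<rho>) - (\<integral>\<theta>. sg x \<theta> \<partial>\<rho>')\<bar> \<le> B1 * W2 \<rho> \<rho>' + \<epsilon>" .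
  qed
  then have "\<alpha> * \<bar>(\<integral>\<theta>. sg x \<theta> \<partial>\<rho>) - (\<integral>\<theta>. sg x \<theta> \<partial>\<rho>')\<bar> \<le> \<alpha> * (B1 * W2 \<rho> \<rho>')" using a by (rule mult_left_mono)
  moreover have "Qnet \<alpha> B\<beta> \<beta> \<sigma>t \<rho> x - Qnet \<alpha> B\<beta> \<beta> \<sigma>t \<rho>' x = \<alpha> * ((\<integral>\<theta>. sg x \<theta> \<partial>\<rho>) - (\<integral>\<theta>. sg x \<theta> \<partial>\<rho>'))"
    by (simp add: Qnet_def right_diff_distrib)
  ultimately show ?thesis using a by (simp add: abs_mult mult.assoc)
qed

text \<open>The Gaussian density is even in \<open>b\<close> and \<beta> is odd, so the integral
  over \<open>b\<close> cancels for each \<open>w\<close>. The network therefore starts at the zero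
  function, and its size at later times is governed by the distance from the initial law.\<close>

lemma Qnet_std_normal:
  assumes P: "P2 (std_normal :: (real \<times> 's \<times> 'a \<times> real) measure)"
  shows "Qnet \<alpha> B\<beta> \<beta> \<sigma>t std_normal (x :: 's \<times> 'a) = 0"
proof -
  let ?N = "std_normal :: (real \<times> 's \<times> 'a \<times> real) measure"
  define c where "c = (2 * pi) powr (- real DIM(real \<times> 's \<times> 'a \<times> real) / 2)"
  define k where "k \<theta> = c * exp (- (norm \<theta>)\<^sup>2 / 2)" for \<theta> :: "real \<times> 's \<times> 'a \<times> real"
  have k0: "0 \<le> k \<theta>" for \<theta> by (simp add: k_def c_def)
  have km[measurable]: "k \<in> borel_measurable borel" unfolding k_def by measurable
  have N: "?N = density lborel (\<lambda>\<theta>. ennreal (k \<theta>))" by (simp add: std_normal_def k_def c_def)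
  have sm[measurable]: "sg x \<in> borel_measurable borel" using sg_measurable[of "\<lambda>_. x" borel "\<lambda>y. y"] by simp
  have i: "integrable lborel (\<lambda>\<theta>. k \<theta> *\<^sub>R sg x \<theta>)"
    using sg_integrable[OF P, of x] unfolding N by (subst (asm) integrable_density) (use k0 in auto)
  define h where "h b w = k (b, w) *\<^sub>R sg x (b, w)" for b w
  have "(\<integral>\<theta>. sg x \<theta> \<partial>?N) = (\<integral>\<theta>. k \<theta> *\<^sub>R sg x \<theta> \<partial>lborel)"
    unfolding N by (rule integral_density) (use k0 in auto)
  also have "\<dots> = (\<integral>w. \<integral>b. h b w \<partial>lborel \<partial>lborel)"
  proof -
    have "integrable (lborel \<Otimes>\<^sub>M lborel) (case_prod h)" unfolding lborel_prod using i by (simp add: h_def split_beta')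
    from lborel_pair.integral_snd[OF this] show ?thesis unfolding lborel_prod by (simp add: h_def split_beta')
  qed
  also have "\<dots> = (\<integral>w. 0 \<partial>(lborel :: ('s \<times> 'a \<times> real) measure))"
  proof (rule Bochner_Integration.integral_cong[OF refl])
    fix w :: "'s \<times> 'a \<times> real"
    have odd: "h (- b) w = - h b w" for b
    proof -
      have "\<beta> (- b) = - \<beta> b" using A1 by (simp add: Assumption1_def odd_fun_def)
      then show ?thesis by (simp add: h_def k_def sg_eq norm_Pair)
    qed
    have "(\<integral>b. h b w \<partial>lborel) = \<bar>-1\<bar> *\<^sub>R (\<integral>b. h (0 + -1 * b) w \<partial>lborel)"
      by (rule lborel_integral_real_affine[of "-1" "\<lambda>b. h b w" 0]) simp
    also have "\<dots> = (\<integral>b. h (- b) w \<partial>lborel)" by simp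
    also have "\<dots> = - (\<integral>b. h b w \<partial>lborel)" unfolding odd by (rule Bochner_Integration.integral_minus)
    finally show "(\<integral>b. h b w \<partial>lborel) = 0" by simp
  qed
  finally show ?thesis by (simp add: Qnet_def)
qed

end

section \<open>Temporal difference error and its pairing with plans\<close>

locale mdp_net = mdp_policy S Act P r \<gamma> \<pi> + network S Act \<beta> \<sigma>t L0 L1 l B\<beta>
  for S :: "'s::euclidean_space set" and Act :: "'a::euclidean_space set" and P r \<gamma> \<pi> \<beta> \<sigma>t L0 L1 l B\<beta> +
  fixes Br \<alpha> :: real and D :: "('s \<times> 'a) measure"
  assumes rB: "\<And>s a. s \<in> S \<Longrightarrow> a \<in> Act \<Longrightarrow> 0 \<le> r s a \<and> r s a \<le> Br"
    and alpha: "1 \<le> \<alpha>" and D: "onSA D"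
begin

abbreviation "\<Phi> \<equiv> visit S Act P \<gamma> \<pi> D"
abbreviation "Qn \<equiv> Qnet \<alpha> B\<beta> \<beta> \<sigma>t :: (real \<times> 's \<times> 'a \<times> real) measure \<Rightarrow> 's \<times> 'a \<Rightarrow> real"
abbreviation "gf \<equiv> gfield S Act P r \<gamma> \<alpha> B\<beta> \<beta> \<sigma>t \<Phi>"

definition td :: "(real \<times> 's \<times> 'a \<times> real) measure \<Rightarrow> 's \<times> 'a \<Rightarrow> real" where
  "td \<rho> x = Qn \<rho> x - r (fst x) (snd x) - \<gamma> * Pt S Act P \<pi> (Qn \<rho>) x"

lemma Phi: "onSA \<Phi>" by (rule onSA_visit[OF D])

lemma Phi_sets [measurable_cong]: "sets \<Phi> = sets borel" using Phi by (simp add: onSA_def)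

lemma r_measurable [measurable]: "(\<lambda>x. r (fst x) (snd x)) \<in> borel_measurable borel"
  using mdp by (simp add: MDP_def split_beta')

lemma td_measurable: "P2 \<rho> \<Longrightarrow> td \<rho> \<in> borel_measurable borel"
proof -
  assume P: "P2 \<rho>"
  note [measurable] = Qnet_measurable[OF P, of \<alpha>] Pt_measurable[OF Qnet_measurable[OF P, of \<alpha>]]
  show ?thesis unfolding td_def[abs_def] by measurable
qed

lemma td_bound:
  assumes P: "P2 \<rho>" and K: "\<And>x. x \<in> S \<times> Act \<Longrightarrow> \<bar>Qn \<rho> x\<bar> \<le> K" and x: "x \<in> S \<times> Act"
  shows "\<bar>td \<rho> x\<bar> \<le> 2 * K + Br"
proof -
  have "\<bar>Pt S Act P \<pi> (Qn \<rho>) x\<bar> \<le> K" by (rule Pt_bound[OF x Qnet_measurable[OF P] K])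
  then have "\<bar>\<gamma> * Pt S Act P \<pi> (Qn \<rho>) x\<bar> \<le> 1 * K" unfolding abs_mult using gamma by (intro mult_mono) auto
  moreover have "\<bar>r (fst x) (snd x)\<bar> \<le> Br" using rB[of "fst x" "snd x"] x by auto
  ultimately show ?thesis using K[OF x] unfolding td_def by linarith
qed

lemma gf_eq: "gf \<rho> \<pi> \<theta> = - (\<integral>x. td \<rho> x *\<^sub>R ((1 / \<alpha>) *\<^sub>R gs x \<theta>) \<partial>\<Phi>)"
  by (simp add: gfield_def td_def)

context
  fixes \<rho> :: "(real \<times> 's \<times> 'a \<times> real) measure" and K :: real
  assumes P: "P2 \<rho>" and K: "\<And>x. x \<in> S \<times> Act \<Longrightarrow> \<bar>Qn \<rho> x\<bar> \<le> K"
begin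

lemma td_AE: "AE x in \<Phi>. x \<in> S \<times> Act \<and> \<bar>td \<rho> x\<bar> \<le> 2 * K + Br"
  using onSA_AE[OF Phi] by eventually_elim (use td_bound[OF P K] in auto)

lemma td0: "0 \<le> 2 * K + Br"
proof -
  obtain s a where "s \<in> S" "a \<in> Act" using SA_ne by blast
  then show ?thesis using order_trans[OF abs_ge_zero td_bound[OF P K, of "(s, a)"]] by simp
qed

lemma gf_integrand: "integrable \<Phi> (\<lambda>x. td \<rho> x *\<^sub>R ((1 / \<alpha>) *\<^sub>R gs x \<theta>))"
proof -
  interpret prob_space \<Phi> using Phi by (simp add: onSA_def)
  note [measurable] = td_measurable[OF P] gs_measurable[of "\<lambda>x. x" borel "\<lambda>_. \<theta>", simplified]
  show ?thesis
  proof (rule integrable_const_bound[of _ "(2 * K + Br) * (1 * B1)"])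
    show "AE x in \<Phi>. norm (td \<rho> x *\<^sub>R ((1 / \<alpha>) *\<^sub>R gs x \<theta>)) \<le> (2 * K + Br) * (1 * B1)"
      using td_AE
    proof eventually_elim
      fix x assume x: "x \<in> S \<times> Act \<and> \<bar>td \<rho> x\<bar> \<le> 2 * K + Br"
      have "\<bar>1 / \<alpha>\<bar> \<le> 1" using alpha by simp
      then show "norm (td \<rho> x *\<^sub>R ((1 / \<alpha>) *\<^sub>R gs x \<theta>)) \<le> (2 * K + Br) * (1 * B1)"
        unfolding norm_scaleR using x gs_le_B1[of x \<theta>] td0 by (intro mult_mono) auto
    qed
  qed measurable
qed

text \<open>Only finiteness of the bound matters: a bounded velocity is admissible in the first
  variation of the distance. The factor \<open>1 / \<alpha>\<close> is simply estimated by
  1.\<close>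

lemma gf_bound: "norm (gf \<rho> \<pi> \<theta>) \<le> (2 * K + Br) * B1"
proof -
  interpret prob_space \<Phi> using Phi by (simp add: onSA_def)
  have "norm (gf \<rho> \<pi> \<theta>) \<le> (\<integral>x. norm (td \<rho> x *\<^sub>R ((1 / \<alpha>) *\<^sub>R gs x \<theta>)) \<partial>\<Phi>)"
    unfolding gf_eq norm_minus_cancel by (rule integral_norm_bound)
  also have "\<dots> \<le> (\<integral>x. (2 * K + Br) * (1 * B1) \<partial>\<Phi>)"
  proof (rule integral_mono_AE)
    show "integrable \<Phi> (\<lambda>x. norm (td \<rho> x *\<^sub>R ((1 / \<alpha>) *\<^sub>R gs x \<theta>)))" by (rule integrable_norm[OF gf_integrand])
    show "AE x in \<Phi>. norm (td \<rho> x *\<^sub>R ((1 / \<alpha>) *\<^sub>R gs x \<theta>)) \<le> (2 * K + Br) * (1 * B1)"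
      using td_AE
    proof eventually_elim
      fix x assume x: "x \<in> S \<times> Act \<and> \<bar>td \<rho> x\<bar> \<le> 2 * K + Br"
      have "\<bar>1 / \<alpha>\<bar> \<le> 1" using alpha by simp
      then show "norm (td \<rho> x *\<^sub>R ((1 / \<alpha>) *\<^sub>R gs x \<theta>)) \<le> (2 * K + Br) * (1 * B1)"
        unfolding norm_scaleR using x gs_le_B1[of x \<theta>] td0 by (intro mult_mono) auto
    qed
  qed auto
  finally show ?thesis by (simp add: prob_space)
qed

lemma gf_measurable: "gf \<rho> \<pi> \<in> borel_measurable borel"
proof -
  interpret prob_space \<Phi> using Phi by (simp add: onSA_def)
  have [measurable]: "(\<lambda>z. td \<rho> (snd z)) \<in> borel_measurable (borel \<Otimes>\<^sub>M \<Phi>)"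
    using td_measurable[OF P] by measurable
  have [measurable]: "(\<lambda>z. gs (snd z) (fst z)) \<in> borel_measurable (borel \<Otimes>\<^sub>M \<Phi>)" by (rule gs_measurable) measurable
  have "(\<lambda>\<theta>. \<integral>x. (\<lambda>(\<theta>, x). td \<rho> x *\<^sub>R ((1 / \<alpha>) *\<^sub>R gs x \<theta>)) (\<theta>, x) \<partial>\<Phi>) \<in> borel_measurable borel"
    by (rule borel_measurable_lebesgue_integral) (unfold split_beta', measurable)
  then show ?thesis unfolding gf_eq[abs_def] by simp
qed

text \<open>Fubini: averaging over \<mu> the pairing of the temporal difference error with a single
  neuron gives its pairing with the network of \<mu>, up to the scaling by \<alpha>. The error is
  bounded on \<open>S \<times> Act\<close> and neurons are bounded everywhere, which settles
  integrability.\<close>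

lemma td_sg:
  assumes M: "P2 \<mu>"
  shows "integrable \<mu> (\<lambda>\<theta>. \<integral>x. td \<rho> x * sg x \<theta> \<partial>\<Phi>)" "\<And>\<theta>. integrable \<Phi> (\<lambda>x. td \<rho> x * sg x \<theta>)"
    "(\<integral>\<theta>. (\<integral>x. td \<rho> x * sg x \<theta> \<partial>\<Phi>) \<partial>\<mu>) = (\<integral>x. td \<rho> x * Qn \<mu> x \<partial>\<Phi>) / \<alpha>"
    "integrable \<Phi> (\<lambda>x. td \<rho> x * Qn \<mu> x)" "(\<lambda>\<theta>. \<integral>x. td \<rho> x * sg x \<theta> \<partial>\<Phi>) \<in> borel_measurable borel"
proof -
  interpret p: prob_space \<Phi> using Phi by (simp add: onSA_def)
  interpret m: prob_space \<mu> using M by (simp add: P2_def)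
  interpret pm: pair_prob_space \<mu> \<Phi> ..
  have [measurable_cong]: "sets \<mu> = sets borel" using M by (simp add: P2_def)
  note [measurable] = td_measurable[OF P] Qnet_measurable[OF M, of \<alpha>]
  obtain C where C: "0 \<le> C" "\<And>x \<theta>. \<bar>sg x \<theta>\<bar> \<le> C" using sg_bound by blast
  obtain Q where Q: "\<And>x. \<bar>Qn \<mu> x\<bar> \<le> Q" using Qnet_bound[OF m.prob_space_axioms] by blast
  have sm[measurable]: "(\<lambda>x. sg x \<theta>) \<in> borel_measurable borel" for \<theta> using sg_measurable[of "\<lambda>x. x" borel "\<lambda>_. \<theta>"] by simp
  have tdsg: "AE x in \<Phi>. \<bar>td \<rho> x * sg x \<theta>\<bar> \<le> (2 * K + Br) * C" for \<theta>
    using td_AE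
  proof eventually_elim
    case (elim x)
    then have "\<bar>td \<rho> x\<bar> \<le> 2 * K + Br" by simp
    then show ?case unfolding abs_mult by (intro mult_mono C td0) auto
  qed
  show i1: "integrable \<Phi> (\<lambda>x. td \<rho> x * sg x \<theta>)" for \<theta>
  proof (rule p.integrable_const_bound[of _ "(2 * K + Br) * C"])
    show "AE x in \<Phi>. norm (td \<rho> x * sg x \<theta>) \<le> (2 * K + Br) * C"
      unfolding real_norm_def by (rule tdsg)
  qed measurable
  show "integrable \<Phi> (\<lambda>x. td \<rho> x * Qn \<mu> x)"
  proof (rule p.integrable_const_bound[of _ "(2 * K + Br) * Q"])
    show "AE x in \<Phi>. norm (td \<rho> x * Qn \<mu> x) \<le> (2 * K + Br) * Q"
      using td_AE by eventually_elim (use Q td0 in \<open>auto simp: abs_mult intro!: mult_mono\<close>)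
  qed measurable
  have sm2[measurable]: "(\<lambda>z. sg (snd z) (fst z)) \<in> borel_measurable (borel \<Otimes>\<^sub>M \<Phi>)" by (rule sg_measurable) measurable
  have "(\<lambda>\<theta>. \<integral>x. (\<lambda>(\<theta>, x). td \<rho> x * sg x \<theta>) (\<theta>, x) \<partial>\<Phi>) \<in> borel_measurable borel"
    by (rule p.borel_measurable_lebesgue_integral) (unfold split_beta', measurable)
  then show hm: "(\<lambda>\<theta>. \<integral>x. td \<rho> x * sg x \<theta> \<partial>\<Phi>) \<in> borel_measurable borel" by simp
  have hb: "\<bar>\<integral>x. td \<rho> x * sg x \<theta> \<partial>\<Phi>\<bar> \<le> (2 * K + Br) * C" for \<theta>
  proof -
    have "\<bar>\<integral>x. td \<rho> x * sg x \<theta> \<partial>\<Phi>\<bar> \<le> (\<integral>x. \<bar>td \<rho> x * sg x \<theta>\<bar> \<partial>\<Phi>)" by (rule integral_abs_bound)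
    also have "\<dots> \<le> (\<integral>x. (2 * K + Br) * C \<partial>\<Phi>)"
    proof (rule integral_mono_AE)
      show "AE x in \<Phi>. \<bar>td \<rho> x * sg x \<theta>\<bar> \<le> (2 * K + Br) * C"
        by (rule tdsg)
    qed (use i1 in auto)
    finally show ?thesis by (simp add: p.prob_space)
  qed
  show "integrable \<mu> (\<lambda>\<theta>. \<integral>x. td \<rho> x * sg x \<theta> \<partial>\<Phi>)"
    by (rule P2_integrable[OF M hm, of "(2 * K + Br) * C" 0]) (use hb in auto)
  have sm3[measurable]: "(\<lambda>z. sg (snd z) (fst z)) \<in> borel_measurable (\<mu> \<Otimes>\<^sub>M \<Phi>)" by (rule sg_measurable) measurable
  have i3: "integrable (\<mu> \<Otimes>\<^sub>M \<Phi>) (\<lambda>(\<theta>, x). td \<rho> x * sg x \<theta>)"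
  proof (rule pm.integrable_const_bound[of _ "(2 * K + Br) * C"])
    have [measurable]: "(\<lambda>z. td \<rho> (snd z)) \<in> borel_measurable (\<mu> \<Otimes>\<^sub>M \<Phi>)" by measurable
    show "(\<lambda>(\<theta>, x). td \<rho> x * sg x \<theta>) \<in> borel_measurable (\<mu> \<Otimes>\<^sub>M \<Phi>)" unfolding split_beta' by measurable
    have AEm: "AE x in \<Phi>. \<bar>td \<rho> x\<bar> \<le> 2 * K + Br" using td_AE by eventually_elim auto
    have "AE z in \<mu> \<Otimes>\<^sub>M \<Phi>. \<bar>td \<rho> (snd z)\<bar> \<le> 2 * K + Br"
    proof (rule pm.AE_pair_measure)
      show "{z \<in> space (\<mu> \<Otimes>\<^sub>M \<Phi>). \<bar>td \<rho> (snd z)\<bar> \<le> 2 * K + Br} \<in> sets (\<mu> \<Otimes>\<^sub>M \<Phi>)" by measurable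
      show "AE x in \<mu>. AE y in \<Phi>. \<bar>td \<rho> (snd (x, y))\<bar> \<le> 2 * K + Br" using AEm by simp
    qed
    then show "AE z in \<mu> \<Otimes>\<^sub>M \<Phi>. norm (case z of (\<theta>, x) \<Rightarrow> td \<rho> x * sg x \<theta>) \<le> (2 * K + Br) * C"
      by eventually_elim (use C td0 in \<open>auto simp: abs_mult split_beta' intro!: mult_mono\<close>)
  qed
  have "(\<integral>\<theta>. (\<integral>x. td \<rho> x * sg x \<theta> \<partial>\<Phi>) \<partial>\<mu>) = (\<integral>x. (\<integral>\<theta>. td \<rho> x * sg x \<theta> \<partial>\<mu>) \<partial>\<Phi>)"
    by (rule pm.Fubini_integral[OF i3, symmetric])
  also have "\<dots> = (\<integral>x. td \<rho> x * Qn \<mu> x / \<alpha> \<partial>\<Phi>)"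
    using alpha by (simp add: Qnet_def)
  finally show "(\<integral>\<theta>. (\<integral>x. td \<rho> x * sg x \<theta> \<partial>\<Phi>) \<partial>\<mu>) = (\<integral>x. td \<rho> x * Qn \<mu> x \<partial>\<Phi>) / \<alpha>" by simp
qed

text \<open>Taylor expansion at the first endpoint turns the product of \<open>x - y\<close> with
  the gradient into the difference of the neurons at \<open>x\<close> and \<open>y\<close>, up to a
  quadratic remainder weighted by the temporal difference error, which is at most
  \<open>2 K + Br\<close>. Integrating over the plan gives the pairing of that error with
  \<open>Qn \<rho> - Qn \<nu>\<close>, to which coercivity applies. The plan may be any coupling;
  its cost enters only through the remainder.\<close>

theorem gf_pairing:
  assumes Pn: "P2 \<nu>" and g: "g \<in> couplings \<rho> \<nu>" and Qn: "\<And>x. x \<in> S \<times> Act \<Longrightarrow> Qn \<nu> x = Qpi S Act P r \<gamma> \<pi> x"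
  shows "\<alpha>\<^sup>2 * (\<integral>z. (fst z - snd z) \<bullet> gf \<rho> \<pi> (fst z) \<partial>g) \<le>
     - (1 - sqrt \<gamma>) * (\<integral>x. (Qn \<rho> x - Qn \<nu> x)\<^sup>2 \<partial>D) + \<alpha> * B2 * (2 * K + Br) / 2 * cost g"
proof -
  interpret p: prob_space \<Phi> using Phi by (simp add: onSA_def)
  interpret pr: prob_space \<rho> using P by (simp add: P2_def)
  interpret pn: prob_space \<nu> using Pn by (simp add: P2_def)
  have Pg: "P2 g" by (rule couplings_P2[OF g P Pn])
  note [measurable] = td_measurable[OF P] Qnet_measurable[OF P, of \<alpha>] Qnet_measurable[OF Pn, of \<alpha>]
  define h where "h \<theta> = (\<integral>x. td \<rho> x * sg x \<theta> \<partial>\<Phi>)" for \<theta>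
  define e where "e x = Qn \<rho> x - Qn \<nu> x" for x
  define c where "c = (2 * K + Br) * B2 / (2 * \<alpha>)"
  have a0: "0 < \<alpha>" using alpha by simp
  have pt: "(x - y) \<bullet> gf \<rho> \<pi> x \<le> - (1 / \<alpha>) * (h x - h y) + c * (norm (x - y))\<^sup>2" for x y
  proof -
    have "(x - y) \<bullet> gf \<rho> \<pi> x = - (\<integral>s. (x - y) \<bullet> (td \<rho> s *\<^sub>R ((1 / \<alpha>) *\<^sub>R gs s x)) \<partial>\<Phi>)"
      unfolding gf_eq inner_minus_right using integral_inner_right[of "x - y" \<Phi> "\<lambda>s. td \<rho> s *\<^sub>R ((1 / \<alpha>) *\<^sub>R gs s x)"] gf_integrand by simp
    also have "\<dots> = (\<integral>s. - ((x - y) \<bullet> (td \<rho> s *\<^sub>R ((1 / \<alpha>) *\<^sub>R gs s x))) \<partial>\<Phi>)" by simp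
    also have "\<dots> \<le> (\<integral>s. - (1 / \<alpha>) * (td \<rho> s * sg s x - td \<rho> s * sg s y) + c * (norm (x - y))\<^sup>2 \<partial>\<Phi>)"
    proof (rule integral_mono_AE)
      show "integrable \<Phi> (\<lambda>s. - ((x - y) \<bullet> (td \<rho> s *\<^sub>R ((1 / \<alpha>) *\<^sub>R gs s x))))"
        by (intro Bochner_Integration.integrable_minus integrable_inner_right) (rule gf_integrand)
      show "integrable \<Phi> (\<lambda>s. - (1 / \<alpha>) * (td \<rho> s * sg s x - td \<rho> s * sg s y) + c * (norm (x - y))\<^sup>2)"
        using td_sg(2)[OF P] by auto
      show "AE s in \<Phi>. - ((x - y) \<bullet> (td \<rho> s *\<^sub>R ((1 / \<alpha>) *\<^sub>R gs s x))) \<le> - (1 / \<alpha>) * (td \<rho> s * sg s x - td \<rho> s * sg s y) + c * (norm (x - y))\<^sup>2"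
        using td_AE
      proof eventually_elim
        fix s assume s: "s \<in> S \<times> Act \<and> \<bar>td \<rho> s\<bar> \<le> 2 * K + Br"
        define R where "R = sg s y - sg s x - gs s x \<bullet> (y - x)"
        have R: "\<bar>R\<bar> \<le> B2 / 2 * (norm (x - y))\<^sup>2"
          unfolding R_def using sg_Taylor[of s y x] s by (simp add: norm_minus_commute)
        have gR: "(x - y) \<bullet> gs s x = sg s x - sg s y + R"
          by (simp add: R_def inner_diff_left inner_diff_right inner_commute)
        have "- ((x - y) \<bullet> (td \<rho> s *\<^sub>R ((1 / \<alpha>) *\<^sub>R gs s x))) = - (1 / \<alpha>) * (td \<rho> s * sg s x - td \<rho> s * sg s y) + - (td \<rho> s * R) / \<alpha>"
          unfolding inner_scaleR_right gR by (simp add: algebra_simps add_divide_distrib diff_divide_distrib)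
        moreover have "- (td \<rho> s * R) / \<alpha> \<le> c * (norm (x - y))\<^sup>2"
        proof -
          have "- (td \<rho> s * R) \<le> \<bar>td \<rho> s\<bar> * \<bar>R\<bar>" unfolding abs_mult[symmetric] by linarith
          also have "\<dots> \<le> (2 * K + Br) * (B2 / 2 * (norm (x - y))\<^sup>2)" using s R td0 by (intro mult_mono) auto
          finally have "- (td \<rho> s * R) / \<alpha> \<le> (2 * K + Br) * (B2 / 2 * (norm (x - y))\<^sup>2) / \<alpha>" using a0 by (intro divide_right_mono) auto
          also have "\<dots> = c * (norm (x - y))\<^sup>2" by (simp add: c_def)
          finally show ?thesis .
        qed
        ultimately show "- ((x - y) \<bullet> (td \<rho> s *\<^sub>R ((1 / \<alpha>) *\<^sub>R gs s x))) \<le> - (1 / \<alpha>) * (td \<rho> s * sg s x - td \<rho> s * sg s y) + c * (norm (x - y))\<^sup>2"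
          by linarith
      qed
    qed
    also have "\<dots> = - (1 / \<alpha>) * (h x - h y) + c * (norm (x - y))\<^sup>2"
      using td_sg(2)[OF P] by (simp add: h_def p.prob_space)
    finally show ?thesis .
  qed
  have hm[measurable]: "h \<in> borel_measurable borel" unfolding h_def[abs_def] by (rule td_sg(5)[OF P])
  have tr: "integrable g (\<lambda>z. h (fst z))" "integrable g (\<lambda>z. h (snd z))"
  proof -
    have [measurable_cong]: "sets g = sets borel" using Pg by (simp add: P2_def)
    have d: "distr g borel fst = \<rho>" "distr g borel snd = \<nu>" using g by (auto simp: couplings_def)
    show "integrable g (\<lambda>z. h (fst z))" "integrable g (\<lambda>z. h (snd z))"
      using td_sg(1)[OF P] td_sg(1)[OF Pn] integrable_distr_eq[of fst g borel h] integrable_distr_eq[of snd g borel h] d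
      unfolding h_def[symmetric] by auto
  qed
  have ig: "integrable g (\<lambda>z. (fst z - snd z) \<bullet> gf \<rho> \<pi> (fst z))"
  proof (rule P2_integrable[OF Pg, of _ "2 * ((2 * K + Br) * B1)" "2 * ((2 * K + Br) * B1)"])
    note [measurable] = gf_measurable
    show "(\<lambda>z. (fst z - snd z) \<bullet> gf \<rho> \<pi> (fst z)) \<in> borel_measurable borel" by measurable
    fix z :: "(real \<times> 's \<times> 'a \<times> real) \<times> (real \<times> 's \<times> 'a \<times> real)"
    have V0: "0 \<le> (2 * K + Br) * B1" using td0 B1_nonneg by simp
    have "(norm (fst z - snd z))\<^sup>2 \<le> 2 * (norm z)\<^sup>2" using norm_diff_sq_le[of "fst z" "snd z"] by (simp add: norm_pair_sq[of z])
    then have n: "norm (fst z - snd z) \<le> 2 + 2 * (norm z)\<^sup>2" using norm_le_one_plus_sq[of "fst z - snd z"] by linarith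
    have "\<bar>(fst z - snd z) \<bullet> gf \<rho> \<pi> (fst z)\<bar> \<le> norm (fst z - snd z) * norm (gf \<rho> \<pi> (fst z))" by (rule Cauchy_Schwarz_ineq2)
    also have "\<dots> \<le> (2 + 2 * (norm z)\<^sup>2) * ((2 * K + Br) * B1)" using n gf_bound by (intro mult_mono) auto
    finally show "norm ((fst z - snd z) \<bullet> gf \<rho> \<pi> (fst z)) \<le> 2 * ((2 * K + Br) * B1) + 2 * ((2 * K + Br) * B1) * (norm z)\<^sup>2"
      by (simp add: algebra_simps)
  qed
  have ic: "integrable g (\<lambda>z. (norm (fst z - snd z))\<^sup>2)" by (rule integrable_cost[OF Pg])
  have "(\<integral>z. (fst z - snd z) \<bullet> gf \<rho> \<pi> (fst z) \<partial>g) \<le> (\<integral>z. - (1 / \<alpha>) * (h (fst z) - h (snd z)) + c * (norm (fst z - snd z))\<^sup>2 \<partial>g)"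
    using tr ig ic by (intro integral_mono pt) auto
  also have "\<dots> = - (1 / \<alpha>) * ((\<integral>z. h (fst z) \<partial>g) - (\<integral>z. h (snd z) \<partial>g)) + c * cost g"
    using tr ic by (simp add: cost_def)
  also have "(\<integral>z. h (fst z) \<partial>g) = (\<integral>\<theta>. h \<theta> \<partial>\<rho>)" by (rule integral_coupling(1)[OF g hm])
  also have "(\<integral>z. h (snd z) \<partial>g) = (\<integral>\<theta>. h \<theta> \<partial>\<nu>)" by (rule integral_coupling(2)[OF g hm])
  also have "(\<integral>\<theta>. h \<theta> \<partial>\<rho>) - (\<integral>\<theta>. h \<theta> \<partial>\<nu>) = (\<integral>x. td \<rho> x * e x \<partial>\<Phi>) / \<alpha>"
    unfolding h_def td_sg(3)[OF P] td_sg(3)[OF Pn] using td_sg(4)[OF P] td_sg(4)[OF Pn]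
    by (simp add: e_def right_diff_distrib diff_divide_distrib)
  finally have "\<alpha>\<^sup>2 * (\<integral>z. (fst z - snd z) \<bullet> gf \<rho> \<pi> (fst z) \<partial>g) \<le> \<alpha>\<^sup>2 * (- (1 / \<alpha>) * ((\<integral>x. td \<rho> x * e x \<partial>\<Phi>) / \<alpha>) + c * cost g)"
    by (intro mult_left_mono) auto
  also have "\<dots> = - (\<integral>x. td \<rho> x * e x \<partial>\<Phi>) + \<alpha> * B2 * (2 * K + Br) / 2 * cost g"
    using a0 by (simp add: c_def field_simps power2_eq_square)
  \<comment> \<open>The Bellman equation of the target removes the reward: on
    \<open>S \<times> Act\<close> the temporal difference error is
    \<open>e - \<gamma> Pt e\<close>.\<close>
  also have "(\<integral>x. td \<rho> x * e x \<partial>\<Phi>) = (\<integral>x. (e x - \<gamma> * Pt S Act P \<pi> e x) * e x \<partial>\<Phi>)"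
  proof (rule integral_cong_AE)
    have em: "e \<in> borel_measurable borel" unfolding e_def[abs_def] by measurable
    note [measurable] = em Pt_measurable[OF em]
    show "(\<lambda>x. td \<rho> x * e x) \<in> borel_measurable \<Phi>" "(\<lambda>x. (e x - \<gamma> * Pt S Act P \<pi> e x) * e x) \<in> borel_measurable \<Phi>" by measurable
    show "AE x in \<Phi>. td \<rho> x * e x = (e x - \<gamma> * Pt S Act P \<pi> e x) * e x"
      using onSA_AE[OF Phi]
    proof eventually_elim
      fix x assume x: "x \<in> S \<times> Act"
      obtain Q1 where Q1: "\<And>x. \<bar>Qn \<rho> x\<bar> \<le> Q1" using Qnet_bound[OF pr.prob_space_axioms] by blast
      obtain Q2 where Q2: "\<And>x. \<bar>Qn \<nu> x\<bar> \<le> Q2" using Qnet_bound[OF pn.prob_space_axioms] by blast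
      have rr: "\<bar>r s a\<bar> \<le> Br" if "s \<in> S" "a \<in> Act" for s a using rB[OF that] by simp
      have b: "Qn \<nu> x = r (fst x) (snd x) + \<gamma> * Pt S Act P \<pi> (Qn \<nu>) x"
        unfolding Qn[OF x] using Bellman(1)[OF rr x] Pt_cong[OF Qn] by simp
      have d: "Pt S Act P \<pi> e x = Pt S Act P \<pi> (Qn \<rho>) x - Pt S Act P \<pi> (Qn \<nu>) x"
        unfolding e_def by (rule Pt_diff[OF x Qnet_measurable[OF P] Q1 Qnet_measurable[OF Pn] Q2])
      have "e x = Qn \<rho> x - Qn \<nu> x" by (simp add: e_def)
      then have "td \<rho> x = e x - \<gamma> * Pt S Act P \<pi> e x" using b by (simp add: td_def d algebra_simps)
      then show "td \<rho> x * e x = (e x - \<gamma> * Pt S Act P \<pi> e x) * e x" by simp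
    qed
  qed
  finally have A: "\<alpha>\<^sup>2 * (\<integral>z. (fst z - snd z) \<bullet> gf \<rho> \<pi> (fst z) \<partial>g) \<le>
     - (\<integral>x. (e x - \<gamma> * Pt S Act P \<pi> e x) * e x \<partial>\<Phi>) + \<alpha> * B2 * (2 * K + Br) / 2 * cost g" .
  have "(1 - sqrt \<gamma>) * (\<integral>x. (e x)\<^sup>2 \<partial>D) \<le> (\<integral>x. (e x - \<gamma> * Pt S Act P \<pi> e x) * e x \<partial>\<Phi>)"
  proof -
    obtain Q1 where Q1: "\<And>x. \<bar>Qn \<rho> x\<bar> \<le> Q1" using Qnet_bound[OF pr.prob_space_axioms] by blast
    obtain Q2 where Q2: "\<And>x. \<bar>Qn \<nu> x\<bar> \<le> Q2" using Qnet_bound[OF pn.prob_space_axioms] by blast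
    have "\<bar>e x\<bar> \<le> Q1 + Q2" for x unfolding e_def using Q1[of x] Q2[of x] by linarith
    then show ?thesis by (intro TD_coercive[OF D]) (auto simp: e_def[abs_def])
  qed
  then show ?thesis using A unfolding e_def by linarith
qed

end

end

section \<open>Growth of policies\<close>

text \<open>Lebesgue differentiation is available on bounded intervals; the countably many horizons
  \<open>n\<close> cover all positive times with one null set.\<close>

lemma right_averages_ae:
  fixes g :: "real \<Rightarrow> real"
  assumes g: "\<And>T. 0 \<le> T \<Longrightarrow> g integrable_on {0..T}"
  shows "AE t in lborel. 0 < t \<longrightarrow> ((\<lambda>h. integral {t..t + h} g / h) \<longlongrightarrow> g t) (at_right 0)"
proof -
  have "AE t in lborel. \<forall>n::nat. 0 < t \<and> t < real n \<longrightarrow> ((\<lambda>u. integral {0..u} g) has_real_derivative g t) (at t)"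
  proof (subst AE_all_countable, rule allI)
    fix n :: nat
    obtain N where N: "negligible N" "\<And>x. x \<in> {0<..<real n} - N \<Longrightarrow> ((\<lambda>u. integral {0..u} g) has_real_derivative g x) (at x)"
      using indefinite_integral_has_derivative_ae[OF g[of "real n"]] by auto
    show "AE t in lborel. 0 < t \<and> t < real n \<longrightarrow> ((\<lambda>u. integral {0..u} g) has_real_derivative g t) (at t)"
      using lebesgue_negligible_AE_lborel[OF N(1)] by eventually_elim (use N(2) in auto)
  qed
  then show ?thesis
  proof eventually_elim
    fix t :: real
    assume a: "\<forall>n::nat. 0 < t \<and> t < real n \<longrightarrow> ((\<lambda>u. integral {0..u} g) has_real_derivative g t) (at t)"
    show "0 < t \<longrightarrow> ((\<lambda>h. integral {t..t + h} g / h) \<longlongrightarrow> g t) (at_right 0)"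
    proof
      assume t: "0 < t"
      obtain n :: nat where "t < real n" using reals_Archimedean2 by blast
      then have "((\<lambda>u. integral {0..u} g) has_real_derivative g t) (at t)" using a t by blast
      then have "((\<lambda>h. (integral {0..t + h} g - integral {0..t} g) / h) \<longlongrightarrow> g t) (at 0)" by (simp add: DERIV_def)
      then have l: "((\<lambda>h. (integral {0..t + h} g - integral {0..t} g) / h) \<longlongrightarrow> g t) (at_right 0)"
        by (rule filterlim_mono) (auto simp: at_le)
      have "\<forall>\<^sub>F h in at_right (0::real). (integral {0..t + h} g - integral {0..t} g) / h = integral {t..t + h} g / h"
        using eventually_at_right_less[of "0::real"]
      proof eventually_elim
        fix h :: real assume h: "0 < h"
        have "integral {0..t} g + integral {t..t + h} g = integral {0..t + h} g"
          using t h by (intro Henstock_Kurzweil_Integration.integral_combine g) auto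
        then show "(integral {0..t + h} g - integral {0..t} g) / h = integral {t..t + h} g / h" by simp
      qed
      with l show "((\<lambda>h. integral {t..t + h} g / h) \<longlongrightarrow> g t) (at_right 0)" by (rule Lim_transform_eventually)
    qed
  qed
qed

text \<open>\<open>y exp (- K \<tau>)\<close> decreases and \<open>y exp (K \<tau>)\<close>
  increases. The two relative changes merge through \<open>1 - exp (- x) \<le> exp x - 1\<close>.
  The bound is proportional to the initial value, so it can be integrated over actions.\<close>

lemma growth_two_sided:
  fixes y A :: "real \<Rightarrow> real"
  assumes h: "0 < h" and d: "\<And>\<tau>. t \<le> \<tau> \<Longrightarrow> \<tau> \<le> t + h \<Longrightarrow> (y has_real_derivative y \<tau> * A \<tau>) (at \<tau>)"
    and A: "\<And>\<tau>. t \<le> \<tau> \<Longrightarrow> \<tau> \<le> t + h \<Longrightarrow> \<bar>A \<tau>\<bar> \<le> K" and y: "\<And>\<tau>. t \<le> \<tau> \<Longrightarrow> \<tau> \<le> t + h \<Longrightarrow> 0 \<le> y \<tau>"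
  shows "\<bar>y t - y (t + h)\<bar> \<le> y t * (exp (K * h) - 1)"
proof -
  have up: "y (t + h) * exp (- K * (t + h)) \<le> y t * exp (- K * t)"
  proof (rule DERIV_nonpos_imp_nonincreasing[of t "t + h" "\<lambda>\<tau>. y \<tau> * exp (- K * \<tau>)"])
    fix \<tau> assume tau: "t \<le> \<tau>" "\<tau> \<le> t + h"
    have "((\<lambda>\<tau>. y \<tau> * exp (- K * \<tau>)) has_real_derivative y \<tau> * A \<tau> * exp (- K * \<tau>) + y \<tau> * (exp (- K * \<tau>) * - K)) (at \<tau>)"
      by (rule derivative_eq_intros d[OF tau] refl | simp)+
    moreover have "y \<tau> * A \<tau> * exp (- K * \<tau>) + y \<tau> * (exp (- K * \<tau>) * - K) = y \<tau> * exp (- K * \<tau>) * (A \<tau> - K)" by (simp add: algebra_simps)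
    moreover have "y \<tau> * exp (- K * \<tau>) * (A \<tau> - K) \<le> 0" using y[OF tau] A[OF tau] by (intro mult_nonneg_nonpos) auto
    ultimately show "\<exists>z. ((\<lambda>\<tau>. y \<tau> * exp (- K * \<tau>)) has_real_derivative z) (at \<tau>) \<and> z \<le> 0" by auto
  qed (use h in auto)
  have lo: "y t * exp (K * t) \<le> y (t + h) * exp (K * (t + h))"
  proof (rule DERIV_nonneg_imp_nondecreasing[of t "t + h" "\<lambda>\<tau>. y \<tau> * exp (K * \<tau>)"])
    fix \<tau> assume tau: "t \<le> \<tau>" "\<tau> \<le> t + h"
    have "((\<lambda>\<tau>. y \<tau> * exp (K * \<tau>)) has_real_derivative y \<tau> * A \<tau> * exp (K * \<tau>) + y \<tau> * (exp (K * \<tau>) * K)) (at \<tau>)"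
      by (rule derivative_eq_intros d[OF tau] refl | simp)+
    moreover have "y \<tau> * A \<tau> * exp (K * \<tau>) + y \<tau> * (exp (K * \<tau>) * K) = y \<tau> * exp (K * \<tau>) * (A \<tau> + K)" by (simp add: algebra_simps)
    moreover have "0 \<le> y \<tau> * exp (K * \<tau>) * (A \<tau> + K)" using y[OF tau] A[OF tau] by (intro mult_nonneg_nonneg) auto
    ultimately show "\<exists>z. ((\<lambda>\<tau>. y \<tau> * exp (K * \<tau>)) has_real_derivative z) (at \<tau>) \<and> 0 \<le> z" by auto
  qed (use h in auto)
  have e1: "exp (- K * t) * exp (K * (t + h)) = exp (K * h)" "exp (- K * (t + h)) * exp (K * (t + h)) = 1"
    "exp (K * t) * exp (- K * (t + h)) = exp (- K * h)" "exp (K * (t + h)) * exp (- K * (t + h)) = 1"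
    unfolding exp_add[symmetric] by (simp_all add: algebra_simps)
  have 1: "y (t + h) \<le> y t * exp (K * h)"
  proof -
    have "y (t + h) = y (t + h) * exp (- K * (t + h)) * exp (K * (t + h))" unfolding mult.assoc e1 by simp
    also have "\<dots> \<le> y t * exp (- K * t) * exp (K * (t + h))" by (rule mult_right_mono[OF up]) simp
    also have "\<dots> = y t * exp (K * h)" unfolding mult.assoc e1 ..
    finally show ?thesis .
  qed
  have 2: "y t * exp (- K * h) \<le> y (t + h)"
  proof -
    have "y t * exp (- K * h) = y t * exp (K * t) * exp (- K * (t + h))" unfolding mult.assoc e1 ..
    also have "\<dots> \<le> y (t + h) * exp (K * (t + h)) * exp (- K * (t + h))" by (rule mult_right_mono[OF lo]) simp
    also have "\<dots> = y (t + h)" unfolding mult.assoc e1 by simp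
    finally show ?thesis .
  qed
  have 3: "1 - exp (- K * h) \<le> exp (K * h) - 1"
    using exp_ge_add_one_self[of "K * h"] exp_ge_add_one_self[of "- K * h"] by linarith
  have y0: "0 \<le> y t" using y[of t] h by simp
  have "y t - y (t + h) \<le> y t * (1 - exp (- K * h))" using 2 by (simp add: algebra_simps)
  also have "\<dots> \<le> y t * (exp (K * h) - 1)" by (rule mult_left_mono[OF 3 y0])
  finally show ?thesis using 1 by (simp add: algebra_simps abs_le_iff)
qed

context mdp_policy
begin

lemma state_visit:
  assumes s: "s \<in> S"
  shows "prob_space (state_visit S Act P \<gamma> \<pi> s)" "AE s' in state_visit S Act P \<gamma> \<pi> s. s' \<in> S"
proof -
  let ?V = "visit S Act P \<gamma> \<pi> (init_at Act \<pi> s)"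
  have V: "onSA ?V" by (rule onSA_visit[OF init_at[OF s]])
  interpret prob_space ?V using V by (simp add: onSA_def)
  have [measurable_cong]: "sets ?V = sets borel" using V by (simp add: onSA_def)
  show "prob_space (state_visit S Act P \<gamma> \<pi> s)" unfolding state_visit_def by (rule prob_space_distr) measurable
  have "AE x in ?V. fst x \<in> S" using onSA_AE[OF V] by eventually_elim auto
  then show "AE s' in state_visit S Act P \<gamma> \<pi> s. s' \<in> S" unfolding state_visit_def
    by (subst AE_distr_iff) (use S_sets in auto)
qed

text \<open>A policy has a density that integrates to one over \<open>Act\<close>, so
  \<open>Act\<close> is not a null set; it lies in the unit ball, so its measure is finite.\<close>

lemma Act_measure: "0 < measure lborel Act" "emeasure lborel Act < \<infinity>"
proof -
  obtain s where s: "s \<in> S" using mdp by (auto simp: MDP_def)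
  have b: "bounded Act"
  proof (rule bounded_subset[OF bounded_cball[of 0 1]])
    show "Act \<subseteq> cball 0 1"
    proof
      fix a assume "a \<in> Act"
      then have "norm (s, a) \<le> 1" using mdp s by (auto simp: MDP_def)
      then show "a \<in> cball 0 1" using norm_fst_snd_le(2)[of "(s, a)"] by simp
    qed
  qed
  show fin: "emeasure lborel Act < \<infinity>" using emeasure_bounded_finite[OF b] by simp
  show "0 < measure lborel Act"
  proof (rule ccontr)
    assume "\<not> 0 < measure lborel Act"
    then have "emeasure lborel Act = 0" using fin measure_nonneg[of lborel Act] by (subst emeasure_eq_ennreal_measure) auto
    then have "AE a in lborel. a \<notin> Act" using S_sets by (intro AE_I[of _ _ Act]) auto
    then have "AE a in lborel. indicator Act a * \<pi> s a = 0" by eventually_elim auto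
    then have "(\<integral>a. indicator Act a * \<pi> s a \<partial>lborel) = (\<integral>a. 0 \<partial>(lborel :: 'a measure))"
    proof (rule integral_cong_AE[rotated 2])
      have "(\<lambda>a. \<pi> s a) \<in> borel_measurable lborel" by (rule pi_measurable) measurable
      then show "(\<lambda>a. indicator Act a * \<pi> s a) \<in> borel_measurable lborel" by measurable
    qed simp
    then show False using pol s by (simp add: policy_def)
  qed
qed

end

text \<open>Two policies at a fixed positive distance force the constant of property (iv) to be nonnegative.\<close>

lemma ex_separated_policies:
  fixes S :: "'s::euclidean_space set" and Act :: "'a::euclidean_space set"
  assumes mdp: "MDP S Act P r \<gamma>" and pol: "policy S Act \<pi>"
  obtains p1 p2 c where "policy S Act p1" "policy S Act p2" "0 < c" "\<And>s. pol_l1 Act p1 p2 s = c"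
proof -
  interpret mdp_policy S Act P r \<gamma> \<pi> using mdp pol by (rule mdp_policy.intro)
  obtain s0 where s0: "s0 \<in> S" using mdp by (auto simp: MDP_def)
  have an: "norm a \<le> 1" if "a \<in> Act" for a
  proof -
    have "norm (s0, a) \<le> 1" using mdp s0 that by (auto simp: MDP_def)
    then show ?thesis using norm_fst_snd_le(2)[of "(s0, a)"] by simp
  qed
  obtain b :: 'a where b: "b \<in> Basis" using nonempty_Basis by blast
  have ab: "\<bar>a \<bullet> b\<bar> \<le> 1" if "a \<in> Act" for a using Cauchy_Schwarz_ineq2[of a b] an[OF that] b by simp
  define m where "m = measure lborel Act"
  have m: "0 < m" unfolding m_def by (rule Act_measure)
  have iA: "integrable lborel (indicator Act :: 'a \<Rightarrow> real)" using Act_measure(2) S_sets by (intro integrable_real_indicator) auto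
  \<comment> \<open>A tilted density: on \<open>Act\<close> its values lie between 1 and 3, since
    actions have norm at most 1, and after normalisation it can agree with the uniform density only
    on a hyperplane, which is a null set.\<close>
  define f where "f a = indicator Act a * (2 + a \<bullet> b)" for a
  have fm[measurable]: "f \<in> borel_measurable borel" unfolding f_def by measurable
  have fi: "integrable lborel f"
  proof (rule Bochner_Integration.integrable_bound[of lborel "\<lambda>a. 3 * indicator Act a :: real"])
    show "AE a in lborel. norm (f a) \<le> norm (3 * indicator Act a :: real)"
    proof (rule AE_I2)
      fix a show "norm (f a) \<le> norm (3 * indicator Act a :: real)"
        using ab[of a] by (cases "a \<in> Act") (auto simp: f_def abs_le_iff)
    qed
  qed (use iA in auto)
  define M where "M = (\<integral>a. f a \<partial>lborel)"
  have fge: "indicator Act a \<le> f a" for a using ab[of a] by (auto simp: f_def indicator_def abs_le_iff)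
  have "m = (\<integral>a. indicator Act a \<partial>lborel)" by (simp add: m_def)
  also have "\<dots> \<le> M" unfolding M_def using iA fi fge by (intro integral_mono) auto
  finally have M: "0 < M" using m by simp
  define p1 where "p1 = (\<lambda>(s::'s) a. indicator Act a / m)"
  define p2 where "p2 = (\<lambda>(s::'s) a. f a / M)"
  have ind: "indicator Act a * indicator Act a = (indicator Act a :: real)" "indicator Act a * f a = f a" for a
    by (auto simp: f_def indicator_def)
  have 1: "policy S Act p1" unfolding policy_def
  proof (intro conjI ballI)
    show "(\<lambda>(s, a). p1 s a) \<in> borel_measurable borel" unfolding p1_def split_beta' by measurable
    fix s assume "s \<in> S"
    show "\<And>a. a \<in> Act \<Longrightarrow> 0 \<le> p1 s a" using m by (simp add: p1_def)
    show "integrable lborel (\<lambda>a. indicator Act a * p1 s a)" using iA by (simp add: p1_def ind)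
    show "(\<integral>a. indicator Act a * p1 s a \<partial>lborel) = 1" using m by (simp add: p1_def ind m_def[symmetric])
  qed
  have 2: "policy S Act p2" unfolding policy_def
  proof (intro conjI ballI)
    show "(\<lambda>(s, a). p2 s a) \<in> borel_measurable borel" unfolding p2_def split_beta' by measurable
    fix s assume "s \<in> S"
    show "\<And>a. a \<in> Act \<Longrightarrow> 0 \<le> p2 s a" using M fge by (auto simp: p2_def intro!: divide_nonneg_pos order_trans[OF indicator_pos_le fge])
    show "integrable lborel (\<lambda>a. indicator Act a * p2 s a)" using fi by (simp add: p2_def ind)
    show "(\<integral>a. indicator Act a * p2 s a \<partial>lborel) = 1" using M by (simp add: p2_def ind M_def[symmetric])
  qed
  define g where "g a = indicator Act a * \<bar>indicator Act a / m - f a / M\<bar>" for a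
  have gm[measurable]: "g \<in> borel_measurable borel" unfolding g_def by measurable
  have gi: "integrable lborel g"
  proof (rule Bochner_Integration.integrable_bound[of _ "\<lambda>a. indicator Act a / m + f a / M"])
    show "AE a in lborel. norm (g a) \<le> norm (indicator Act a / m + f a / M)"
    proof (rule AE_I2)
      fix a
      have "0 \<le> indicator Act a / m" "0 \<le> f a / M" using m M order_trans[OF indicator_pos_le fge[of a]] by auto
      moreover have "norm (g a) \<le> \<bar>indicator Act a / m - f a / M\<bar>" by (auto simp: g_def indicator_def)
      ultimately show "norm (g a) \<le> norm (indicator Act a / m + f a / M)" unfolding real_norm_def by linarith
    qed
  qed (use iA fi in auto)
  define c where "c = (\<integral>a. g a \<partial>lborel)"
  have g0: "0 \<le> g a" for a by (simp add: g_def)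
  have "c \<noteq> 0"
  proof
    assume "c = 0"
    then have "AE a in lborel. g a = 0" using integral_nonneg_eq_0_iff_AE[OF gi] g0 by (simp add: c_def)
    moreover have "AE a in lborel. a \<notin> {a. b \<bullet> a = M / m - 2}"
      by (intro lebesgue_negligible_AE_lborel negligible_hyperplane) (use b nonzero_Basis in blast)
    ultimately have "AE a in lborel. a \<notin> Act"
    proof eventually_elim
      fix a assume a: "g a = 0" "a \<notin> {a. b \<bullet> a = M / m - 2}"
      show "a \<notin> Act"
      proof
        assume "a \<in> Act"
        then have "1 / m = (2 + a \<bullet> b) / M" using a(1) by (simp add: g_def f_def)
        then show False using a(2) m M by (simp add: field_simps inner_commute)
      qed
    qed
    then have "emeasure lborel Act = 0" using S_sets AE_iff_measurable[of Act lborel "\<lambda>a. a \<notin> Act"] by simp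
    then show False using m by (simp add: m_def measure_def)
  qed
  moreover have "0 \<le> c" unfolding c_def using g0 by (intro integral_nonneg_AE AE_I2) auto
  ultimately have "0 < c" by simp
  moreover have "pol_l1 Act p1 p2 s = c" for s by (simp add: pol_l1_def p1_def p2_def c_def g_def)
  ultimately show ?thesis using 1 2 by (intro that[of p1 p2 c])
qed

section \<open>The coupled flow\<close>

locale coupled_flow =
  fixes S :: "'s::euclidean_space set" and Act :: "'a::euclidean_space set"
    and P :: "'s \<Rightarrow> 's \<Rightarrow> 'a \<Rightarrow> real" and r :: "'s \<Rightarrow> 'a \<Rightarrow> real" and \<gamma> :: real
    and \<beta> \<sigma>t :: "real \<Rightarrow> real" and L0 L1 l :: real
    and Br \<alpha> B\<beta> \<eta> Dbar Bcal :: real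
    and \<rho>P :: "('s \<Rightarrow> 'a \<Rightarrow> real) \<Rightarrow> (real \<times> ('s \<times> 'a \<times> real)) measure"
    and \<phi>t :: "('s \<Rightarrow> 'a \<Rightarrow> real) \<Rightarrow> ('s \<times> 'a) measure"
    and \<rho> :: "real \<Rightarrow> (real \<times> ('s \<times> 'a \<times> real)) measure"
    and \<pi> :: "real \<Rightarrow> 's \<Rightarrow> 'a \<Rightarrow> real"
  assumes mdp: "MDP S Act P r \<gamma>"
    and A1: "Assumption1 \<beta> \<sigma>t L0 L1 l"
    and rB: "\<And>s a. s \<in> S \<Longrightarrow> a \<in> Act \<Longrightarrow> 0 \<le> r s a \<and> r s a \<le> Br"
    and alpha: "1 \<le> \<alpha>"
    and L1fam: "Lemma1_family S Act P r \<gamma> \<alpha> B\<beta> \<beta> \<sigma>t \<phi>t \<rho>P Dbar Bcal"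
    and eta: "\<eta> > 0"
    and phit: "\<And>p. policy S Act p \<Longrightarrow> prob_space (\<phi>t p) \<and> sets (\<phi>t p) = sets borel \<and>
                 emeasure (\<phi>t p) (S \<times> Act) = 1"
    and pol: "\<And>t. t \<ge> 0 \<Longrightarrow> policy S Act (\<pi> t)"
    and rho0: "\<rho> 0 = std_normal"
    and CE: "weak_continuity_eq \<eta> \<rho>
               (\<lambda>t. gfield S Act P r \<gamma> \<alpha> B\<beta> \<beta> \<sigma>t (visit S Act P \<gamma> (\<pi> t) (\<phi>t (\<pi> t))) (\<rho> t) (\<pi> t))"
    and PDE: "\<And>t s a. t \<ge> 0 \<Longrightarrow> s \<in> S \<Longrightarrow> a \<in> Act \<Longrightarrow>
               ((\<lambda>\<tau>. \<pi> \<tau> s a) has_real_derivative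
                  (\<pi> t s a * (Qnet \<alpha> B\<beta> \<beta> \<sigma>t (\<rho> t) (s, a)
                     - (\<integral>a'. indicator Act a' * Qnet \<alpha> B\<beta> \<beta> \<sigma>t (\<rho> t) (s, a') * \<pi> t s a' \<partial>lborel))))
               (at t within {0..})"
    and ac1: "W2_abs_cont \<rho>"
    and ac2: "W2_abs_cont (\<lambda>t. \<rho>P (\<pi> t))"
begin

abbreviation "vt t \<equiv> gfield S Act P r \<gamma> \<alpha> B\<beta> \<beta> \<sigma>t (visit S Act P \<gamma> (\<pi> t) (\<phi>t (\<pi> t))) (\<rho> t) (\<pi> t)"
abbreviation "Q t \<equiv> Qnet \<alpha> B\<beta> \<beta> \<sigma>t (\<rho> t) :: 's \<times> 'a \<Rightarrow> real"
abbreviation "W \<tau> \<equiv> W2 (\<rho> \<tau>) (\<rho>P (\<pi> \<tau>))"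

sublocale network S Act \<beta> \<sigma>t L0 L1 l B\<beta>
proof (rule network.intro)
  show "Assumption1 \<beta> \<sigma>t L0 L1 l" by (rule A1)
  show "norm (s, a) \<le> 1" if "s \<in> S" "a \<in> Act" for s a using mdp that unfolding MDP_def by blast
  show "S \<noteq> {}" "Act \<noteq> {}" using mdp unfolding MDP_def by blast+
qed

lemma mp: "0 \<le> t \<Longrightarrow> mdp_policy S Act P r \<gamma> (\<pi> t)"
  using mdp pol by (intro mdp_policy.intro)

lemma mn:
  assumes t: "0 \<le> t" shows "mdp_net S Act P r \<gamma> (\<pi> t) \<beta> \<sigma>t L0 L1 l Br \<alpha> (\<phi>t (\<pi> t))"
proof -
  note phi = phit[OF pol[OF t]]
  interpret mdp_policy S Act P r \<gamma> "\<pi> t" by (rule mp[OF t])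
  show ?thesis
    by unfold_locales (use rB alpha phi in \<open>auto simp: onSA_def\<close>)
qed

lemma Pr: "0 \<le> t \<Longrightarrow> P2 (\<rho> t)" and Pn: "0 \<le> t \<Longrightarrow> P2 (\<rho>P (\<pi> t))"
  using ac1 ac2 by (auto simp: W2_abs_cont_def)

lemmas family_W2 = L1fam[unfolded Lemma1_family_def, THEN conjunct2, rule_format]

lemma family_Q: "0 \<le> t \<Longrightarrow> x \<in> S \<times> Act \<Longrightarrow> Qnet \<alpha> B\<beta> \<beta> \<sigma>t (\<rho>P (\<pi> t)) x = Qpi S Act P r \<gamma> (\<pi> t) x"
  using L1fam[unfolded Lemma1_family_def, THEN conjunct1, rule_format, OF pol] by (cases x) simp

text \<open>The initial network is identically zero, so the distance travelled by the parameter
  measure bounds the output.\<close>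

lemma Q_bound: "0 \<le> t \<Longrightarrow> x \<in> S \<times> Act \<Longrightarrow> \<bar>Q t x\<bar> \<le> \<alpha> * B1 * W2 (\<rho> t) (\<rho> 0)"
  using Qnet_W2[OF Pr[of t] Pr[of 0], of x \<alpha>] Qnet_std_normal[OF Pr[of 0, unfolded rho0], of \<alpha> x] alpha by (simp add: rho0)

text \<open>A negative constant would turn property (iv) for two separated policies into a negative
  upper bound of a distance. The sign is needed when an inequality between extended reals is
  multiplied by the constant.\<close>

lemma Bcal_nonneg: "0 \<le> Bcal"
proof (rule ccontr)
  assume "\<not> 0 \<le> Bcal"
  obtain p1 p2 c where p: "policy S Act p1" "policy S Act p2" "0 < c" "\<And>s. pol_l1 Act p1 p2 s = c"
    by (rule ex_separated_policies[OF mdp pol[of 0]]) auto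
  interpret p1: mdp_policy S Act P r \<gamma> p1 using mdp p(1) by (rule mdp_policy.intro)
  have "(\<integral>\<^sup>+ s'. ennreal (pol_l1 Act p1 p2 s') \<partial>state_visit S Act P \<gamma> p1 s) = ennreal c" if "s \<in> S" for s
    using prob_space.emeasure_space_1[OF p1.state_visit(1)[OF that]] by (simp add: p(4))
  then have "(SUP s\<in>S. enn2ereal (\<integral>\<^sup>+ s'. ennreal (pol_l1 Act p1 p2 s') \<partial>state_visit S Act P \<gamma> p1 s)) = (SUP s\<in>S. ereal c)"
    using p(3) by (intro SUP_cong refl) (simp add: enn2ereal_ennreal)
  also have "\<dots> = ereal c" using SA_ne by simp
  finally have "ereal (W2 (\<rho>P p1) (\<rho>P p2)) \<le> ereal (\<alpha> powr (-1/2) * Bcal) * ereal c"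
    using family_W2[OF p(1,2)] by (simp only:)
  then have "W2 (\<rho>P p1) (\<rho>P p2) \<le> \<alpha> powr (-1/2) * Bcal * c" by simp
  moreover have "\<alpha> powr (-1/2) * Bcal * c < 0"
    using \<open>\<not> 0 \<le> Bcal\<close> p(3) alpha by (intro mult_neg_pos mult_pos_neg) auto
  ultimately show False using W2_nonneg[of "\<rho>P p1" "\<rho>P p2"] by linarith
qed

text \<open>The advantage is at most \<open>2 K\<close> in absolute value, so every action density
  changes by a relative amount of at most \<open>exp (2 K h) - 1\<close>. Integrated against a
  density of mass one, this bounds the \<open>l1\<close> change at every state, hence its mean under
  every state visitation measure.\<close>

lemma policy_move:
  assumes t: "0 < t" and h: "0 < h" and K: "\<And>\<tau> x. t \<le> \<tau> \<Longrightarrow> \<tau> \<le> t + h \<Longrightarrow> x \<in> S \<times> Act \<Longrightarrow> \<bar>Q \<tau> x\<bar> \<le> K"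
  shows "W2 (\<rho>P (\<pi> t)) (\<rho>P (\<pi> (t + h))) \<le> \<alpha> powr (-1/2) * Bcal * (exp (2 * K * h) - 1)"
proof -
  interpret m: mdp_policy S Act P r \<gamma> "\<pi> t" by (rule mp) (use t in simp)
  interpret m': mdp_policy S Act P r \<gamma> "\<pi> (t + h)" by (rule mp) (use t h in simp)
  obtain s0 a0 where sa0: "s0 \<in> S" "a0 \<in> Act" using SA_ne by blast
  have K0: "0 \<le> K" using order_trans[OF abs_ge_zero K[of t "(s0, a0)"]] h sa0 by simp
  have e0: "0 \<le> exp (2 * K * h) - 1" using K0 h by simp
  have l1: "pol_l1 Act (\<pi> t) (\<pi> (t + h)) s \<le> exp (2 * K * h) - 1" if s: "s \<in> S" for s
  proof -
    have pt: "\<bar>\<pi> t s a - \<pi> (t + h) s a\<bar> \<le> \<pi> t s a * (exp (2 * K * h) - 1)" if a: "a \<in> Act" for a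
    proof (rule growth_two_sided[of h t "\<lambda>\<tau>. \<pi> \<tau> s a", OF h])
      fix \<tau> assume tau: "t \<le> \<tau>" "\<tau> \<le> t + h"
      then have t0: "0 \<le> \<tau>" "0 < \<tau>" using t by auto
      let ?A = "\<lambda>\<tau>. Q \<tau> (s, a) - (\<integral>a'. indicator Act a' * Q \<tau> (s, a') * \<pi> \<tau> s a' \<partial>lborel)"
      \<comment> \<open>Positive times are interior to the half-line, so the derivative prescribed
        by the system is an ordinary one.\<close>
      have "at \<tau> within {0..} = at \<tau>" using t0 by (intro at_within_interior) simp
      then show "((\<lambda>\<tau>. \<pi> \<tau> s a) has_real_derivative \<pi> \<tau> s a * ?A \<tau>) (at \<tau>)" using PDE[OF t0(1) s a] by simp
      have pp: "policy S Act (\<pi> \<tau>)" by (rule pol[OF t0(1)])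
      have i: "integrable lborel (\<lambda>a'. K * (indicator Act a' * \<pi> \<tau> s a'))" using pp s by (auto simp: policy_def)
      have bd: "\<bar>indicator Act a' * Q \<tau> (s, a') * \<pi> \<tau> s a'\<bar> \<le> K * (indicator Act a' * \<pi> \<tau> s a')" for a'
      proof (cases "a' \<in> Act")
        case True
        have "\<bar>Q \<tau> (s, a')\<bar> * \<pi> \<tau> s a' \<le> K * \<pi> \<tau> s a'" using K[OF tau, of "(s, a')"] s True pp by (intro mult_right_mono) (auto simp: policy_def)
        moreover have "0 \<le> \<pi> \<tau> s a'" using pp s True by (auto simp: policy_def)
        ultimately show ?thesis using True by (simp add: abs_mult)
      qed simp
      have "\<bar>\<integral>a'. indicator Act a' * Q \<tau> (s, a') * \<pi> \<tau> s a' \<partial>lborel\<bar> \<le> K"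
      \<comment> \<open>If the integrand of the average is not integrable, the integral is 0 by
        convention and the bound still holds.\<close>
      proof (cases "integrable lborel (\<lambda>a'. indicator Act a' * Q \<tau> (s, a') * \<pi> \<tau> s a')")
        case True
        have "\<bar>\<integral>a'. indicator Act a' * Q \<tau> (s, a') * \<pi> \<tau> s a' \<partial>lborel\<bar> \<le> (\<integral>a'. K * (indicator Act a' * \<pi> \<tau> s a') \<partial>lborel)"
          using True i bd by (intro order_trans[OF integral_abs_bound] integral_mono) auto
        also have "\<dots> = K" using pp s by (simp add: policy_def)
        finally show ?thesis .
      next
        case False then show ?thesis using K0 by (simp add: not_integrable_integral_eq)
      qed
      then show "\<bar>?A \<tau>\<bar> \<le> 2 * K" using K[OF tau, of "(s, a)"] s a by auto
      show "0 \<le> \<pi> \<tau> s a" using pp s a by (auto simp: policy_def)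
    qed
    have i1: "integrable lborel (\<lambda>a. indicator Act a * \<pi> t s a)" "integrable lborel (\<lambda>a. indicator Act a * \<pi> (t + h) s a)"
      using m.pol m'.pol s by (auto simp: policy_def)
    have "integrable lborel (\<lambda>a. \<bar>indicator Act a * \<pi> t s a - indicator Act a * \<pi> (t + h) s a\<bar>)" using i1 by auto
    moreover have "(\<lambda>a. \<bar>indicator Act a * \<pi> t s a - indicator Act a * \<pi> (t + h) s a\<bar>) = (\<lambda>a. indicator Act a * \<bar>\<pi> t s a - \<pi> (t + h) s a\<bar>)"
      by (auto simp: fun_eq_iff indicator_def)
    ultimately have i2: "integrable lborel (\<lambda>a. indicator Act a * \<bar>\<pi> t s a - \<pi> (t + h) s a\<bar>)" by simp
    have "pol_l1 Act (\<pi> t) (\<pi> (t + h)) s \<le> (\<integral>a. (indicator Act a * \<pi> t s a) * (exp (2 * K * h) - 1) \<partial>lborel)"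
      unfolding pol_l1_def using i1 i2 pt by (intro integral_mono) (auto simp: indicator_def)
    also have "\<dots> = exp (2 * K * h) - 1" using m.pol s by (simp add: policy_def)
    finally show ?thesis .
  qed
  have "(SUP s\<in>S. enn2ereal (\<integral>\<^sup>+ s'. ennreal (pol_l1 Act (\<pi> t) (\<pi> (t + h)) s') \<partial>state_visit S Act P \<gamma> (\<pi> t) s)) \<le> ereal (exp (2 * K * h) - 1)"
  proof (rule SUP_least)
    fix s assume s: "s \<in> S"
    have "(\<integral>\<^sup>+ s'. ennreal (pol_l1 Act (\<pi> t) (\<pi> (t + h)) s') \<partial>state_visit S Act P \<gamma> (\<pi> t) s) \<le> (\<integral>\<^sup>+ s'. ennreal (exp (2 * K * h) - 1) \<partial>state_visit S Act P \<gamma> (\<pi> t) s)"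
    proof (rule nn_integral_mono_AE)
      show "AE s' in state_visit S Act P \<gamma> (\<pi> t) s. ennreal (pol_l1 Act (\<pi> t) (\<pi> (t + h)) s') \<le> ennreal (exp (2 * K * h) - 1)"
        using m.state_visit(2)[OF s] by eventually_elim (intro ennreal_leI l1)
    qed
    also have "\<dots> = ennreal (exp (2 * K * h) - 1)" using prob_space.emeasure_space_1[OF m.state_visit(1)[OF s]] by simp
    finally have "enn2ereal (\<integral>\<^sup>+ s'. ennreal (pol_l1 Act (\<pi> t) (\<pi> (t + h)) s') \<partial>state_visit S Act P \<gamma> (\<pi> t) s) \<le> enn2ereal (ennreal (exp (2 * K * h) - 1))"
      by (simp add: less_eq_ennreal.rep_eq)
    then show "enn2ereal (\<integral>\<^sup>+ s'. ennreal (pol_l1 Act (\<pi> t) (\<pi> (t + h)) s') \<partial>state_visit S Act P \<gamma> (\<pi> t) s) \<le> ereal (exp (2 * K * h) - 1)"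
      using e0 by (simp add: enn2ereal_ennreal)
  qed
  then have "ereal (\<alpha> powr (-1/2) * Bcal) * (SUP s\<in>S. enn2ereal (\<integral>\<^sup>+ s'. ennreal (pol_l1 Act (\<pi> t) (\<pi> (t + h)) s') \<partial>state_visit S Act P \<gamma> (\<pi> t) s))
     \<le> ereal (\<alpha> powr (-1/2) * Bcal) * ereal (exp (2 * K * h) - 1)"
    using Bcal_nonneg by (intro ereal_mult_left_mono) auto
  moreover have "ereal (W2 (\<rho>P (\<pi> t)) (\<rho>P (\<pi> (t + h)))) \<le> ereal (\<alpha> powr (-1/2) * Bcal) * (SUP s\<in>S. enn2ereal (\<integral>\<^sup>+ s'. ennreal (pol_l1 Act (\<pi> t) (\<pi> (t + h)) s') \<partial>state_visit S Act P \<gamma> (\<pi> t) s))"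
    by (rule family_W2[OF m.pol m'.pol])
  ultimately have "ereal (W2 (\<rho>P (\<pi> t)) (\<rho>P (\<pi> (t + h)))) \<le> ereal (\<alpha> powr (-1/2) * Bcal) * ereal (exp (2 * K * h) - 1)" by (rule order_trans[rotated])
  then show ?thesis by simp
qed

text \<open>The triangle inequality bounds increments of the distance by the integrals of the two
  speed bounds together; differentiability follows on each interval \<open>[0, n]\<close>.\<close>

lemma W_differentiable_ae: "AE t in lborel. 0 < t \<longrightarrow> W differentiable (at t)"
proof -
  obtain m1 where "\<forall>T. m1 absolutely_integrable_on {0..T}" "\<forall>s t. 0 \<le> s \<longrightarrow> s \<le> t \<longrightarrow> W2 (\<rho> s) (\<rho> t) \<le> integral {s..t} m1"
    using ac1 unfolding W2_abs_cont_def by blast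
  then have m1: "\<And>T. m1 absolutely_integrable_on {0..T}" "\<And>s t. 0 \<le> s \<Longrightarrow> s \<le> t \<Longrightarrow> W2 (\<rho> s) (\<rho> t) \<le> integral {s..t} m1"
    by simp_all
  obtain m2 where "\<forall>T. m2 absolutely_integrable_on {0..T}" "\<forall>s t. 0 \<le> s \<longrightarrow> s \<le> t \<longrightarrow> W2 (\<rho>P (\<pi> s)) (\<rho>P (\<pi> t)) \<le> integral {s..t} m2"
    using ac2 unfolding W2_abs_cont_def by blast
  then have m2: "\<And>T. m2 absolutely_integrable_on {0..T}" "\<And>s t. 0 \<le> s \<Longrightarrow> s \<le> t \<Longrightarrow> W2 (\<rho>P (\<pi> s)) (\<rho>P (\<pi> t)) \<le> integral {s..t} m2"
    by simp_all
  have "AE t in lborel. \<forall>n::nat. 0 < t \<and> t < real n \<longrightarrow> W differentiable (at t)"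
  proof (subst AE_all_countable, rule allI, rule integral_dominated_increments_differentiable_ae)
    fix n :: nat
    show "(\<lambda>x. m1 x + m2 x) absolutely_integrable_on {0..real n}" by (rule set_integral_add(1)[OF m1(1) m2(1)])
    fix s t :: real assume st: "0 \<le> s" "s \<le> t" "t \<le> real n"
    have i: "m1 integrable_on {s..t}" "m2 integrable_on {s..t}"
      using integrable_on_subinterval[of m1 "{0..real n}" s t] integrable_on_subinterval[of m2 "{0..real n}" s t] m1(1) m2(1) st
      by (auto simp: absolutely_integrable_on_def)
    note P = Pr[OF st(1)] Pn[OF st(1)] Pr[OF order_trans[OF st(1,2)]] Pn[OF order_trans[OF st(1,2)]]
    have 1: "W t \<le> W2 (\<rho> t) (\<rho> s) + W2 (\<rho> s) (\<rho>P (\<pi> t))" by (rule W2_triangle[OF P(1,3,4)])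
    have 2: "W2 (\<rho> s) (\<rho>P (\<pi> t)) \<le> W s + W2 (\<rho>P (\<pi> s)) (\<rho>P (\<pi> t))" by (rule W2_triangle[OF P(2,1,4)])
    have 3: "W s \<le> W2 (\<rho> s) (\<rho> t) + W2 (\<rho> t) (\<rho>P (\<pi> s))" by (rule W2_triangle[OF P(3,1,2)])
    have 4: "W2 (\<rho> t) (\<rho>P (\<pi> s)) \<le> W t + W2 (\<rho>P (\<pi> t)) (\<rho>P (\<pi> s))" by (rule W2_triangle[OF P(4,3,2)])
    have "W2 (\<rho> t) (\<rho> s) = W2 (\<rho> s) (\<rho> t)" "W2 (\<rho>P (\<pi> t)) (\<rho>P (\<pi> s)) = W2 (\<rho>P (\<pi> s)) (\<rho>P (\<pi> t))"
      by (rule W2_commute[OF P(3,1)], rule W2_commute[OF P(4,2)])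
    then have "\<bar>W t - W s\<bar> \<le> W2 (\<rho> s) (\<rho> t) + W2 (\<rho>P (\<pi> s)) (\<rho>P (\<pi> t))" using 1 2 3 4 by linarith
    also have "\<dots> \<le> integral {s..t} m1 + integral {s..t} m2" using m1(2)[OF st(1,2)] m2(2)[OF st(1,2)] by linarith
    also have "\<dots> = integral {s..t} (\<lambda>x. m1 x + m2 x)" by (rule Henstock_Kurzweil_Integration.integral_add[OF i, symmetric])
    finally show "\<bar>W t - W s\<bar> \<le> integral {s..t} (\<lambda>x. m1 x + m2 x)" .
  qed
  then show ?thesis
  proof eventually_elim
    fix t :: real assume a: "\<forall>n::nat. 0 < t \<and> t < real n \<longrightarrow> W differentiable (at t)"
    obtain n :: nat where "t < real n" using reals_Archimedean2 by blast
    then show "0 < t \<longrightarrow> W differentiable (at t)" using a by blast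
  qed
qed

text \<open>At almost every time the right averages of the speed bound \<open>m1\<close> converge to
  \<open>m1 t\<close>, so any larger constant works for small steps.\<close>

lemma speed_ae: "AE t in lborel. 0 < t \<longrightarrow> (\<exists>C\<ge>0. \<forall>\<^sub>F h in at_right 0. W2 (\<rho> t) (\<rho> (t + h)) \<le> C * h)"
proof -
  obtain m1 where "\<forall>T. m1 absolutely_integrable_on {0..T}" "\<forall>s t. 0 \<le> s \<longrightarrow> s \<le> t \<longrightarrow> W2 (\<rho> s) (\<rho> t) \<le> integral {s..t} m1"
    using ac1 unfolding W2_abs_cont_def by blast
  then have m1: "\<And>T. m1 absolutely_integrable_on {0..T}" "\<And>s t. 0 \<le> s \<Longrightarrow> s \<le> t \<Longrightarrow> W2 (\<rho> s) (\<rho> t) \<le> integral {s..t} m1"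
    by simp_all
  have "AE t in lborel. 0 < t \<longrightarrow> ((\<lambda>h. integral {t..t + h} m1 / h) \<longlongrightarrow> m1 t) (at_right 0)"
    by (rule right_averages_ae) (use m1(1) in \<open>auto simp: absolutely_integrable_on_def\<close>)
  then show ?thesis
  proof eventually_elim
    fix t :: real assume a: "0 < t \<longrightarrow> ((\<lambda>h. integral {t..t + h} m1 / h) \<longlongrightarrow> m1 t) (at_right 0)"
    show "0 < t \<longrightarrow> (\<exists>C\<ge>0. \<forall>\<^sub>F h in at_right 0. W2 (\<rho> t) (\<rho> (t + h)) \<le> C * h)"
    proof (intro impI exI conjI)
      assume t: "0 < t"
      show "0 \<le> \<bar>m1 t\<bar> + 1" by simp
      have "m1 t < \<bar>m1 t\<bar> + 1" by linarith
      then have "\<forall>\<^sub>F h in at_right 0. integral {t..t + h} m1 / h < \<bar>m1 t\<bar> + 1"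
        by (rule order_tendstoD(2)[OF a[rule_format, OF t]])
      then show "\<forall>\<^sub>F h in at_right 0. W2 (\<rho> t) (\<rho> (t + h)) \<le> (\<bar>m1 t\<bar> + 1) * h"
        using eventually_at_right_less[of "0::real"]
      proof eventually_elim
        fix h :: real assume h: "integral {t..t + h} m1 / h < \<bar>m1 t\<bar> + 1" "0 < h"
        then have "integral {t..t + h} m1 \<le> (\<bar>m1 t\<bar> + 1) * h" by (simp add: field_simps)
        then show "W2 (\<rho> t) (\<rho> (t + h)) \<le> (\<bar>m1 t\<bar> + 1) * h" using m1(2)[of t "t + h"] t h by linarith
      qed
    qed
  qed
qed

text \<open>The null set of exceptional times depends on the test function. Taking the radius and
  \<kappa> to be integers and the remaining parameters to be lists over a countable set leaves
  countably many functions, so one null set serves all.\<close>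

lemma test_ae:
  assumes D: "countable (D :: ((real \<times> ('s \<times> 'a \<times> real)) \<times> real) set)"
  shows "AE t in lborel. 0 < t \<longrightarrow> (\<forall>(R::nat)>0. \<forall>(\<kappa>::nat)>0. \<forall>ps\<in>lists D. ps \<noteq> [] \<longrightarrow>
       ((\<lambda>h. ((\<integral>x. tfun (real R) (real \<kappa>) (length ps) (\<lambda>i. fst (ps ! i)) (\<lambda>i. snd (ps ! i)) x \<partial>\<rho> (t + h))
            - (\<integral>x. tfun (real R) (real \<kappa>) (length ps) (\<lambda>i. fst (ps ! i)) (\<lambda>i. snd (ps ! i)) x \<partial>\<rho> t)) / h)
          \<longlongrightarrow> (\<integral>x. tgrad (real R) (real \<kappa>) (length ps) (\<lambda>i. fst (ps ! i)) (\<lambda>i. snd (ps ! i)) x \<bullet> (\<eta> *\<^sub>R vt t x) \<partial>\<rho> t)) (at_right 0))"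
proof -
  define lim where "lim t R \<kappa> ps \<longleftrightarrow> ((\<lambda>h. ((\<integral>x. tfun (real R) (real \<kappa>) (length ps) (\<lambda>i. fst (ps ! i)) (\<lambda>i. snd (ps ! i)) x \<partial>\<rho> (t + h))
            - (\<integral>x. tfun (real R) (real \<kappa>) (length ps) (\<lambda>i. fst (ps ! i)) (\<lambda>i. snd (ps ! i)) x \<partial>\<rho> t)) / h)
          \<longlongrightarrow> (\<integral>x. tgrad (real R) (real \<kappa>) (length ps) (\<lambda>i. fst (ps ! i)) (\<lambda>i. snd (ps ! i)) x \<bullet> (\<eta> *\<^sub>R vt t x) \<partial>\<rho> t)) (at_right 0)"
    for t and R \<kappa> :: nat and ps
  let ?X = "{0<..} \<times> {0<..} \<times> (lists D - {[]}) :: (nat \<times> nat \<times> ((real \<times> ('s \<times> 'a \<times> real)) \<times> real) list) set"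
  have one: "AE t in lborel. 0 < t \<longrightarrow> lim t R \<kappa> ps" if "0 < R" "0 < \<kappa>" "ps \<noteq> []" for R \<kappa> ps
  proof -
    define f where "f = tfun (real R) (real \<kappa>) (length ps) (\<lambda>i. fst (ps ! i)) (\<lambda>i. snd (ps ! i))"
    define G where "G = tgrad (real R) (real \<kappa>) (length ps) (\<lambda>i. fst (ps ! i)) (\<lambda>i. snd (ps ! i))"
    have N: "0 < length ps" "0 < real \<kappa>" using that by auto
    have test: "(\<forall>x. (f has_derivative (\<lambda>h. G x \<bullet> h)) (at x)) \<and> continuous_on UNIV G \<and> bounded {x. f x \<noteq> 0}"
      unfolding f_def G_def using tfun_has_derivative[OF N] tgrad_continuous[OF N(1)] tfun_support[of "real R"] that(1) by auto
    define gg where "gg s = \<eta> * (\<integral>\<theta>. G \<theta> \<bullet> vt s \<theta> \<partial>\<rho> s)" for s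
    have ce: "gg integrable_on {t1..t2} \<and> (\<integral>\<theta>. f \<theta> \<partial>\<rho> t2) - (\<integral>\<theta>. f \<theta> \<partial>\<rho> t1) = integral {t1..t2} gg" if "0 \<le> t1" "t1 \<le> t2" for t1 t2
      unfolding gg_def using CE[unfolded weak_continuity_eq_def, rule_format, OF test that] by simp
    have "AE t in lborel. 0 < t \<longrightarrow> ((\<lambda>h. integral {t..t + h} gg / h) \<longlongrightarrow> gg t) (at_right 0)"
      by (rule right_averages_ae) (use ce in auto)
    then show ?thesis
    proof eventually_elim
      fix t assume a: "0 < t \<longrightarrow> ((\<lambda>h. integral {t..t + h} gg / h) \<longlongrightarrow> gg t) (at_right 0)"
      show "0 < t \<longrightarrow> lim t R \<kappa> ps"
      proof
        assume t: "0 < t"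
        have "\<forall>\<^sub>F h in at_right 0. integral {t..t + h} gg / h = ((\<integral>\<theta>. f \<theta> \<partial>\<rho> (t + h)) - (\<integral>\<theta>. f \<theta> \<partial>\<rho> t)) / h"
          using eventually_at_right_less[of "0::real"] by eventually_elim (use ce[of t] t in auto)
        from Lim_transform_eventually[OF a[rule_format, OF t] this]
        have "((\<lambda>h. ((\<integral>\<theta>. f \<theta> \<partial>\<rho> (t + h)) - (\<integral>\<theta>. f \<theta> \<partial>\<rho> t)) / h) \<longlongrightarrow> gg t) (at_right 0)" .
        moreover have "gg t = (\<integral>x. G x \<bullet> (\<eta> *\<^sub>R vt t x) \<partial>\<rho> t)" by (simp add: gg_def)
        ultimately show "lim t R \<kappa> ps" by (simp add: lim_def f_def G_def)
      qed
    qed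
  qed
  have "countable ?X" using D by (intro countable_SIGMA countable_Diff countable_lists) auto
  then have "AE t in lborel. \<forall>q\<in>?X. 0 < t \<longrightarrow> lim t (fst q) (fst (snd q)) (snd (snd q))"
    by (subst AE_ball_countable) (auto intro!: one)
  then show ?thesis unfolding lim_def[symmetric] by eventually_elim auto
qed

text \<open>By the triangle inequality through \<open>\<rho>P (\<pi> t)\<close> the new distance is
  at most \<open>a + q h\<close>, with \<open>a\<close> measured to the old target. Its square
  splits into \<open>a^2\<close>, controlled by the first variation, a cross term whose quotient by
  \<open>h\<close> tends to \<open>4 A b (K + e)\<close>, and a negligible square of
  \<open>q h\<close>. The auxiliary error \<open>e\<close> is kept until the quotients have
  converged and is then sent to 0.\<close>

lemma derivative_bound:
  assumes t: "0 < t" and Wd: "(W has_real_derivative W') (at t)"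
    and C: "0 \<le> C" "\<forall>\<^sub>F h in at_right 0. W2 (\<rho> t) (\<rho> (t + h)) \<le> C * h"
    and dense: "\<And>z e. 0 < e \<Longrightarrow> \<exists>d\<in>D. dist d z < e"
    and test: "\<forall>(R::nat)>0. \<forall>(\<kappa>::nat)>0. \<forall>ps\<in>lists D. ps \<noteq> [] \<longrightarrow>
       ((\<lambda>h. ((\<integral>x. tfun (real R) (real \<kappa>) (length ps) (\<lambda>i. fst (ps ! i)) (\<lambda>i. snd (ps ! i)) x \<partial>\<rho> (t + h))
            - (\<integral>x. tfun (real R) (real \<kappa>) (length ps) (\<lambda>i. fst (ps ! i)) (\<lambda>i. snd (ps ! i)) x \<partial>\<rho> t)) / h)
          \<longlongrightarrow> (\<integral>x. tgrad (real R) (real \<kappa>) (length ps) (\<lambda>i. fst (ps ! i)) (\<lambda>i. snd (ps ! i)) x \<bullet> (\<eta> *\<^sub>R vt t x) \<partial>\<rho> t)) (at_right 0)"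
  defines "K \<equiv> \<alpha> * B1 * W2 (\<rho> t) (\<rho> 0)"
  shows "\<alpha>\<^sup>2 / (2 * \<eta>) * (2 * W t * W') \<le>
     - (1 - sqrt \<gamma>) * (\<integral>x. (Q t x - Qnet \<alpha> B\<beta> \<beta> \<sigma>t (\<rho>P (\<pi> t)) x)\<^sup>2 \<partial>\<phi>t (\<pi> t))
     + \<alpha> * B2 * (2 * K + Br) / 2 * (W t)\<^sup>2 + 2 * \<alpha>\<^sup>2 / \<eta> * W t * (\<alpha> powr (-1/2) * Bcal) * K"
proof -
  have t0: "0 \<le> t" using t by simp
  interpret mnt: mdp_net S Act P r \<gamma> "\<pi> t" \<beta> \<sigma>t L0 L1 l B\<beta> Br \<alpha> "\<phi>t (\<pi> t)" by (rule mn[OF t0])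
  let ?\<nu> = "\<rho>P (\<pi> t)"
  define A where "A = W t"
  define b where "b = \<alpha> powr (-1/2) * Bcal"
  define E where "E = (\<integral>x. (Q t x - Qnet \<alpha> B\<beta> \<beta> \<sigma>t ?\<nu> x)\<^sup>2 \<partial>\<phi>t (\<pi> t))"
  have b0: "0 \<le> b" using Bcal_nonneg by (simp add: b_def)
  have A0: "0 \<le> A" by (simp add: A_def W2_nonneg)
  have K: "\<bar>Q t x\<bar> \<le> K" if "x \<in> S \<times> Act" for x unfolding K_def by (rule Q_bound[OF t0 that])
  have K0: "0 \<le> K" unfolding K_def using alpha B1_nonneg W2_nonneg by (intro mult_nonneg_nonneg) auto
  have Br0: "0 \<le> Br" using rB SA_ne by force
  define v where "v x = \<eta> *\<^sub>R vt t x" for x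
  have vm: "v \<in> borel_measurable borel" unfolding v_def using mnt.gf_measurable[OF Pr[OF t0] K] by measurable
  have vb: "norm (v x) \<le> \<eta> * ((2 * K + Br) * B1)" for x
    unfolding v_def norm_scaleR using mnt.gf_bound[OF Pr[OF t0] K, of x] eta by (simp add: mult_left_mono)
  have Ph: "P2 (\<rho> (t + h))" if "0 < h" for h using Pr[of "t + h"] t that by simp
  have main: "2 * W t * W' \<le> 2 * (\<eta> / \<alpha>\<^sup>2) * (- (1 - sqrt \<gamma>) * E + \<alpha> * B2 * (2 * K + Br) / 2 * (A\<^sup>2 + e)) + 2 * e + 4 * A * b * (K + e)"
    if e: "0 < e" for e
  proof -
    obtain g where g: "g \<in> couplings (\<rho> t) ?\<nu>" "cost g \<le> A\<^sup>2 + e"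
      and gW: "\<forall>\<^sub>F h in at_right 0. (W2 (\<rho> (t + h)) ?\<nu>)\<^sup>2 \<le> A\<^sup>2 + 2 * h * ((\<integral>z. (fst z - snd z) \<bullet> v (fst z) \<partial>g) + e)"
    proof (rule W2_sq_right_increment[OF Pr[OF t0] Pn[OF t0] Ph C(2) vm vb _ e])
      fix \<kappa> N :: nat and y w p K'
      assume "0 < \<kappa>" "0 < N" "\<And>h. 0 < h \<Longrightarrow> p h \<in> couplings (\<rho> t) (\<rho> (t + h))" "\<forall>\<^sub>F h in at_right 0. cost (p h) \<le> (K' * h)\<^sup>2"
      then show "((\<lambda>h. (\<integral>z. (fst z - gibbs_mean (real \<kappa>) N y w (fst z)) \<bullet> (snd z - fst z) \<partial>p h) / h)
           \<longlongrightarrow> (\<integral>x. (x - gibbs_mean (real \<kappa>) N y w x) \<bullet> v x \<partial>\<rho> t)) (at_right 0)"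
        using test by (intro gibbs_pairing_limit[OF Pr[OF t0] Ph vm vb dense]) (auto simp: v_def)
    qed (auto simp: A_def that)
    define X where "X = (\<integral>z. (fst z - snd z) \<bullet> v (fst z) \<partial>g)"
    have Xb: "X \<le> \<eta> / \<alpha>\<^sup>2 * (- (1 - sqrt \<gamma>) * E + \<alpha> * B2 * (2 * K + Br) / 2 * (A\<^sup>2 + e))"
    proof -
      have Qn: "Qnet \<alpha> B\<beta> \<beta> \<sigma>t ?\<nu> x = Qpi S Act P r \<gamma> (\<pi> t) x" if "x \<in> S \<times> Act" for x
        by (rule family_Q[OF t0 that])
      have "X = \<eta> * (\<integral>z. (fst z - snd z) \<bullet> vt t (fst z) \<partial>g)" by (simp add: X_def v_def)
      also have "\<dots> = \<eta> / \<alpha>\<^sup>2 * (\<alpha>\<^sup>2 * (\<integral>z. (fst z - snd z) \<bullet> vt t (fst z) \<partial>g))" using alpha by simp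
      also have "\<dots> \<le> \<eta> / \<alpha>\<^sup>2 * (- (1 - sqrt \<gamma>) * E + \<alpha> * B2 * (2 * K + Br) / 2 * cost g)"
        unfolding E_def using eta by (intro mult_left_mono mnt.gf_pairing[OF Pr[OF t0] K Pn[OF t0] g(1) Qn]) auto
      also have "\<dots> \<le> \<eta> / \<alpha>\<^sup>2 * (- (1 - sqrt \<gamma>) * E + \<alpha> * B2 * (2 * K + Br) / 2 * (A\<^sup>2 + e))"
        using eta g(2) alpha B2_nonneg K0 Br0 by (intro mult_left_mono add_left_mono) auto
      finally show ?thesis .
    qed
    \<comment> \<open>Bound for the motion of the target within a step \<open>h\<close>;
      \<open>K + e\<close> bounds the network on the whole window, not only at
      \<open>t\<close>.\<close>
    define q where "q h = b * (exp (2 * (K + e) * h) - 1)" for h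
    have q0: "(q has_real_derivative b * (2 * (K + e))) (at 0)"
      unfolding q_def by (auto intro!: derivative_eq_intros)
    have q00: "q 0 = 0" by (simp add: q_def)
    have "((\<lambda>h. q h / h) \<longlongrightarrow> b * (2 * (K + e))) (at 0)" using q0 by (simp add: DERIV_def q00)
    then have ql: "((\<lambda>h. q h / h) \<longlongrightarrow> b * (2 * (K + e))) (at_right 0)"
      by (rule filterlim_mono) (auto simp: at_le)
    have qz: "(q \<longlongrightarrow> 0) (at_right 0)"
    proof -
      have "isCont q 0" using q0 by (rule DERIV_isCont)
      then have "(q \<longlongrightarrow> 0) (at 0)" by (simp add: isCont_def q00)
      then show ?thesis by (rule filterlim_mono) (auto simp: at_le)
    qed
    have hpos: "\<forall>\<^sub>F h in at_right (0::real). 0 < h" by (simp add: eventually_at_right_less)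
    have move: "\<forall>\<^sub>F h in at_right 0. W2 ?\<nu> (\<rho>P (\<pi> (t + h))) \<le> q h"
    proof -
      obtain d where d: "0 < d" "\<And>h. 0 < h \<Longrightarrow> h < d \<Longrightarrow> W2 (\<rho> t) (\<rho> (t + h)) \<le> C * h"
        using C(2) by (auto simp: eventually_at_right_field)
      \<comment> \<open>On this window the parameter measure moves so little that the bound on the
        network grows by at most \<open>e\<close>.\<close>
      define d' where "d' = min d (e / (\<alpha> * B1 * C + 1))"
      have c0: "0 \<le> \<alpha> * B1 * C" using alpha B1_nonneg C(1) by simp
      have d': "0 < d'" using d(1) e c0 by (simp add: d'_def)
      have "\<forall>\<^sub>F h in at_right 0. h < d'" using d' by (auto simp: eventually_at_right_field)
      then show ?thesis using hpos
      proof eventually_elim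
        fix h :: real assume h: "h < d'" "0 < h"
        show "W2 ?\<nu> (\<rho>P (\<pi> (t + h))) \<le> q h"
          unfolding q_def b_def
        proof (rule policy_move[OF t h(2)])
          fix \<tau> x assume tau: "t \<le> \<tau>" "\<tau> \<le> t + h" and x: "x \<in> S \<times> Act"
          have tau0: "0 \<le> \<tau>" using t tau by simp
          have Wt: "W2 (\<rho> t) (\<rho> \<tau>) \<le> C * h"
          \<comment> \<open>The speed estimate is available only for positive steps; at
            \<open>\<tau> = t\<close> the distance is 0 by the diagonal coupling.\<close>
          proof (cases "\<tau> = t")
            case True
            have "W2 (\<rho> t) (\<rho> t) \<le> 0"
            proof -
              have "(W2 (\<rho> t) (\<rho> t))\<^sup>2 \<le> cost (distr (\<rho> t) borel (\<lambda>x. (x, x)))" by (rule W2_le_cost[OF diagonal_coupling[OF Pr[OF t0]] Pr[OF t0] Pr[OF t0]])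
              also have "\<dots> = 0"
              proof -
                have [measurable_cong]: "sets (\<rho> t) = sets borel" by (rule P2_sets[OF Pr[OF t0]])
                show ?thesis unfolding cost_def by (subst integral_distr) auto
              qed
              finally show ?thesis by simp
            qed
            then show ?thesis using True mult_nonneg_nonneg[OF C(1), of h] h by simp
          next
            case False
            then have "W2 (\<rho> t) (\<rho> (t + (\<tau> - t))) \<le> C * (\<tau> - t)" using tau h d' by (intro d(2)) (auto simp: d'_def)
            also have "\<dots> \<le> C * h" using tau C(1) by (intro mult_left_mono) auto
            finally show ?thesis by simp
          qed
          have "W2 (\<rho> \<tau>) (\<rho> 0) \<le> W2 (\<rho> \<tau>) (\<rho> t) + W2 (\<rho> t) (\<rho> 0)" using Pr t0 tau0 by (intro W2_triangle) auto
          also have "W2 (\<rho> \<tau>) (\<rho> t) = W2 (\<rho> t) (\<rho> \<tau>)" using Pr t0 tau0 by (intro W2_commute) auto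
          finally have "W2 (\<rho> \<tau>) (\<rho> 0) \<le> C * h + W2 (\<rho> t) (\<rho> 0)" using Wt by simp
          then have "\<alpha> * B1 * W2 (\<rho> \<tau>) (\<rho> 0) \<le> \<alpha> * B1 * (C * h + W2 (\<rho> t) (\<rho> 0))" using alpha B1_nonneg by (intro mult_left_mono) auto
          also have "\<dots> = \<alpha> * B1 * C * h + K" by (simp add: K_def algebra_simps)
          also have "\<dots> \<le> K + e"
          proof -
            have "\<alpha> * B1 * C * h \<le> (\<alpha> * B1 * C + 1) * h" using h by simp
            also have "\<dots> \<le> e" using h c0 by (simp add: d'_def field_simps min_less_iff_conj)
            finally show ?thesis by simp
          qed
          finally show "\<bar>Q \<tau> x\<bar> \<le> K + e" using Q_bound[OF tau0 x] by linarith
        qed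
      qed
    qed
    have "\<forall>\<^sub>F h in at_right 0. ((W (t + h))\<^sup>2 - A\<^sup>2) / h \<le> 2 * (X + e) + 2 * (A + C * h) * (q h / h) + q h * (q h / h)"
      using hpos gW C(2) move
    proof eventually_elim
      fix h :: real
      assume h: "0 < h" and w: "(W2 (\<rho> (t + h)) ?\<nu>)\<^sup>2 \<le> A\<^sup>2 + 2 * h * ((\<integral>z. (fst z - snd z) \<bullet> v (fst z) \<partial>g) + e)"
        and c: "W2 (\<rho> t) (\<rho> (t + h)) \<le> C * h" and m: "W2 ?\<nu> (\<rho>P (\<pi> (t + h))) \<le> q h"
      have th: "0 \<le> t + h" using t h by simp
      define a where "a = W2 (\<rho> (t + h)) ?\<nu>"
      have a0: "0 \<le> a" by (simp add: a_def W2_nonneg)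
      have q0': "0 \<le> q h" using order_trans[OF W2_nonneg m] .
      have "a \<le> W2 (\<rho> (t + h)) (\<rho> t) + A" unfolding a_def A_def using Pr Pn t0 th by (intro W2_triangle) auto
      also have "W2 (\<rho> (t + h)) (\<rho> t) = W2 (\<rho> t) (\<rho> (t + h))" using Pr t0 th by (intro W2_commute) auto
      finally have aA: "a \<le> A + C * h" using c by simp
      have "W (t + h) \<le> a + W2 ?\<nu> (\<rho>P (\<pi> (t + h)))" unfolding a_def using Pr Pn t0 th by (intro W2_triangle) auto
      then have "W (t + h) \<le> a + q h" using m by simp
      then have "(W (t + h))\<^sup>2 \<le> (a + q h)\<^sup>2" using W2_nonneg by (intro power_mono) auto
      also have "\<dots> = a\<^sup>2 + 2 * a * q h + q h * q h" by (simp add: power2_eq_square algebra_simps)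
      also have "\<dots> \<le> A\<^sup>2 + 2 * h * (X + e) + 2 * (A + C * h) * q h + q h * q h"
        using w aA q0' unfolding a_def[symmetric] X_def[symmetric] by (intro add_mono mult_right_mono mult_left_mono) auto
      also have "2 * (A + C * h) * q h = h * (2 * (A + C * h) * (q h / h))" using h by simp
      also have "q h * q h = h * (q h * (q h / h))" using h by simp
      finally have "(W (t + h))\<^sup>2 - A\<^sup>2 \<le> h * (2 * (X + e) + 2 * (A + C * h) * (q h / h) + q h * (q h / h))"
        by (simp only: distrib_left mult.left_commute[of h 2] mult.assoc)
      then show "((W (t + h))\<^sup>2 - A\<^sup>2) / h \<le> 2 * (X + e) + 2 * (A + C * h) * (q h / h) + q h * (q h / h)"
        using h by (simp add: pos_divide_le_eq mult.commute)
    qed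
    moreover have "((\<lambda>h. ((W (t + h))\<^sup>2 - A\<^sup>2) / h) \<longlongrightarrow> 2 * W t * W') (at_right 0)"
    proof -
      have "((\<lambda>\<tau>. (W \<tau>)\<^sup>2) has_real_derivative 2 * W t * W') (at t)"
        using DERIV_power[OF Wd, of 2] by (simp add: mult_ac)
      then have "((\<lambda>h. ((W (t + h))\<^sup>2 - (W t)\<^sup>2) / h) \<longlongrightarrow> 2 * W t * W') (at 0)" by (simp add: DERIV_def)
      then show ?thesis unfolding A_def by (rule filterlim_mono) (auto simp: at_le)
    qed
    moreover have "((\<lambda>h. 2 * (X + e) + 2 * (A + C * h) * (q h / h) + q h * (q h / h)) \<longlongrightarrow>
        2 * (X + e) + 2 * (A + C * 0) * (b * (2 * (K + e))) + 0 * (b * (2 * (K + e)))) (at_right 0)"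
      by (intro tendsto_intros ql qz)
    ultimately have "2 * W t * W' \<le> 2 * (X + e) + 2 * (A + C * 0) * (b * (2 * (K + e))) + 0 * (b * (2 * (K + e)))"
      by (intro tendsto_le[of "at_right (0::real)"]) auto
    also have "\<dots> = 2 * X + 2 * e + 4 * A * b * (K + e)" by (simp add: algebra_simps)
    finally show ?thesis using Xb unfolding mult.assoc by linarith
  qed
  have "2 * W t * W' \<le> 2 * (\<eta> / \<alpha>\<^sup>2) * (- (1 - sqrt \<gamma>) * E + \<alpha> * B2 * (2 * K + Br) / 2 * A\<^sup>2) + 4 * A * b * K"
  proof (rule tendsto_lowerbound)
    have "((\<lambda>e. 2 * (\<eta> / \<alpha>\<^sup>2) * (- (1 - sqrt \<gamma>) * E + \<alpha> * B2 * (2 * K + Br) / 2 * (A\<^sup>2 + e)) + 2 * e + 4 * A * b * (K + e)) \<longlongrightarrow>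
      2 * (\<eta> / \<alpha>\<^sup>2) * (- (1 - sqrt \<gamma>) * E + \<alpha> * B2 * (2 * K + Br) / 2 * (A\<^sup>2 + 0)) + 2 * 0 + 4 * A * b * (K + 0)) (at_right 0)"
      by (intro tendsto_intros)
    then show "((\<lambda>e. 2 * (\<eta> / \<alpha>\<^sup>2) * (- (1 - sqrt \<gamma>) * E + \<alpha> * B2 * (2 * K + Br) / 2 * (A\<^sup>2 + e)) + 2 * e + 4 * A * b * (K + e)) \<longlongrightarrow>
      2 * (\<eta> / \<alpha>\<^sup>2) * (- (1 - sqrt \<gamma>) * E + \<alpha> * B2 * (2 * K + Br) / 2 * A\<^sup>2) + 4 * A * b * K) (at_right 0)" by simp
    show "\<forall>\<^sub>F e in at_right 0. 2 * W t * W' \<le> 2 * (\<eta> / \<alpha>\<^sup>2) * (- (1 - sqrt \<gamma>) * E + \<alpha> * B2 * (2 * K + Br) / 2 * (A\<^sup>2 + e)) + 2 * e + 4 * A * b * (K + e)"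
      using eventually_at_right_less[of "0::real"] by eventually_elim (rule main)
  qed auto
  then have "\<alpha>\<^sup>2 / (2 * \<eta>) * (2 * W t * W') \<le> \<alpha>\<^sup>2 / (2 * \<eta>) * (2 * (\<eta> / \<alpha>\<^sup>2) * (- (1 - sqrt \<gamma>) * E + \<alpha> * B2 * (2 * K + Br) / 2 * A\<^sup>2) + 4 * A * b * K)"
    using eta by (intro mult_left_mono) auto
  also have "\<dots> = (- (1 - sqrt \<gamma>) * E + \<alpha> * B2 * (2 * K + Br) / 2 * A\<^sup>2) + 2 * \<alpha>\<^sup>2 / \<eta> * A * b * K"
  proof -
    have "\<alpha>\<^sup>2 / (2 * \<eta>) * (2 * (\<eta> / \<alpha>\<^sup>2) * y + 4 * A * b * K) = y + 2 * \<alpha>\<^sup>2 / \<eta> * A * b * K" for y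
      using eta alpha by (simp add: field_simps)
    then show ?thesis .
  qed
  finally show ?thesis unfolding A_def b_def E_def by simp
qed

theorem conclusion:
  "AE t in lborel. 0 < t \<longrightarrow>
     (\<exists>D. ((\<lambda>\<tau>. (\<alpha> * W2 (\<rho> \<tau>) (\<rho>P (\<pi> \<tau>)))\<^sup>2 / (2 * \<eta>)) has_real_derivative D) (at t) \<and>
        ereal (1 - sqrt \<gamma>) *
          enn2ereal (\<integral>\<^sup>+ x. ennreal ((Qnet \<alpha> B\<beta> \<beta> \<sigma>t (\<rho> t) x - Qpi S Act P r \<gamma> (\<pi> t) x)\<^sup>2) \<partial>\<phi>t (\<pi> t))
        \<le> ereal (- D
             + 2 * \<alpha> powr (1/2) * (1 / \<eta>) * Bcal * B1c S Act B\<beta> \<beta> \<sigma>t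
                 * (\<alpha> * W2 (\<rho> t) (\<rho> 0)) * (\<alpha> * W2 (\<rho> t) (\<rho>P (\<pi> t)))
             + (1 / \<alpha>) * B2c S Act B\<beta> \<beta> \<sigma>t
                 * (4 * B1c S Act B\<beta> \<beta> \<sigma>t * max (\<alpha> * W2 (\<rho>P (\<pi> t)) (\<rho> 0)) (\<alpha> * W2 (\<rho> t) (\<rho> 0)) + Br)
                 * (\<alpha> * W2 (\<rho> t) (\<rho>P (\<pi> t)))\<^sup>2))"
  (is "AE t in lborel. 0 < t \<longrightarrow> ?C t")
proof -
  obtain D :: "((real \<times> ('s \<times> 'a \<times> real)) \<times> real) set" where D: "countable D" "\<And>X. open X \<Longrightarrow> X \<noteq> {} \<Longrightarrow> \<exists>d\<in>D. d \<in> X"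
    by (rule countable_dense_setE) blast
  have dense: "\<exists>d\<in>D. dist d z < e" if "0 < e" for z e
    using D(2)[of "ball z e"] that by (auto simp: dist_commute)
  show ?thesis
    using W_differentiable_ae speed_ae test_ae[OF D(1)]
  proof eventually_elim
    fix t :: real
    assume wd: "0 < t \<longrightarrow> W differentiable (at t)"
      and sp: "0 < t \<longrightarrow> (\<exists>C\<ge>0. \<forall>\<^sub>F h in at_right 0. W2 (\<rho> t) (\<rho> (t + h)) \<le> C * h)"
      and test: "0 < t \<longrightarrow> (\<forall>(R::nat)>0. \<forall>(\<kappa>::nat)>0. \<forall>ps\<in>lists D. ps \<noteq> [] \<longrightarrow>
       ((\<lambda>h. ((\<integral>x. tfun (real R) (real \<kappa>) (length ps) (\<lambda>i. fst (ps ! i)) (\<lambda>i. snd (ps ! i)) x \<partial>\<rho> (t + h))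
            - (\<integral>x. tfun (real R) (real \<kappa>) (length ps) (\<lambda>i. fst (ps ! i)) (\<lambda>i. snd (ps ! i)) x \<partial>\<rho> t)) / h)
          \<longlongrightarrow> (\<integral>x. tgrad (real R) (real \<kappa>) (length ps) (\<lambda>i. fst (ps ! i)) (\<lambda>i. snd (ps ! i)) x \<bullet> (\<eta> *\<^sub>R vt t x) \<partial>\<rho> t)) (at_right 0))"
    show "0 < t \<longrightarrow> ?C t"
    proof
      assume t: "0 < t"
      then have t0: "0 \<le> t" by simp
      interpret mnt: mdp_net S Act P r \<gamma> "\<pi> t" \<beta> \<sigma>t L0 L1 l B\<beta> Br \<alpha> "\<phi>t (\<pi> t)" by (rule mn[OF t0])
      obtain W' where W': "(W has_real_derivative W') (at t)" using wd t by (auto simp: real_differentiable_def)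
      obtain C where C: "0 \<le> C" "\<forall>\<^sub>F h in at_right 0. W2 (\<rho> t) (\<rho> (t + h)) \<le> C * h" using sp t by blast
      define Dv where "Dv = \<alpha>\<^sup>2 / (2 * \<eta>) * (2 * W t * W')"
      have "((\<lambda>\<tau>. \<alpha>\<^sup>2 / (2 * \<eta>) * (W \<tau>)\<^sup>2) has_real_derivative \<alpha>\<^sup>2 / (2 * \<eta>) * (2 * W t * W')) (at t)"
        using DERIV_cmult[OF DERIV_power[OF W', of 2], of "\<alpha>\<^sup>2 / (2 * \<eta>)"] by (simp add: mult_ac)
      then have der: "((\<lambda>\<tau>. (\<alpha> * W2 (\<rho> \<tau>) (\<rho>P (\<pi> \<tau>)))\<^sup>2 / (2 * \<eta>)) has_real_derivative Dv) (at t)"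
        by (simp add: power_mult_distrib Dv_def)
      define E where "E = (\<integral>x. (Q t x - Qnet \<alpha> B\<beta> \<beta> \<sigma>t (\<rho>P (\<pi> t)) x)\<^sup>2 \<partial>\<phi>t (\<pi> t))"
      define K where "K = \<alpha> * B1 * W2 (\<rho> t) (\<rho> 0)"
      have bound: "Dv \<le> - (1 - sqrt \<gamma>) * E + \<alpha> * B2 * (2 * K + Br) / 2 * (W t)\<^sup>2 + 2 * \<alpha>\<^sup>2 / \<eta> * W t * (\<alpha> powr (-1/2) * Bcal) * K"
        unfolding Dv_def E_def K_def using test t by (intro derivative_bound[OF t W' C dense]) auto
      \<comment> \<open>The weighting measure is concentrated on \<open>S \<times> Act\<close>,
        where the action-value function equals the network of the target. Both networks are bounded,
        so the extended integral is a real number.\<close>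
      have nnE: "(\<integral>\<^sup>+ x. ennreal ((Q t x - Qpi S Act P r \<gamma> (\<pi> t) x)\<^sup>2) \<partial>\<phi>t (\<pi> t)) = ennreal E"
      proof -
        interpret ph: prob_space "\<phi>t (\<pi> t)" using phit[OF pol[OF t0]] by simp
        have [measurable_cong]: "sets (\<phi>t (\<pi> t)) = sets borel" using phit[OF pol[OF t0]] by simp
        interpret pr: prob_space "\<rho> t" by (rule P2_prob[OF Pr[OF t0]])
        interpret pn: prob_space "\<rho>P (\<pi> t)" by (rule P2_prob[OF Pn[OF t0]])
        note [measurable] = Qnet_measurable[OF Pr[OF t0], of \<alpha>] Qnet_measurable[OF Pn[OF t0], of \<alpha>]
        obtain q1 where q1: "\<And>x. \<bar>Q t x\<bar> \<le> q1" using Qnet_bound[OF pr.prob_space_axioms] by blast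
        obtain q2 where q2: "\<And>x::'s \<times> 'a. \<bar>Qnet \<alpha> B\<beta> \<beta> \<sigma>t (\<rho>P (\<pi> t)) x\<bar> \<le> q2" using Qnet_bound[OF pn.prob_space_axioms] by blast
        have "(\<integral>\<^sup>+ x. ennreal ((Q t x - Qpi S Act P r \<gamma> (\<pi> t) x)\<^sup>2) \<partial>\<phi>t (\<pi> t)) = (\<integral>\<^sup>+ x. ennreal ((Q t x - Qnet \<alpha> B\<beta> \<beta> \<sigma>t (\<rho>P (\<pi> t)) x)\<^sup>2) \<partial>\<phi>t (\<pi> t))"
        proof (rule nn_integral_cong_AE)
          show "AE x in \<phi>t (\<pi> t). ennreal ((Q t x - Qpi S Act P r \<gamma> (\<pi> t) x)\<^sup>2) = ennreal ((Q t x - Qnet \<alpha> B\<beta> \<beta> \<sigma>t (\<rho>P (\<pi> t)) x)\<^sup>2)"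
            using mnt.onSA_AE[OF mnt.D]
          proof eventually_elim
            fix x :: "'s \<times> 'a" assume "x \<in> S \<times> Act"
            then have "Qnet \<alpha> B\<beta> \<beta> \<sigma>t (\<rho>P (\<pi> t)) x = Qpi S Act P r \<gamma> (\<pi> t) x"
              by (rule family_Q[OF t0])
            then show "ennreal ((Q t x - Qpi S Act P r \<gamma> (\<pi> t) x)\<^sup>2) = ennreal ((Q t x - Qnet \<alpha> B\<beta> \<beta> \<sigma>t (\<rho>P (\<pi> t)) x)\<^sup>2)" by simp
          qed
        qed
        also have "\<dots> = ennreal E" unfolding E_def
        proof (rule nn_integral_eq_integral)
          show "integrable (\<phi>t (\<pi> t)) (\<lambda>x. (Q t x - Qnet \<alpha> B\<beta> \<beta> \<sigma>t (\<rho>P (\<pi> t)) x)\<^sup>2)"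
          proof (rule ph.integrable_const_bound[of _ "(q1 + q2)\<^sup>2"])
            show "AE x in \<phi>t (\<pi> t). norm ((Q t x - Qnet \<alpha> B\<beta> \<beta> \<sigma>t (\<rho>P (\<pi> t)) x)\<^sup>2) \<le> (q1 + q2)\<^sup>2"
            proof (rule AE_I2)
              fix x :: "'s \<times> 'a"
              have "\<bar>Q t x - Qnet \<alpha> B\<beta> \<beta> \<sigma>t (\<rho>P (\<pi> t)) x\<bar> \<le> q1 + q2" using q1[of x] q2[of x] by linarith
              then have "\<bar>Q t x - Qnet \<alpha> B\<beta> \<beta> \<sigma>t (\<rho>P (\<pi> t)) x\<bar>\<^sup>2 \<le> (q1 + q2)\<^sup>2" by (intro power_mono) auto
              then show "norm ((Q t x - Qnet \<alpha> B\<beta> \<beta> \<sigma>t (\<rho>P (\<pi> t)) x)\<^sup>2) \<le> (q1 + q2)\<^sup>2" by simp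
            qed
          qed measurable
        qed simp
        finally show ?thesis .
      qed
      have E0: "0 \<le> E" by (simp add: E_def)
      \<comment> \<open>Of \<open>\<alpha>^2\<close>, \<open>\<alpha>^(-1/2)\<close> and the
        \<alpha> inside \<open>K\<close>, two full factors scale the two distances and
        \<open>\<alpha>^(1/2)\<close> remains.\<close>
      have T1: "2 * \<alpha>\<^sup>2 / \<eta> * W t * (\<alpha> powr (-1/2) * Bcal) * K = 2 * \<alpha> powr (1/2) * (1 / \<eta>) * Bcal * B1 * (\<alpha> * W2 (\<rho> t) (\<rho> 0)) * (\<alpha> * W t)"
      proof -
        have "\<alpha> * \<alpha> powr (-1/2) = \<alpha> powr (1/2)"
          using alpha powr_add[of \<alpha> 1 "-1/2"] by simp
        then show ?thesis unfolding K_def using eta by (simp add: power2_eq_square field_simps)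
      qed
      \<comment> \<open>The argument yields \<open>K + Br / 2\<close> with \<open>K\<close> taken
        from the distance of \<open>\<rho> t\<close> alone; the factor 4, the maximum and the full
        \<open>Br\<close> of the stated bound only enlarge it.\<close>
      have T2: "\<alpha> * B2 * (2 * K + Br) / 2 * (W t)\<^sup>2 \<le> (1 / \<alpha>) * B2 * (4 * B1 * max (\<alpha> * W2 (\<rho>P (\<pi> t)) (\<rho> 0)) (\<alpha> * W2 (\<rho> t) (\<rho> 0)) + Br) * (\<alpha> * W t)\<^sup>2"
      proof -
        define m where "m = max (\<alpha> * W2 (\<rho>P (\<pi> t)) (\<rho> 0)) (\<alpha> * W2 (\<rho> t) (\<rho> 0))"
        have Br0: "0 \<le> Br" using rB SA_ne by force
        have w0: "0 \<le> \<alpha> * W2 (\<rho> t) (\<rho> 0)" using alpha by (intro mult_nonneg_nonneg W2_nonneg) auto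
        have "K = B1 * (\<alpha> * W2 (\<rho> t) (\<rho> 0))" by (simp add: K_def)
        also have "\<dots> \<le> B1 * m" unfolding m_def using B1_nonneg by (intro mult_left_mono) auto
        finally have Km: "K \<le> B1 * m" .
        have "0 \<le> B1 * m" using Km w0 B1_nonneg by (intro mult_nonneg_nonneg) (auto simp: m_def le_max_iff_disj)
        then have "(2 * K + Br) / 2 \<le> 4 * B1 * m + Br" using Km Br0 by simp
        then have "\<alpha> * B2 * (W t)\<^sup>2 * ((2 * K + Br) / 2) \<le> \<alpha> * B2 * (W t)\<^sup>2 * (4 * B1 * m + Br)"
          using alpha B2_nonneg by (intro mult_left_mono) auto
        also have "\<dots> = (1 / \<alpha>) * B2 * (4 * B1 * m + Br) * (\<alpha> * W t)\<^sup>2"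
          using alpha by (simp add: power2_eq_square field_simps)
        finally show ?thesis unfolding m_def by (simp add: mult_ac)
      qed
      have "(1 - sqrt \<gamma>) * E \<le> - Dv + 2 * \<alpha> powr (1/2) * (1 / \<eta>) * Bcal * B1 * (\<alpha> * W2 (\<rho> t) (\<rho> 0)) * (\<alpha> * W t)
          + (1 / \<alpha>) * B2 * (4 * B1 * max (\<alpha> * W2 (\<rho>P (\<pi> t)) (\<rho> 0)) (\<alpha> * W2 (\<rho> t) (\<rho> 0)) + Br) * (\<alpha> * W t)\<^sup>2"
        using bound T1 T2 by linarith
      moreover have "ereal (1 - sqrt \<gamma>) * enn2ereal (\<integral>\<^sup>+ x. ennreal ((Q t x - Qpi S Act P r \<gamma> (\<pi> t) x)\<^sup>2) \<partial>\<phi>t (\<pi> t)) = ereal ((1 - sqrt \<gamma>) * E)"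
        unfolding nnE using E0 by (simp add: enn2ereal_ennreal)
      ultimately show "?C t"
        using der by (intro exI[of _ Dv] conjI) simp_all
    qed
  qed
qed

end

theorem theorem2:
  fixes S :: "'s::euclidean_space set" and Act :: "'a::euclidean_space set"
    and P :: "'s \<Rightarrow> 's \<Rightarrow> 'a \<Rightarrow> real" and r :: "'s \<Rightarrow> 'a \<Rightarrow> real" and \<gamma> :: real
    and \<beta> \<sigma>t :: "real \<Rightarrow> real" and L0 L1 l :: real
    and Br M\<mu> M\<psi> M1 M2 G :: real and \<mu> :: "('s \<times> 'a \<times> real) measure"
    and \<phi> :: "'s \<Rightarrow> real" and \<psi> :: "'s \<Rightarrow> ('s \<times> 'a \<times> real) measure"
    and \<alpha> B\<beta> \<eta> Dbar Bcal :: real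
    and \<rho>P :: "('s \<Rightarrow> 'a \<Rightarrow> real) \<Rightarrow> (real \<times> ('s \<times> 'a \<times> real)) measure"
    and \<phi>t :: "('s \<Rightarrow> 'a \<Rightarrow> real) \<Rightarrow> ('s \<times> 'a) measure"
    and \<rho> :: "real \<Rightarrow> (real \<times> ('s \<times> 'a \<times> real)) measure"
    and \<pi> :: "real \<Rightarrow> 's \<Rightarrow> 'a \<Rightarrow> real"
  assumes mdp: "MDP S Act P r \<gamma>"
    and A1: "Assumption1 \<beta> \<sigma>t L0 L1 l"
    and A2: "Assumption2 S Act P r \<sigma>t Br \<mu> \<phi> \<psi> M\<mu> M\<psi> M1 M2 G"
    and alpha: "1 \<le> \<alpha>"
    and Bbeta: "B\<beta> \<ge> 2 * (Br + \<gamma> * (1 - \<gamma>) powr (-1) * Br * M1)"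
    and L1fam: "Lemma1_family S Act P r \<gamma> \<alpha> B\<beta> \<beta> \<sigma>t \<phi>t \<rho>P Dbar Bcal"
    and eta: "\<eta> > 0"
    and phit: "\<And>p. policy S Act p \<Longrightarrow> prob_space (\<phi>t p) \<and> sets (\<phi>t p) = sets borel \<and>
                 emeasure (\<phi>t p) (S \<times> Act) = 1"
    and pol: "\<And>t. t \<ge> 0 \<Longrightarrow> policy S Act (\<pi> t)"
    and rho0: "\<rho> 0 = std_normal"
    and CE: "weak_continuity_eq \<eta> \<rho>
               (\<lambda>t. gfield S Act P r \<gamma> \<alpha> B\<beta> \<beta> \<sigma>t (visit S Act P \<gamma> (\<pi> t) (\<phi>t (\<pi> t))) (\<rho> t) (\<pi> t))"
    and PDE: "\<And>t s a. t \<ge> 0 \<Longrightarrow> s \<in> S \<Longrightarrow> a \<in> Act \<Longrightarrow>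
               ((\<lambda>\<tau>. \<pi> \<tau> s a) has_real_derivative
                  (\<pi> t s a * (Qnet \<alpha> B\<beta> \<beta> \<sigma>t (\<rho> t) (s, a)
                     - (\<integral>a'. indicator Act a' * Qnet \<alpha> B\<beta> \<beta> \<sigma>t (\<rho> t) (s, a') * \<pi> t s a' \<partial>lborel))))
               (at t within {0..})"
    and ac1: "W2_abs_cont \<rho>"
    and ac2: "W2_abs_cont (\<lambda>t. \<rho>P (\<pi> t))"
  shows "AE t in lborel. 0 < t \<longrightarrow>
     (\<exists>D. ((\<lambda>\<tau>. (\<alpha> * W2 (\<rho> \<tau>) (\<rho>P (\<pi> \<tau>)))\<^sup>2 / (2 * \<eta>)) has_real_derivative D) (at t) \<and>
        ereal (1 - sqrt \<gamma>) *
          enn2ereal (\<integral>\<^sup>+ x. ennreal ((Qnet \<alpha> B\<beta> \<beta> \<sigma>t (\<rho> t) x - Qpi S Act P r \<gamma> (\<pi> t) x)\<^sup>2) \<partial>\<phi>t (\<pi> t))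
        \<le> ereal (- D
             + 2 * \<alpha> powr (1/2) * (1 / \<eta>) * Bcal * B1c S Act B\<beta> \<beta> \<sigma>t
                 * (\<alpha> * W2 (\<rho> t) (\<rho> 0)) * (\<alpha> * W2 (\<rho> t) (\<rho>P (\<pi> t)))
             + (1 / \<alpha>) * B2c S Act B\<beta> \<beta> \<sigma>t
                 * (4 * B1c S Act B\<beta> \<beta> \<sigma>t * max (\<alpha> * W2 (\<rho>P (\<pi> t)) (\<rho> 0)) (\<alpha> * W2 (\<rho> t) (\<rho> 0)) + Br)
                 * (\<alpha> * W2 (\<rho> t) (\<rho>P (\<pi> t)))\<^sup>2))"
proof -
  have rB: "0 \<le> r s a \<and> r s a \<le> Br" if "s \<in> S" "a \<in> Act" for s a
    using A2 that unfolding Assumption2_def by blast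
  have "coupled_flow S Act P r \<gamma> \<beta> \<sigma>t L0 L1 l Br \<alpha> B\<beta> \<eta> Dbar Bcal \<rho>P \<phi>t \<rho> \<pi>"
    by (rule coupled_flow.intro[OF mdp A1 rB alpha L1fam eta phit pol rho0 CE PDE ac1 ac2])
  then show ?thesis by (rule coupled_flow.conclusion)
qed

end
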